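(* Let $m\ge 3$, let $u(t)$ be a weak solution of the Navier-Stokes equations in $\mathbb{R}^m$ with initial velocity $u_0$, and let $v(t)=u(t)-e^{t\Delta}u_0$. Let $0\le r<1$. Then $v(\cdot)$ is Hölder continuous in the norm of $\mathcal{L}^1_r(\mathbb{R}^m)$: if $0<\alpha<(1-r)/2$, then $$\|v(t+h)-v(t)\|_{\mathcal{L}^1_r}\le c_\alpha|h|^\alpha$$ whenever $t\ge 0$, $t+h\ge 0$, $|h|\le 1$, where $c_\alpha$ is bounded uniformly in $t$ for $t$ in any compact interval of $[0,\infty)$.
   Context: Function spaces are also used for $\mathbb{R}^m$-valued fields, componentwise. $e^{t\Delta}$ is the heat semigroup on $\mathbb{R}^m$. For $1\le p<\infty$ and $r\ge 0$, $\mathcal{L}^p_r(\mathbb{R}^m)=(I-\Delta)^{-r/2}L^p(\mathbb{R}^m)\subset L^p(\mathbb{R}^m)$ with norm $\|f\|_{\mathcal{L}^p_r}=\|(I-\Delta)^{r/2}f\|_p$. The quantity $c_\alpha$ does not depend on $h$; it may depend on $\alpha$, $r$, $m$, $u$ and (in a locally bounded way) on $t$. Weak solution: let $u_0\in L^2(\mathbb{R}^m)$ be divergence free. $u$ is a weak solution of the Navier-Stokes equations with initial velocity $u_0$ if for each $T>0$, $u\in L^\infty([0,T];L^2(\mathbb{R}^m))\cap L^2([0,T];H^1(\mathbb{R}^m))$, $\nabla_x\cdot u(t,x)=0$ (distributional derivatives), and for every $\mathbb{R}^m$-valued $\phi\in C_0^\infty([0,T)\times\mathbb{R}^m)$ with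 $\nabla_x\cdot\phi(s,x)=0$, $$\int_0^t[-(u(s),\partial_s\phi(s))+(\nabla u(s),\nabla\phi(s))+(u(s)\cdot\nabla u(s),\phi(s))]\,ds=(u_0,\phi(0))-(u(t),\phi(t))$$ for a.e. $t\in[0,T)$, including $t=0$. Here $(u,v)=\sum_i\int u_iv_i\,dx$ (used whenever the product is integrable), $(\nabla u,\nabla v)=\sum_{i,j}\int\partial_{x_i}u_j\partial_{x_i}v_j\,dx$, $(u\cdot\nabla u)_j=\sum_k u_k\partial_{x_k}u_j$. The energy inequality is not assumed. Convention: a weak solution is a priori defined only for a.e. $t$; after modification on a null set of times it is weakly continuous from $[0,\infty)$ to $L^2(\mathbb{R}^m)$ with $u(0)=u_0$, and $u(t)$ denotes this weakly continuous version. *)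

theory Defs
  imports "HOL-Analysis.Analysis"
begin

text \<open>
  Functions on \<open>\<real>\<^sup>m\<close> are total functions on \<^typ>\<open>real ^ 'n\<close>, with \<open>m = CARD('n)\<close>; elements of
  function spaces are represented by arbitrary Lebesgue measurable representatives, and equality
  in such a space is equality almost everywhere. Vector-valued integrals are componentwise.
\<close>

section \<open>Lebesgue spaces\<close>

definition Lp_space :: "real \<Rightarrow> ((real ^ 'n) \<Rightarrow> 'b::{banach, second_countable_topology}) set"
  where "Lp_space p =
    {f. f \<in> borel_measurable lebesgue \<and> integrable lebesgue (\<lambda>x. norm (f x) powr p)}"

definition Lp_norm :: "real \<Rightarrow> ((real ^ 'n) \<Rightarrow> 'b::{banach, second_countable_topology}) \<Rightarrow> real"
  where "Lp_norm p f = (LINT x|lebesgue. norm (f x) powr p) powr (1 / p)"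

definition L2_pair :: "((real ^ 'n) \<Rightarrow> real ^ 'n) \<Rightarrow> ((real ^ 'n) \<Rightarrow> real ^ 'n) \<Rightarrow> real"
  where "L2_pair f g = (LINT x|lebesgue. f x \<bullet> g x)"

section \<open>Heat semigroup and Bessel potential spaces\<close>

definition heat_kernel :: "real \<Rightarrow> real ^ 'n \<Rightarrow> real"
  where "heat_kernel t x =
    (4 * pi * t) powr (- (real CARD('n) / 2)) * exp (- ((norm x)\<^sup>2 / (4 * t)))"

definition heat_semigroup ::
    "real \<Rightarrow> ((real ^ 'n) \<Rightarrow> 'b::{banach, second_countable_topology}) \<Rightarrow> (real ^ 'n) \<Rightarrow> 'b"
  where "heat_semigroup t f =
    (if t = 0 then f else (\<lambda>x. LINT y|lebesgue. heat_kernel t (x - y) *\<^sub>R f y))"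

text \<open>
  The operator \<open>(I - \<Delta>)\<^bsup>-r/2\<^esup>\<close> is convolution with the Bessel kernel, obtained from
  \<open>\<lambda>\<^bsup>-r/2\<^esup> = \<Gamma>(r/2)\<^sup>-\<^sup>1 \<integral>\<^sub>0\<^sup>\<infinity> s\<^bsup>r/2-1\<^esup> e\<^bsup>-s\<lambda>\<^esup> ds\<close> at \<open>\<lambda> = I - \<Delta>\<close>, where \<open>e\<^bsup>-s(I-\<Delta>)\<^esup> = e\<^bsup>-s\<^esup> e\<^bsup>s\<Delta>\<^esup>\<close>;
  its Fourier multiplier is \<open>(1 + |\<xi>|\<^sup>2)\<^bsup>-r/2\<^esup>\<close>. For \<open>r \<le> m\<close> the kernel is infinite at the origin, where
  the integral below takes the value 0; this is immaterial for the convolution.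
\<close>

definition bessel_kernel :: "real \<Rightarrow> real ^ 'n \<Rightarrow> real"
  where "bessel_kernel r x =
    (LINT s:{0<..}|lebesgue. s powr (r / 2 - 1) * exp (- s) * heat_kernel s x) / Gamma (r / 2)"

definition bessel_potential ::
    "real \<Rightarrow> ((real ^ 'n) \<Rightarrow> 'b::{banach, second_countable_topology}) \<Rightarrow> (real ^ 'n) \<Rightarrow> 'b"
  where "bessel_potential r f =
    (if r = 0 then f else (\<lambda>x. LINT y|lebesgue. bessel_kernel r (x - y) *\<^sub>R f y))"

definition bessel_space ::
    "real \<Rightarrow> real \<Rightarrow> ((real ^ 'n) \<Rightarrow> 'b::{banach, second_countable_topology}) set"
  where "bessel_space p r =
    {f \<in> Lp_space p. \<exists>g\<in>Lp_space p. AE x in lebesgue. f x = bessel_potential r g x}"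

text \<open>
  \<open>(I - \<Delta>)\<^bsup>r/2\<^esup>\<close> on \<^term>\<open>bessel_space p r\<close>, the inverse of the injective operator
  \<open>(I - \<Delta>)\<^bsup>-r/2\<^esup>\<close> on \<open>L\<^sup>p\<close>; the choice only concerns null sets.
\<close>

definition bessel_inverse ::
    "real \<Rightarrow> real \<Rightarrow> ((real ^ 'n) \<Rightarrow> 'b::{banach, second_countable_topology}) \<Rightarrow> (real ^ 'n) \<Rightarrow> 'b"
  where "bessel_inverse p r f =
    (SOME g. g \<in> Lp_space p \<and> (AE x in lebesgue. f x = bessel_potential r g x))"

definition bessel_norm ::
    "real \<Rightarrow> real \<Rightarrow> ((real ^ 'n) \<Rightarrow> 'b::{banach, second_countable_topology}) \<Rightarrow> real"
  where "bessel_norm p r f = Lp_norm p (bessel_inverse p r f)"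

section \<open>Test functions, weak derivatives and \<open>H\<^sup>1\<close>\<close>

primrec C_k :: "nat \<Rightarrow> ('a::real_normed_vector \<Rightarrow> 'b::real_normed_vector) \<Rightarrow> bool"
  where
    "C_k 0 f \<longleftrightarrow> continuous_on UNIV f"
  | "C_k (Suc k) f \<longleftrightarrow>
       (\<forall>x. f differentiable (at x)) \<and> (\<forall>v. C_k k (\<lambda>x. frechet_derivative f (at x) v))"

definition smooth :: "('a::real_normed_vector \<Rightarrow> 'b::real_normed_vector) \<Rightarrow> bool"
  where "smooth f \<longleftrightarrow> (\<forall>k. C_k k f)"

definition test_function :: "('a::real_normed_vector \<Rightarrow> 'b::real_normed_vector) \<Rightarrow> bool"
  where "test_function f \<longleftrightarrow> smooth f \<and> compact (closure {x. f x \<noteq> 0})"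

definition partial :: "'n \<Rightarrow> ((real ^ 'n) \<Rightarrow> 'b::real_normed_vector) \<Rightarrow> (real ^ 'n) \<Rightarrow> 'b"
  where "partial k f x = frechet_derivative f (at x) (axis k 1)"

definition locally_integrable ::
    "((real ^ 'n) \<Rightarrow> 'b::{banach, second_countable_topology}) \<Rightarrow> bool"
  where "locally_integrable f \<longleftrightarrow> (\<forall>K. compact K \<longrightarrow> set_integrable lebesgue K f)"

definition has_weak_partial ::
    "'n \<Rightarrow> ((real ^ 'n) \<Rightarrow> 'b::{banach, second_countable_topology}) \<Rightarrow> ((real ^ 'n) \<Rightarrow> 'b) \<Rightarrow> bool"
  where "has_weak_partial k f g \<longleftrightarrow> locally_integrable f \<and> locally_integrable g \<and>
    (\<forall>\<psi> :: (real ^ 'n) \<Rightarrow> real. test_function \<psi> \<longrightarrow>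
      (LINT x|lebesgue. partial k \<psi> x *\<^sub>R f x) = - (LINT x|lebesgue. \<psi> x *\<^sub>R g x))"

text \<open>The weak partial derivative is unique up to null sets.\<close>

definition weak_partial ::
    "'n \<Rightarrow> ((real ^ 'n) \<Rightarrow> 'b::{banach, second_countable_topology}) \<Rightarrow> (real ^ 'n) \<Rightarrow> 'b"
  where "weak_partial k f = (SOME g. has_weak_partial k f g)"

definition H1_space :: "((real ^ 'n) \<Rightarrow> 'b::{banach, second_countable_topology}) set"
  where "H1_space = {f \<in> Lp_space 2. \<forall>k. \<exists>g\<in>Lp_space 2. has_weak_partial k f g}"

definition H1_norm :: "((real ^ 'n) \<Rightarrow> 'b::{banach, second_countable_topology}) \<Rightarrow> real"
  where "H1_norm f = sqrt ((Lp_norm 2 f)\<^sup>2 + (\<Sum>k\<in>UNIV. (Lp_norm 2 (weak_partial k f))\<^sup>2))"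

definition weakly_div_free :: "((real ^ 'n) \<Rightarrow> real ^ 'n) \<Rightarrow> bool"
  where "weakly_div_free f \<longleftrightarrow> locally_integrable f \<and>
    (\<forall>\<psi> :: (real ^ 'n) \<Rightarrow> real. test_function \<psi> \<longrightarrow>
      (LINT x|lebesgue. (\<Sum>k\<in>UNIV. f x $ k * partial k \<psi> x)) = 0)"

section \<open>Bochner spaces on a time interval\<close>

text \<open>
  Strong measurability of \<open>u\<close> with values in the space \<open>X\<close> normed by \<open>N\<close>: almost everywhere
  \<open>u\<close> is the \<open>N\<close>-limit of \<open>X\<close>-valued simple functions.
\<close>

definition strongly_measurable ::
    "'t measure \<Rightarrow> ('a \<Rightarrow> 'b::minus) set \<Rightarrow> (('a \<Rightarrow> 'b) \<Rightarrow> real) \<Rightarrow> ('t \<Rightarrow> 'a \<Rightarrow> 'b) \<Rightarrow> bool"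
  where "strongly_measurable M X N u \<longleftrightarrow> (AE t in M. u t \<in> X) \<and>
    (\<exists>s. (\<forall>n::nat. simple_function M (s n) \<and> s n ` space M \<subseteq> X) \<and>
         (AE t in M. (\<lambda>n. N (\<lambda>x. s n t x - u t x)) \<longlonglongrightarrow> 0))"

definition Linf_L2 :: "real \<Rightarrow> (real \<Rightarrow> (real ^ 'n) \<Rightarrow> real ^ 'n) set"
  where "Linf_L2 T = {u. strongly_measurable (lebesgue_on {0..T}) (Lp_space 2) (Lp_norm 2) u \<and>
    (\<exists>C. AE t in lebesgue_on {0..T}. Lp_norm 2 (u t) \<le> C)}"

definition L2_H1 :: "real \<Rightarrow> (real \<Rightarrow> (real ^ 'n) \<Rightarrow> real ^ 'n) set"
  where "L2_H1 T = {u. strongly_measurable (lebesgue_on {0..T}) H1_space H1_norm u \<and>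
    integrable (lebesgue_on {0..T}) (\<lambda>t. (H1_norm (u t))\<^sup>2)}"

section \<open>Weak solutions of the Navier-Stokes equations\<close>

definition convection :: "((real ^ 'n) \<Rightarrow> real ^ 'n) \<Rightarrow> (real ^ 'n) \<Rightarrow> real ^ 'n"
  where "convection f x = (\<Sum>k\<in>UNIV. f x $ k *\<^sub>R weak_partial k f x)"

text \<open>
  \<open>C\<^sub>0\<^sup>\<infinity>([0,T) \<times> \<real>\<^sup>m)\<close> consists of the restrictions to \<open>s \<ge> 0\<close> of smooth fields on \<open>\<real> \<times> \<real>\<^sup>m\<close> with compact
  support in \<open>(-\<infinity>,T) \<times> \<real>\<^sup>m\<close>. Only the restriction has to be divergence free.
\<close>

definition div_free_test_field :: "real \<Rightarrow> (real \<times> (real ^ 'n) \<Rightarrow> real ^ 'n) \<Rightarrow> bool"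
  where "div_free_test_field T \<phi> \<longleftrightarrow>
    test_function \<phi> \<and> closure {z. \<phi> z \<noteq> 0} \<subseteq> {..<T} \<times> UNIV \<and>
    (\<forall>s\<in>{0..<T}. \<forall>x. (\<Sum>k\<in>UNIV. partial k (\<lambda>y. \<phi> (s, y)) x $ k) = 0)"

text \<open>
  For \<open>u\<close> in the required spaces the time integrand below is integrable on \<open>[0,t]\<close>, and all spatial
  products are integrable for almost every time.
\<close>

definition weak_solution ::
    "((real ^ 'n) \<Rightarrow> real ^ 'n) \<Rightarrow> (real \<Rightarrow> (real ^ 'n) \<Rightarrow> real ^ 'n) \<Rightarrow> bool"
  where "weak_solution u\<^sub>0 u \<longleftrightarrow>
    u\<^sub>0 \<in> Lp_space 2 \<and> weakly_div_free u\<^sub>0 \<and>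
    (\<forall>T>0. u \<in> Linf_L2 T \<and> u \<in> L2_H1 T \<and>
      (AE t in lebesgue_on {0..T}. weakly_div_free (u t)) \<and>
      (\<forall>\<phi>. div_free_test_field T \<phi> \<longrightarrow>
        (let identity_at = (\<lambda>t.
           (LINT s:{0..t}|lebesgue.
              - L2_pair (u s) (\<lambda>x. vector_derivative (\<lambda>\<tau>. \<phi> (\<tau>, x)) (at s))
              + (\<Sum>k\<in>UNIV. L2_pair (weak_partial k (u s)) (partial k (\<lambda>x. \<phi> (s, x))))
              + L2_pair (convection (u s)) (\<lambda>x. \<phi> (s, x)))
           = L2_pair u\<^sub>0 (\<lambda>x. \<phi> (0, x)) - L2_pair (u t) (\<lambda>x. \<phi> (t, x)))
         in (AE t in lebesgue_on {0..<T}. identity_at t) \<and> identity_at 0)))"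

text \<open>
  The weakly continuous version: defined in \<open>L\<^sup>2\<close> at every time \<open>t \<ge> 0\<close>, weakly continuous there,
  with \<open>u(0) = u\<^sub>0\<close>.
\<close>

definition weakly_continuous_from ::
    "((real ^ 'n) \<Rightarrow> real ^ 'n) \<Rightarrow> (real \<Rightarrow> (real ^ 'n) \<Rightarrow> real ^ 'n) \<Rightarrow> bool"
  where "weakly_continuous_from u\<^sub>0 u \<longleftrightarrow>
    (\<forall>t\<ge>0. u t \<in> Lp_space 2) \<and>
    (\<forall>g\<in>Lp_space 2. continuous_on {0..} (\<lambda>t. L2_pair (u t) g)) \<and>
    (AE x in lebesgue. u 0 x = u\<^sub>0 x)"

end

theory Submission
  imports Defs "HOL-Probability.Probability"
begin

text \<open>
  Write \<open>G\<^sub>\<sigma>\<close> for the heat kernel. For every scalar \<open>\<eta>\<close> the field \<open>\<nabla>\<partial>\<^sub>i\<eta> - e\<^sub>i \<Delta>\<eta>\<close> is divergence free, so it may be used to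
  test the equation; taking for \<open>\<eta>\<close> the backward heat kernel centred at a point \<open>x\<close>, cut off at infinity, eliminates the
  pressure and the Stokes part and leaves the Duhamel formula
  \<open>\<Delta>e\<^bsup>\<sigma>\<Delta>\<^esup> v\<^sub>i(t) = - \<Sum>\<^sub>j\<^sub>k \<integral>\<^sub>0\<^sup>t M\<^sub>i\<^sub>j\<^sub>k(\<sigma> + t - s) * (u\<^sub>j u\<^sub>k)(s) ds\<close>, where \<open>M\<close> consists of third derivatives of \<open>G\<close>. Since \<open>u\<^sub>j u\<^sub>k\<close> is
  bounded in \<open>L\<^sup>1\<close> and \<open>\<parallel>M(\<sigma>)\<parallel>\<^sub>1 \<le> C\<sigma>\<^bsup>-3/2\<^esup>\<close>, \<open>\<parallel>\<partial>\<^sub>\<sigma>M(\<sigma>)\<parallel>\<^sub>1 \<le> C\<sigma>\<^bsup>-5/2\<^esup>\<close>, the increment \<open>f = v(t + h) - v(t)\<close> satisfies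
  \<open>\<parallel>\<Delta>e\<^bsup>\<sigma>\<Delta>\<^esup> f\<parallel>\<^sub>1 \<le> C (\<sigma>\<^bsup>-1/2\<^esup> - (\<sigma> + h)\<^bsup>-1/2\<^esup>) \<le> C h\<^sup>\<alpha> \<sigma>\<^bsup>-1/2-\<alpha>\<^esup>\<close>. No Riesz transform of an \<open>L\<^sup>1\<close> function is ever needed, because
  \<open>f = - \<integral>\<^sub>0\<^sup>\<infinity> \<Delta>e\<^bsup>\<sigma>\<Delta>\<^esup> f d\<sigma>\<close> and \<open>(I - \<Delta>)\<^bsup>r/2\<^esup> f = \<Gamma>(1 - r/2)\<^sup>-\<^sup>1 \<integral>\<^sub>0\<^sup>\<infinity> \<sigma>\<^bsup>-r/2\<^esup> e\<^bsup>-\<sigma>\<^esup> e\<^bsup>\<sigma>\<Delta>\<^esup> (I - \<Delta>) f d\<sigma>\<close> converge absolutely in \<open>L\<^sup>1\<close>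
  as soon as \<open>\<sigma>\<^bsup>-r/2\<^esup> \<sigma>\<^bsup>-1/2-\<alpha>\<^esup>\<close> is integrable at \<open>0\<close>, that is \<open>\<alpha> < (1 - r)/2\<close>.
\<close>

text \<open>Two obstacles shape the argument. The increment f is known only to lie in L^2, while the
  integrals produce L^1 functions. The comparison takes place in \<open>gint\<close>, the functions
  integrable against every Gaussian, where the heat flow acts and is injective
  (\<open>heat_injective\<close>); the identities for f and its Bessel potential are proved after
  applying \<open>Ht t\<close> with t > 0, where nothing is singular. Square integrability of f also
  makes \<open>Ht s f\<close> vanish as s tends to infinity, so that no boundary term is left there.
  The equation, moreover, admits only compactly supported test fields and holds only for almost
  every time. Cut-off heat kernels are therefore kept in a class closed under differentiation that
  carries Gaussian bounds uniform in the cut-off, so that no derivative of a cut-off is ever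
  estimated by hand; weak continuity then reaches every t. The derivative of the nonlinear term is
  moved onto the kernel because \<open>u\<^sub>j u\<^sub>k\<close> is bounded in L^1 on compact time
  intervals, whereas u . grad u is controlled in L^1 only after integration in time.\<close>

abbreviation nn_integral_lborel :: "('a :: euclidean_space \<Rightarrow> ennreal) \<Rightarrow> ennreal" (binder "NN " 10)
  where "nn_integral_lborel f \<equiv> nn_integral lborel f"
abbreviation Li where "Li f \<equiv> integrable lborel f"
abbreviation BM where "BM M \<equiv> borel_measurable M"
abbreviation lb2 where "lb2 \<equiv> lborel \<Otimes>\<^sub>M lborel"
text \<open>Half-line integrals are written over the whole line with this factor, so that Fubini on
  \<open>lb2\<close> applies to them directly.\<close>

abbreviation pos :: "real \<Rightarrow> real" where "pos \<equiv> indicator {0<..}"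
abbreviation Gk where "Gk \<equiv> heat_kernel"
abbreviation seq_lim (infix "~>" 60) where "X ~> L \<equiv> X \<longlonglongrightarrow> L"
text \<open>The kernel stands at \<open>y - x\<close> because it comes from a test function of y
  centred at x.\<close>

abbreviation quad :: "(real ^ 'n \<Rightarrow> real) \<Rightarrow> (real ^ 'n \<Rightarrow> real) \<Rightarrow> (real ^ 'n \<Rightarrow> real) \<Rightarrow> real ^ 'n \<Rightarrow> real"
  where "quad a b K x \<equiv> LBINT y. a y * b y * K (y - x)"
abbreviation sum_UNIV :: "('i :: finite \<Rightarrow> 'b :: comm_monoid_add) \<Rightarrow> 'b" (binder "SS " 10) where "sum_UNIV f \<equiv> sum f UNIV"

section \<open>The heat kernel and its derivatives\<close>

lemma heat_kernel_pos: "t > 0 \<Longrightarrow> Gk t x > 0"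
 by (simp add: heat_kernel_def)

lemma heat_kernel_nonneg: "Gk t x \<ge> 0"
 by (simp add: heat_kernel_def)

lemma heat_kernel_measurable [measurable (raw)]:
 assumes [measurable]: "f \<in> BM M" "g \<in> BM M"
 shows "(\<lambda>w. Gk (f w) (g w :: real ^ 'n)) \<in> BM M"
 unfolding heat_kernel_def by measurable

lemma heat_kernel_minus: "Gk t (- x) = Gk t x"
 by (simp add: heat_kernel_def)

lemma heat_kernel_diff_commute: "Gk t (x - y) = Gk t (y - x)"
 by (simp add: heat_kernel_def norm_minus_commute)

section \<open>Total mass and semigroup law of the Gaussian\<close>

lemma lborel_reflect: "lborel = distr lborel borel (\<lambda>y. x - y :: 'a::euclidean_space)"
 using lborel_affine[of "-1" x] by (simp add: density_1)

lemma nn_integral_reflect: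
 fixes f :: "'a::euclidean_space \<Rightarrow> ennreal"
 assumes [measurable]: "f \<in> BM borel"
 shows "(NN y. f (x - y)) = (NN y. f y)"
 by (subst (2) lborel_reflect[of x]) (simp add: nn_integral_distr)

lemma nn_integral_translate:
 fixes f :: "'a::euclidean_space \<Rightarrow> ennreal"
 assumes [measurable]: "f \<in> BM borel"
 shows "(NN y. f (y - x)) = (NN y. f y)"
proof -
 have "(\<integral>\<^sup>+y. f y \<partial>distr lborel borel ((+) (- x))) = (NN y. f (- x + y))"
  by (rule nn_integral_distr) auto
 then show ?thesis by (simp add: lborel_distr_plus)
qed

lemma nn_integral_gauss_real:
 assumes "c > 0"
 shows "(NN x. ennreal (exp (- (c * x\<^sup>2)))) = ennreal (sqrt (pi / c))"
proof -
 \<comment> \<open>The standard deviation for which the normal density has the exponent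
   \<open>- (c * x\<^sup>2)\<close>.\<close>
 define s where "s = sqrt (1 / (2 * c))"
 have s: "s > 0" "s\<^sup>2 = 1 / (2 * c)" using assms by (auto simp: s_def)
 have e: "exp (- (c * x\<^sup>2)) = sqrt (pi / c) * normal_density 0 s x" for x
 proof -
  have "2 * s\<^sup>2 = 1 / c" using s by simp
  then have "- (x - 0)\<^sup>2 / (2 * s\<^sup>2) = - (c * x\<^sup>2)" "2 * pi * s\<^sup>2 = pi / c"
   unfolding s(2) using assms by (auto simp: field_simps)
  then show ?thesis using assms unfolding normal_density_def by (simp del: diff_zero)
 qed
 have "(NN x. ennreal (normal_density 0 s x)) = ennreal (\<integral>x. normal_density 0 s x \<partial>lborel)"
  using s by (intro nn_integral_eq_integral integrable_normal_density) auto
 also have "\<dots> = 1" using s by (simp add: integral_normal_density)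
 finally show ?thesis unfolding e using assms
  by (simp add: ennreal_mult' nn_integral_cmult)
qed

lemma nn_integral_gauss:
 assumes "c > 0"
 shows "(NN x. ennreal (exp (- (c * (norm (x :: real ^ 'n))\<^sup>2))))
  = ennreal ((pi / c) powr (real CARD('n) / 2))"
proof -
 have e: "exp (- (c * (norm x)\<^sup>2)) = (\<Prod>b\<in>Basis. exp (- (c * (x \<bullet> b)\<^sup>2)))" for x :: "real ^ 'n"
  unfolding power2_norm_eq_inner euclidean_inner[of x x]
  by (simp add: exp_sum sum_distrib_left sum_negf[symmetric] power2_eq_square)
 have "(NN x. ennreal (exp (- (c * (norm (x :: real ^ 'n))\<^sup>2))))
  = (NN x. (\<Prod>b\<in>Basis. ennreal (exp (- (c * ((x :: real ^ 'n) \<bullet> b)\<^sup>2)))))"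
  unfolding e by (simp add: prod_ennreal)
 also have "\<dots> = (\<Prod>b\<in>(Basis :: (real ^ 'n) set). (NN x. ennreal (exp (- (c * x\<^sup>2)))))"
  by (rule nn_integral_lborel_prod) auto
 also have "\<dots> = ennreal (sqrt (pi / c) ^ CARD('n))"
  using assms by (simp add: nn_integral_gauss_real ennreal_power)
 also have "sqrt (pi / c) ^ CARD('n) = (pi / c) powr (real CARD('n) / 2)"
  using assms by (simp add: powr_half_sqrt[symmetric] powr_powr[symmetric] powr_realpow flip: powr_powr)
   (simp add: powr_powr powr_realpow[symmetric])
 finally show ?thesis .
qed

lemma nn_integral_heat_kernel_0:
 assumes "t > 0"
 shows "(NN y. ennreal (Gk t (y :: real ^ 'n))) = 1"
proof -
 have "(NN y. ennreal (Gk t (y :: real ^ 'n))) =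
  ennreal ((4 * pi * t) powr (- (real CARD('n) / 2))) * ennreal ((4 * pi * t) powr (real CARD('n) / 2))"
  using nn_integral_gauss[of "1 / (4 * t)", where 'n='n] assms
  by (simp add: heat_kernel_def ennreal_mult' nn_integral_cmult mult.assoc) (simp add: mult_ac)
 also have "\<dots> = 1"
  using assms by (subst ennreal_mult[symmetric]) (auto simp: powr_add[symmetric])
 finally show ?thesis .
qed

lemma nn_integral_heat_kernel:
 assumes "t > 0"
 shows "(NN y. ennreal (Gk t (x - y :: real ^ 'n))) = 1"
  and "(NN y. ennreal (Gk t (y - x :: real ^ 'n))) = 1"
 using nn_integral_reflect[of "\<lambda>y. ennreal (Gk t (y :: real ^ 'n))" x]
  nn_integral_heat_kernel_0[OF assms, where 'n='n]
 by (simp_all add: heat_kernel_diff_commute[of t _ x])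

text \<open>Completing the square in y: the product of two Gaussians is a Gaussian in y about a
  weighted mean of x and z, times a Gaussian in x - z. Integrating y out is then the semigroup
  law.\<close>

lemma heat_kernel_mult:
 fixes x y z :: "real ^ 'n"
 assumes "t > 0" "s > 0"
 shows "Gk t (x - y) * Gk s (y - z) =
  Gk (t + s) (x - z) * Gk (t * s / (t + s)) (y - (1 / (t + s)) *\<^sub>R (s *\<^sub>R x + t *\<^sub>R z))"
proof -
 have ts: "t + s > 0" using assms by simp
 define c where "c = (1 / (t + s)) *\<^sub>R (s *\<^sub>R x + t *\<^sub>R z)"
 have xz: "x - z = (x - y) + (y - z)" by simp
 have yc: "y - c = (1 / (t + s)) *\<^sub>R (t *\<^sub>R (y - z) - s *\<^sub>R (x - y))"
 proof -
  have "(t + s) *\<^sub>R (y - c) = (t + s) *\<^sub>R y - (s *\<^sub>R x + t *\<^sub>R z)"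
   using ts by (simp add: c_def scaleR_diff_right)
  also have "\<dots> = t *\<^sub>R (y - z) - s *\<^sub>R (x - y)" by (simp add: algebra_simps)
  finally have "(1 / (t + s)) *\<^sub>R ((t + s) *\<^sub>R (y - c)) = (1 / (t + s)) *\<^sub>R (t *\<^sub>R (y - z) - s *\<^sub>R (x - y))" by (rule arg_cong)
  then show ?thesis using ts by simp
 qed
 have n2: "(norm (y - c))\<^sup>2 = (1/(t+s))\<^sup>2 * (norm (t *\<^sub>R (y - z) - s *\<^sub>R (x - y)))\<^sup>2"
  unfolding yc norm_scaleR by (simp only: power_mult_distrib power2_abs)
 define a b ab where "a = (x - y) \<bullet> (x - y)" "b = (y - z) \<bullet> (y - z)" "ab = (x - y) \<bullet> (y - z)"
 have n3: "(norm (t *\<^sub>R (y - z) - s *\<^sub>R (x - y)))\<^sup>2 = t\<^sup>2 * b + s\<^sup>2 * a - 2 * s * t * ab"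
 proof -
  have "(norm (t *\<^sub>R p - s *\<^sub>R q))\<^sup>2 = t\<^sup>2 * (p \<bullet> p) + s\<^sup>2 * (q \<bullet> q) - 2 * s * t * (q \<bullet> p)" for p q :: "real ^ 'n"
   unfolding power2_norm_eq_inner by (simp add: inner_diff_left inner_diff_right inner_commute power2_eq_square)
  then show ?thesis by (simp add: a_b_ab_def)
 qed
 have n4: "(norm (x - z))\<^sup>2 = a + b + 2 * ab"
  unfolding xz power2_norm_eq_inner a_b_ab_def by (simp only: inner_add_left inner_add_right inner_commute)
 have n5: "(norm (x - y))\<^sup>2 = a" "(norm (y - z))\<^sup>2 = b"
  by (simp_all add: power2_norm_eq_inner a_b_ab_def)
 have *: "(norm (x - y))\<^sup>2 / (4 * t) + (norm (y - z))\<^sup>2 / (4 * s) =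
  (norm (x - z))\<^sup>2 / (4 * (t + s)) + (norm (y - c))\<^sup>2 / (4 * (t * s / (t + s)))"
  unfolding n2 n3 n4 n5 using assms ts
  by (simp add: divide_simps power2_eq_square) (simp add: algebra_simps)
 have **: "(4 * pi * t) powr p * (4 * pi * s) powr p = (4 * pi * (t + s)) powr p * (4 * pi * (t * s / (t + s))) powr p" for p
  using assms ts by (simp add: powr_mult[symmetric]) (simp add: mult_ac)
 have "Gk t (x - y) * Gk s (y - z) = ((4 * pi * t) powr (- (real CARD('n) / 2)) * (4 * pi * s) powr (- (real CARD('n) / 2)))
  * exp (- ((norm (x - y))\<^sup>2 / (4 * t) + (norm (y - z))\<^sup>2 / (4 * s)))"
  unfolding heat_kernel_def minus_add_distrib exp_add by (simp only: mult_ac)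
 then show ?thesis unfolding * **
  unfolding heat_kernel_def minus_add_distrib exp_add c_def by (simp only: mult_ac)
qed

lemma nn_integral_heat_kernel_mult:
 fixes x z :: "real ^ 'n"
 assumes "t > 0" "s > 0"
 shows "(NN y. ennreal (Gk t (x - y) * Gk s (y - z))) = ennreal (Gk (t + s) (x - z))"
 using assms unfolding heat_kernel_mult[OF assms]
 by (simp add: ennreal_mult heat_kernel_nonneg nn_integral_cmult nn_integral_heat_kernel)

text \<open>Finite combinations of the functions \<open>x\<^bsup>\<beta>\<^esup> \<sigma>\<^bsup>-k\<^esup> G\<^sub>\<sigma>(x)\<close> of parabolic order \<open>d = 2k - |\<beta>|\<close>; these are the
 functions bounded by \<open>\<sigma>\<^bsup>-d/2\<^esup> G\<^sub>2\<^sub>\<sigma>\<close> that arise by differentiating \<open>G\<close>.\<close>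

inductive hk :: "nat \<Rightarrow> (real \<Rightarrow> real ^ 'n \<Rightarrow> real) \<Rightarrow> bool" where
 hk_base: "hk 0 Gk"
| hk_mul: "hk d f \<Longrightarrow> hk (Suc d) (\<lambda>sg x. x $ k / sg * f sg x)"
| hk_div: "hk d f \<Longrightarrow> hk (Suc (Suc d)) (\<lambda>sg x. f sg x / sg)"
| hk_lin: "hk d f \<Longrightarrow> hk d g \<Longrightarrow> hk d (\<lambda>sg x. a * f sg x + b * g sg x)"

lemma hk_zero: "hk d (\<lambda>sg (x::real^'n). 0)"
proof (induction d)
 case 0
 show ?case using hk_lin[OF hk_base hk_base, of 0 0] by simp
next
 case (Suc d)
 show ?case using hk_mul[OF Suc] by simp
qed

lemma hk_sum: "(\<And>k. k \<in> S \<Longrightarrow> hk d (f k)) \<Longrightarrow> hk d (\<lambda>sg x. \<Sum>k\<in>S. f k sg x)"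
proof (induction S rule: infinite_finite_induct)
 case (insert k S)
 then have "hk d (\<lambda>sg x. 1 * f k sg x + 1 * (\<Sum>k\<in>S. f k sg x))"
  by (intro hk_lin) auto
 then show ?case using insert by simp
qed (auto simp: hk_zero)

lemma hk_cmult: "hk d f \<Longrightarrow> hk d (\<lambda>sg x. a * f sg x)"
 using hk_lin[of d f f a 0] by simp

lemma hk_measurable:
 assumes "hk d f" and [measurable]: "a \<in> BM M" "b \<in> BM M"
 shows "(\<lambda>w. f (a w) (b w)) \<in> BM M"
 using assms(1)
proof induction
 case hk_base
 show ?case by measurable
next
 case (hk_mul d f k)
 have [measurable]: "(\<lambda>w. b w $ k) \<in> BM M"
  by (rule measurable_compose[OF assms(3) borel_measurable_continuous_onI]) (auto intro: continuous_intros)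
 show ?case using hk_mul by measurable
next
 case (hk_div d f)
 then show ?case by measurable
next
 case (hk_lin d f g a b)
 then show ?case by measurable
qed

section \<open>Gaussian bounds in terms of the parabolic order\<close>

lemma power_le_exp:
 assumes "(x::real) \<ge> 0"
 shows "x ^ N / fact N \<le> exp x"
proof -
 have "(\<Sum>n\<in>{N}. x ^ n / fact n) \<le> (\<Sum>n. x ^ n / fact n)"
  using assms summable_exp[of x] by (intro sum_le_suminf) (auto simp: divide_inverse mult.commute)
 then show ?thesis by (simp add: exp_def divide_inverse mult.commute)
qed

lemma exp_dominates_power:
 assumes "a > (0::real)"
 shows "\<exists>C\<ge>0. \<forall>q\<ge>0. (1 + q) ^ N \<le> C * exp (a * q)"
proof (intro exI conjI allI impI)
 fix q :: real assume q: "q \<ge> 0"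
 have "(a * (1 + q)) ^ N / fact N \<le> exp (a * (1 + q))"
  by (rule power_le_exp) (use assms q in auto)
 then show "(1 + q) ^ N \<le> (fact N / a ^ N * exp a) * exp (a * q)"
  using assms by (simp add: field_simps power_mult_distrib[symmetric] exp_add)
qed (use assms in auto)

text \<open>In the scaled variable q = |x| / sqrt \<sigma> a factor \<open>x $ k / sg\<close> costs
  a power -1/2 of \<sigma> and at most a factor 1 + q^2, while a division by \<sigma> costs a power
  -1. The polynomial is carried along and absorbed only in \<open>hk_bound\<close>, so that the
  Gaussian is widened just once.\<close>

lemma hk_poly_bound:
 assumes "hk d f"
 shows "\<exists>C\<ge>0. \<exists>N. \<forall>sg>0. \<forall>x :: real ^ 'n. \<bar>f sg x\<bar> \<le>
  C * sg powr (- (real d / 2)) * (1 + (norm x)\<^sup>2 / sg) ^ N * Gk sg x"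
 using assms
proof induction
 case hk_base
 show ?case by (intro exI[of _ 1] conjI exI[of _ 0]) (auto simp: heat_kernel_nonneg)
next
 case (hk_mul d f k)
 then obtain C N where C: "C \<ge> 0" "\<forall>sg>0. \<forall>x :: real ^ 'n. \<bar>f sg x\<bar> \<le>
  C * sg powr (- (real d / 2)) * (1 + (norm x)\<^sup>2 / sg) ^ N * Gk sg x" by blast
 show ?case
 proof (intro exI[of _ C] conjI exI[of _ "Suc N"] allI impI)
  fix sg :: real and x :: "real ^ 'n" assume s: "sg > 0"
  define q where "q = norm x / sqrt sg"
  have q: "q \<ge> 0" "(norm x)\<^sup>2 / sg = q\<^sup>2" using s by (auto simp: q_def power_divide)
  have "q \<le> 1 + q\<^sup>2" using zero_le_power2[of "q - 1/2"] by (simp add: power2_eq_square algebra_simps)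
  have "\<bar>x $ k / sg\<bar> \<le> norm x / sg" using s component_le_norm_cart[of x k] by (simp add: divide_right_mono)
  also have "norm x / sg = sg powr (-1/2) * q" using s
   by (simp add: q_def powr_minus powr_half_sqrt real_div_sqrt field_simps)
  also have "\<dots> \<le> sg powr (-1/2) * (1 + (norm x)\<^sup>2 / sg)" using \<open>q \<le> _\<close> unfolding q(2) by (intro mult_left_mono) auto
  finally have "\<bar>x $ k / sg\<bar> * \<bar>f sg x\<bar> \<le> (sg powr (-1/2) * (1 + (norm x)\<^sup>2 / sg)) *
   (C * sg powr (- (real d / 2)) * (1 + (norm x)\<^sup>2 / sg) ^ N * Gk sg x)"
   using C s by (intro mult_mono) auto
  also have "\<dots> = C * (sg powr (-1/2) * sg powr (- (real d / 2))) * (1 + (norm x)\<^sup>2 / sg) ^ Suc N * Gk sg x"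
   by (simp add: mult_ac)
  also have "sg powr (-1/2) * sg powr (- (real d / 2)) = sg powr (- (real (Suc d) / 2))"
  proof -
   have "-1/2 + - (real d / 2) = - (real (Suc d) / 2)" by (simp add: field_simps)
   then show ?thesis by (simp only: powr_add[symmetric])
  qed
  finally show "\<bar>x $ k / sg * f sg x\<bar> \<le> C * sg powr (- (real (Suc d) / 2)) * (1 + (norm x)\<^sup>2 / sg) ^ Suc N * Gk sg x"
   by (simp only: abs_mult)
 qed (use C in auto)
next
 case (hk_div d f)
 then obtain C N where C: "C \<ge> 0" "\<forall>sg>0. \<forall>x :: real ^ 'n. \<bar>f sg x\<bar> \<le>
  C * sg powr (- (real d / 2)) * (1 + (norm x)\<^sup>2 / sg) ^ N * Gk sg x" by blast
 show ?case
 proof (intro exI[of _ C] conjI exI[of _ N] allI impI)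
  fix sg :: real and x :: "real ^ 'n" assume s: "sg > 0"
  have e: "sg powr (- (real (Suc (Suc d)) / 2)) = sg powr (- (real d / 2)) / sg"
  proof -
   have "- (real (Suc (Suc d)) / 2) = - (real d / 2) - 1" by (simp add: field_simps)
   then show ?thesis using s by (simp only: powr_diff powr_one)
  qed
  have "\<bar>f sg x\<bar> / sg \<le> C * sg powr (- (real d / 2)) * (1 + (norm x)\<^sup>2 / sg) ^ N * Gk sg x / sg"
   using C s by (intro divide_right_mono) auto
  then show "\<bar>f sg x / sg\<bar> \<le> C * sg powr (- (real (Suc (Suc d)) / 2)) * (1 + (norm x)\<^sup>2 / sg) ^ N * Gk sg x"
   unfolding e using s by (simp add: mult_ac)
 qed (use C in auto)
next
 case (hk_lin d f g a b)
 then obtain C N C' N' where C: "C \<ge> 0" "\<And>sg x :: real ^ 'n. sg > 0 \<Longrightarrow> \<bar>f sg x\<bar> \<le>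
  C * sg powr (- (real d / 2)) * (1 + (norm x)\<^sup>2 / sg) ^ N * Gk sg x"
 and C': "C' \<ge> 0" "\<And>sg x :: real ^ 'n. sg > 0 \<Longrightarrow> \<bar>g sg x\<bar> \<le>
  C' * sg powr (- (real d / 2)) * (1 + (norm x)\<^sup>2 / sg) ^ N' * Gk sg x" by meson
 show ?case
 proof (intro exI[of _ "\<bar>a\<bar> * C + \<bar>b\<bar> * C'"] conjI exI[of _ "N + N'"] allI impI)
  fix sg :: real and x :: "real ^ 'n" assume s: "sg > 0"
  have 1: "(1 + (norm x)\<^sup>2 / sg) ^ N \<le> (1 + (norm x)\<^sup>2 / sg) ^ (N + N')"
    "(1 + (norm x)\<^sup>2 / sg) ^ N' \<le> (1 + (norm x)\<^sup>2 / sg) ^ (N + N')"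
   using s by (auto intro!: power_increasing)
  have "\<bar>f sg x\<bar> \<le> C * sg powr (- (real d / 2)) * (1 + (norm x)\<^sup>2 / sg) ^ (N + N') * Gk sg x"
   by (rule order.trans[OF C(2)[OF s]]) (intro mult_mono 1 order.refl; use s C heat_kernel_nonneg in auto)
  moreover have "\<bar>g sg x\<bar> \<le> C' * sg powr (- (real d / 2)) * (1 + (norm x)\<^sup>2 / sg) ^ (N + N') * Gk sg x"
   by (rule order.trans[OF C'(2)[OF s]]) (intro mult_mono 1 order.refl; use s C' heat_kernel_nonneg in auto)
  ultimately have "\<bar>a\<bar> * \<bar>f sg x\<bar> + \<bar>b\<bar> * \<bar>g sg x\<bar> \<le>
   \<bar>a\<bar> * (C * sg powr (- (real d / 2)) * (1 + (norm x)\<^sup>2 / sg) ^ (N + N') * Gk sg x)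
   + \<bar>b\<bar> * (C' * sg powr (- (real d / 2)) * (1 + (norm x)\<^sup>2 / sg) ^ (N + N') * Gk sg x)"
   by (intro add_mono mult_left_mono) auto
  moreover have "\<bar>a * f sg x + b * g sg x\<bar> \<le> \<bar>a\<bar> * \<bar>f sg x\<bar> + \<bar>b\<bar> * \<bar>g sg x\<bar>"
   by (metis abs_mult abs_triangle_ineq)
  ultimately show "\<bar>a * f sg x + b * g sg x\<bar> \<le> (\<bar>a\<bar> * C + \<bar>b\<bar> * C') * sg powr (- (real d / 2)) * (1 + (norm x)\<^sup>2 / sg) ^ (N + N') * Gk sg x"
   by (simp add: algebra_simps)
 qed (use C C' in auto)
qed

text \<open>Since 1/(4\<sigma>) = 1/(8\<sigma>) + 1/(8\<sigma>), one half of the Gaussian exponent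
  forms \<open>Gk (2 * sg)\<close> and the other half absorbs the polynomial. The change of
  prefactor produces the factor 2 to the power m/2.\<close>

lemma hk_bound:
 assumes "hk d f"
 obtains C where "C \<ge> 0" "\<And>sg x :: real ^ 'n. sg > 0 \<Longrightarrow>
  \<bar>f sg x\<bar> \<le> C * sg powr (- (real d / 2)) * Gk (2 * sg) x"
proof -
 obtain C N where C: "C \<ge> 0" "\<And>sg x :: real ^ 'n. sg > 0 \<Longrightarrow> \<bar>f sg x\<bar> \<le>
  C * sg powr (- (real d / 2)) * (1 + (norm x)\<^sup>2 / sg) ^ N * Gk sg x"
  using hk_poly_bound[OF assms] by meson
 obtain K :: real where K: "K \<ge> 0" "\<And>q. q \<ge> 0 \<Longrightarrow> (1 + q) ^ N \<le> K * exp (1/8 * q)"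
  using exp_dominates_power[of "1/8" N] by auto
 show ?thesis
 proof (rule that)
  show "C * (K * 2 powr (real CARD('n) / 2)) \<ge> 0" using C K by simp
  fix sg :: real and x :: "real ^ 'n" assume s: "sg > 0"
  have e1: "exp (- ((norm x)\<^sup>2 / (4 * sg))) = exp (- (1/8 * ((norm x)\<^sup>2 / sg))) * exp (- ((norm x)\<^sup>2 / (4 * (2 * sg))))"
   using s by (subst exp_add[symmetric]) (simp add: field_simps)
  have e2: "(4 * pi * sg) powr (- (real CARD('n) / 2)) = 2 powr (real CARD('n) / 2) * (4 * pi * (2 * sg)) powr (- (real CARD('n) / 2))"
  proof -
   have "(4 * pi * (2 * sg)) powr (- (real CARD('n) / 2)) = (2 * (4 * pi * sg)) powr (- (real CARD('n) / 2))"
    by (simp add: mult_ac)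
   also have "\<dots> = 2 powr (- (real CARD('n) / 2)) * (4 * pi * sg) powr (- (real CARD('n) / 2))"
    by (rule powr_mult)
   finally show ?thesis by (simp add: mult.assoc[symmetric] powr_add[symmetric])
  qed
  have G: "Gk sg x = 2 powr (real CARD('n) / 2) * exp (- (1/8 * ((norm x)\<^sup>2 / sg))) * Gk (2 * sg) x"
   unfolding heat_kernel_def e1 e2 by (simp only: mult_ac)
  have "(1 + (norm x)\<^sup>2 / sg) ^ N * exp (- (1/8 * ((norm x)\<^sup>2 / sg))) \<le> K * exp (1/8 * ((norm x)\<^sup>2 / sg)) * exp (- (1/8 * ((norm x)\<^sup>2 / sg)))"
   using K(2)[of "(norm x)\<^sup>2 / sg"] s by (intro mult_right_mono) auto
  also have "\<dots> = K" by (simp add: exp_minus)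
  finally have 1: "(1 + (norm x)\<^sup>2 / sg) ^ N * exp (- (1/8 * ((norm x)\<^sup>2 / sg))) \<le> K" .
  have "\<bar>f sg x\<bar> \<le> C * sg powr (- (real d / 2)) * (1 + (norm x)\<^sup>2 / sg) ^ N * Gk sg x"
   by (rule C(2)[OF s])
  also have "\<dots> = C * sg powr (- (real d / 2)) * ((1 + (norm x)\<^sup>2 / sg) ^ N * exp (- (1/8 * ((norm x)\<^sup>2 / sg)))) *
   2 powr (real CARD('n) / 2) * Gk (2 * sg) x"
   unfolding G by (simp only: mult_ac)
  also have "\<dots> \<le> C * sg powr (- (real d / 2)) * K * 2 powr (real CARD('n) / 2) * Gk (2 * sg) x"
   using C 1 by (intro mult_right_mono mult_left_mono) (auto simp: heat_kernel_nonneg)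
  finally show "\<bar>f sg x\<bar> \<le> C * (K * 2 powr (real CARD('n) / 2)) * sg powr (- (real d / 2)) * Gk (2 * sg) x"
   by (simp add: mult_ac)
 qed
qed

section \<open>Space-time derivatives of the kernels\<close>

text \<open>Joint differentiability in (\<sigma>, x) is recorded instead of separate partial
  derivatives, because the kernels are later composed with space-time maps such as the one sending
  (s, y) to (T - s, y - x). The functions \<open>f'\<close> are the spatial partials,
  \<open>g\<close> is the time derivative.\<close>

definition hk_deriv ::
  "(real \<Rightarrow> real ^ 'n \<Rightarrow> real) \<Rightarrow> ('n \<Rightarrow> real \<Rightarrow> real ^ 'n \<Rightarrow> real) \<Rightarrow> (real \<Rightarrow> real ^ 'n \<Rightarrow> real) \<Rightarrow> bool"
 where "hk_deriv f f' g \<longleftrightarrow> (\<forall>sg>0. \<forall>x. ((\<lambda>p. f (fst p) (snd p)) has_derivative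
  (\<lambda>v. fst v * g sg x + (SS k. snd v $ k * f' k sg x))) (at (sg, x)))"

lemma heat_kernel_deriv:
 "hk_deriv (Gk :: real \<Rightarrow> real ^ 'n \<Rightarrow> real)
  (\<lambda>k sg x. - (1/2) * (x $ k / sg * Gk sg x))
  (\<lambda>sg x. - (real CARD('n) / 2) * (Gk sg x / sg)
    + 1 / 4 * (SS k. x $ k / sg * (x $ k / sg * Gk sg x)))"
 unfolding hk_deriv_def
proof (intro allI impI)
 fix sg :: real and x :: "real ^ 'n" assume s: "sg > 0"
 define c where "c = - (real CARD('n) / 2)"
 \<comment> \<open>With the power of the prefactor written as an exponential the kernel becomes one
   exponential of a differentiable function. The two agree for \<sigma> > 0, hence the passage
   through the open set \<open>{0<..} \<times> UNIV\<close>.\<close>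
 define E where "E = (\<lambda>p :: real \<times> (real ^ 'n). exp (c * ln (4 * pi * fst p) - (snd p \<bullet> snd p) * inverse (4 * fst p)))"
 have E: "E p = Gk (fst p) (snd p)" if "p \<in> {0<..} \<times> UNIV" for p
 proof -
  have "fst p > 0" using that by auto
  then have "(4 * pi * fst p) powr c = exp (c * ln (4 * pi * fst p))" by (simp add: powr_def)
  then have "Gk (fst p) (snd p) = exp (c * ln (4 * pi * fst p)) * exp (- (snd p \<bullet> snd p / (4 * fst p)))"
   unfolding heat_kernel_def c_def[symmetric] power2_norm_eq_inner by (simp only:)
  then show ?thesis by (simp only: E_def diff_conv_add_uminus exp_add divide_inverse)
 qed
 have EE: "Gk sg x = E (sg, x)" using E[of "(sg, x)"] s by simp
 have a: "((\<lambda>p :: real \<times> (real ^ 'n). ln (4 * pi * fst p)) has_derivative (\<lambda>v. fst v / sg)) (at (sg, x))"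
 proof -
  have "((\<lambda>p :: real \<times> (real ^ 'n). 4 * pi * fst p) has_derivative (\<lambda>v. 4 * pi * fst v)) (at (sg, x))"
   by (intro has_derivative_mult_right has_derivative_fst has_derivative_ident)
  then have "((\<lambda>p :: real \<times> (real ^ 'n). ln (4 * pi * fst p)) has_derivative (\<lambda>v. (4 * pi * fst v) * inverse (4 * pi * fst (sg, x)))) (at (sg, x))"
   using s by (intro has_derivative_ln) auto
  moreover have "(4 * pi * fst v) * inverse (4 * pi * fst (sg, x)) = fst v / sg" for v :: "real \<times> (real ^ 'n)"
   using s by (simp add: field_simps)
  ultimately show ?thesis by simp
 qed
 have b: "((\<lambda>p :: real \<times> (real ^ 'n). snd p \<bullet> snd p) has_derivative (\<lambda>v. 2 * (x \<bullet> snd v))) (at (sg, x))"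
 proof -
  have "((\<lambda>p :: real \<times> (real ^ 'n). snd p \<bullet> snd p) has_derivative (\<lambda>v. snd (sg, x) \<bullet> snd v + snd v \<bullet> snd (sg, x))) (at (sg, x))"
   by (intro has_derivative_inner has_derivative_snd has_derivative_ident)
  then show ?thesis by (simp add: inner_commute)
 qed
 have d: "((\<lambda>p :: real \<times> (real ^ 'n). inverse (4 * fst p)) has_derivative (\<lambda>v. - (fst v / (4 * sg\<^sup>2)))) (at (sg, x))"
 proof -
  have "((\<lambda>p :: real \<times> (real ^ 'n). 4 * fst p) has_derivative (\<lambda>v. 4 * fst v)) (at (sg, x))"
   by (intro has_derivative_mult_right has_derivative_fst has_derivative_ident)
  then have "((\<lambda>p :: real \<times> (real ^ 'n). inverse (4 * fst p)) has_derivative (\<lambda>v. - (inverse (4 * fst (sg, x)) * (4 * fst v) * inverse (4 * fst (sg, x))))) (at (sg, x))"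
   using s by (intro Deriv.has_derivative_inverse) auto
  moreover have "- (inverse (4 * fst (sg, x)) * (4 * fst v) * inverse (4 * fst (sg, x))) = - (fst v / (4 * sg\<^sup>2))" for v :: "real \<times> (real ^ 'n)"
   using s by (simp add: power2_eq_square field_simps)
  ultimately show ?thesis by (simp only:)
 qed
 have "(E has_derivative (\<lambda>v. (c * (fst v / sg) - ((snd (sg, x) \<bullet> snd (sg, x)) * (- (fst v / (4 * sg\<^sup>2))) + 2 * (x \<bullet> snd v) * inverse (4 * fst (sg, x))) )
   * exp (c * ln (4 * pi * fst (sg, x)) - (snd (sg, x) \<bullet> snd (sg, x)) * inverse (4 * fst (sg, x))))) (at (sg, x))"
  unfolding E_def
  by (intro has_derivative_exp has_derivative_diff has_derivative_mult_right a has_derivative_mult b d)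
 then have "(E has_derivative (\<lambda>v. E (sg, x) * (c * (fst v / sg) - ((2 * (x \<bullet> snd v)) * (4 * sg) - (x \<bullet> x) * (4 * fst v)) / (4 * sg)\<^sup>2))) (at (sg, x))"
 proof (rule back_subst[where P = "\<lambda>d. (E has_derivative d) (at (sg, x))"])
  show "(\<lambda>v. (c * (fst v / sg) - ((snd (sg, x) \<bullet> snd (sg, x)) * (- (fst v / (4 * sg\<^sup>2))) + 2 * (x \<bullet> snd v) * inverse (4 * fst (sg, x))) )
   * exp (c * ln (4 * pi * fst (sg, x)) - (snd (sg, x) \<bullet> snd (sg, x)) * inverse (4 * fst (sg, x))))
   = (\<lambda>v. E (sg, x) * (c * (fst v / sg) - ((2 * (x \<bullet> snd v)) * (4 * sg) - (x \<bullet> x) * (4 * fst v)) / (4 * sg)\<^sup>2))"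
  proof (rule ext)
   fix v :: "real \<times> (real ^ 'n)"
   have "((2 * A) * (4 * sg) - B * (4 * w)) / (4 * sg)\<^sup>2 = B * (- (w / (4 * sg\<^sup>2))) + 2 * A * inverse (4 * sg)" for A B w :: real
    using s by (simp add: diff_divide_distrib inverse_eq_divide) (simp add: power2_eq_square field_simps)
   from this[of "x \<bullet> snd v" "x \<bullet> x" "fst v"] show "(c * (fst v / sg) - ((snd (sg, x) \<bullet> snd (sg, x)) * (- (fst v / (4 * sg\<^sup>2))) + 2 * (x \<bullet> snd v) * inverse (4 * fst (sg, x))) )
   * exp (c * ln (4 * pi * fst (sg, x)) - (snd (sg, x) \<bullet> snd (sg, x)) * inverse (4 * fst (sg, x)))
   = E (sg, x) * (c * (fst v / sg) - ((2 * (x \<bullet> snd v)) * (4 * sg) - (x \<bullet> x) * (4 * fst v)) / (4 * sg)\<^sup>2)"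
    by (simp only: E_def fst_conv snd_conv mult.commute)
  qed
 qed
 then have "((\<lambda>p. Gk (fst p) (snd p)) has_derivative (\<lambda>v. E (sg, x) * (c * (fst v / sg) - ((2 * (x \<bullet> snd v)) * (4 * sg) - (x \<bullet> x) * (4 * fst v)) / (4 * sg)\<^sup>2))) (at (sg, x))"
  by (rule has_derivative_transform_within_open[of _ _ _ UNIV "{0<..} \<times> UNIV"]) (use s E in "auto intro!: open_Times")
 moreover have "E (sg, x) * (c * (fst v / sg) - ((2 * (x \<bullet> snd v)) * (4 * sg) - (x \<bullet> x) * (4 * fst v)) / (4 * sg)\<^sup>2)
  = fst v * (- (real CARD('n) / 2) * (Gk sg x / sg)
    + 1 / 4 * (SS k. x $ k / sg * (x $ k / sg * Gk sg x)))
   + (SS k. snd v $ k * (- (1/2) * (x $ k / sg * Gk sg x)))" for v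
 proof -
  have 1: "(SS k. x $ k / sg * (x $ k / sg * Gk sg x)) = (x \<bullet> x) / sg\<^sup>2 * Gk sg x"
   by (simp add: inner_vec_def sum_divide_distrib sum_distrib_left sum_distrib_right power2_eq_square mult_ac)
  have 2: "(SS k. snd v $ k * (- (1/2) * (x $ k / sg * Gk sg x))) = - (1/2) * ((x \<bullet> snd v) / sg * Gk sg x)"
   by (simp add: inner_vec_def sum_divide_distrib sum_distrib_left sum_distrib_right sum_negf mult_ac)
  have "c * (w / sg) - ((2 * A) * (4 * sg) - B * (4 * w)) / (4 * sg)\<^sup>2
   = w * (c / sg + 1 / 4 * (B / sg\<^sup>2)) - (1 / 2) * (A / sg)" for A B w
   using s by (simp add: diff_divide_distrib) (simp add: field_simps power2_eq_square)
  note 3 = this[of "fst v" "x \<bullet> snd v" "x \<bullet> x"]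
  show ?thesis unfolding 1 2 EE[symmetric] 3 by (simp add: c_def algebra_simps)
 qed
 ultimately show "((\<lambda>p. Gk (fst p) (snd p)) has_derivative
  (\<lambda>v. fst v * (- (real CARD('n) / 2) * (Gk sg x / sg)
    + 1 / 4 * (SS k. x $ k / sg * (x $ k / sg * Gk sg x)))
   + (SS k. snd v $ k * (- (1/2) * (x $ k / sg * Gk sg x))))) (at (sg, x))"
  by simp
qed

text \<open>The factors \<open>1 *\<close> and \<open>(- 1) *\<close> give the derivatives the shape
  produced by the rule \<open>hk_lin\<close>, so that their membership in \<open>hk\<close> follows
  by introduction rules alone.\<close>

lemma hk_deriv_mul:
 fixes f :: "real \<Rightarrow> real ^ 'n \<Rightarrow> real"
 assumes fg: "hk_deriv f f' g"
 shows "hk_deriv (\<lambda>sg x. x $ j / sg * f sg x) (\<lambda>k sg x. (if k = j then 1 else 0) * (f sg x / sg) + 1 * (x $ j / sg * f' k sg x))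
   (\<lambda>sg x. (- 1) * (x $ j / sg * f sg x / sg) + 1 * (x $ j / sg * g sg x))"
 unfolding hk_deriv_def
proof (intro allI impI)
 fix sg :: real and x :: "real ^ 'n" assume s: "sg > 0"
 have "((\<lambda>p. f (fst p) (snd p)) has_derivative (\<lambda>v. fst v * g sg x + (SS k. snd v $ k * f' k sg x))) (at (sg, x))"
  using fg s unfolding hk_deriv_def by blast
 moreover have "((\<lambda>p. snd p $ j / fst p) has_derivative (\<lambda>v. snd v $ j / sg - fst v * (x $ j / sg / sg))) (at (sg, x))"
 proof -
  have "((\<lambda>p :: real \<times> (real ^ 'n). snd p $ j) has_derivative (\<lambda>v. snd v $ j)) (at (sg, x))"
   by (intro bounded_linear_imp_has_derivative bounded_linear_compose[OF bounded_linear_vec_nth bounded_linear_snd])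
  from has_derivative_divide'[OF this has_derivative_fst[OF has_derivative_ident]] s
  have "((\<lambda>p. snd p $ j / fst p) has_derivative (\<lambda>v. (snd v $ j * sg - x $ j * fst v) / (sg * sg))) (at (sg, x))"
   by simp
  then show ?thesis using s by (simp add: diff_divide_distrib mult.commute)
 qed
 ultimately have "((\<lambda>p. snd p $ j / fst p * f (fst p) (snd p)) has_derivative
  (\<lambda>v. (x $ j / sg) * (fst v * g sg x + (SS k. snd v $ k * f' k sg x)) + (snd v $ j / sg - fst v * (x $ j / sg / sg)) * f sg x)) (at (sg, x))"
  using has_derivative_mult[of "\<lambda>p. snd p $ j / fst p" _ "(sg, x)" UNIV "\<lambda>p. f (fst p) (snd p)"] by simp
 moreover have "(x $ j / sg) * (fst v * g sg x + (SS k. snd v $ k * f' k sg x)) + (snd v $ j / sg - fst v * (x $ j / sg / sg)) * f sg x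
  = fst v * (- 1 * (x $ j / sg * f sg x / sg) + 1 * (x $ j / sg * g sg x)) +
    (SS k. snd v $ k * ((if k = j then 1 else 0) * (f sg x / sg) + 1 * (x $ j / sg * f' k sg x)))" for v
 proof -
  have "(SS k. snd v $ k * ((if k = j then 1 else 0) * (f sg x / sg) + 1 * (x $ j / sg * f' k sg x)))
   = (SS k. if k = j then snd v $ k * (f sg x / sg) else 0) + (x $ j / sg) * (SS k. snd v $ k * f' k sg x)"
   unfolding sum_distrib_left sum.distrib[symmetric] by (rule sum.cong) (auto simp: algebra_simps)
  then show ?thesis by (simp add: sum.delta algebra_simps)
 qed
 ultimately show "((\<lambda>p. snd p $ j / fst p * f (fst p) (snd p)) has_derivative
    (\<lambda>v. fst v * (- 1 * (x $ j / sg * f sg x / sg) + 1 * (x $ j / sg * g sg x)) +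
    (SS k. snd v $ k * ((if k = j then 1 else 0) * (f sg x / sg) + 1 * (x $ j / sg * f' k sg x))))) (at (sg, x))"
  by simp
qed

text \<open>Parabolic scaling: a space derivative raises the order by one, a time derivative by two.
  Closure of \<open>hk\<close> under both means that higher derivatives of the Gaussian never have
  to be written out; only their order enters the estimates.\<close>

lemma hk_deriv_ex:
 fixes f :: "real \<Rightarrow> real ^ 'n \<Rightarrow> real"
 assumes "hk d f"
 shows "\<exists>f' g. (\<forall>k. hk (Suc d) (f' k)) \<and> hk (Suc (Suc d)) g \<and> hk_deriv f f' g"
 using assms
proof induction
 case hk_base
 show ?case
  by (rule exI, rule exI, intro conjI allI, rule_tac [3] heat_kernel_deriv)
   (intro hk_cmult hk_lin hk_div hk_mul hk_sum hk.hk_base)+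
next
 case (hk_mul d f j)
 then obtain f' g where fg: "\<forall>k. hk (Suc d) (f' k)" "hk (Suc (Suc d)) g" "hk_deriv f f' g" by blast
 show ?case
 proof (intro exI conjI allI)
  show "hk (Suc (Suc d)) (\<lambda>sg x. (if k = j then 1 else 0) * (f sg x / sg) + 1 * (x $ j / sg * f' k sg x))" for k
   by (intro hk_lin hk_div hk.hk_mul fg(1)[rule_format] hk_mul(1))
  show "hk (Suc (Suc (Suc d))) (\<lambda>sg x. (- 1) * (x $ j / sg * f sg x / sg) + 1 * (x $ j / sg * g sg x))"
   by (intro hk_lin hk_div hk.hk_mul fg hk_mul(1))
  show "hk_deriv (\<lambda>sg x. x $ j / sg * f sg x) (\<lambda>k sg x. (if k = j then 1 else 0) * (f sg x / sg) + 1 * (x $ j / sg * f' k sg x))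
   (\<lambda>sg x. (- 1) * (x $ j / sg * f sg x / sg) + 1 * (x $ j / sg * g sg x))"
   by (rule hk_deriv_mul[OF fg(3)])
 qed
next
 case (hk_div d f)
 then obtain f' g where fg: "\<forall>k. hk (Suc d) (f' k)" "hk (Suc (Suc d)) g" "hk_deriv f f' g" by blast
 show ?case
 proof (intro exI conjI allI)
  show "hk (Suc (Suc (Suc d))) (\<lambda>sg x. f' k sg x / sg)" for k
   by (intro hk_lin hk.hk_div fg(1)[rule_format])
  show "hk (Suc (Suc (Suc (Suc d)))) (\<lambda>sg x. 1 * (g sg x / sg) + (- 1) * (f sg x / sg / sg))"
   by (intro hk_lin hk.hk_div fg hk_div(1))
  show "hk_deriv (\<lambda>sg x. f sg x / sg) (\<lambda>k sg x. f' k sg x / sg) (\<lambda>sg x. 1 * (g sg x / sg) + (- 1) * (f sg x / sg / sg))"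
   unfolding hk_deriv_def
  proof (intro allI impI)
   fix sg :: real and x :: "real ^ 'n" assume s: "sg > 0"
   have fd: "((\<lambda>p. f (fst p) (snd p)) has_derivative (\<lambda>v. fst v * g sg x + (SS k. snd v $ k * f' k sg x))) (at (sg, x))"
    using fg(3) s unfolding hk_deriv_def by blast
   have gd: "((\<lambda>p. 1 / fst p) has_derivative (\<lambda>v. - (fst v / sg / sg))) (at (sg, x))"
   proof -
    have "((\<lambda>p :: real \<times> (real ^ 'n). inverse (fst p)) has_derivative (\<lambda>v. - (inverse (fst (sg, x)) * fst v * inverse (fst (sg, x))))) (at (sg, x))"
     using s by (intro Deriv.has_derivative_inverse has_derivative_fst has_derivative_ident) auto
    then show ?thesis by (simp add: divide_inverse mult_ac)
   qed
   have "((\<lambda>p. 1 / fst p * f (fst p) (snd p)) has_derivative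
    (\<lambda>v. (1 / sg) * (fst v * g sg x + (SS k. snd v $ k * f' k sg x)) + (- (fst v / sg / sg)) * f sg x)) (at (sg, x))"
    using has_derivative_mult[OF gd fd] by (simp only: fst_conv snd_conv)
   moreover have "(1 / sg) * (fst v * g sg x + (SS k. snd v $ k * f' k sg x)) + (- (fst v / sg / sg)) * f sg x
    = fst v * (1 * (g sg x / sg) + - 1 * (f sg x / sg / sg)) + (SS k. snd v $ k * (f' k sg x / sg))" for v
    by (simp add: sum_divide_distrib algebra_simps add_divide_distrib)
   ultimately show "((\<lambda>p. f (fst p) (snd p) / fst p) has_derivative
      (\<lambda>v. fst v * (1 * (g sg x / sg) + - 1 * (f sg x / sg / sg)) + (SS k. snd v $ k * (f' k sg x / sg)))) (at (sg, x))"
    by simp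
  qed
 qed
next
 case (hk_lin d f1 f2 a b)
 then obtain f1' g1 f2' g2 where fg: "\<forall>k. hk (Suc d) (f1' k)" "hk (Suc (Suc d)) g1" "hk_deriv f1 f1' g1"
  "\<forall>k. hk (Suc d) (f2' k)" "hk (Suc (Suc d)) g2" "hk_deriv f2 f2' g2" by blast
 show ?case
 proof (intro exI conjI allI)
  show "hk (Suc d) (\<lambda>sg x. a * f1' k sg x + b * f2' k sg x)" for k
   by (intro hk.hk_lin fg[rule_format])
  show "hk (Suc (Suc d)) (\<lambda>sg x. a * g1 sg x + b * g2 sg x)"
   by (intro hk.hk_lin fg)
  show "hk_deriv (\<lambda>sg x. a * f1 sg x + b * f2 sg x) (\<lambda>k sg x. a * f1' k sg x + b * f2' k sg x) (\<lambda>sg x. a * g1 sg x + b * g2 sg x)"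
   unfolding hk_deriv_def
  proof (intro allI impI)
   fix sg :: real and x :: "real ^ 'n" assume s: "sg > 0"
   have "((\<lambda>p. f1 (fst p) (snd p)) has_derivative (\<lambda>v. fst v * g1 sg x + (SS k. snd v $ k * f1' k sg x))) (at (sg, x))"
    "((\<lambda>p. f2 (fst p) (snd p)) has_derivative (\<lambda>v. fst v * g2 sg x + (SS k. snd v $ k * f2' k sg x))) (at (sg, x))"
    using fg s unfolding hk_deriv_def by blast+
   from has_derivative_add[OF has_derivative_mult_right[OF this(1), of a] has_derivative_mult_right[OF this(2), of b]]
   show "((\<lambda>p. a * f1 (fst p) (snd p) + b * f2 (fst p) (snd p)) has_derivative
    (\<lambda>v. fst v * (a * g1 sg x + b * g2 sg x) + (SS k. snd v $ k * (a * f1' k sg x + b * f2' k sg x)))) (at (sg, x))"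
    by (rule back_subst[where P = "\<lambda>d. (_ has_derivative d) _"]) (auto simp: algebra_simps sum.distrib sum_distrib_left)
  qed
 qed
qed

lemma hk_deriv_time:
 fixes x :: "real ^ 'n"
 assumes "hk_deriv f f' g" "sg > 0"
 shows "((\<lambda>s. f s x) has_real_derivative g sg x) (at sg)"
proof -
 have "((\<lambda>p. f (fst p) (snd p)) has_derivative (\<lambda>v. fst v * g sg x + (SS k. snd v $ k * f' k sg x))) (at (sg, x))"
  using assms by (auto simp: hk_deriv_def)
 moreover have "((\<lambda>s. (s, x)) has_derivative (\<lambda>h. (h, 0))) (at sg)"
  by (intro has_derivative_Pair has_derivative_ident has_derivative_const)
 ultimately have "((\<lambda>s. f (fst (s, x)) (snd (s, x))) has_derivative (\<lambda>h. fst (h, 0 :: real ^ 'n) * g sg x + (SS k. snd (h, 0 :: real ^ 'n) $ k * f' k sg x))) (at sg)"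
  by (rule has_derivative_compose[rotated])
 then show ?thesis by (simp add: has_field_derivative_def mult_commute_abs)
qed

lemma hk_deriv_space:
 fixes x :: "real ^ 'n"
 assumes "hk_deriv f f' g" "sg > 0"
 shows "((\<lambda>x. f sg x) has_derivative (\<lambda>v. SS k. v $ k * f' k sg x)) (at x)"
proof -
 have "((\<lambda>p. f (fst p) (snd p)) has_derivative (\<lambda>v. fst v * g sg x + (SS k. snd v $ k * f' k sg x))) (at (sg, x))"
  using assms by (auto simp: hk_deriv_def)
 moreover have "((\<lambda>y. (sg, y)) has_derivative (\<lambda>h. (0, h))) (at x)"
  by (intro has_derivative_Pair has_derivative_ident has_derivative_const)
 ultimately have "((\<lambda>y. f (fst (sg, y)) (snd (sg, y))) has_derivative (\<lambda>h. fst (0 :: real, h) * g sg x + (SS k. snd (0 :: real, h) $ k * f' k sg x))) (at x)"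
  by (rule has_derivative_compose[rotated])
 then show ?thesis by simp
qed

lemma hk_continuous: 
 fixes f :: "real \<Rightarrow> real ^ 'n \<Rightarrow> real"
 assumes "hk d f" "sg > 0"
 shows "continuous_on UNIV (f sg)"
proof -
 obtain f' g where "hk_deriv f f' g" using hk_deriv_ex[OF assms(1)] by blast
 then have "(f sg) differentiable (at x)" for x
  using hk_deriv_space[of f f' g sg x] assms(2) by (auto simp: differentiable_def)
 then show ?thesis by (simp add: continuous_at_imp_continuous_on differentiable_imp_continuous_within)
qed

text \<open>The time derivative of the heat kernel, which is also its Laplacian.\<close>

definition Gk' :: "real \<Rightarrow> real ^ 'n \<Rightarrow> real"
 where "Gk' sg x = - (real CARD('n) / 2) * (Gk sg x / sg)
    + 1 / 4 * (SS k. x $ k / sg * (x $ k / sg * Gk sg x))"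

lemma hk_heat_kernel': "hk 2 (Gk' :: real \<Rightarrow> real ^ 'n \<Rightarrow> real)"
proof -
 have "hk (Suc (Suc 0)) (\<lambda>sg x :: real ^ 'n. - (real CARD('n) / 2) * (Gk sg x / sg)
    + 1 / 4 * (SS k. x $ k / sg * (x $ k / sg * Gk sg x)))"
  by (intro hk_lin hk_div hk_sum hk_mul hk_base)
 moreover have "(Gk' :: real \<Rightarrow> real ^ 'n \<Rightarrow> real) = (\<lambda>sg x. - (real CARD('n) / 2) * (Gk sg x / sg)
    + 1 / 4 * (SS k. x $ k / sg * (x $ k / sg * Gk sg x)))"
  by (intro ext) (simp only: Gk'_def)
 ultimately show ?thesis by (simp only: numeral_2_eq_2)
qed

lemma hk_deriv_heat_kernel:
 "hk_deriv (Gk :: real \<Rightarrow> real ^ 'n \<Rightarrow> real) (\<lambda>k sg x. - (1/2) * (x $ k / sg * Gk sg x)) Gk'"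
 using heat_kernel_deriv[where 'n='n] by (simp only: Gk'_def[abs_def])

text \<open>The exponential increases with s and the prefactor decreases, so the first is taken at b
  and the second at a.\<close>

lemma heat_kernel_mono:
 fixes z :: "real ^ 'n"
 assumes "0 < a" "a \<le> s" "s \<le> b"
 shows "Gk s z \<le> (b / a) powr (real CARD('n) / 2) * Gk b z"
proof -
 have 1: "exp (- ((norm z)\<^sup>2 / (4 * s))) \<le> exp (- ((norm z)\<^sup>2 / (4 * b)))"
  using assms by (auto intro!: divide_left_mono)
 have "(4 * pi * s) powr (- (real CARD('n) / 2)) \<le> (4 * pi * a) powr (- (real CARD('n) / 2))"
  using assms by (intro powr_mono2') auto
 also have "(4 * pi * a) powr (- (real CARD('n) / 2)) = (b / a) powr (real CARD('n) / 2) * (4 * pi * b) powr (- (real CARD('n) / 2))"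
 proof -
  have "(4 * pi * b) powr (real CARD('n) / 2) = (b / a) powr (real CARD('n) / 2) * (4 * pi * a) powr (real CARD('n) / 2)"
   using assms by (subst powr_mult[symmetric]) (simp add: field_simps)
  then show ?thesis using assms by (simp add: powr_minus field_simps)
 qed
 finally have 2: "(4 * pi * s) powr (- (real CARD('n) / 2)) \<le> (b / a) powr (real CARD('n) / 2) * (4 * pi * b) powr (- (real CARD('n) / 2))" .
 show ?thesis unfolding heat_kernel_def mult.assoc[symmetric] by (intro mult_mono 1 2) auto
qed

text \<open>Supplies one Gaussian that dominates the kernel on a whole interval of times away from
  0, as dominated convergence in the time variable requires.\<close>

lemma hk_local_bound:
 fixes f :: "real \<Rightarrow> real ^ 'n \<Rightarrow> real"
 assumes "hk d f" "0 < a" "a \<le> b"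
 obtains C where "C \<ge> 0" "\<And>s z. a \<le> s \<Longrightarrow> s \<le> b \<Longrightarrow> \<bar>f s z\<bar> \<le> C * Gk (2 * b) z"
proof -
 obtain C where C: "C \<ge> 0" "\<And>sg x. sg > 0 \<Longrightarrow> \<bar>f sg x\<bar> \<le> C * sg powr (- (real d / 2)) * Gk (2 * sg) x"
  using hk_bound[OF assms(1)] by blast
 show ?thesis
 proof (rule that)
  show "C * a powr (- (real d / 2)) * (b / a) powr (real CARD('n) / 2) \<ge> 0" using C by simp
  fix s and z :: "real ^ 'n" assume s: "a \<le> s" "s \<le> b"
  have "\<bar>f s z\<bar> \<le> C * s powr (- (real d / 2)) * Gk (2 * s) z"
   using C s assms by auto
  also have "\<dots> \<le> C * a powr (- (real d / 2)) * ((b / a) powr (real CARD('n) / 2) * Gk (2 * b) z)"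
   using heat_kernel_mono[of "2 * a" "2 * s" "2 * b" z] s assms C
   by (intro mult_mono mult_left_mono powr_mono2') (auto simp: heat_kernel_nonneg)
  finally show "\<bar>f s z\<bar> \<le> C * a powr (- (real d / 2)) * (b / a) powr (real CARD('n) / 2) * Gk (2 * b) z"
   by (simp only: mult_ac)
 qed
qed

section \<open>Convolution with Gaussian kernels\<close>

text \<open>The common domain of the heat flow: it contains L^1 and L^2. Integrability is asked for
  every s because the widths of Gaussians add under convolution, and the class has to be stable
  under that.\<close>

definition gint :: "(real ^ 'n \<Rightarrow> real) \<Rightarrow> bool"
 where "gint f \<longleftrightarrow> f \<in> BM borel \<and> (\<forall>s>0. \<forall>x. Li (\<lambda>y. Gk s (x - y) * f y))"

text \<open>The kernels dual to \<open>gint\<close>: one Gaussian majorant suffices for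
  integrability against every function of that class.\<close>

definition gbound :: "(real ^ 'n \<Rightarrow> real) \<Rightarrow> bool"
 where "gbound k \<longleftrightarrow> k \<in> BM borel \<and> (\<exists>C s. s > 0 \<and> (\<forall>z. \<bar>k z\<bar> \<le> C * Gk s z))"

definition conv :: "(real ^ 'n \<Rightarrow> real) \<Rightarrow> (real ^ 'n \<Rightarrow> real) \<Rightarrow> real ^ 'n \<Rightarrow> real"
 where "conv k f x = (LBINT y. k (x - y) * f y)"

abbreviation Ht where "Ht t \<equiv> conv (heat_kernel t)"
abbreviation Ht' where "Ht' t \<equiv> conv (Gk' t)"

lemma gint_measurable: "gint f \<Longrightarrow> f \<in> BM borel"
 and gbound_measurable: "gbound k \<Longrightarrow> k \<in> BM borel"
 by (auto simp: gint_def gbound_def)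

lemma gboundE:
 fixes k :: "real ^ 'a \<Rightarrow> real"
 assumes "gbound k"
 obtains C s where "C \<ge> 0" "s > 0" "\<And>z. \<bar>k z\<bar> \<le> C * Gk s z"
proof -
 from assms obtain C s where C: "s > 0" "\<And>z. \<bar>k z\<bar> \<le> C * Gk s z" by (auto simp: gbound_def)
 have "0 \<le> C * Gk s (0 :: real ^ 'a)" by (rule order.trans[OF abs_ge_zero C(2)])
 moreover have "Gk s (0 :: real ^ 'a) > 0" by (rule heat_kernel_pos[OF C(1)])
 ultimately have "C \<ge> 0" by (simp add: zero_le_mult_iff)
 with C that show ?thesis by blast
qed

lemma hk_gbound: "hk d f \<Longrightarrow> sg > 0 \<Longrightarrow> gbound (f sg :: real ^ 'n \<Rightarrow> real)"
proof -
 assume f: "hk d f" "sg > 0"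
 obtain C where "\<And>s z. sg \<le> s \<Longrightarrow> s \<le> sg \<Longrightarrow> \<bar>f s z\<bar> \<le> C * Gk (2 * sg) z"
  by (rule hk_local_bound[OF f order.refl]) iprover
 then have "\<forall>z. \<bar>f sg z\<bar> \<le> C * Gk (2 * sg) z" by simp
 moreover have "2 * sg > 0" using f by simp
 moreover have "f sg \<in> BM borel" by (rule hk_measurable[OF f(1)]) auto
 ultimately show ?thesis unfolding gbound_def by blast
qed

lemma gbound_heat_kernel: "sg > 0 \<Longrightarrow> gbound (Gk sg :: real ^ 'n \<Rightarrow> real)"
 by (rule hk_gbound[OF hk_base])

lemma conv_integrable:
 assumes "gbound k" "gint f"
 shows "Li (\<lambda>y. k (x - y) * f y)"
proof -
 obtain C s where C: "C \<ge> 0" "s > 0" "\<And>z. \<bar>k z\<bar> \<le> C * Gk s z" using gboundE[OF assms(1)] by blast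
 have [measurable]: "k \<in> BM borel" "f \<in> BM borel"
  using assms by (auto simp: gint_measurable gbound_measurable)
 have "Li (\<lambda>y. C * (Gk s (x - y) * f y))"
  using assms(2) C unfolding gint_def by (intro integrable_mult_right) auto
 then show ?thesis
 proof (rule Bochner_Integration.integrable_bound)
  show "AE y in lborel. norm (k (x - y) * f y) \<le> norm (C * (Gk s (x - y) * f y))"
  proof (intro AE_I2)
   fix y
   have "\<bar>k (x - y)\<bar> * \<bar>f y\<bar> \<le> C * Gk s (x - y) * \<bar>f y\<bar>"
    by (intro mult_right_mono C) auto
   then show "norm (k (x - y) * f y) \<le> norm (C * (Gk s (x - y) * f y))"
    using C heat_kernel_nonneg[of s "x - y"] by (simp add: abs_mult mult.assoc)
  qed
 qed measurable
qed

lemma gint_abs: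
 assumes "gint f" shows "gint (\<lambda>x. \<bar>f x\<bar>)"
 unfolding gint_def
proof (intro conjI allI impI)
 have [measurable]: "f \<in> BM borel" using assms by (rule gint_measurable)
 show "(\<lambda>x. \<bar>f x\<bar>) \<in> BM borel" by measurable
 fix s x assume "(s::real) > 0"
 then have "Li (\<lambda>y. \<bar>Gk s (x - y) * f y\<bar>)"
  using assms unfolding gint_def by (intro integrable_abs) auto
 then show "Li (\<lambda>y. Gk s (x - y) * \<bar>f y\<bar>)"
  by (simp add: abs_mult heat_kernel_nonneg)
qed

lemma gint_lin:
 assumes "gint f" "gint g" shows "gint (\<lambda>x. a * f x + b * g x)"
 unfolding gint_def
proof (intro conjI allI impI)
 have [measurable]: "f \<in> BM borel" "g \<in> BM borel"
  using assms by (auto intro: gint_measurable)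
 show "(\<lambda>x. a * f x + b * g x) \<in> BM borel" by measurable
 fix s x assume "(s::real) > 0"
 then have "Li (\<lambda>y. a * (Gk s (x - y) * f y) + b * (Gk s (x - y) * g y))"
  using assms unfolding gint_def by (intro Bochner_Integration.integrable_add integrable_mult_right) auto
 then show "Li (\<lambda>y. Gk s (x - y) * (a * f y + b * g y))"
  by (simp add: distrib_left mult_ac)
qed

lemma gint_integrable: 
 assumes "Li f" shows "gint (f :: real ^ 'n \<Rightarrow> real)"
 unfolding gint_def
proof (intro conjI allI impI)
 show [measurable]: "f \<in> BM borel" using borel_measurable_integrable[OF assms] by simp
 fix s :: real and x :: "real ^ 'n" assume s: "s > 0"
 show "Li (\<lambda>y. Gk s (x - y) * f y)"
 proof (rule Bochner_Integration.integrable_bound)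
  show "Li (\<lambda>y. (4 * pi * s) powr - (real CARD('n) / 2) * f y)" using assms by simp
  show "AE y in lborel. norm (Gk s (x - y) * f y) \<le> norm ((4 * pi * s) powr - (real CARD('n) / 2) * f y)"
  proof (intro AE_I2)
   fix y
   have "Gk s (x - y) \<le> (4 * pi * s) powr - (real CARD('n) / 2)"
    using s by (simp add: heat_kernel_def mult_left_le)
   then have "Gk s (x - y) * \<bar>f y\<bar> \<le> (4 * pi * s) powr - (real CARD('n) / 2) * \<bar>f y\<bar>"
    by (intro mult_right_mono) auto
   then show "norm (Gk s (x - y) * f y) \<le> norm ((4 * pi * s) powr - (real CARD('n) / 2) * f y)"
    by (simp add: abs_mult heat_kernel_nonneg)
  qed
 qed measurable
qed

lemma heat_kernel_square:
 assumes "s > 0"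
 shows "(Gk s (z :: real ^ 'n))\<^sup>2 = (4 * pi * s) powr (- (real CARD('n) / 2)) * 2 powr (- (real CARD('n) / 2)) * Gk (s / 2) z"
proof -
 have "(4 * pi * s) powr (- (real CARD('n) / 2)) = 2 powr (- (real CARD('n) / 2)) * (4 * pi * (s / 2)) powr (- (real CARD('n) / 2))"
  by (subst powr_mult[symmetric]) (simp add: mult_ac)
 moreover have "(exp (- ((norm z)\<^sup>2 / (4 * s))))\<^sup>2 = exp (- ((norm z)\<^sup>2 / (4 * (s / 2))))"
  using assms by (simp add: exp_double[symmetric])
 ultimately show ?thesis unfolding heat_kernel_def power_mult_distrib
  by (simp only: power2_eq_square mult_ac)
qed

lemma integrable_heat_kernel:
 assumes "s > 0" shows "Li (\<lambda>y. Gk s (x - y :: real ^ 'n))"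
  and "(LBINT y. Gk s (x - y :: real ^ 'n)) = 1"
proof -
 have *: "has_bochner_integral lborel (\<lambda>y. Gk s (x - y :: real ^ 'n)) 1"
  using nn_integral_heat_kernel(1)[OF assms, of x]
  by (intro has_bochner_integral_nn_integral) (auto simp: heat_kernel_nonneg)
 then show "Li (\<lambda>y. Gk s (x - y :: real ^ 'n))"
  "(LBINT y. Gk s (x - y :: real ^ 'n)) = 1"
  by (auto simp: has_bochner_integral_iff)
qed

lemma gint_square_integrable: 
 assumes [measurable]: "f \<in> BM borel" and f: "Li (\<lambda>x. (f x)\<^sup>2)"
 shows "gint (f :: real ^ 'n \<Rightarrow> real)"
 unfolding gint_def
proof (intro conjI allI impI)
 fix s :: real and x :: "real ^ 'n" assume s: "s > 0"
 show "Li (\<lambda>y. Gk s (x - y) * f y)"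
 proof (rule Bochner_Integration.integrable_bound)
  show "Li (\<lambda>y. (Gk s (x - y))\<^sup>2 + (f y)\<^sup>2)" using f s
   unfolding heat_kernel_square[OF s] by (intro Bochner_Integration.integrable_add integrable_mult_right integrable_heat_kernel) auto
  have "\<bar>a * b\<bar> \<le> \<bar>a\<^sup>2 + b\<^sup>2\<bar>" for a b :: real
  proof -
   have "2 * \<bar>a * b\<bar> \<le> a\<^sup>2 + b\<^sup>2"
    using zero_le_power2[of "\<bar>a\<bar> - \<bar>b\<bar>"] by (simp add: power2_diff abs_mult)
   then show ?thesis by simp
  qed
  then show "AE y in lborel. norm (Gk s (x - y) * f y) \<le> norm ((Gk s (x - y))\<^sup>2 + (f y)\<^sup>2)"
   by (intro AE_I2) auto
 qed measurable
qed measurable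

text \<open>Both kernels are replaced by Gaussian majorants; the integral over z then collapses, by
  the semigroup law, to a single Gaussian of width \<open>s' + s\<close>, against which |f| is
  integrable.\<close>

lemma pair_integrable:
 fixes l k f :: "real ^ 'n \<Rightarrow> real"
 assumes "gbound l" "gbound k" "gint f"
 shows "integrable lb2 (\<lambda>(z, y). l (x - z) * k (z - y) * f y)"
proof -
 obtain C s where C: "C \<ge> 0" "s > 0" "\<And>z. \<bar>k z\<bar> \<le> C * Gk s z" using gboundE[OF assms(2)] by blast
 obtain C' s' where C': "C' \<ge> 0" "s' > 0" "\<And>z. \<bar>l z\<bar> \<le> C' * Gk s' z" using gboundE[OF assms(1)] by blast
 have [measurable]: "k \<in> BM borel" "l \<in> BM borel" "f \<in> BM borel"
  using assms by (auto simp: gint_measurable gbound_measurable)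
 have bd: "\<bar>l (x - z) * k (z - y) * f y\<bar> \<le> (Gk s' (x - z) * Gk s (z - y)) * (C' * C * \<bar>f y\<bar>)" for z y
 proof -
  have "\<bar>l (x - z)\<bar> * \<bar>k (z - y)\<bar> * \<bar>f y\<bar> \<le> (C' * Gk s' (x - z)) * (C * Gk s (z - y)) * \<bar>f y\<bar>"
   using C C' by (intro mult_mono) (auto simp: heat_kernel_nonneg)
  then show ?thesis by (simp add: abs_mult mult_ac)
 qed
 have "(\<integral>\<^sup>+p. ennreal (norm (case p of (z, y) \<Rightarrow> l (x - z) * k (z - y) * f y)) \<partial>lb2)
  \<le> (\<integral>\<^sup>+p. (case p of (z, y) \<Rightarrow> ennreal (Gk s' (x - z) * Gk s (z - y)) * ennreal (C' * C * \<bar>f y\<bar>)) \<partial>lb2)"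
  using bd C C' by (intro nn_integral_mono) (auto simp: heat_kernel_nonneg ennreal_mult[symmetric] intro!: ennreal_leI)
 also have "\<dots> = (NN y. (NN z. ennreal (Gk s' (x - z) * Gk s (z - y)) * ennreal (C' * C * \<bar>f y\<bar>)))"
  by (subst lborel_pair.nn_integral_snd[symmetric]) auto
 also have "\<dots> = (NN y. ennreal (Gk (s' + s) (x - y) * (C' * C * \<bar>f y\<bar>)))"
  using C C' by (intro nn_integral_cong, subst nn_integral_multc)
   (auto simp: nn_integral_heat_kernel_mult ennreal_mult'[symmetric] heat_kernel_nonneg)
 also have "\<dots> < \<infinity>"
 proof -
  have "Li (\<lambda>y. Gk (s' + s) (x - y) * (\<bar>f y\<bar>) * (C' * C))"
   using gint_abs[OF assms(3)] C C' unfolding gint_def by (intro integrable_mult_left) auto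
  then have "Li (\<lambda>y. Gk (s' + s) (x - y) * (C' * C * \<bar>f y\<bar>))" by (simp add: mult_ac)
  then show ?thesis using C C' by (subst nn_integral_eq_integral) (auto simp: heat_kernel_nonneg)
 qed
 finally show ?thesis by (intro integrableI_bounded) auto
qed

lemma conv_reflect:
 assumes [measurable]: "k \<in> BM borel" "f \<in> BM borel"
 shows "conv k f x = (LBINT y. k y * f (x - y))"
proof -
 have "(LINT y|distr lborel borel (\<lambda>y. x - y). k (x - y) * f y) = (LBINT y. k y * f (x - y))"
  by (subst integral_distr) auto
 then show ?thesis unfolding conv_def by (metis lborel_reflect)
qed

lemma conv_commute:
 assumes "k \<in> BM borel" "f \<in> BM borel"
 shows "conv k f = conv f k"
 using conv_reflect[OF assms] by (auto simp: conv_def mult.commute)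

lemma conv_measurable [measurable]:
 assumes [measurable]: "k \<in> BM borel" "f \<in> BM borel"
 shows "conv k f \<in> BM borel"
 unfolding conv_def[abs_def] by measurable

lemma gint_conv:
 fixes k f :: "real ^ 'n \<Rightarrow> real"
 assumes "gbound k" "gint f" shows "gint (conv k f)"
 unfolding gint_def
proof (intro conjI allI impI)
 have [measurable]: "k \<in> BM borel" "f \<in> BM borel"
  using assms by (auto simp: gint_measurable gbound_measurable)
 show "conv k f \<in> BM borel" by measurable
 fix s :: real and x :: "real ^ 'n" assume "s > 0"
 from lborel_pair.integrable_fst'[OF pair_integrable[OF gbound_heat_kernel[OF this] assms, of x]]
 show "Li (\<lambda>y. Gk s (x - y) * conv k f y)"
  by (simp add: conv_def mult.assoc)
qed

lemma conv_conv:
 fixes k l f :: "real ^ 'n \<Rightarrow> real"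
 assumes "gbound l" "gbound k" "gint f"
 shows "conv l (conv k f) x = conv (conv l k) f x"
proof -
 have "conv l (conv k f) x = (LBINT z. LBINT y. l (x - z) * k (z - y) * f y)"
  unfolding conv_def by (simp add: mult.assoc)
 also have "\<dots> = (LBINT y. LBINT z. l (x - z) * k (z - y) * f y)"
  by (rule lborel_pair.Fubini_integral[symmetric]) (rule pair_integrable[OF assms])
 also have "\<dots> = (LBINT y. (LBINT z. l (x - z) * k (z - y)) * f y)" by simp
 also have "(\<lambda>y. LBINT z. l (x - z) * k (z - y)) = (\<lambda>y. conv l k (x - y))"
 proof
  fix y
  have [measurable]: "k \<in> BM borel" "l \<in> BM borel"
   using assms by (auto simp: gbound_measurable)
  have "(LBINT z. l (x - z) * k (z - y)) = (LINT z|distr lborel borel ((+) y). l (x - z) * k (z - y))"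
   by (simp add: lborel_distr_plus)
  also have "\<dots> = (LBINT z. l (x - y - z) * k z)"
   by (subst integral_distr) (auto simp: algebra_simps)
  finally show "(LBINT z. l (x - z) * k (z - y)) = conv l k (x - y)" by (simp add: conv_def)
 qed
 finally show ?thesis unfolding conv_def by simp
qed

lemma conv_heat_heat:
 fixes x :: "real ^ 'n"
 assumes "t > 0" "s > 0"
 shows "Ht t (Gk s) x = Gk (t + s) x"
 unfolding conv_def using nn_integral_heat_kernel_mult[OF assms, of x 0]
 by (intro has_bochner_integral_integral_eq has_bochner_integral_nn_integral) (auto simp: heat_kernel_nonneg)

lemma conv_heat_semigroup:
 fixes f :: "real ^ 'n \<Rightarrow> real"
 assumes "t > 0" "s > 0" "gint f"
 shows "Ht t (Ht s f) x = Ht (t + s) f x"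
proof -
 have "Ht t (Gk s) = (Gk (t + s) :: real ^ 'n \<Rightarrow> real)"
  using assms by (intro ext conv_heat_heat)
 then show ?thesis using assms by (simp add: conv_conv gbound_heat_kernel)
qed

section \<open>Time derivative of the heat flow\<close>

text \<open>The mean value theorem bounds every difference quotient by w, so dominated convergence
  applies along each sequence that tends to \<open>sg\<close> inside the window.\<close>

lemma DERIV_integral:
 fixes k k' :: "real \<Rightarrow> 'a \<Rightarrow> real"
 assumes ab: "a < sg" "sg < b"
  and k: "\<And>s. a < s \<Longrightarrow> s < b \<Longrightarrow> integrable M (k s)"
  and k' [measurable]: "k' sg \<in> BM M"
  and D: "\<And>s y. a < s \<Longrightarrow> s < b \<Longrightarrow> y \<in> space M \<Longrightarrow> ((\<lambda>s. k s y) has_real_derivative k' s y) (at s)"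
  and w: "integrable M w" "\<And>s y. a < s \<Longrightarrow> s < b \<Longrightarrow> y \<in> space M \<Longrightarrow> \<bar>k' s y\<bar> \<le> w y"
 shows "((\<lambda>s. LINT y|M. k s y) has_real_derivative (LINT y|M. k' sg y)) (at sg)"
proof -
 have "((\<lambda>s. ((LINT y|M. k s y) - (LINT y|M. k sg y)) / (s - sg)) \<longlongrightarrow> (LINT y|M. k' sg y)) (at sg within {a<..<b})"
  unfolding tendsto_at_iff_sequentially comp_def
 proof (intro allI impI)
  fix X :: "nat \<Rightarrow> real" assume X: "\<forall>i. X i \<in> {a<..<b} - {sg}" "X ~> sg"
  have [measurable]: "k (X i) \<in> BM M" "k sg \<in> BM M" for i
   using k[of "X i"] k[of sg] X(1) ab by auto
  have e: "((LINT y|M. k (X i) y) - (LINT y|M. k sg y)) / (X i - sg) = (LINT y|M. (k (X i) y - k sg y) / (X i - sg))" for i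
   using k[of "X i"] k[of sg] X(1) ab by (subst integral_divide_zero) (simp add: Bochner_Integration.integral_diff)
  have "(\<lambda>i. LINT y|M. (k (X i) y - k sg y) / (X i - sg)) ~> (LINT y|M. k' sg y)"
  proof (rule integral_dominated_convergence[where w = w])
   show "AE y in M. (\<lambda>i. (k (X i) y - k sg y) / (X i - sg)) ~> k' sg y"
   proof (rule AE_I2)
    fix y assume y: "y \<in> space M"
    have "((\<lambda>s. (k s y - k sg y) / (s - sg)) \<longlongrightarrow> k' sg y) (at sg)"
     using D[OF ab y] by (simp add: has_field_derivative_iff)
    moreover have "filterlim X (at sg) sequentially"
     using X by (auto simp: filterlim_at)
    ultimately show "(\<lambda>i. (k (X i) y - k sg y) / (X i - sg)) ~> k' sg y"
     by (rule filterlim_compose)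
   qed
   show "AE y in M. norm ((k (X i) y - k sg y) / (X i - sg)) \<le> w y" for i
   proof (rule AE_I2)
    fix y assume y: "y \<in> space M"
    have Xi: "X i \<in> {a<..<b}" "X i \<noteq> sg" using X by auto
    have "\<exists>z\<in>{a<..<b}. k (X i) y - k sg y = (X i - sg) * k' z y"
    proof (cases "sg < X i")
     case True
     have "\<exists>z>sg. z < X i \<and> k (X i) y - k sg y = (X i - sg) * k' z y"
      by (rule MVT2[OF True]) (use D y ab Xi in auto)
     then show ?thesis using Xi ab by (auto intro!: bexI)
    next
     case False
     then have "X i < sg" using Xi by auto
     then have "\<exists>z>X i. z < sg \<and> k sg y - k (X i) y = (sg - X i) * k' z y"
      by (rule MVT2) (use D y ab Xi in auto)
     then obtain z where "X i < z" "z < sg" "k sg y - k (X i) y = (sg - X i) * k' z y" by blast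
     then show ?thesis using Xi ab by (intro bexI[of _ z]) (auto simp: algebra_simps)
    qed
    then show "norm ((k (X i) y - k sg y) / (X i - sg)) \<le> w y"
     using w(2) y Xi by (auto simp: abs_mult)
   qed
  qed (use w in auto)
  then show "(\<lambda>i. ((LINT y|M. k (X i) y) - (LINT y|M. k sg y)) / (X i - sg)) ~> (LINT y|M. k' sg y)"
   by (simp only: e)
 qed
 moreover have "at sg within {a<..<b} = at sg"
  using ab by (intro at_within_open) auto
 ultimately show ?thesis by (simp add: has_field_derivative_iff)
qed

lemma conv_deriv:
 fixes f :: "real \<Rightarrow> real ^ 'n \<Rightarrow> real"
 assumes f: "hk d f" and g: "hk d' g" and D: "hk_deriv f f' g" and h: "gint h" and s: "sg > 0"
 shows "((\<lambda>s. conv (f s) h x) has_real_derivative conv (g sg) h x) (at sg)"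
proof -
 \<comment> \<open>A window around \<sigma> that stays away from 0, so that one Gaussian of fixed
   width dominates the time derivative on it.\<close>
 obtain C where C: "C \<ge> 0" "\<And>s z. sg / 2 \<le> s \<Longrightarrow> s \<le> 2 * sg \<Longrightarrow> \<bar>g s z\<bar> \<le> C * Gk (2 * (2 * sg)) z"
  by (rule hk_local_bound[OF g, of "sg / 2" "2 * sg"]) (use s in auto)
 show ?thesis
  unfolding conv_def
 proof (rule DERIV_integral[where a = "sg / 2" and b = "2 * sg" and w = "\<lambda>y. C * (Gk (2 * (2 * sg)) (x - y) * \<bar>h y\<bar>)"])
  show "sg / 2 < sg" "sg < 2 * sg" using s by auto
  show "Li (\<lambda>y. f t (x - y) * h y)" if "sg / 2 < t" for t
   using conv_integrable[OF hk_gbound[OF f] h] that s by auto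
  have [measurable]: "g sg \<in> BM borel" "h \<in> BM borel"
   using gbound_measurable[OF hk_gbound[OF g s]] gint_measurable[OF h] by auto
  show "(\<lambda>y. g sg (x - y) * h y) \<in> BM lborel" by measurable
  show "((\<lambda>s. f s (x - y) * h y) has_real_derivative g t (x - y) * h y) (at t)" if "sg / 2 < t" for t y
   using hk_deriv_time[OF D, of t "x - y"] that s by (auto intro!: derivative_eq_intros)
  show "Li (\<lambda>y. C * (Gk (2 * (2 * sg)) (x - y) * \<bar>h y\<bar>))"
   using gint_abs[OF h] s unfolding gint_def by (intro integrable_mult_right) auto
  fix t y assume "sg / 2 < t" "t < 2 * sg"
  then have "\<bar>g t (x - y)\<bar> * \<bar>h y\<bar> \<le> C * Gk (2 * (2 * sg)) (x - y) * \<bar>h y\<bar>"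
   using C by (intro mult_right_mono) auto
  then show "\<bar>g t (x - y) * h y\<bar> \<le> C * (Gk (2 * (2 * sg)) (x - y) * \<bar>h y\<bar>)"
   by (simp add: abs_mult mult.assoc)
 qed
qed

lemmas conv_heat_deriv = conv_deriv[OF hk_base hk_heat_kernel' hk_deriv_heat_kernel]

lemma gbound_heat_kernel': "sg > 0 \<Longrightarrow> gbound (Gk' sg :: real ^ 'n \<Rightarrow> real)"
 by (rule hk_gbound[OF hk_heat_kernel'])

text \<open>By the semigroup law both sides are derivatives of the same function of \<sigma>, so
  uniqueness of the derivative gives the identity without computing a convolution of
  \<open>Gk'\<close> with a Gaussian. The second form follows because convolutions commute.\<close>

lemma conv_heat_heat':
 fixes f :: "real ^ 'n \<Rightarrow> real"
 assumes t: "ta > 0" and s: "sg > 0" and f: "gint f"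
 shows "Ht' sg (Ht ta f) x = Ht' (sg + ta) f x"
  and "Ht ta (Ht' sg f) x = Ht' (sg + ta) f x"
proof -
 have g: "gint (Ht ta f)" using assms by (intro gint_conv gbound_heat_kernel)
 have 1: "((\<lambda>s. Ht s (Ht ta f) x) has_real_derivative Ht' sg (Ht ta f) x) (at sg)"
  by (rule conv_heat_deriv[OF g s])
 have "((\<lambda>s. Ht (s + ta) f x) has_real_derivative Ht' (sg + ta) f x) (at sg)"
  using conv_heat_deriv[OF f, of "sg + ta" x] s t by (auto simp: DERIV_shift)
 moreover have "eventually (\<lambda>s. Ht (s + ta) f x = Ht s (Ht ta f) x) (nhds sg)"
  using eventually_nhds_in_open[of "{0<..}" sg] s
  by (auto elim!: eventually_mono simp: conv_heat_semigroup t f)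
 ultimately have "((\<lambda>s. Ht s (Ht ta f) x) has_real_derivative Ht' (sg + ta) f x) (at sg)"
  by (subst (asm) DERIV_cong_ev[OF refl _ refl])
 from DERIV_unique[OF 1 this]
 show 2: "Ht' sg (Ht ta f) x = Ht' (sg + ta) f x" .
 have "Ht ta (Ht' sg f) x = Ht' sg (Ht ta f) x"
  using s t f by (simp add: conv_conv gbound_heat_kernel gbound_heat_kernel'
    conv_commute[of "Gk' sg"] gbound_measurable)
 with 2 show "Ht ta (Ht' sg f) x = Ht' (sg + ta) f x" by simp
qed

section \<open>Short-time limits and injectivity of the heat flow\<close>

text \<open>The substitution y = sqrt t w moves the time into the argument of f and leaves the fixed
  weight \<open>Gk 1\<close>; for bounded f the limit t -> 0 is then dominated.\<close>

lemma conv_heat_scaled: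
 fixes f :: "real ^ 'n \<Rightarrow> real"
 assumes t: "ta > 0" and [measurable]: "f \<in> BM borel"
 shows "Ht ta f x = (LBINT w. Gk 1 w * f (x - sqrt ta *\<^sub>R w))"
proof -
 have sc: "Gk ta (sqrt ta *\<^sub>R w) * sqrt ta ^ CARD('n) = Gk 1 w" for w :: "real ^ 'n"
 proof -
  have "(4 * pi * ta) powr (- (real CARD('n) / 2)) * sqrt ta ^ CARD('n) = (4 * pi) powr (- (real CARD('n) / 2))"
  proof -
   have "sqrt ta ^ CARD('n) = ta powr (real CARD('n) / 2)"
    using t by (simp add: powr_half_sqrt[symmetric] powr_realpow[symmetric] powr_powr)
   moreover have "(4 * pi * ta) powr (- (real CARD('n) / 2)) = (4 * pi) powr (- (real CARD('n) / 2)) * ta powr (- (real CARD('n) / 2))"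
    by (rule powr_mult)
   ultimately show ?thesis using t by (simp add: powr_minus)
  qed
  then show ?thesis using t by (simp add: heat_kernel_def power_mult_distrib)
 qed
 have "Ht ta f x = (LBINT y. Gk ta y * f (x - y))"
  by (rule conv_reflect) measurable
 also have "\<dots> = (LINT y|density (distr lborel borel (\<lambda>x. 0 + sqrt ta *\<^sub>R x)) (\<lambda>_. ennreal (\<bar>sqrt ta\<bar> ^ DIM(real ^ 'n))). Gk ta y * f (x - y))"
 proof -
  have "density (distr lborel borel (\<lambda>x. 0 + sqrt ta *\<^sub>R x)) (\<lambda>_. ennreal (\<bar>sqrt ta\<bar> ^ DIM(real ^ 'n))) = (lborel :: (real ^ 'n) measure)"
   using t by (intro lborel_affine[symmetric]) auto
  then show ?thesis by (simp only:)
 qed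
 also have "\<dots> = (LBINT w. sqrt ta ^ CARD('n) * (Gk ta (sqrt ta *\<^sub>R w) * f (x - sqrt ta *\<^sub>R w)))"
 proof -
  have [measurable]: "(\<lambda>w :: real ^ 'n. 0 + sqrt ta *\<^sub>R w) \<in> lborel \<rightarrow>\<^sub>M borel" by measurable
  have "(LINT y|density (distr lborel borel (\<lambda>x. 0 + sqrt ta *\<^sub>R x)) (\<lambda>_. ennreal (\<bar>sqrt ta\<bar> ^ DIM(real ^ 'n))). Gk ta y * f (x - y))
   = (LINT y|distr lborel borel (\<lambda>x. 0 + sqrt ta *\<^sub>R x). (\<bar>sqrt ta\<bar> ^ DIM(real ^ 'n)) *\<^sub>R (Gk ta y * f (x - y)))"
   by (rule integral_density) auto
  also have "\<dots> = (LBINT w. (\<bar>sqrt ta\<bar> ^ DIM(real ^ 'n)) *\<^sub>R (Gk ta (0 + sqrt ta *\<^sub>R w) * f (x - (0 + sqrt ta *\<^sub>R w))))"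
   by (rule integral_distr) measurable
  finally show ?thesis using t by simp
 qed
 also have "(\<lambda>w. sqrt ta ^ CARD('n) * (Gk ta (sqrt ta *\<^sub>R w) * f (x - sqrt ta *\<^sub>R w)))
  = (\<lambda>w. Gk 1 w * f (x - sqrt ta *\<^sub>R w))"
  unfolding sc[symmetric] by (simp only: mult_ac)
 finally show ?thesis .
qed

lemma conv_heat_tendsto:
 fixes f :: "real ^ 'n \<Rightarrow> real"
 assumes f: "continuous_on UNIV f" "\<And>x. \<bar>f x\<bar> \<le> B" and X: "X ~> 0" "\<And>n. X n > 0"
 shows "(\<lambda>n. Ht (X n) f x) ~> f x"
proof -
 have [measurable]: "f \<in> BM borel" using f by (intro borel_measurable_continuous_onI)
 have "(\<lambda>n. LBINT w. Gk 1 w * f (x - sqrt (X n) *\<^sub>R w)) ~> (LBINT w. Gk 1 (w :: real ^ 'n) * f x)"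
 proof (rule integral_dominated_convergence[where w = "\<lambda>w :: real ^ 'n. B * Gk 1 w"])
  show "Li (\<lambda>w. B * Gk 1 (w :: real ^ 'n))"
   using integrable_heat_kernel(1)[of 1 "0 :: real ^ 'n"] by (intro integrable_mult_right) (simp add: heat_kernel_minus)
  show "AE w in lborel. (\<lambda>n. Gk 1 w * f (x - sqrt (X n) *\<^sub>R w)) ~> Gk 1 w * f x"
  proof (intro AE_I2 tendsto_mult tendsto_const)
   fix w
   have "(\<lambda>n. x - sqrt (X n) *\<^sub>R w) ~> x - sqrt 0 *\<^sub>R w"
    by (intro tendsto_intros X)
   then have "(\<lambda>n. x - sqrt (X n) *\<^sub>R w) ~> x" by simp
   then show "(\<lambda>n. f (x - sqrt (X n) *\<^sub>R w)) ~> f x"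
    using f(1) by (intro continuous_on_tendsto_compose[of UNIV f]) auto
  qed
  show "AE w in lborel. norm (Gk 1 w * f (x - sqrt (X n) *\<^sub>R w)) \<le> B * Gk 1 w" for n
   using f(2) by (intro AE_I2) (auto simp: abs_mult heat_kernel_nonneg mult.commute[of B] intro!: mult_left_mono)
 qed auto
 moreover have "(LBINT w. Gk 1 (w :: real ^ 'n) * f x) = f x"
  using integrable_heat_kernel(2)[of 1 "0 :: real ^ 'n"] by (simp add: heat_kernel_minus)
 ultimately show ?thesis using X(2) by (auto simp: conv_heat_scaled)
qed

lemma gbound_bounded:
 assumes "gbound (k :: real ^ 'n \<Rightarrow> real)" obtains B where "\<And>x. \<bar>k x\<bar> \<le> B"
proof -
 obtain C s where C: "C \<ge> 0" "s > 0" "\<And>z. \<bar>k z\<bar> \<le> C * Gk s z" using gboundE[OF assms] by blast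
 have "\<bar>k z\<bar> \<le> C * (4 * pi * s) powr - (real CARD('n) / 2)" for z
 proof -
  have "Gk s z \<le> (4 * pi * s) powr - (real CARD('n) / 2)"
   using C(2) by (simp add: heat_kernel_def mult_left_le)
  then show ?thesis using C by (meson mult_left_mono order.trans)
 qed
 with that show ?thesis by blast
qed

lemma gbound_integrable_mult:
 assumes "gbound k" "gint (f :: real ^ 'n \<Rightarrow> real)"
 shows "Li (\<lambda>y. k y * f y)"
proof -
 \<comment> \<open>The pairing of k with f is the value at 0 of the convolution with the reflected
   kernel.\<close>
 have "gbound (\<lambda>z. k (- z))"
  using assms(1) unfolding gbound_def by (auto simp: measurable_compose[OF borel_measurable_uminus] heat_kernel_minus) (metis heat_kernel_minus)
 from conv_integrable[OF this assms(2), of 0] show ?thesis by simp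
qed

text \<open>The heat kernel is even, so Fubini moves the semigroup from f to k. Limits of f, about
  which little is known, thereby become limits of the regular function k.\<close>

lemma gbound_symmetric:
 assumes k: "gbound k" and f: "gint (f :: real ^ 'n \<Rightarrow> real)" and t: "t > 0"
 shows "(LBINT x. k x * Ht t f x) = (LBINT y. Ht t k y * f y)"
proof -
 have k': "gbound (\<lambda>z. k (- z))"
  using k unfolding gbound_def by (auto simp: measurable_compose[OF borel_measurable_uminus]) (metis heat_kernel_minus)
 \<comment> \<open>\<open>- (0 - z)\<close> is z, written so that the integrand matches
   \<open>pair_integrable\<close> at the point 0.\<close>
 have "(LBINT x. k x * Ht t f x) = (LBINT z. LBINT y. k (- (0 - z)) * Gk t (z - y) * f y)"
  by (simp add: conv_def mult.assoc)
 also have "\<dots> = (LBINT y. LBINT z. k (- (0 - z)) * Gk t (z - y) * f y)"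
  by (rule lborel_pair.Fubini_integral[symmetric]) (rule pair_integrable[OF k' gbound_heat_kernel[OF t] f])
 also have "\<dots> = (LBINT y. Ht t k y * f y)"
  by (simp add: conv_def heat_kernel_diff_commute[of t _ "_ :: real ^ 'n"] mult.commute)
 finally show ?thesis .
qed

text \<open>After the semigroup has been moved to k, pointwise convergence is available by
  continuity, and for times at most 1 all \<open>Ht (X n) k\<close> lie below a multiple of one
  Gaussian of width \<open>1 + s\<close>.\<close>

lemma gbound_approx_tendsto:
 assumes k: "gbound k" "continuous_on UNIV k" and f: "gint (f :: real ^ 'n \<Rightarrow> real)"
  and X: "X ~> 0" "\<And>n. X n > 0" "\<And>n. X n \<le> 1"
 shows "(\<lambda>n. LBINT x. k x * Ht (X n) f x) ~> (LBINT x. k x * f x)"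
proof -
 obtain C s where C: "C \<ge> 0" "s > 0" "\<And>z. \<bar>k z\<bar> \<le> C * Gk s z" using gboundE[OF k(1)] by blast
 obtain B where B: "\<And>x. \<bar>k x\<bar> \<le> B" using gbound_bounded[OF k(1)] by blast
 define C' where "C' = C * ((1 + s) / s) powr (real CARD('n) / 2)"
 have [measurable]: "k \<in> BM borel" "f \<in> BM borel"
  using k f by (auto intro: gbound_measurable gint_measurable)
 have bd: "\<bar>Ht (X n) k y\<bar> \<le> C' * Gk (1 + s) y" for n y
 proof -
  have i: "Li (\<lambda>z. Gk (X n) (y - z) * Gk s z)"
   using X C by (intro conv_integrable gbound_heat_kernel gint_integrable)
    (use integrable_heat_kernel(1)[of s "0 :: real ^ 'n"] in "auto simp: heat_kernel_minus")
  have "\<bar>Ht (X n) k y\<bar> \<le> (LBINT z. \<bar>Gk (X n) (y - z) * k z\<bar>)"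
   unfolding conv_def by (rule integral_abs_bound)
  also have "\<dots> \<le> (LBINT z. C * (Gk (X n) (y - z) * Gk s z))"
  proof (rule integral_mono_AE')
   show "Li (\<lambda>z. C * (Gk (X n) (y - z) * Gk s z))"
    by (intro integrable_mult_right i)
   show "AE z in lborel. \<bar>Gk (X n) (y - z) * k z\<bar> \<le> C * (Gk (X n) (y - z) * Gk s z)"
   proof (intro AE_I2)
    fix z
    have "Gk (X n) (y - z) * \<bar>k z\<bar> \<le> Gk (X n) (y - z) * (C * Gk s z)"
     by (intro mult_left_mono C heat_kernel_nonneg)
    then show "\<bar>Gk (X n) (y - z) * k z\<bar> \<le> C * (Gk (X n) (y - z) * Gk s z)"
     by (simp add: abs_mult heat_kernel_nonneg mult_ac)
   qed
  qed (use C in "auto simp: heat_kernel_nonneg intro!: AE_I2")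
  also have "\<dots> = C * Gk (X n + s) y"
   using conv_heat_heat[OF X(2)[of n] C(2), of y] by (simp add: conv_def)
  also have "\<dots> \<le> C * (((1 + s) / s) powr (real CARD('n) / 2) * Gk (1 + s) y)"
   using X(2,3)[of n] C by (intro mult_left_mono heat_kernel_mono) auto
  finally show ?thesis by (simp add: C'_def)
 qed
 have "(\<lambda>n. LBINT y. Ht (X n) k y * f y) ~> (LBINT y. k y * f y)"
 proof (rule integral_dominated_convergence[where w = "\<lambda>y. C' * (Gk (1 + s) y * \<bar>f y\<bar>)"])
  show "Li (\<lambda>y. C' * (Gk (1 + s) y * \<bar>f y\<bar>))"
   using C by (intro integrable_mult_right gbound_integrable_mult gbound_heat_kernel gint_abs f) auto
  show "AE y in lborel. (\<lambda>n. Ht (X n) k y * f y) ~> k y * f y"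
   using B by (intro AE_I2 tendsto_mult tendsto_const conv_heat_tendsto[OF k(2) _ X(1,2)]) auto
  show "AE y in lborel. norm (Ht (X n) k y * f y) \<le> C' * (Gk (1 + s) y * \<bar>f y\<bar>)" for n
  proof (rule AE_I2)
   fix y
   show "norm (Ht (X n) k y * f y) \<le> C' * (Gk (1 + s) y * \<bar>f y\<bar>)"
    using mult_right_mono[OF bd[of n y], of "\<bar>f y\<bar>"] by (simp add: abs_mult mult.assoc)
  qed
 qed auto
 then show ?thesis by (simp add: gbound_symmetric[OF k(1) f X(2)])
qed

text \<open>Truncation to the interval from -e to e. With a Gaussian for e it turns an arbitrary
  measurable f into an admissible kernel whose product with f is nonnegative and vanishes only where
  f does.\<close>

definition clip :: "real \<Rightarrow> real \<Rightarrow> real" where "clip e z = max (- e) (min e z)"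

lemma clip: "e \<ge> 0 \<Longrightarrow> \<bar>clip e z\<bar> \<le> e" "e \<ge> 0 \<Longrightarrow> \<bar>clip e z\<bar> \<le> \<bar>z\<bar>" "e \<ge> 0 \<Longrightarrow> z * clip e z \<ge> 0"
 "e > 0 \<Longrightarrow> z * clip e z = 0 \<Longrightarrow> z = 0" "e \<ge> 0 \<Longrightarrow> \<bar>z - clip e z\<bar> \<le> \<bar>z\<bar>" "\<bar>z\<bar> \<le> e \<Longrightarrow> clip e z = z"
 by (auto simp: clip_def max_def min_def zero_le_mult_iff split: if_splits)

lemma clip_measurable [measurable (raw)]:
 assumes [measurable]: "f \<in> BM M" "g \<in> BM M"
 shows "(\<lambda>x. clip (f x) (g x)) \<in> BM M"
 unfolding clip_def by measurable

text \<open>A measurable function is an almost everywhere limit of continuous ones; clipping these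
  at a Gaussian keeps them continuous, makes them kernels, and commutes with the limit.\<close>

lemma clip_gbound_approx:
 fixes f :: "real ^ 'n \<Rightarrow> real"
 assumes [measurable]: "f \<in> BM borel" and B: "B \<ge> 0"
 obtains g where "\<And>n. continuous_on UNIV (g n)" "\<And>n x. \<bar>g n x\<bar> \<le> B * Gk 1 x" "\<And>n. gbound (g n)"
  "AE x in lborel. (\<lambda>n. g n x) ~> clip (B * Gk 1 x) (f x)"
proof -
 have "f measurable_on UNIV"
  by (intro lebesgue_measurable_imp_measurable_on) (auto intro: measurable_completion)
 then obtain N g where g: "negligible N" "\<And>n. continuous_on UNIV (g n)" "\<And>x. x \<notin> N \<Longrightarrow> (\<lambda>n. g n x) ~> f x"
  unfolding measurable_on_def by auto
 define e where "e = (\<lambda>x :: real ^ 'n. B * Gk 1 x)"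
 have e: "continuous_on UNIV e" "\<And>x. e x \<ge> 0"
  unfolding e_def using hk_continuous[OF hk_base, of 1, where 'n='n] B
  by (auto intro!: continuous_intros simp: heat_kernel_nonneg)
 show ?thesis
 proof (rule that[of "\<lambda>n x. clip (e x) (g n x)"])
  show c: "continuous_on UNIV (\<lambda>x. clip (e x) (g n x))" for n
   unfolding clip_def by (intro continuous_intros e g)
  show b: "\<bar>clip (e x) (g n x)\<bar> \<le> B * Gk 1 x" for n x
   using clip(1)[OF e(2)] by (simp add: e_def)
  show "gbound (\<lambda>x. clip (e x) (g n x))" for n
  proof -
   have "\<exists>C s. s > 0 \<and> (\<forall>x. \<bar>clip (e x) (g n x)\<bar> \<le> C * Gk s x)"
    by (rule exI[of _ B], rule exI[of _ 1]) (use b in auto)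
   then show ?thesis unfolding gbound_def using borel_measurable_continuous_onI[OF c] by auto
  qed
  have "AE x in lebesgue. x \<notin> N" using g(1) by (simp add: negligible_iff_null_sets AE_not_in)
  then have "AE x in lborel. x \<notin> N" by (simp add: AE_completion_iff)
  then show "AE x in lborel. (\<lambda>n. clip (e x) (g n x)) ~> clip (B * Gk 1 x) (f x)"
  proof eventually_elim
   case (elim x)
   then show ?case unfolding clip_def e_def by (intro tendsto_intros g(3))
  qed
 qed
qed

text \<open>The flow vanishes, hence so does its limit at time 0 against every continuous kernel
  \<open>g n\<close>. As the kernels tend to f clipped at a Gaussian, the integral of the
  nonnegative function \<open>clip (Gk 1 x) (f x) * f x\<close> is 0, which forces f = 0. This is
  the uniqueness statement behind all representations below.\<close>

lemma heat_injective:
 fixes f :: "real ^ 'n \<Rightarrow> real"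
 assumes f: "gint f" and 0: "\<And>t x. t > 0 \<Longrightarrow> Ht t f x = 0"
 shows "AE x in lborel. f x = 0"
proof -
 have [measurable]: "f \<in> BM borel" using f by (rule gint_measurable)
 obtain g where g: "\<And>n. continuous_on UNIV (g n)" "\<And>n x. \<bar>g n x\<bar> \<le> 1 * Gk 1 x" "\<And>n. gbound (g n)"
  "AE x in lborel. (\<lambda>n. g n x) ~> clip (1 * Gk 1 x) (f x)"
  using clip_gbound_approx[of f 1] by auto
 define X where "X = (\<lambda>n. 1 / real (Suc n))"
 have X: "X ~> 0" "\<And>n. X n > 0" "\<And>n. X n \<le> 1"
  unfolding X_def using lim_inverse_n' LIMSEQ_inverse_real_of_nat by (auto simp: inverse_eq_divide)
 have z: "(LBINT x. g n x * f x) = 0" for n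
  using gbound_approx_tendsto[OF g(3)[of n] g(1)[of n] f X] 0 X(2) by (simp add: LIMSEQ_const_iff)
 have i: "Li (\<lambda>x. Gk 1 x * \<bar>f x\<bar>)"
  by (intro gbound_integrable_mult gbound_heat_kernel gint_abs f) auto
 have [measurable]: "g n \<in> BM borel" for n using g(3) by (rule gbound_measurable)
 have "(\<lambda>n. LBINT x. g n x * f x) ~> (LBINT x. clip (Gk 1 x) (f x) * f x)"
 proof (rule integral_dominated_convergence[OF _ _ i])
  show "AE x in lborel. (\<lambda>n. g n x * f x) ~> clip (Gk 1 x) (f x) * f x"
   using g(4) by eventually_elim (auto intro!: tendsto_intros)
  show "AE x in lborel. norm (g n x * f x) \<le> Gk 1 x * \<bar>f x\<bar>" for n
   using g(2) by (intro AE_I2) (auto simp: abs_mult intro!: mult_right_mono)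
 qed auto
 then have "(LBINT x. clip (Gk 1 x) (f x) * f x) = 0" using z by (simp add: LIMSEQ_const_iff)
 moreover have "Li (\<lambda>x. clip (Gk 1 x) (f x) * f x)"
 proof (rule Bochner_Integration.integrable_bound[OF i])
  show "AE x in lborel. norm (clip (Gk 1 x) (f x) * f x) \<le> norm (Gk 1 x * \<bar>f x\<bar>)"
  proof (rule AE_I2)
   fix x
   show "norm (clip (Gk 1 x) (f x) * f x) \<le> norm (Gk 1 x * \<bar>f x\<bar>)"
    using mult_right_mono[OF clip(1)[OF heat_kernel_nonneg[of 1 x], of "f x"], of "\<bar>f x\<bar>"]
    by (simp add: abs_mult heat_kernel_nonneg)
  qed
 qed measurable
 moreover have "AE x in lborel. 0 \<le> clip (Gk 1 x) (f x) * f x"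
 proof (rule AE_I2)
  fix x show "0 \<le> clip (Gk 1 x) (f x) * f x"
   using clip(3)[OF heat_kernel_nonneg, of "f x" 1 x] by (simp only: mult.commute)
 qed
 ultimately have "AE x in lborel. clip (Gk 1 x) (f x) * f x = 0"
  using integral_nonneg_eq_0_iff_AE by blast
 then show ?thesis
 proof eventually_elim
  case (elim x)
  then have "f x * clip (Gk 1 x) (f x) = 0" by (subst mult.commute)
  moreover have "Gk 1 x > 0" by (rule heat_kernel_pos) simp
  ultimately show ?case by (rule clip(4)[rotated])
 qed
qed

section \<open>Square integrable functions\<close>

lemma L2_mult_integrable:
 fixes f g :: "'a \<Rightarrow> real"
 assumes [measurable]: "f \<in> BM M" "g \<in> BM M"
  and fg: "integrable M (\<lambda>x. (f x)\<^sup>2)" "integrable M (\<lambda>x. (g x)\<^sup>2)"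
 shows "integrable M (\<lambda>x. f x * g x)"
proof (rule Bochner_Integration.integrable_bound)
 show "integrable M (\<lambda>x. (f x)\<^sup>2 + (g x)\<^sup>2)" using fg by simp
 have "\<bar>a * b\<bar> \<le> \<bar>a\<^sup>2 + b\<^sup>2\<bar>" for a b :: real
 proof -
  have "2 * \<bar>a * b\<bar> \<le> a\<^sup>2 + b\<^sup>2"
   using zero_le_power2[of "\<bar>a\<bar> - \<bar>b\<bar>"] by (simp add: power2_diff abs_mult)
  then show ?thesis by simp
 qed
 then show "AE x in M. norm (f x * g x) \<le> norm ((f x)\<^sup>2 + (g x)\<^sup>2)" by (intro AE_I2) auto
qed measurable

lemma L2_cauchy_schwarz:
 fixes f g :: "'a \<Rightarrow> real"
 assumes [measurable]: "f \<in> BM M" "g \<in> BM M"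
  and fg: "integrable M (\<lambda>x. (f x)\<^sup>2)" "integrable M (\<lambda>x. (g x)\<^sup>2)"
 shows "\<bar>LINT x|M. f x * g x\<bar> \<le> sqrt (LINT x|M. (f x)\<^sup>2) * sqrt (LINT x|M. (g x)\<^sup>2)"
proof -
 define A P Q where "A = (LINT x|M. (f x)\<^sup>2)" "P = (LINT x|M. f x * g x)" "Q = (LINT x|M. (g x)\<^sup>2)"
 note defs = this
 have AQ: "A \<ge> 0" "Q \<ge> 0" by (auto simp: defs)
 have i: "integrable M (\<lambda>x. f x * g x)" by (rule L2_mult_integrable) (use fg in auto)
 have q: "t\<^sup>2 * A + 2 * t * P + Q \<ge> 0" for t
 proof -
  have "0 \<le> (LINT x|M. (t * f x + g x)\<^sup>2)" by simp
  also have "(\<lambda>x. (t * f x + g x)\<^sup>2) = (\<lambda>x. t\<^sup>2 * (f x)\<^sup>2 + 2 * t * (f x * g x) + (g x)\<^sup>2)"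
   by (intro ext) (simp add: power2_eq_square algebra_simps)
  also have "(LINT x|M. t\<^sup>2 * (f x)\<^sup>2 + 2 * t * (f x * g x) + (g x)\<^sup>2) = t\<^sup>2 * A + 2 * t * P + Q"
   using fg i by (simp add: defs)
  finally show ?thesis .
 qed
 have "P\<^sup>2 \<le> A * Q"
 proof (cases "A = 0")
  case True
  have "P = 0"
  proof (rule ccontr)
   assume "P \<noteq> 0"
   \<comment> \<open>For A = 0 the quadratic is affine in t, and at this t its value would be
     -1.\<close>
   then have "(2 * (- (Q + 1) / (2 * P))) * P = - (Q + 1)" by simp
   then show False using q[of "- (Q + 1) / (2 * P)"] True by simp
  qed
  then show ?thesis using AQ by simp
 next
  case False
  then have "A > 0" using AQ by simp
  then show ?thesis using q[of "- P / A"] by (simp add: field_simps power2_eq_square)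
 qed
 then have "sqrt (P\<^sup>2) \<le> sqrt (A * Q)" by (rule real_sqrt_le_mono)
 then show ?thesis by (simp add: real_sqrt_mult defs)
qed

definition L2 :: "(real ^ 'n \<Rightarrow> real) \<Rightarrow> bool"
 where "L2 f \<longleftrightarrow> f \<in> BM borel \<and> Li (\<lambda>x. (f x)\<^sup>2)"

definition nrm2 :: "(real ^ 'n \<Rightarrow> real) \<Rightarrow> real"
 where "nrm2 f = sqrt (LBINT x. (f x)\<^sup>2)"

lemma L2_measurable: "L2 f \<Longrightarrow> f \<in> BM borel" by (simp add: L2_def)

lemma nrm2_nonneg [simp]: "nrm2 f \<ge> 0" by (simp add: nrm2_def)

lemma nrm2_square: "(nrm2 f)\<^sup>2 = (LBINT x. (f x)\<^sup>2)" by (simp add: nrm2_def)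

lemma L2_gint: "L2 f \<Longrightarrow> gint f"
 by (auto simp: L2_def intro: gint_square_integrable)

lemma L2_mult: "L2 f \<Longrightarrow> L2 g \<Longrightarrow> Li (\<lambda>x. f x * g x)"
 by (auto simp: L2_def intro!: L2_mult_integrable)

lemma L2_CS: "L2 f \<Longrightarrow> L2 g \<Longrightarrow> \<bar>LBINT x. f x * g x\<bar> \<le> nrm2 f * nrm2 g"
 unfolding nrm2_def L2_def by (rule L2_cauchy_schwarz) auto

lemma L2_abs: "L2 f \<Longrightarrow> L2 (\<lambda>x. \<bar>f x\<bar>)" by (auto simp: L2_def intro: borel_measurable_abs)

lemma nrm2_abs: "nrm2 (\<lambda>x. \<bar>f x\<bar>) = nrm2 f" by (simp add: nrm2_def)

lemma L2_lin:
 assumes "L2 f" "L2 g" shows "L2 (\<lambda>x. a * f x + b * g x)"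
proof -
 have "Li (\<lambda>x. a\<^sup>2 * (f x)\<^sup>2 + (2 * a * b) * (f x * g x) + b\<^sup>2 * (g x)\<^sup>2)"
  using assms L2_mult[OF assms] by (auto simp: L2_def)
 moreover have "(\<lambda>x. (a * f x + b * g x)\<^sup>2) = (\<lambda>x. a\<^sup>2 * (f x)\<^sup>2 + (2 * a * b) * (f x * g x) + b\<^sup>2 * (g x)\<^sup>2)"
  by (intro ext) (simp add: power2_eq_square algebra_simps)
 ultimately show ?thesis using assms by (auto simp: L2_def)
qed

lemma L2_diff: "L2 f \<Longrightarrow> L2 g \<Longrightarrow> L2 (\<lambda>x. f x - g x)"
 using L2_lin[of f g 1 "-1"] by simp

lemma nrm2_diff_square:
 assumes "L2 f" "L2 g"
 shows "(nrm2 (\<lambda>x. f x - g x))\<^sup>2 = (nrm2 f)\<^sup>2 - 2 * (LBINT x. f x * g x) + (nrm2 g)\<^sup>2"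
proof -
 have "(\<lambda>x. (f x - g x)\<^sup>2) = (\<lambda>x. (f x)\<^sup>2 - 2 * (f x * g x) + (g x)\<^sup>2)"
  by (intro ext) (simp add: power2_eq_square algebra_simps)
 then show ?thesis unfolding nrm2_square using assms L2_mult[OF assms]
  by (simp add: L2_def)
qed

lemma gbound_L2: "gbound k \<Longrightarrow> L2 k"
proof -
 assume k: "gbound k"
 then obtain C s where C: "C \<ge> 0" "s > 0" "\<And>z. \<bar>k z\<bar> \<le> C * Gk s z" using gboundE by blast
 have [measurable]: "k \<in> BM borel" using k by (rule gbound_measurable)
 obtain B where B: "\<And>x. \<bar>k x\<bar> \<le> B" using gbound_bounded[OF k] by blast
 have "Li (\<lambda>z. k z * k z)"
 proof (rule gbound_integrable_mult[OF k])
  show "gint k"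
  proof (rule gint_integrable, rule Bochner_Integration.integrable_bound)
   show "Li (\<lambda>z. C * Gk s z)"
    using integrable_heat_kernel(1)[OF C(2), of 0] by (intro integrable_mult_right) (simp add: heat_kernel_minus)
   show "AE x in lborel. norm (k x) \<le> norm (C * Gk s x)"
    using C by (intro AE_I2) (auto simp: heat_kernel_nonneg)
  qed measurable
 qed
 then show ?thesis by (simp add: L2_def power2_eq_square)
qed

lemma gbound_integrable: "gbound k \<Longrightarrow> Li k"
proof -
 assume k: "gbound k"
 have "gint (\<lambda>x :: real ^ 'a. 1)" unfolding gint_def using integrable_heat_kernel by auto
 from gbound_integrable_mult[OF k this] show ?thesis by simp
qed

lemma gbound_shift:
 assumes "gbound (k :: real ^ 'n \<Rightarrow> real)" shows "L2 (\<lambda>y. k (x - y))" "nrm2 (\<lambda>y. k (x - y)) = nrm2 k"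
proof -
 have [measurable]: "k \<in> BM borel" using assms by (rule gbound_measurable)
 have i: "integrable (distr lborel borel (\<lambda>y. x - y)) (\<lambda>y. (k y)\<^sup>2)"
  using gbound_L2[OF assms] lborel_reflect[of x] by (simp add: L2_def)
 have [measurable]: "(\<lambda>y. x - y) \<in> lborel \<rightarrow>\<^sub>M borel" by measurable
 show "L2 (\<lambda>y. k (x - y))"
  using i by (subst (asm) integrable_distr_eq) (auto simp: L2_def)
 have "(LINT y|distr lborel borel (\<lambda>y. x - y). (k y)\<^sup>2) = (LBINT y. (k (x - y))\<^sup>2)"
  by (rule integral_distr) measurable
 then show "nrm2 (\<lambda>y. k (x - y)) = nrm2 k" unfolding nrm2_def by (metis lborel_reflect)
qed

text \<open>Jensen's inequality for the probability density \<open>Gk t (x - y)\<close>: the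
  variance of f about its mean \<open>c\<close> is nonnegative, which bounds the square of the flow
  by the flow of the square. Integration in x then uses mass one.\<close>

lemma heat_L2:
 fixes f :: "real ^ 'n \<Rightarrow> real"
 assumes f: "L2 f" and t: "t > 0"
 shows "L2 (Ht t f)" "nrm2 (Ht t f) \<le> nrm2 f"
proof -
 have [measurable]: "f \<in> BM borel" using f by (rule L2_measurable)
 have f2: "Li (\<lambda>x. (f x)\<^sup>2)" using f by (simp add: L2_def)
 then have g2: "gint (\<lambda>x. (f x)\<^sup>2)" by (rule gint_integrable)
 have i1: "Li (\<lambda>y. Gk t (x - y) * f y)" "Li (\<lambda>y. Gk t (x - y) * (f y)\<^sup>2)" for x
  using L2_gint[OF f] g2 t by (auto intro!: conv_integrable gbound_heat_kernel)
 have J: "(Ht t f x)\<^sup>2 \<le> Ht t (\<lambda>x. (f x)\<^sup>2) x" for x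
 proof -
  define c where "c = Ht t f x"
  have "0 \<le> (LBINT y. Gk t (x - y) * (f y - c)\<^sup>2)" by (simp add: heat_kernel_nonneg)
  also have "(\<lambda>y. Gk t (x - y) * (f y - c)\<^sup>2) = (\<lambda>y. Gk t (x - y) * (f y)\<^sup>2 - (2 * c) * (Gk t (x - y) * f y) + c\<^sup>2 * Gk t (x - y))"
   by (intro ext) (simp add: power2_eq_square algebra_simps)
  also have "(LBINT y. Gk t (x - y) * (f y)\<^sup>2 - (2 * c) * (Gk t (x - y) * f y) + c\<^sup>2 * Gk t (x - y))
   = Ht t (\<lambda>x. (f x)\<^sup>2) x - 2 * c * c + c\<^sup>2"
   using i1[of x] integrable_heat_kernel[OF t, of x] by (simp add: conv_def c_def)
  finally show ?thesis by (simp add: c_def power2_eq_square)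
 qed
 have "(NN x. ennreal (Ht t (\<lambda>x. (f x)\<^sup>2) x)) = (NN x. NN y. ennreal (Gk t (x - y)) * ennreal ((f y)\<^sup>2))"
  unfolding conv_def using i1(2)
  by (intro nn_integral_cong) (subst nn_integral_eq_integral[symmetric], auto simp: heat_kernel_nonneg ennreal_mult)
 also have "\<dots> = (NN y. NN x. ennreal (Gk t (x - y)) * ennreal ((f y)\<^sup>2))"
  by (rule lborel_pair.Fubini') measurable
 also have "\<dots> = (NN y. ennreal ((f y)\<^sup>2))"
  using t by (simp add: nn_integral_multc nn_integral_heat_kernel)
 also have "\<dots> = ennreal (LBINT y. (f y)\<^sup>2)" using f2 by (intro nn_integral_eq_integral) auto
 finally have n: "(NN x. ennreal (Ht t (\<lambda>x. (f x)\<^sup>2) x)) = ennreal (LBINT y. (f y)\<^sup>2)" .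
 have "0 \<le> Ht t (\<lambda>x. (f x)\<^sup>2) x" for x
  using J[of x] by (meson order.trans zero_le_power2)
 then have h: "has_bochner_integral lborel (Ht t (\<lambda>x. (f x)\<^sup>2)) (LBINT y. (f y)\<^sup>2)"
  by (intro has_bochner_integral_nn_integral) (auto simp: n)
 have i: "Li (\<lambda>x. (Ht t f x)\<^sup>2)"
  by (rule Bochner_Integration.integrable_bound[of _ "Ht t (\<lambda>x. (f x)\<^sup>2)"])
   (use h J in "auto simp: has_bochner_integral_iff intro!: AE_I2 order.trans[OF _ abs_ge_self]")
 then show "L2 (Ht t f)" by (simp add: L2_def)
 have "(LBINT x. (Ht t f x)\<^sup>2) \<le> (LBINT x. Ht t (\<lambda>x. (f x)\<^sup>2) x)"
  using h J by (intro integral_mono i) (auto simp: has_bochner_integral_iff)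
 also have "\<dots> = (LBINT y. (f y)\<^sup>2)" using h by (simp add: has_bochner_integral_iff)
 finally show "nrm2 (Ht t f) \<le> nrm2 f" by (simp add: nrm2_def)
qed

text \<open>Two approximations: f is clipped at n times a Gaussian, with error dominated by f^2, and
  the clipped function is replaced by a continuous kernel, with error dominated by the square of
  that Gaussian.\<close>

lemma L2_approx:
 fixes f :: "real ^ 'n \<Rightarrow> real"
 assumes f: "L2 f" and e: "e > 0"
 obtains k where "gbound k" "continuous_on UNIV k" "nrm2 (\<lambda>x. f x - k x) < e"
proof -
 have [measurable]: "f \<in> BM borel" using f by (rule L2_measurable)
 have f2: "Li (\<lambda>x. (f x)\<^sup>2)" using f by (simp add: L2_def)
 define c where "c = (\<lambda>n x. clip (real n * Gk 1 x) (f x))"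
 have [measurable]: "c n \<in> BM borel" for n unfolding c_def by measurable
 have "(\<lambda>n. LBINT x. (f x - c n x)\<^sup>2) ~> (LINT x|(lborel :: (real ^ 'n) measure). (0 :: real))"
 proof (rule integral_dominated_convergence[OF _ _ f2])
  show "AE x in lborel. (\<lambda>n. (f x - c n x)\<^sup>2) ~> 0"
  proof (rule AE_I2)
   fix x
   obtain N where N: "\<bar>f x\<bar> / Gk 1 x < real N" using reals_Archimedean2 by blast
   have "f x - c n x = 0" if "n \<ge> N" for n
   proof -
    have "\<bar>f x\<bar> / Gk 1 x \<le> real n" using N that by linarith
    then have "\<bar>f x\<bar> \<le> real n * Gk 1 x" using heat_kernel_pos[of 1 x] by (simp add: field_simps)
    then show ?thesis using clip(6) by (simp add: c_def)
   qed
   then have "eventually (\<lambda>n. (f x - c n x)\<^sup>2 = 0) sequentially"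
    by (auto simp: eventually_sequentially intro!: exI[of _ N])
   then show "(\<lambda>n. (f x - c n x)\<^sup>2) ~> 0" by (rule tendsto_eventually)
  qed
  show "AE x in lborel. norm ((f x - c n x)\<^sup>2) \<le> (f x)\<^sup>2" for n
   using clip(5)[of "real n * Gk 1 _"] by (intro AE_I2) (auto simp: c_def heat_kernel_nonneg abs_le_square_iff[symmetric])
 qed auto
 \<comment> \<open>A quarter for each of the two errors, because they are added through (a + b)^2
   \<le> 2 a^2 + 2 b^2.\<close>
 then have "eventually (\<lambda>n. (LBINT x. (f x - c n x)\<^sup>2) < e\<^sup>2 / 4) sequentially"
  using e by (intro order_tendstoD(2)) auto
 then obtain n where n: "(LBINT x. (f x - c n x)\<^sup>2) < e\<^sup>2 / 4" by (auto simp: eventually_sequentially)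
 obtain g where g: "\<And>k. continuous_on UNIV (g k)" "\<And>k x. \<bar>g k x\<bar> \<le> real n * Gk 1 x" "\<And>k. gbound (g k)"
  "AE x in lborel. (\<lambda>k. g k x) ~> clip (real n * Gk 1 x) (f x)"
  by (rule clip_gbound_approx[of f "real n"]) auto
 have cL: "L2 (c n)"
 proof (rule gbound_L2, unfold gbound_def, intro conjI)
  show "\<exists>C s. s > 0 \<and> (\<forall>z. \<bar>c n z\<bar> \<le> C * Gk s z)"
   by (rule exI[of _ "real n"], rule exI[of _ 1]) (auto simp: c_def heat_kernel_nonneg intro!: clip(1))
 qed measurable
 have [measurable]: "g k \<in> BM borel" for k using g(3) by (rule gbound_measurable)
 have "(\<lambda>k. LBINT x. (c n x - g k x)\<^sup>2) ~> (LINT x|(lborel :: (real ^ 'n) measure). (0 :: real))"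
 proof (rule integral_dominated_convergence)
  show "Li (\<lambda>x. 4 * (real n)\<^sup>2 * (Gk 1 (x :: real ^ 'n))\<^sup>2)"
   using gbound_L2[OF gbound_heat_kernel[of 1]] by (intro integrable_mult_right) (auto simp: L2_def)
  show "AE x in lborel. (\<lambda>k. (c n x - g k x)\<^sup>2) ~> 0"
   using g(4)
  proof eventually_elim
   case (elim x)
   then have "(\<lambda>k. (c n x - g k x)\<^sup>2) ~> (c n x - c n x)\<^sup>2" unfolding c_def by (intro tendsto_intros)
   then show ?case by simp
  qed
  show "AE x in lborel. norm ((c n x - g k x)\<^sup>2) \<le> 4 * (real n)\<^sup>2 * (Gk 1 x)\<^sup>2" for k
  proof (rule AE_I2)
   fix x
   have "\<bar>c n x\<bar> \<le> real n * Gk 1 x" by (auto simp: c_def heat_kernel_nonneg intro!: clip(1))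
   then have "\<bar>c n x - g k x\<bar> \<le> \<bar>2 * real n * Gk 1 x\<bar>" using g(2)[of k x] by linarith
   then have "(c n x - g k x)\<^sup>2 \<le> (2 * real n * Gk 1 x)\<^sup>2" by (simp only: abs_le_square_iff)
   then show "norm ((c n x - g k x)\<^sup>2) \<le> 4 * (real n)\<^sup>2 * (Gk 1 x)\<^sup>2" by (simp add: power_mult_distrib)
  qed
 qed auto
 then have "eventually (\<lambda>k. (LBINT x. (c n x - g k x)\<^sup>2) < e\<^sup>2 / 4) sequentially"
  using e by (intro order_tendstoD(2)) auto
 then obtain k where k: "(LBINT x. (c n x - g k x)\<^sup>2) < e\<^sup>2 / 4" by (auto simp: eventually_sequentially)
 have L: "L2 (\<lambda>x. f x - c n x)" "L2 (\<lambda>x. c n x - g k x)" "L2 (\<lambda>x. f x - g k x)"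
  using f cL gbound_L2[OF g(3)] by (auto intro!: L2_diff)
 have "(LBINT x. (f x - g k x)\<^sup>2) \<le> (LBINT x. 2 * (f x - c n x)\<^sup>2 + 2 * (c n x - g k x)\<^sup>2)"
 proof (rule integral_mono)
  fix x
  show "(f x - g k x)\<^sup>2 \<le> 2 * (f x - c n x)\<^sup>2 + 2 * (c n x - g k x)\<^sup>2"
   using zero_le_power2[of "(f x - c n x) - (c n x - g k x)"] by (simp add: power2_eq_square algebra_simps)
 qed (use L in "auto simp: L2_def")
 also have "\<dots> < e\<^sup>2" using n k L by (simp add: L2_def)
 finally have "nrm2 (\<lambda>x. f x - g k x) < e" using e unfolding nrm2_def by (simp add: real_less_lsqrt)
 with g that show ?thesis by blast
qed

text \<open>The limit is known for continuous kernels in place of g; these are dense in L^2, and the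
  flow is a contraction, so the error of the replacement is uniform in n.\<close>

lemma heat_weak_tendsto:
 fixes f g :: "real ^ 'n \<Rightarrow> real"
 assumes f: "L2 f" and g: "L2 g" and X: "X ~> 0" "\<And>n. X n > 0" "\<And>n. X n \<le> 1"
 shows "(\<lambda>n. LBINT x. g x * Ht (X n) f x) ~> (LBINT x. g x * f x)"
proof (rule LIMSEQ_I)
 fix r :: real assume r: "r > 0"
 \<comment> \<open>The replacement of g by k is made twice, each time at a cost of at most
   \<open>e * nrm2 f\<close>; the summand 2 keeps the denominator positive if f has norm 0.\<close>
 define e where "e = r / (2 * nrm2 f + 2)"
 have e: "e > 0" "2 * nrm2 f * e < r" 
 proof -
  have p: "2 * nrm2 f + 2 > 0" by (intro add_nonneg_pos) auto
  then show "e > 0" using r by (simp add: e_def)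
  have "2 * nrm2 f * r < r * (2 * nrm2 f + 2)" using r by (simp add: algebra_simps)
  then show "2 * nrm2 f * e < r" using p by (simp add: e_def divide_less_eq)
 qed
 obtain k where k: "gbound k" "continuous_on UNIV k" "nrm2 (\<lambda>x. g x - k x) < e" using L2_approx[OF g e(1)] by blast
 have kL: "L2 k" by (rule gbound_L2[OF k(1)])
 have "(\<lambda>n. LBINT x. k x * Ht (X n) f x) ~> (LBINT x. k x * f x)"
  by (rule gbound_approx_tendsto[OF k(1,2) L2_gint[OF f] X])
 from LIMSEQ_D[OF this, of "r - 2 * nrm2 f * e"] e obtain N where
  N: "\<And>n. n \<ge> N \<Longrightarrow> \<bar>(LBINT x. k x * Ht (X n) f x) - (LBINT x. k x * f x)\<bar> < r - 2 * nrm2 f * e"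
  by auto
 show "\<exists>no. \<forall>n\<ge>no. norm ((LBINT x. g x * Ht (X n) f x) - (LBINT x. g x * f x)) < r"
 proof (intro exI allI impI)
  fix n assume n: "n \<ge> N"
  have h: "L2 (Ht (X n) f)" "nrm2 (Ht (X n) f) \<le> nrm2 f"
   using heat_L2[OF f X(2)] by auto
  have gk: "L2 (\<lambda>x. g x - k x)" using g kL by (rule L2_diff)
  have 1: "(LBINT x. g x * u x) = (LBINT x. (g x - k x) * u x) + (LBINT x. k x * u x)" if "L2 u" for u
   using L2_mult[OF gk that] L2_mult[OF kL that] by (subst Bochner_Integration.integral_add[symmetric]) (auto simp: algebra_simps)
  have 2: "\<bar>LBINT x. (g x - k x) * u x\<bar> \<le> e * nrm2 f" if "L2 u" "nrm2 u \<le> nrm2 f" for u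
  proof -
   have "\<bar>LBINT x. (g x - k x) * u x\<bar> \<le> nrm2 (\<lambda>x. g x - k x) * nrm2 u" by (rule L2_CS[OF gk that(1)])
   also have "\<dots> \<le> e * nrm2 f" using k(3) that e by (intro mult_mono) auto
   finally show ?thesis .
  qed
  show "norm ((LBINT x. g x * Ht (X n) f x) - (LBINT x. g x * f x)) < r"
   unfolding 1[OF h(1)] 1[OF f] real_norm_def using 2[OF h] 2[OF f order.refl] N[OF n] by (simp add: mult.commute)
 qed
qed

text \<open>Weak convergence together with the contraction property: the squared distance is at most
  2 ||f||^2 - 2 (f, Ht f), and the right side tends to 0.\<close>

lemma heat_strong_tendsto:
 fixes f :: "real ^ 'n \<Rightarrow> real"
 assumes f: "L2 f" and X: "X ~> 0" "\<And>n. X n > 0" "\<And>n. X n \<le> 1"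
 shows "(\<lambda>n. nrm2 (\<lambda>x. Ht (X n) f x - f x)) ~> 0"
proof -
 have "(\<lambda>n. 2 * (nrm2 f)\<^sup>2 - 2 * (LBINT x. f x * Ht (X n) f x)) ~> 2 * (nrm2 f)\<^sup>2 - 2 * (LBINT x. f x * f x)"
  by (intro tendsto_intros heat_weak_tendsto f X)
 then have 1: "(\<lambda>n. 2 * (nrm2 f)\<^sup>2 - 2 * (LBINT x. f x * Ht (X n) f x)) ~> 0"
 proof -
  have "2 * (nrm2 f)\<^sup>2 - 2 * (LBINT x. f x * f x) = 0"
   unfolding nrm2_square by (simp add: power2_eq_square)
  then show "(\<lambda>n. 2 * (nrm2 f)\<^sup>2 - 2 * (LBINT x. f x * Ht (X n) f x)) ~> 2 * (nrm2 f)\<^sup>2 - 2 * (LBINT x. f x * f x)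
   \<Longrightarrow> ?thesis" by (simp only:)
 qed
 have "(\<lambda>n. (nrm2 (\<lambda>x. Ht (X n) f x - f x))\<^sup>2) ~> 0"
 proof (rule tendsto_sandwich[OF _ _ tendsto_const 1])
  show "\<forall>\<^sub>F n in sequentially. (nrm2 (\<lambda>x. Ht (X n) f x - f x))\<^sup>2 \<le> 2 * (nrm2 f)\<^sup>2 - 2 * (LBINT x. f x * Ht (X n) f x)"
  proof (intro always_eventually allI)
   fix n
   have h: "L2 (Ht (X n) f)" "nrm2 (Ht (X n) f) \<le> nrm2 f"
    using heat_L2[OF f X(2)] by auto
   have "(nrm2 (Ht (X n) f))\<^sup>2 \<le> (nrm2 f)\<^sup>2" using h(2) by (intro power_mono) auto
   then show "(nrm2 (\<lambda>x. Ht (X n) f x - f x))\<^sup>2 \<le> 2 * (nrm2 f)\<^sup>2 - 2 * (LBINT x. f x * Ht (X n) f x)"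
    unfolding nrm2_diff_square[OF h(1) f] by (simp add: mult.commute)
  qed
 qed auto
 from tendsto_real_sqrt[OF this] show ?thesis by simp
qed

section \<open>Bessel potentials\<close>

lemma integrable_half_line_shift:
 fixes f :: "real \<Rightarrow> real"
 shows "Li (\<lambda>s. pos s * f (s + t)) \<longleftrightarrow> Li (\<lambda>s. indicator {t<..} s * f s)"
  and "(LBINT s. pos s * f (s + t)) = (LBINT s. indicator {t<..} s * f s)"
proof -
 have e: "(\<lambda>s. indicator {t<..} (t + 1 * s) * f (t + 1 * s)) = (\<lambda>s. pos s * f (s + t))"
  by (auto simp: fun_eq_iff indicator_def add.commute)
 show "Li (\<lambda>s. pos s * f (s + t)) \<longleftrightarrow> Li (\<lambda>s. indicator {t<..} s * f s)"
  using lborel_integrable_real_affine_iff[of 1 "\<lambda>s. indicator {t<..} s * f s" t] by (simp add: e[simplified])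
 show "(LBINT s. pos s * f (s + t)) = (LBINT s. indicator {t<..} s * f s)"
  using lborel_integral_real_affine[of 1 "\<lambda>s. indicator {t<..} s * f s" t] by (simp add: e[simplified])
qed

lemma FTC_half_line:
 fixes f F :: "real \<Rightarrow> real"
 assumes D: "\<And>s. s \<ge> 0 \<Longrightarrow> (F has_real_derivative f s) (at s)"
  and f: "continuous_on {0..} f" "Li (\<lambda>s. pos s * f s)"
  and L: "(F \<longlongrightarrow> L) at_top"
 shows "(LBINT s. pos s * f s) = L - F 0"
proof -
 have e: "(LBINT s. indicator {0..real n} s * f s) = F (real n) - F 0" for n
 proof -
  have "(LBINT s. indicator {0..real n} s *\<^sub>R f s) = F (real n) - F 0"
  proof (rule integral_FTC_atLeastAtMost)
   show "(F has_vector_derivative f x) (at x within {0..real n})" if "0 \<le> x" for x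
    using D[OF that] by (simp add: has_real_derivative_iff_has_vector_derivative has_vector_derivative_at_within)
   show "continuous_on {0..real n} f" using f(1) by (rule continuous_on_subset) auto
  qed auto
  then show ?thesis by simp
 qed
 have "(\<lambda>n. LBINT s. indicator {0..real n} s * f s) ~> (LBINT s. pos s * f s)"
 proof (rule integral_dominated_convergence[where w = "\<lambda>s. \<bar>pos s * f s\<bar>"])
  show "Li (\<lambda>s. \<bar>pos s * f s\<bar>)" using f(2) by (rule integrable_abs)
  show "(\<lambda>s. pos s * f s) \<in> BM lborel" using f(2) by (rule borel_measurable_integrable)
  show "(\<lambda>s. indicator {0..real n} s * f s) \<in> BM lborel" for n
   using borel_measurable_continuous_on_indicator[of "{0..real n}" f] continuous_on_subset[OF f(1), of "{0..real n}"] by auto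
  show "AE s in lborel. (\<lambda>n. indicator {0..real n} s * f s) ~> pos s * f s"
   using AE_lborel_singleton[of 0]
  proof eventually_elim
   case (elim s)
   obtain N where "s < real N" using reals_Archimedean2 by blast
   then have "eventually (\<lambda>n. indicator {0..real n} s * f s = pos s * f s) sequentially"
    unfolding eventually_sequentially using elim by (intro exI[of _ N]) (auto simp: indicator_def)
   then show ?case by (rule tendsto_eventually)
  qed
  show "AE s in lborel. norm (indicator {0..real n} s * f s) \<le> \<bar>pos s * f s\<bar>" for n
   using AE_lborel_singleton[of 0] by eventually_elim (auto simp: indicator_def)
 qed
 moreover have "(\<lambda>n. F (real n) - F 0) ~> L - F 0"
  by (intro tendsto_intros filterlim_compose[OF L filterlim_real_sequentially])
 ultimately show ?thesis using LIMSEQ_unique by (simp only: e)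
qed

text \<open>The exponents a - 1 and -a add up to -1, which cancels the Jacobian of s = \<rho> t;
  this is why the value does not depend on \<rho>.\<close>

lemma nn_integral_Beta:
 assumes a: "0 < a" "a < (1::real)" and \<rho>: "\<rho> > 0"
 shows "(NN s. ennreal (indicator {0<..<\<rho>} s * (s powr (a - 1) * (\<rho> - s) powr (- a)))) = ennreal (Gamma a * Gamma (1 - a))"
proof -
 have 1: "(NN t. ennreal (indicator {0<..<1} t * (t powr (a - 1) * (1 - t) powr (- a)))) = ennreal (Gamma a * Gamma (1 - a))"
 proof -
  have "((\<lambda>t. t powr (a - 1) * (1 - t) powr (- a)) has_integral Beta a (1 - a)) {0..1}"
   using has_integral_Beta_real[of a "1 - a"] a by simp
  then have "((\<lambda>t. t powr (a - 1) * (1 - t) powr (- a)) has_integral Beta a (1 - a)) {0<..<1}"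
   by (simp add: has_integral_Icc_iff_Ioo)
  from nn_integral_has_integral_lebesgue[OF _ this] show ?thesis by (simp add: Beta_def)
 qed
 have "(NN s. ennreal (indicator {0<..<\<rho>} s * (s powr (a - 1) * (\<rho> - s) powr (- a))))
  = ennreal \<rho> * (NN t. ennreal (indicator {0<..<\<rho>} (\<rho> * t) * ((\<rho> * t) powr (a - 1) * (\<rho> - \<rho> * t) powr (- a))))"
  using nn_integral_real_affine[of "\<lambda>s. ennreal (indicator {0<..<\<rho>} s * (s powr (a - 1) * (\<rho> - s) powr (- a)))" \<rho> 0] \<rho> by simp
 also have "\<dots> = (NN t. ennreal \<rho> * ennreal (indicator {0<..<\<rho>} (\<rho> * t) * ((\<rho> * t) powr (a - 1) * (\<rho> - \<rho> * t) powr (- a))))"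
  by (rule nn_integral_cmult[symmetric]) measurable
 also have "\<dots> = (NN t. ennreal (indicator {0<..<1} t * (t powr (a - 1) * (1 - t) powr (- a))))"
 proof (rule nn_integral_cong)
  fix t
  have i: "indicator {0<..<\<rho>} (\<rho> * t) = (indicator {0<..<1} t :: real)"
   using \<rho> by (auto simp: indicator_def zero_less_mult_iff)
  show "ennreal \<rho> * ennreal (indicator {0<..<\<rho>} (\<rho> * t) * ((\<rho> * t) powr (a - 1) * (\<rho> - \<rho> * t) powr (- a)))
   = ennreal (indicator {0<..<1} t * (t powr (a - 1) * (1 - t) powr (- a)))"
  proof (cases "t \<in> {0<..<1}")
   case True
   have "(\<rho> * t) powr (a - 1) = \<rho> powr (a - 1) * t powr (a - 1)" by (rule powr_mult)
   moreover have "(\<rho> - \<rho> * t) powr (- a) = \<rho> powr (- a) * (1 - t) powr (- a)"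
    by (subst powr_mult[symmetric]) (simp add: right_diff_distrib)
   moreover have "\<rho> * \<rho> powr (a - 1) * \<rho> powr (- a) = 1"
   proof -
    have "\<rho> powr 1 * \<rho> powr (a - 1) * \<rho> powr (- a) = \<rho> powr (1 + (a - 1) + (- a))" by (simp only: powr_add)
    then show ?thesis using \<rho> by simp
   qed
   moreover have "\<rho> * ((\<rho> powr (a - 1) * t powr (a - 1)) * (\<rho> powr (- a) * (1 - t) powr (- a)))
    = (\<rho> * \<rho> powr (a - 1) * \<rho> powr (- a)) * (t powr (a - 1) * (1 - t) powr (- a))" by (simp only: mult_ac)
   ultimately have "\<rho> * ((\<rho> * t) powr (a - 1) * (\<rho> - \<rho> * t) powr (- a)) = t powr (a - 1) * (1 - t) powr (- a)"
    by (simp only: mult_1)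
   then show ?thesis using True \<rho> by (simp add: i ennreal_mult'[symmetric])
  qed (simp add: i)
 qed
 finally show ?thesis by (simp add: 1)
qed

text \<open>Abel's identity: fractional integrals of orders a and 1 - a compose to the ordinary
  integral. With \<rho> = \<sigma> + s, Fubini leaves for each \<rho> the Beta integral, a constant.
  It links the Bessel potential, whose weight is s^(a-1), to its inverse, whose weight is
  \<sigma>^(-a).\<close>

lemma Beta_convolution:
 fixes h :: "real \<Rightarrow> real"
 assumes a: "0 < a" "a < 1" and h: "Li (\<lambda>s. pos s * h s)"
 shows "(LBINT s. pos s * (s powr (a - 1) * (LBINT sg. pos sg * (sg powr (- a) * h (sg + s)))))
  = Gamma a * Gamma (1 - a) * (LBINT s. pos s * h s)"
proof -
 define h0 where "h0 = (\<lambda>s. pos s * h s)"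
 have [measurable]: "h0 \<in> BM borel" using borel_measurable_integrable[OF h] by (simp add: h0_def)
 define k where "k = (\<lambda>\<rho> s :: real. indicator {0<..<\<rho>} s * (s powr (a - 1) * (\<rho> - s) powr (- a)))"
 have k0: "k \<rho> s \<ge> 0" for \<rho> s by (simp add: k_def)
 have k_alt: "k \<rho> s = (if 0 < s \<and> s < \<rho> then s powr (a - 1) * (\<rho> - s) powr (- a) else 0)" for \<rho> s
  by (simp add: k_def indicator_def)
 have [measurable]: "(\<lambda>p. k (fst p) (snd p)) \<in> BM (borel \<Otimes>\<^sub>M borel)"
  unfolding k_alt by measurable
 have [measurable]: "k \<rho> \<in> BM borel" for \<rho>
  unfolding k_def by measurable
 have G: "Gamma a * Gamma (1 - a) \<ge> 0" using a by (simp add: less_imp_le)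
 have nk: "(NN s. ennreal (k \<rho> s)) = ennreal (Gamma a * Gamma (1 - a))" if "\<rho> > 0" for \<rho>
  using nn_integral_Beta[OF a that] by (simp add: k_def)
 have int: "integrable lb2 (\<lambda>(\<rho>, s). k \<rho> s * h0 \<rho>)"
 proof (rule integrableI_bounded)
  show "(\<lambda>(\<rho>, s). k \<rho> s * h0 \<rho>) \<in> BM lb2" by measurable
  have "(\<integral>\<^sup>+p. ennreal (norm (case p of (\<rho>, s) \<Rightarrow> k \<rho> s * h0 \<rho>)) \<partial>lb2)
   = (NN \<rho>. (NN s. ennreal (k \<rho> s) * ennreal \<bar>h0 \<rho>\<bar>))"
   by (subst lborel.nn_integral_fst[symmetric]) (auto simp: abs_mult k0 ennreal_mult)
  also have "\<dots> = (NN \<rho>. ennreal (Gamma a * Gamma (1 - a)) * ennreal \<bar>h0 \<rho>\<bar>)"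
  proof (rule nn_integral_cong)
   fix \<rho>
   show "(NN s. ennreal (k \<rho> s) * ennreal \<bar>h0 \<rho>\<bar>) = ennreal (Gamma a * Gamma (1 - a)) * ennreal \<bar>h0 \<rho>\<bar>"
    using nk[of \<rho>] by (cases "\<rho> > 0") (auto simp: h0_def nn_integral_multc)
  qed
  also have "\<dots> < \<infinity>"
  proof -
   have "(NN \<rho>. ennreal \<bar>h0 \<rho>\<bar>) < \<infinity>" using h by (simp add: integrable_iff_bounded h0_def)
   then show ?thesis by (subst nn_integral_cmult) (auto simp: ennreal_mult_less_top)
  qed
  finally show "(\<integral>\<^sup>+p. ennreal (norm (case p of (\<rho>, s) \<Rightarrow> k \<rho> s * h0 \<rho>)) \<partial>lb2) < \<infinity>" .
 qed
 have "(LBINT s. pos s * (s powr (a - 1) * (LBINT sg. pos sg * (sg powr (- a) * h (sg + s)))))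
  = (LBINT s. LBINT \<rho>. k \<rho> s * h0 \<rho>)"
 proof (rule Bochner_Integration.integral_cong[OF refl])
  fix s :: real
  have "(LBINT sg. pos sg * (sg powr (- a) * h (sg + s))) = (LBINT \<rho>. indicator {s<..} \<rho> * ((\<rho> - s) powr (- a) * h \<rho>))"
   using integrable_half_line_shift(2)[of "\<lambda>\<rho>. (\<rho> - s) powr (- a) * h \<rho>" s] by simp
  then have "pos s * (s powr (a - 1) * (LBINT sg. pos sg * (sg powr (- a) * h (sg + s))))
   = (LBINT \<rho>. pos s * (s powr (a - 1) * (indicator {s<..} \<rho> * ((\<rho> - s) powr (- a) * h \<rho>))))"
   by simp
  also have "\<dots> = (LBINT \<rho>. k \<rho> s * h0 \<rho>)"
   by (rule Bochner_Integration.integral_cong) (auto simp: k_def h0_def indicator_def)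
  finally show "pos s * (s powr (a - 1) * (LBINT sg. pos sg * (sg powr (- a) * h (sg + s))))
   = (LBINT \<rho>. k \<rho> s * h0 \<rho>)" .
 qed
 also have "\<dots> = (LBINT \<rho>. LBINT s. k \<rho> s * h0 \<rho>)"
  by (rule lborel_pair.Fubini_integral) (rule int)
 also have "\<dots> = (LBINT \<rho>. Gamma a * Gamma (1 - a) * h0 \<rho>)"
 proof (rule Bochner_Integration.integral_cong[OF refl])
  fix \<rho>
  show "(LBINT s. k \<rho> s * h0 \<rho>) = Gamma a * Gamma (1 - a) * h0 \<rho>"
  proof (cases "\<rho> > 0")
   case True
   have "has_bochner_integral lborel (k \<rho>) (Gamma a * Gamma (1 - a))"
    using nk[OF True] G by (intro has_bochner_integral_nn_integral) (auto simp: k0)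
   then show ?thesis by (simp add: has_bochner_integral_iff)
  qed (simp add: h0_def)
 qed
 finally show ?thesis by (simp add: h0_def)
qed

section \<open>Recovery of a function from the time derivative of its heat flow\<close>

lemma hk_conv_measurable [measurable (raw)]:
 assumes "hk d k" and [measurable]: "a \<in> BM M" "b \<in> BM M" "f \<in> BM borel"
 shows "(\<lambda>w. conv (k (a w)) f (b w :: real ^ 'n)) \<in> BM M"
proof -
 have [measurable]: "(\<lambda>p. k (a (fst p)) (b (fst p) - snd p)) \<in> BM (M \<Otimes>\<^sub>M lborel)"
  by (rule hk_measurable[OF assms(1)]) measurable
 show ?thesis unfolding conv_def by measurable
qed

lemma conv_integral:
 fixes w :: "real \<Rightarrow> real ^ 'n \<Rightarrow> real"
 assumes w: "integrable lb2 (\<lambda>(s, z). w s z)" and k: "gbound k"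
 shows "Li (\<lambda>s. conv k (w s) x)"
  and "conv k (\<lambda>z. LBINT s. w s z) x = (LBINT s. conv k (w s) x)"
proof -
 obtain B where B: "\<And>x. \<bar>k x\<bar> \<le> B" using gbound_bounded[OF k] by blast
 have [measurable]: "k \<in> BM borel" using k by (rule gbound_measurable)
 have [measurable]: "(\<lambda>(s, z). w s z) \<in> BM lb2"
  using w by (rule borel_measurable_integrable)
 have i: "integrable lb2 (\<lambda>(s, z). k (x - z) * w s z)"
 proof (rule Bochner_Integration.integrable_bound)
  show "integrable lb2 (\<lambda>p. B * (case p of (s, z) \<Rightarrow> w s z))" using w by (rule integrable_mult_right)
  show "AE p in lborel \<Otimes>\<^sub>M lborel. norm (case p of (s, z) \<Rightarrow> k (x - z) * w s z) \<le> norm (B * (case p of (s, z) \<Rightarrow> w s z))"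
  proof (intro AE_I2, clarify)
   fix s z
   have "\<bar>k (x - z)\<bar> * \<bar>w s z\<bar> \<le> \<bar>B\<bar> * \<bar>w s z\<bar>"
    using B[of "x - z"] by (intro mult_right_mono) auto
   then show "norm (k (x - z) * w s z) \<le> norm (B * w s z)" by (simp add: abs_mult)
  qed
 qed measurable
 show "Li (\<lambda>s. conv k (w s) x)"
  using lborel_pair.integrable_fst[OF i] by (simp add: conv_def)
 have "(LBINT z. LBINT s. k (x - z) * w s z) = (LBINT s. LBINT z. k (x - z) * w s z)"
  by (rule lborel_pair.Fubini_integral[OF i])
 then show "conv k (\<lambda>z. LBINT s. w s z) x = (LBINT s. conv k (w s) x)"
  by (simp add: conv_def)
qed

lemma conv_cmult: "conv k (\<lambda>z. c * f z) x = c * conv k f x"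
 by (simp add: conv_def mult.left_commute)

lemma nn_integral_conv_heat:
 fixes f :: "real ^ 'n \<Rightarrow> real"
 assumes [measurable]: "f \<in> BM borel" and t: "t > 0"
 shows "(NN x. ennreal \<bar>Ht t f x\<bar>) \<le> (NN x. ennreal \<bar>f x\<bar>)"
proof -
 have "(NN x. ennreal \<bar>Ht t f x\<bar>) \<le> (NN x. NN y. ennreal (Gk t (x - y)) * ennreal \<bar>f y\<bar>)"
 proof (rule nn_integral_mono)
  fix x
  have "ennreal (norm (LBINT y. Gk t (x - y) * f y)) \<le> (NN y. ennreal (norm (Gk t (x - y) * f y)))"
  \<comment> \<open>Without integrability the Bochner integral is 0 and the bound is
    trivial.\<close>
  proof (cases "Li (\<lambda>y. Gk t (x - y) * f y)")
   case True then show ?thesis by (rule integral_norm_bound_ennreal)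
  qed (simp add: not_integrable_integral_eq)
  then show "ennreal \<bar>Ht t f x\<bar> \<le> (NN y. ennreal (Gk t (x - y)) * ennreal \<bar>f y\<bar>)"
   by (simp add: conv_def abs_mult heat_kernel_nonneg ennreal_mult)
 qed
 also have "\<dots> = (NN y. NN x. ennreal (Gk t (x - y)) * ennreal \<bar>f y\<bar>)"
  by (rule lborel_pair.Fubini') measurable
 also have "\<dots> = (NN x. ennreal \<bar>f x\<bar>)"
  using t by (simp add: nn_integral_multc nn_integral_heat_kernel)
 finally show ?thesis .
qed

lemma hk_conv_continuous:
 fixes k :: "real \<Rightarrow> real ^ 'n \<Rightarrow> real"
 assumes "hk d k" "gint f"
 shows "continuous_on {0<..} (\<lambda>s. conv (k s) f x)"
proof -
 obtain k' g where kg: "hk (Suc (Suc d)) g" "hk_deriv k k' g" using hk_deriv_ex[OF assms(1)] by blast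
 show ?thesis
 proof (intro continuous_at_imp_continuous_on ballI)
  fix s :: real assume "s \<in> {0<..}"
  then have "((\<lambda>s. conv (k s) f x) has_real_derivative conv (g s) f x) (at s)"
   by (intro conv_deriv[OF assms(1) kg assms(2)]) auto
  then show "isCont (\<lambda>s. conv (k s) f x) s" by (rule DERIV_isCont)
 qed
qed

lemma heat_representation:
 fixes f :: "real ^ 'n \<Rightarrow> real"
 assumes f: "gint f"
  and lim: "\<And>x. ((\<lambda>s. Ht s f x) \<longlongrightarrow> 0) at_top"
  and int: "integrable lb2 (\<lambda>(s, z). pos s * Ht' s f z)"
 shows "AE x in lborel. f x = - (LBINT s. pos s * Ht' s f x)"
  and "Li f"
  and "(LBINT x. \<bar>f x\<bar>) \<le> (LINT p|lb2. \<bar>case p of (s, z) \<Rightarrow> pos s * Ht' s f z\<bar>)"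
  and "\<And>t x. t > 0 \<Longrightarrow> Li (\<lambda>s. pos s * Ht' (s + t) f x)"
proof -
 define F where "F = (\<lambda>x. LBINT s. pos s * Ht' s f x)"
 have Fi: "Li F"
  using lborel_pair.integrable_snd[OF int] by (simp add: F_def)
 have c: "Ht t (\<lambda>z. pos s * Ht' s f z) x = pos s * Ht' (s + t) f x" if "t > 0" for t s x
  unfolding conv_cmult using conv_heat_heat'(2)[OF that _ f, of s x] by (auto simp: indicator_def)
 show i: "Li (\<lambda>s. pos s * Ht' (s + t) f x)" if "t > 0" for t x
  using conv_integral(1)[OF int gbound_heat_kernel[OF that], of x] by (simp add: c[OF that])
 have P: "Ht t F x = - Ht t f x" if t: "t > 0" for t x
 proof -
  have "Ht t F x = (LBINT s. pos s * Ht' (s + t) f x)"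
   using conv_integral(2)[OF int gbound_heat_kernel[OF that], of x] by (simp add: c[OF that] F_def)
  also have "\<dots> = 0 - Ht (0 + t) f x"
  proof (rule FTC_half_line[OF _ _ i[OF t]])
   show "((\<lambda>s. Ht (s + t) f x) has_real_derivative Ht' (s + t) f x) (at s)" if "s \<ge> 0" for s
    using conv_heat_deriv[OF f, of "s + t" x] that t by (simp add: DERIV_shift)
   show "continuous_on {0..} (\<lambda>s. Ht' (s + t) f x)"
    by (rule continuous_on_compose2[OF hk_conv_continuous[OF hk_heat_kernel' f]]) (use t in "auto intro!: continuous_intros")
   show "((\<lambda>s. Ht (s + t) f x) \<longlongrightarrow> 0) at_top"
    using filterlim_compose[OF lim filterlim_tendsto_add_at_top[OF tendsto_const[of t] filterlim_ident]]
    by (simp add: add.commute)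
  qed
  finally show ?thesis by simp
 qed
 have "gint (\<lambda>x. 1 * f x + 1 * F x)" by (intro gint_lin f gint_integrable Fi)
 moreover have "Ht t (\<lambda>x. 1 * f x + 1 * F x) x = 0" if "t > 0" for t x
 proof -
  have "Ht t (\<lambda>x. 1 * f x + 1 * F x) x = Ht t f x + Ht t F x"
   unfolding conv_def using conv_integrable[OF gbound_heat_kernel[OF that] f, of x] conv_integrable[OF gbound_heat_kernel[OF that] gint_integrable[OF Fi], of x]
   by (simp add: distrib_left)
  then show ?thesis using P[OF that] by simp
 qed
 ultimately have "AE x in lborel. 1 * f x + 1 * F x = 0" by (rule heat_injective)
 then have ae: "AE x in lborel. f x = - F x" by eventually_elim simp
 then show "AE x in lborel. f x = - (LBINT s. pos s * Ht' s f x)" by (simp add: F_def)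
 have [measurable]: "f \<in> BM borel" "F \<in> BM borel"
  using gint_measurable[OF f] borel_measurable_integrable[OF Fi] by auto
 show fi: "Li f"
  using ae Fi by (subst integrable_cong_AE[of _ _ "\<lambda>x. - F x"]) auto
 have "(LBINT x. \<bar>f x\<bar>) = (LBINT x. \<bar>F x\<bar>)"
  using ae by (intro integral_cong_AE) auto
 also have "\<dots> \<le> (LBINT x. LBINT s. \<bar>pos s * Ht' s f x\<bar>)"
 proof (rule integral_mono)
  show "Li (\<lambda>x. \<bar>F x\<bar>)" using Fi by simp
  have "integrable lb2 (\<lambda>(s, z). \<bar>pos s * Ht' s f z\<bar>)"
   using integrable_abs[OF int] by (simp add: case_prod_unfold)
  from lborel_pair.integrable_snd[OF this] show "Li (\<lambda>x. LBINT s. \<bar>pos s * Ht' s f x\<bar>)" .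
  show "\<bar>F x\<bar> \<le> (LBINT s. \<bar>pos s * Ht' s f x\<bar>)" for x
   unfolding F_def by (rule integral_abs_bound)
 qed
 also have "\<dots> = (LINT p|lb2. \<bar>case p of (s, z) \<Rightarrow> pos s * Ht' s f z\<bar>)"
 proof -
  have "integrable lb2 (\<lambda>(s, z). \<bar>pos s * Ht' s f z\<bar>)"
   using integrable_abs[OF int] by (simp add: case_prod_unfold)
  from lborel_pair.integral_snd[OF this] show ?thesis by (simp add: case_prod_unfold)
 qed
 finally show "(LBINT x. \<bar>f x\<bar>) \<le> (LINT p|lb2. \<bar>case p of (s, z) \<Rightarrow> pos s * Ht' s f z\<bar>)" .
qed

section \<open>Bessel potentials of integrable functions and their injectivity\<close>

lemma nn_integral_Gamma_half_line:
 assumes "a > (0 :: real)"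
 shows "(NN s. ennreal (pos s * (s powr (a - 1) * exp (- s)))) = ennreal (Gamma a)"
proof -
 have "(NN s. ennreal (pos s * (s powr (a - 1) * exp (- s))))
  = (NN s. ennreal (indicator {0..} s * s powr (a - 1) / exp s))"
  using AE_lborel_singleton[of 0]
  by (intro nn_integral_cong_AE) (eventually_elim, auto simp: indicator_def exp_minus divide_inverse)
 then show ?thesis using Gamma_conv_nn_integral_real[OF assms] by simp
qed

lemma bessel_kernel_eq:
 "bessel_kernel r x = (LBINT s. pos s * (s powr (r / 2 - 1) * exp (- s) * Gk s x)) / Gamma (r / 2)"
 unfolding bessel_kernel_def set_lebesgue_integral_def
 by (subst integral_completion) auto

lemma bessel_kernel_measurable [measurable]: "bessel_kernel r \<in> BM borel"
 unfolding bessel_kernel_eq[abs_def] by measurable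

lemma bessel_potential_eq:
 fixes g :: "real ^ 'n \<Rightarrow> real"
 assumes [measurable]: "g \<in> BM borel" and r: "r \<noteq> 0"
 shows "bessel_potential r g = conv (bessel_kernel r) g"
 unfolding bessel_potential_def conv_def using r by (auto simp: integral_completion)

text \<open>The potential is an average of heat flows against a Gamma density. The triple integral
  that justifies this factorizes as \<open>Gamma (r / 2)\<close> times the norm of g. After
  \<open>Ht t\<close> the resulting formula holds at every point x.\<close>

lemma bessel_conv:
 fixes g :: "real ^ 'n \<Rightarrow> real"
 assumes g: "Li g" and r: "r > 0"
 shows "Li (conv (bessel_kernel r) g)"
  and "\<And>t x. t > 0 \<Longrightarrow> Ht t (conv (bessel_kernel r) g) x =
   (LBINT s. pos s * (s powr (r / 2 - 1) * exp (- s) * Ht (s + t) g x)) / Gamma (r / 2)"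
  and "\<And>t x. t > 0 \<Longrightarrow> Li (\<lambda>s. pos s * (s powr (r / 2 - 1) * exp (- s) * Ht (s + t) g x))"
proof -
 have [measurable]: "g \<in> BM borel" using borel_measurable_integrable[OF g] by simp
 define \<omega> where "\<omega> = (\<lambda>s. pos s * (s powr (r / 2 - 1) * exp (- s)) :: real)"
 have \<omega>0: "\<omega> s \<ge> 0" for s by (simp add: \<omega>_def)
 have [measurable]: "\<omega> \<in> BM borel" unfolding \<omega>_def by measurable
 have \<omega>1: "\<omega> s = 0" if "s \<le> 0" for s using that by (simp add: \<omega>_def)
 have \<omega>G: "(NN s. ennreal (\<omega> s)) = ennreal (Gamma (r / 2))"
  using nn_integral_Gamma_half_line[of "r / 2"] r by (simp add: \<omega>_def)
 have gfin: "(NN y. ennreal \<bar>g y\<bar>) < \<infinity>" using g by (simp add: integrable_iff_bounded)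
 have nn: "(NN s. NN z. NN y. ennreal (\<omega> s * Gk s (z - y) * \<bar>g y\<bar>)) < \<infinity>"
 proof -
  have "(NN z. NN y. ennreal (\<omega> s * Gk s (z - y) * \<bar>g y\<bar>)) = ennreal (\<omega> s) * (NN y. ennreal \<bar>g y\<bar>)" for s
  proof (cases "s > 0")
   case True
   have "(NN z. NN y. ennreal (\<omega> s * Gk s (z - y) * \<bar>g y\<bar>))
    = (NN y. NN z. ennreal (\<omega> s * Gk s (z - y) * \<bar>g y\<bar>))"
    by (rule lborel_pair.Fubini') measurable
   also have "\<dots> = (NN y. ennreal (\<omega> s) * ennreal \<bar>g y\<bar>)"
    using True \<omega>0 by (intro nn_integral_cong)
     (simp add: ennreal_mult heat_kernel_nonneg nn_integral_multc nn_integral_cmult nn_integral_heat_kernel)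
   finally show ?thesis by (simp add: nn_integral_cmult)
  qed (simp add: \<omega>1)
  then show ?thesis using gfin by (simp add: nn_integral_multc \<omega>G ennreal_mult_less_top)
 qed
 define J where "J = (\<lambda>z. LBINT s. \<omega> s * Ht s g z)"
 have int: "integrable lb2 (\<lambda>(s, z). \<omega> s * Ht s g z)"
 proof (rule integrableI_bounded)
  show [measurable]: "(\<lambda>(s, z). \<omega> s * Ht s g z) \<in> BM lb2"
   using hk_conv_measurable[OF hk_base, of fst "lborel \<Otimes>\<^sub>M lborel" snd g] by (simp add: case_prod_unfold)
  have "(\<integral>\<^sup>+p. ennreal (norm (case p of (s, z) \<Rightarrow> \<omega> s * Ht s g z)) \<partial>lb2)
   = (NN s. NN z. ennreal \<bar>\<omega> s * Ht s g z\<bar>)"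
   by (subst lborel.nn_integral_fst[symmetric]) auto
  also have "\<dots> \<le> (NN s. NN z. NN y. ennreal (\<omega> s * Gk s (z - y) * \<bar>g y\<bar>))"
  proof (intro nn_integral_mono)
   fix s and z
   show "ennreal \<bar>\<omega> s * Ht s g z\<bar> \<le> (NN y. ennreal (\<omega> s * Gk s (z - y) * \<bar>g y\<bar>))"
   proof (cases "s > 0")
    case True
    have "Li (\<lambda>y. \<omega> s * (Gk s (z - y) * g y))"
     using conv_integrable[OF gbound_heat_kernel[OF True] gint_integrable[OF g], of z] by simp
    from integral_norm_bound_ennreal[OF this] show ?thesis
     by (simp add: conv_def abs_mult \<omega>0 heat_kernel_nonneg mult.assoc)
   qed (simp add: \<omega>1)
  qed
  finally show "(\<integral>\<^sup>+p. ennreal (norm (case p of (s, z) \<Rightarrow> \<omega> s * Ht s g z)) \<partial>lb2) < \<infinity>"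
   using nn by simp
 qed
 have Ji: "Li J" using lborel_pair.integrable_snd[OF int] by (simp add: J_def)
 have nn': "(NN z. NN s. NN y. ennreal (\<omega> s * Gk s (z - y) * \<bar>g y\<bar>)) < \<infinity>"
  using nn by (subst lborel_pair.Fubini') measurable
 \<comment> \<open>Tonelli gives finiteness of the inner integral, and hence the exchange of
   integrations, only for almost every z. This is enough because the identity is used under
   \<open>Ht t\<close>.\<close>
 have "AE z in lborel. (NN s. NN y. ennreal (\<omega> s * Gk s (z - y) * \<bar>g y\<bar>)) \<noteq> \<infinity>"
  by (rule nn_integral_PInf_AE) (use nn' in auto)
 then have ae: "AE z in lborel. conv (bessel_kernel r) g z = J z / Gamma (r / 2)"
 proof eventually_elim
  case (elim z)
  have i: "integrable lb2 (\<lambda>(s, y). \<omega> s * Gk s (z - y) * g y)"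
  proof (rule integrableI_bounded)
   have "(\<integral>\<^sup>+p. ennreal (norm (case p of (s, y) \<Rightarrow> \<omega> s * Gk s (z - y) * g y)) \<partial>lb2)
    = (NN s. NN y. ennreal (\<omega> s * Gk s (z - y) * \<bar>g y\<bar>))"
    by (subst lborel.nn_integral_fst[symmetric]) (auto simp: abs_mult \<omega>0 heat_kernel_nonneg)
   then show "(\<integral>\<^sup>+p. ennreal (norm (case p of (s, y) \<Rightarrow> \<omega> s * Gk s (z - y) * g y)) \<partial>lb2) < \<infinity>"
    using elim by (simp add: less_top)
  qed measurable
  have "conv (bessel_kernel r) g z = (LBINT y. (LBINT s. \<omega> s * Gk s (z - y) * g y) / Gamma (r / 2))"
  proof -
   have "bessel_kernel r x = (LBINT s. \<omega> s * Gk s x) / Gamma (r / 2)" for x :: "real ^ 'n"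
    unfolding bessel_kernel_eq by (simp add: \<omega>_def mult.assoc)
   then show ?thesis unfolding conv_def by simp
  qed
  also have "\<dots> = (LBINT y. LBINT s. \<omega> s * Gk s (z - y) * g y) / Gamma (r / 2)"
   by simp
  also have "(LBINT y. LBINT s. \<omega> s * Gk s (z - y) * g y) = (LBINT s. LBINT y. \<omega> s * Gk s (z - y) * g y)"
   by (rule lborel_pair.Fubini_integral[OF i])
  also have "\<dots> = J z" by (simp add: J_def conv_def mult.assoc)
  finally show ?case .
 qed
 have [measurable]: "J \<in> BM borel" using borel_measurable_integrable[OF Ji] by simp
 show "Li (conv (bessel_kernel r) g)"
  using ae Ji by (subst integrable_cong_AE[of _ _ "\<lambda>z. J z / Gamma (r / 2)"]) auto
 fix t :: real and x assume t: "t > 0"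
 have c: "Ht t (\<lambda>z. \<omega> s * Ht s g z) x = pos s * (s powr (r / 2 - 1) * exp (- s) * Ht (s + t) g x)" for s
  unfolding conv_cmult using conv_heat_semigroup[OF t, of s g x] gint_integrable[OF g] by (auto simp: indicator_def \<omega>_def add.commute)
 show "Li (\<lambda>s. pos s * (s powr (r / 2 - 1) * exp (- s) * Ht (s + t) g x))"
  using conv_integral(1)[OF int gbound_heat_kernel[OF t], of x] by (simp only: c)
 have "Ht t (conv (bessel_kernel r) g) x = Ht t (\<lambda>z. (1 / Gamma (r / 2)) * J z) x"
  unfolding conv_def using ae by (intro integral_cong_AE) (auto simp: conv_def[symmetric])
 also have "\<dots> = (LBINT s. pos s * (s powr (r / 2 - 1) * exp (- s) * Ht (s + t) g x)) / Gamma (r / 2)"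
  unfolding conv_cmult[of _ "1 / Gamma (r / 2)"] J_def conv_integral(2)[OF int gbound_heat_kernel[OF t]] by (simp only: c) simp
 finally show "Ht t (conv (bessel_kernel r) g) x = (LBINT s. pos s * (s powr (r / 2 - 1) * exp (- s) * Ht (s + t) g x)) / Gamma (r / 2)" .
qed

lemma conv_heat_bounded:
 fixes f :: "real ^ 'n \<Rightarrow> real"
 assumes f: "Li f" and t: "0 < t" "t \<le> s"
 shows "\<bar>Ht s f x\<bar> \<le> (4 * pi * t) powr (- (real CARD('n) / 2)) * (LBINT y. \<bar>f y\<bar>)"
proof -
 have b: "Gk s z \<le> (4 * pi * t) powr (- (real CARD('n) / 2))" for z :: "real ^ 'n"
 proof -
  have "Gk s z \<le> (4 * pi * s) powr (- (real CARD('n) / 2))"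
   using t by (simp add: heat_kernel_def mult_left_le)
  also have "\<dots> \<le> (4 * pi * t) powr (- (real CARD('n) / 2))" using t by (intro powr_mono2') auto
  finally show ?thesis .
 qed
 have "\<bar>Ht s f x\<bar> \<le> (LBINT y. \<bar>Gk s (x - y) * f y\<bar>)"
  unfolding conv_def by (rule integral_abs_bound)
 also have "\<dots> \<le> (LBINT y. (4 * pi * t) powr (- (real CARD('n) / 2)) * \<bar>f y\<bar>)"
 proof (rule integral_mono)
  show "Li (\<lambda>y. \<bar>Gk s (x - y) * f y\<bar>)"
   using t by (intro integrable_abs conv_integrable gbound_heat_kernel gint_integrable f) auto
  show "Li (\<lambda>y. (4 * pi * t) powr (- (real CARD('n) / 2)) * \<bar>f y\<bar>)" using f by simp
  show "\<bar>Gk s (x - y) * f y\<bar> \<le> (4 * pi * t) powr (- (real CARD('n) / 2)) * \<bar>f y\<bar>" for y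
   using b[of "x - y"] by (simp add: abs_mult heat_kernel_nonneg mult_right_mono)
 qed
 finally show ?thesis by simp
qed

lemma integrable_exp_half_line: "Li (\<lambda>s :: real. pos s * exp (- s))"
proof -
 have "(NN s. ennreal (pos s * (s powr (1 - 1) * exp (- s)))) = ennreal (Gamma 1)"
  by (rule nn_integral_Gamma_half_line) simp
 moreover have "(NN s. ennreal (pos s * (s powr (1 - 1) * exp (- s)))) = (NN s. ennreal (norm (pos s * exp (- s) :: real)))"
  by (intro nn_integral_cong) (auto simp: indicator_def)
 ultimately have "(NN s. ennreal (norm (pos s * exp (- s) :: real))) < \<infinity>" by simp
 then show ?thesis by (intro integrableI_bounded) auto
qed

lemma integrable_exp_conv_heat:
 fixes f :: "real ^ 'n \<Rightarrow> real"
 assumes f: "Li f" and t: "t > 0"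
 shows "Li (\<lambda>s. pos s * (exp (- s) * Ht (s + t) f x))"
proof -
 have [measurable]: "f \<in> BM borel" using borel_measurable_integrable[OF f] by simp
 have [measurable]: "(\<lambda>s. Ht (s + t) f x) \<in> BM borel"
  by (rule hk_conv_measurable[OF hk_base]) measurable
 define C where "C = (4 * pi * t) powr (- (real CARD('n) / 2)) * (LBINT y. \<bar>f y\<bar>)"
 show ?thesis
 proof (rule Bochner_Integration.integrable_bound)
  show "Li (\<lambda>s. C * (pos s * exp (- s)))"
   by (intro integrable_mult_right integrable_exp_half_line)
  show "AE s in lborel. norm (pos s * (exp (- s) * Ht (s + t) f x)) \<le> norm (C * (pos s * exp (- s)))"
  proof (rule AE_I2)
   fix s
   show "norm (pos s * (exp (- s) * Ht (s + t) f x)) \<le> norm (C * (pos s * exp (- s)))"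
   proof (cases "s > 0")
    case True
    then have "\<bar>Ht (s + t) f x\<bar> \<le> C"
     unfolding C_def using t by (intro conv_heat_bounded f) auto
    then show ?thesis using True by (simp add: abs_mult mult.commute[of C] mult_left_mono)
   qed simp
  qed
 qed measurable
qed

text \<open>The difference of two tail integrals is the integral over an interval, so a primitive of
  \<phi> is locally constant and its derivative vanishes.\<close>

lemma continuous_eq_0_if_integral_0:
 fixes \<phi> :: "real \<Rightarrow> real"
 assumes c: "continuous_on {0<..} \<phi>" and i: "\<And>t. t > 0 \<Longrightarrow> Li (\<lambda>s. indicator {t<..} s * \<phi> s)"
  and z: "\<And>t. t > 0 \<Longrightarrow> (LBINT s. indicator {t<..} s * \<phi> s) = 0" and t: "t > 0"
 shows "\<phi> t = 0"
proof -
 have c': "continuous_on {t / 2..2 * t} \<phi>" using c by (rule continuous_on_subset) (use t in auto)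
 have z': "integral {t / 2..x} \<phi> = 0" if x: "x \<in> {t / 2..2 * t}" for x
 proof -
  have "(LBINT s. indicator {t / 2..x} s * \<phi> s) = (LBINT s. indicator {t / 2<..} s * \<phi> s - indicator {x<..} s * \<phi> s)"
  proof (rule integral_cong_AE)
   show "(\<lambda>s. indicator {t / 2..x} s * \<phi> s) \<in> BM lborel"
    using borel_measurable_continuous_on_indicator[of "{t / 2..x}" \<phi>] continuous_on_subset[OF c', of "{t / 2..x}"] x by auto
   show "(\<lambda>s. indicator {t / 2<..} s * \<phi> s - indicator {x<..} s * \<phi> s) \<in> BM lborel"
    using i[of "t / 2"] i[of x] x t by (intro borel_measurable_diff borel_measurable_integrable) auto
   show "AE s in lborel. indicator {t / 2..x} s * \<phi> s = indicator {t / 2<..} s * \<phi> s - indicator {x<..} s * \<phi> s"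
    using AE_lborel_singleton[of "t / 2"] by eventually_elim (use x in "auto simp: indicator_def")
  qed
  also have "\<dots> = 0" using i[of "t / 2"] i[of x] z[of "t / 2"] z[of x] x t by simp
  finally have "(LINT s:{t / 2..x}|lborel. \<phi> s) = 0" by (simp add: set_lebesgue_integral_def)
  moreover have "set_integrable lborel {t / 2..x} \<phi>"
   by (rule borel_integrable_atLeastAtMost') (rule continuous_on_subset[OF c'], use x in auto)
  ultimately show ?thesis by (simp add: set_borel_integral_eq_integral(2))
 qed
 have "((\<lambda>x. integral {t / 2..x} \<phi>) has_real_derivative \<phi> t) (at t within {t / 2..2 * t})"
  by (rule integral_has_real_derivative[OF c']) (use t in auto)
 then have "((\<lambda>x. integral {t / 2..x} \<phi>) has_real_derivative \<phi> t) (at t)"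
  using t by (simp add: at_within_Icc_at)
 moreover have "eventually (\<lambda>x. integral {t / 2..x} \<phi> = 0) (nhds t)"
  using eventually_nhds_in_open[of "{t / 2<..<2 * t}" t] t by (auto elim!: eventually_mono intro!: z')
 ultimately have "((\<lambda>x. 0) has_real_derivative \<phi> t) (at t)"
  by (subst (asm) DERIV_cong_ev[OF refl _ refl])
 from DERIV_unique[OF this DERIV_const] show ?thesis .
qed

text \<open>Under \<open>Ht t\<close> the hypothesis says that the fractional integral of order a =
  r/2 of \<open>exp (- s) * Ht (s + t) d x\<close> is 0 for every t. A further fractional
  integration of order 1 - a turns it into a vanishing tail integral of a continuous function; that
  function is therefore 0, and \<open>heat_injective\<close> finishes.\<close>

lemma bessel_injective:
 fixes d :: "real ^ 'n \<Rightarrow> real"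
 assumes d: "Li d" and r: "0 < r" "r < 2" and z: "AE x in lborel. conv (bessel_kernel r) d x = 0"
 shows "AE x in lborel. d x = 0"
proof (rule heat_injective[OF gint_integrable[OF d]])
 define a where "a = r / 2"
 have a: "0 < a" "a < 1" using r by (auto simp: a_def)
 have G: "Gamma a > 0" "Gamma (1 - a) > 0" using a by auto
 fix t :: real and x :: "real ^ 'n" assume t: "t > 0"
 have Ji: "Li (conv (bessel_kernel r) d)" by (rule bessel_conv(1)[OF d r(1)])
 have A: "(LBINT s. pos s * (s powr (a - 1) * exp (- s) * Ht (s + t) d x)) = 0" if t: "t > 0" for t
 proof -
  have [measurable]: "conv (bessel_kernel r) d \<in> BM borel"
   using borel_measurable_integrable[OF Ji] by simp
  have "Ht t (conv (bessel_kernel r) d) x = (LINT y|(lborel :: (real ^ 'n) measure). 0)"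
   unfolding conv_def[of "Gk t"] using z by (intro integral_cong_AE) auto
  then show ?thesis using bessel_conv(2)[OF d r(1) t, of x] G by (simp add: a_def)
 qed
 have E: "(LBINT s. pos s * (exp (- s) * Ht (s + t) d x)) = 0" if t: "t > 0" for t
 proof -
  define h where "h = (\<lambda>s. exp (- s) * Ht (s + t) d x)"
  have hi: "Li (\<lambda>s. pos s * h s)"
   unfolding h_def by (rule integrable_exp_conv_heat[OF d t])
  \<comment> \<open>The roles of a and 1 - a are exchanged: the inner weight \<sigma>^(a-1) is now
    that of the Bessel potential, so the inner integral is 0 by \<open>A\<close>.\<close>
  have "Gamma (1 - a) * Gamma (1 - (1 - a)) * (LBINT s. pos s * h s) =
   (LBINT s. pos s * (s powr ((1 - a) - 1) * (LBINT sg. pos sg * (sg powr (- (1 - a)) * h (sg + s)))))"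
   by (rule Beta_convolution[symmetric]) (use a hi in auto)
  also have "\<dots> = (LINT s|(lborel :: real measure). 0)"
  proof (rule Bochner_Integration.integral_cong[OF refl])
   fix s :: real
   show "pos s * (s powr ((1 - a) - 1) * (LBINT sg. pos sg * (sg powr (- (1 - a)) * h (sg + s)))) = 0"
   proof (cases "s > 0")
    case True
    have "(\<lambda>sg. pos sg * (sg powr (- (1 - a)) * h (sg + s))) =
     (\<lambda>sg. exp (- s) * (pos sg * (sg powr (a - 1) * exp (- sg) * conv (Gk (sg + (s + t))) d x)))"
    proof (rule ext)
     fix sg
     have "exp (- (sg + s)) = exp (- s) * exp (- sg)" by (simp add: exp_add[symmetric])
     then show "pos sg * (sg powr (- (1 - a)) * h (sg + s)) = exp (- s) * (pos sg * (sg powr (a - 1) * exp (- sg) * conv (Gk (sg + (s + t))) d x))"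
      by (simp add: h_def add.assoc mult_ac)
    qed
    then have "(LBINT sg. pos sg * (sg powr (- (1 - a)) * h (sg + s))) = 0"
     using A[of "s + t"] True t by simp
    then show ?thesis by simp
   qed simp
  qed
  finally show ?thesis using G by (simp add: h_def)
 qed
 define \<phi> where "\<phi> = (\<lambda>s. exp (- s) * Ht s d x)"
 have e: "(\<lambda>s. pos s * \<phi> (s + t)) = (\<lambda>s. exp (- t) * (pos s * (exp (- s) * Ht (s + t) d x)))" for t
 proof (rule ext)
  fix s
  have "exp (- (s + t)) = exp (- t) * exp (- s)" by (simp add: exp_add[symmetric])
  then show "pos s * \<phi> (s + t) = exp (- t) * (pos s * (exp (- s) * Ht (s + t) d x))"
   unfolding \<phi>_def by (simp add: mult_ac)
 qed
 have "\<phi> t = 0"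
 proof (rule continuous_eq_0_if_integral_0[OF _ _ _ t])
  show "continuous_on {0<..} \<phi>"
   unfolding \<phi>_def by (intro continuous_intros hk_conv_continuous[OF hk_base gint_integrable[OF d]])
  show "Li (\<lambda>s. indicator {t<..} s * \<phi> s)" if "t > 0" for t
   unfolding integrable_half_line_shift(1)[of \<phi> t, symmetric] e
   by (intro integrable_mult_right integrable_exp_conv_heat d that)
  show "(LBINT s. indicator {t<..} s * \<phi> s) = 0" if "t > 0" for t
   unfolding integrable_half_line_shift(2)[of \<phi> t, symmetric] e using E[OF that] by simp
 qed
 then show "Ht t d x = 0" by (simp add: \<phi>_def)
qed

section \<open>The inverse Bessel potential in L^1\<close>

lemma pair_norm_bound:
 fixes w :: "real \<Rightarrow> real ^ 'n \<Rightarrow> real"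
 assumes [measurable]: "(\<lambda>(s, z). w s z) \<in> BM lb2"
  and w: "(NN s. NN z. ennreal \<bar>w s z\<bar>) \<le> ennreal A" and A: "A \<ge> 0"
 shows "integrable lb2 (\<lambda>(s, z). w s z)"
  and "(LINT p|lb2. \<bar>case p of (s, z) \<Rightarrow> w s z\<bar>) \<le> A"
  and "(LBINT z. \<bar>LBINT s. w s z\<bar>) \<le> A"
proof -
 have n: "(\<integral>\<^sup>+p. ennreal \<bar>case p of (s, z) \<Rightarrow> w s z\<bar> \<partial>lb2) \<le> ennreal A"
  using w by (subst lborel.nn_integral_fst[symmetric]) auto
 show i: "integrable lb2 (\<lambda>(s, z). w s z)"
 proof (rule integrableI_bounded)
  show "(\<integral>\<^sup>+p. ennreal (norm (case p of (s, z) \<Rightarrow> w s z)) \<partial>lb2) < \<infinity>"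
   using order.strict_trans1[OF n, of \<infinity>] by simp
 qed measurable
 have "ennreal (LINT p|lb2. \<bar>case p of (s, z) \<Rightarrow> w s z\<bar>) \<le> ennreal A"
  using n by (subst nn_integral_eq_integral[symmetric]) (auto intro: integrable_abs[OF i])
 then show b: "(LINT p|lb2. \<bar>case p of (s, z) \<Rightarrow> w s z\<bar>) \<le> A" using A by simp
 have i': "integrable lb2 (\<lambda>(s, z). \<bar>w s z\<bar>)"
  using integrable_abs[OF i] by (simp add: case_prod_unfold)
 have "(LBINT z. \<bar>LBINT s. w s z\<bar>) \<le> (LBINT z. LBINT s. \<bar>w s z\<bar>)"
 proof (rule integral_mono)
  show "Li (\<lambda>z. \<bar>LBINT s. w s z\<bar>)" by (intro integrable_abs lborel_pair.integrable_snd[OF i])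
  show "Li (\<lambda>z. LBINT s. \<bar>w s z\<bar>)" by (rule lborel_pair.integrable_snd[OF i'])
 qed (rule integral_abs_bound)
 also have "\<dots> = (LINT p|lb2. \<bar>case p of (s, z) \<Rightarrow> w s z\<bar>)"
  using lborel_pair.integral_snd[OF i'] by (simp add: case_prod_unfold)
 finally show "(LBINT z. \<bar>LBINT s. w s z\<bar>) \<le> A" using b by simp
qed

text \<open>\<open>d\<close> is the profile in time of the L^1 norm of the Laplacian of the flow,
  \<open>B\<close> its amplitude, and \<open>K\<close> bounds its integral both with and without the
  weight. In the constant, 1 stems from the part with \<open>Ht\<close>, whose factor
  \<open>Gamma (1 - r / 2)\<close> cancels the normalization and which costs the norm of f;
  \<open>1 / Gamma (1 - r / 2)\<close> stems from the part with \<open>Ht'\<close>.\<close>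

lemma bessel_estimate:
 fixes f :: "real ^ 'n \<Rightarrow> real" and d :: "real \<Rightarrow> real"
 assumes f: "gint f" and lim: "\<And>x. ((\<lambda>s. Ht s f x) \<longlongrightarrow> 0) at_top"
  and r: "0 \<le> r" "r < 2" and B: "B \<ge> 0" "K \<ge> 0"
  and d: "\<And>s. s > 0 \<Longrightarrow> (NN z. ennreal \<bar>Ht' s f z\<bar>) \<le> ennreal (B * d s)"
  and d0: "\<And>s. d s \<ge> 0" and [measurable]: "d \<in> BM borel"
  and K: "(NN s. ennreal (pos s * d s)) \<le> ennreal K"
   "(NN s. ennreal (pos s * (s powr (- (r / 2)) * d s))) \<le> ennreal K"
 shows "Li f \<and> (\<exists>g. Li g \<and> (AE x in lborel. f x = bessel_potential r g x) \<and>
  (LBINT x. \<bar>g x\<bar>) \<le> (1 + 1 / Gamma (1 - r / 2)) * (B * K))"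
proof -
 have [measurable]: "f \<in> BM borel" using f by (rule gint_measurable)
 define a where "a = r / 2"
 have a: "0 \<le> a" "a < 1" using r by (auto simp: a_def)
 have G: "Gamma (1 - a) > 0" using a by auto
 have wt: "(NN s. NN z. ennreal \<bar>pos s * (\<omega> s * Ht' s f z)\<bar>) \<le> ennreal (B * K)"
  if [measurable]: "\<omega> \<in> BM borel" and \<omega>: "\<And>s. \<omega> s \<ge> 0" "(NN s. ennreal (pos s * (\<omega> s * d s))) \<le> ennreal K" for \<omega>
 proof -
  have "(NN z. ennreal \<bar>pos s * (\<omega> s * Ht' s f z)\<bar>) \<le> ennreal B * ennreal (pos s * (\<omega> s * d s))" for s
  proof (cases "s > 0")
   case True
   have [measurable]: "Ht' s f \<in> BM borel"
    using gbound_measurable[OF gbound_heat_kernel'[OF True]] by measurable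
   have "(NN z. ennreal \<bar>pos s * (\<omega> s * Ht' s f z)\<bar>) = ennreal (\<omega> s) * (NN z. ennreal \<bar>Ht' s f z\<bar>)"
    using True \<omega>(1) by (simp add: abs_mult ennreal_mult nn_integral_cmult)
   also have "\<dots> \<le> ennreal (\<omega> s) * ennreal (B * d s)" by (intro mult_left_mono d True) auto
   also have "\<dots> = ennreal B * ennreal (pos s * (\<omega> s * d s))"
    using True B \<omega>(1) d0 by (simp add: ennreal_mult[symmetric] mult_ac)
   finally show ?thesis .
  qed simp
  then have "(NN s. NN z. ennreal \<bar>pos s * (\<omega> s * Ht' s f z)\<bar>) \<le> (NN s. ennreal B * ennreal (pos s * (\<omega> s * d s)))"
   by (intro nn_integral_mono) auto
  also have "\<dots> = ennreal B * (NN s. ennreal (pos s * (\<omega> s * d s)))"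
   by (rule nn_integral_cmult) measurable
  also have "\<dots> \<le> ennreal B * ennreal K" by (intro mult_left_mono \<omega>) auto
  finally show ?thesis using B by (simp add: ennreal_mult)
 qed
 have meas [measurable]: "(\<lambda>(s, z). Ht' s f z) \<in> BM lb2"
  "(\<lambda>(s, z). Ht s f z) \<in> BM lb2"
  using hk_conv_measurable[OF hk_heat_kernel', of fst "lborel \<Otimes>\<^sub>M lborel" snd f]
   hk_conv_measurable[OF hk_base, of fst "lborel \<Otimes>\<^sub>M lborel" snd f] by (simp_all add: case_prod_unfold)
 have BK: "B * K \<ge> 0" using B by simp
 have m0: "(\<lambda>(s, z). pos s * Ht' s f z) \<in> BM lb2" by measurable
 note int0 = pair_norm_bound[OF m0 _ BK]
 have n0: "(NN s. NN z. ennreal \<bar>pos s * Ht' s f z\<bar>) \<le> ennreal (B * K)"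
  using wt[of "\<lambda>_. 1"] K by simp
 note rep = heat_representation[OF f lim int0(1)[OF n0]]
 have fK: "(LBINT x. \<bar>f x\<bar>) \<le> B * K" using rep(3) int0(2)[OF n0] by simp
 have fi: "Li f" by (rule rep(2))
 have "\<exists>g. Li g \<and> (AE x in lborel. f x = bessel_potential r g x) \<and>
  (LBINT x. \<bar>g x\<bar>) \<le> (1 + 1 / Gamma (1 - a)) * (B * K)"
 proof (cases "r = 0")
  case True
  have "(LBINT x. \<bar>f x\<bar>) \<le> (1 + 1 / Gamma (1 - a)) * (B * K)"
   using fK BK G by (auto intro: order.trans simp: algebra_simps)
  then show ?thesis using True fi by (intro exI[of _ f]) (auto simp: bessel_potential_def)
 next
  case False
  then have a0: "a > 0" and r0: "r > 0" using r by (auto simp: a_def)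
  define w1 where "w1 = (\<lambda>s z. pos s * (s powr (- a) * exp (- s) * Ht s f z))"
  define w2 where "w2 = (\<lambda>s z. pos s * (s powr (- a) * exp (- s) * Ht' s f z))"
  have [measurable]: "(\<lambda>(s, z). w1 s z) \<in> BM lb2" "(\<lambda>(s, z). w2 s z) \<in> BM lb2"
   unfolding w1_def w2_def by measurable
  have n1: "(NN s. NN z. ennreal \<bar>w1 s z\<bar>) \<le> ennreal (Gamma (1 - a) * (B * K))"
  proof -
   have fn: "(NN x. ennreal \<bar>f x\<bar>) \<le> ennreal (B * K)"
    using fK fi by (subst nn_integral_eq_integral) (auto intro: ennreal_leI)
   have "(NN z. ennreal \<bar>w1 s z\<bar>) \<le> ennreal (pos s * (s powr ((1 - a) - 1) * exp (- s))) * ennreal (B * K)" for s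
   proof (cases "s > 0")
    case True
    have [measurable]: "Ht s f \<in> BM borel" by measurable
    have "(NN z. ennreal \<bar>w1 s z\<bar>) = ennreal (s powr (- a) * exp (- s)) * (NN z. ennreal \<bar>Ht s f z\<bar>)"
     using True by (simp add: w1_def abs_mult ennreal_mult nn_integral_cmult)
    also have "\<dots> \<le> ennreal (s powr (- a) * exp (- s)) * ennreal (B * K)"
     by (intro mult_left_mono order.trans[OF nn_integral_conv_heat fn] True) auto
    finally show ?thesis using True by simp
   qed (simp add: w1_def)
   then have "(NN s. NN z. ennreal \<bar>w1 s z\<bar>) \<le> (NN s. ennreal (pos s * (s powr ((1 - a) - 1) * exp (- s))) * ennreal (B * K))"
    by (intro nn_integral_mono) auto
   also have "\<dots> = ennreal (Gamma (1 - a)) * ennreal (B * K)"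
    using nn_integral_Gamma_half_line[of "1 - a"] a by (subst nn_integral_multc) auto
   finally show ?thesis using G BK by (simp add: ennreal_mult)
  qed
  have n2: "(NN s. NN z. ennreal \<bar>w2 s z\<bar>) \<le> ennreal (B * K)"
   unfolding w2_def
  proof (rule wt)
   \<comment> \<open>Here the exponential is merely estimated by 1, since \<open>d\<close> provides
     the decay; in \<open>w1\<close> the exponential is the only source of decay.\<close>
   have "(NN s. ennreal (pos s * (s powr (- a) * exp (- s) * d s))) \<le> (NN s. ennreal (pos s * (s powr (- (r / 2)) * d s)))"
    by (intro nn_integral_mono ennreal_leI) (auto simp: indicator_def a_def d0 mult.assoc intro!: mult_left_mono mult_left_le_one_le)
   then show "(NN s. ennreal (pos s * (s powr (- a) * exp (- s) * d s))) \<le> ennreal K" using K(2) by simp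
  qed auto
  define w where "w = (\<lambda>s z. w1 s z - w2 s z)"
  have [measurable]: "(\<lambda>(s, z). w s z) \<in> BM lb2" unfolding w_def by measurable
  have w_alt: "w s = (\<lambda>z. (pos s * (s powr (- a) * exp (- s))) * (Ht s f z - Ht' s f z))" for s
   by (auto simp: w_def w1_def w2_def algebra_simps)
  have nw: "(NN s. NN z. ennreal \<bar>w s z\<bar>) \<le> ennreal (Gamma (1 - a) * (B * K) + B * K)"
  proof -
   have "(NN s. NN z. ennreal \<bar>w s z\<bar>) \<le> (NN s. NN z. ennreal \<bar>w1 s z\<bar> + ennreal \<bar>w2 s z\<bar>)"
    by (intro nn_integral_mono) (auto simp: w_def ennreal_plus[symmetric] intro!: ennreal_leI simp del: ennreal_plus)
   also have "\<dots> = (NN s. NN z. ennreal \<bar>w1 s z\<bar>) + (NN s. NN z. ennreal \<bar>w2 s z\<bar>)"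
    by (simp add: nn_integral_add)
   also have "\<dots> \<le> ennreal (Gamma (1 - a) * (B * K)) + ennreal (B * K)" by (intro add_mono n1 n2)
   finally show ?thesis using G BK by (simp add: ennreal_plus)
  qed
  have A0: "Gamma (1 - a) * (B * K) + B * K \<ge> 0" using G BK by simp
  note W = pair_norm_bound[of w, OF _ nw A0]
  have wi: "integrable lb2 (\<lambda>(s, z). w s z)" by (rule W(1)) measurable
  define g where "g = (\<lambda>z. (1 / Gamma (1 - a)) * (LBINT s. w s z))"
  have gi: "Li g"
   unfolding g_def using lborel_pair.integrable_snd[OF wi] by (rule integrable_mult_right)
  have gn: "(LBINT x. \<bar>g x\<bar>) \<le> (1 + 1 / Gamma (1 - a)) * (B * K)"
  proof -
   have "(LBINT x. \<bar>g x\<bar>) = (1 / Gamma (1 - a)) * (LBINT z. \<bar>LBINT s. w s z\<bar>)"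
    using G by (simp add: g_def abs_mult)
   also have "\<dots> \<le> (1 / Gamma (1 - a)) * (Gamma (1 - a) * (B * K) + B * K)"
    using G by (intro mult_left_mono W(3)) auto
   also have "\<dots> = (1 + 1 / Gamma (1 - a)) * (B * K)" using G by (simp add: field_simps)
   finally show ?thesis .
  qed
  define H where "H = (\<lambda>x s. Ht s f x - Ht' s f x)"
  have g_heat: "Ht t g x = (1 / Gamma (1 - a)) * (LBINT s. pos s * (s powr (- a) * exp (- s) * H x (s + t)))" if t: "t > 0" for t x
  proof -
   have "Ht t (w s) x = pos s * (s powr (- a) * exp (- s) * H x (s + t))" for s
   proof (cases "s > 0")
    case True
    have i: "Li (\<lambda>y. Gk t (x - y) * Ht s f y)" "Li (\<lambda>y. Gk t (x - y) * Ht' s f y)"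
     using t True f by (auto intro!: conv_integrable gbound_heat_kernel gint_conv gbound_heat_kernel')
    have "Ht t (\<lambda>z. Ht s f z - Ht' s f z) x
     = Ht t (Ht s f) x - Ht t (Ht' s f) x"
     using i by (simp add: conv_def[of "Gk t"] right_diff_distrib)
    then show ?thesis unfolding w_alt conv_cmult H_def
     using True t f by (simp add: conv_heat_semigroup conv_heat_heat' add.commute)
   qed (simp add: w_alt conv_def)
   then show ?thesis unfolding g_def conv_cmult conv_integral(2)[OF wi gbound_heat_kernel[OF t]] by simp
  qed
  have "AE x in lborel. 1 * f x + (- 1) * conv (bessel_kernel r) g x = 0"
  proof (rule heat_injective)
   have Ji: "Li (conv (bessel_kernel r) g)" by (rule bessel_conv(1)[OF gi r0])
   show "gint (\<lambda>x. 1 * f x + (- 1) * conv (bessel_kernel r) g x)" by (intro gint_lin f gint_integrable Ji)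
   fix t :: real and x :: "real ^ 'n" assume t: "t > 0"
   \<comment> \<open>With this h the two nested fractional integrals in the potential of g compose
     by \<open>Beta_convolution\<close> to the plain integral of h.\<close>
   define h where "h = (\<lambda>s. exp (- s) * H x (s + t))"
   have hi: "Li (\<lambda>s. pos s * h s)"
   proof -
    have "Li (\<lambda>s. pos s * (exp (- s) * Ht' (s + t) f x))"
    proof (rule Bochner_Integration.integrable_bound[OF rep(4)[OF t, of x]])
     have [measurable]: "(\<lambda>s. Ht' (s + t) f x) \<in> BM borel"
      by (rule hk_conv_measurable[OF hk_heat_kernel']) measurable
     show "(\<lambda>s. pos s * (exp (- s) * Ht' (s + t) f x)) \<in> BM lborel" by measurable
     show "AE s in lborel. norm (pos s * (exp (- s) * Ht' (s + t) f x)) \<le> norm (pos s * Ht' (s + t) f x)"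
      by (intro AE_I2) (auto simp: indicator_def abs_mult mult_left_le_one_le)
    qed
    from Bochner_Integration.integrable_diff[OF integrable_exp_conv_heat[OF fi t, of x] this]
    show ?thesis by (simp add: h_def H_def algebra_simps)
   qed
   have "Ht t (conv (bessel_kernel r) g) x
    = (LBINT s. pos s * (s powr (a - 1) * exp (- s) * Ht (s + t) g x)) / Gamma a"
    using bessel_conv(2)[OF gi r0 t] by (simp add: a_def)
   also have "(LBINT s. pos s * (s powr (a - 1) * exp (- s) * Ht (s + t) g x))
    = (LBINT s. (1 / Gamma (1 - a)) * (pos s * (s powr (a - 1) * (LBINT sg. pos sg * (sg powr (- a) * h (sg + s))))))"
   proof (rule Bochner_Integration.integral_cong[OF refl])
    fix s :: real
    show "pos s * (s powr (a - 1) * exp (- s) * Ht (s + t) g x)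
     = (1 / Gamma (1 - a)) * (pos s * (s powr (a - 1) * (LBINT sg. pos sg * (sg powr (- a) * h (sg + s)))))"
    proof (cases "s > 0")
     case True
     have "(\<lambda>sg. pos sg * (sg powr (- a) * h (sg + s))) = (\<lambda>sg. exp (- s) * (pos sg * (sg powr (- a) * exp (- sg) * H x (sg + (s + t)))))"
     proof (rule ext)
      fix sg
      have "exp (- (sg + s)) = exp (- s) * exp (- sg)" by (simp add: exp_add[symmetric])
      then show "pos sg * (sg powr (- a) * h (sg + s)) = exp (- s) * (pos sg * (sg powr (- a) * exp (- sg) * H x (sg + (s + t))))"
       by (simp add: h_def add.assoc mult_ac)
     qed
     then show ?thesis using True t by (simp add: g_heat)
    qed simp
   qed
   also have "\<dots> = (1 / Gamma (1 - a)) * (Gamma a * Gamma (1 - a) * (LBINT s. pos s * h s))"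
    using Beta_convolution[OF a0 a(2) hi] by simp
   \<comment> \<open>h is an exact derivative, namely that of
     \<open>- (exp (- s) * Ht (s + t) f x)\<close>. The term at infinity vanishes and the one at 0
     is the flow of f.\<close>
   also have "(LBINT s. pos s * h s) = 0 - (- (exp (- 0) * Ht (0 + t) f x))"
   proof (rule FTC_half_line[OF _ _ hi])
    show "((\<lambda>s. - (exp (- s) * Ht (s + t) f x)) has_real_derivative h s) (at s)" if "s \<ge> 0" for s
    proof -
     have "((\<lambda>s. Ht (s + t) f x) has_real_derivative Ht' (s + t) f x) (at s)"
      using conv_heat_deriv[OF f, of "s + t" x] that t by (simp add: DERIV_shift)
     then show ?thesis unfolding h_def H_def
      by (auto intro!: derivative_eq_intros simp: algebra_simps)
    qed
    have "continuous_on {0..} (\<lambda>s. Ht' (s + t) f x)" "continuous_on {0..} (\<lambda>s. Ht (s + t) f x)"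
     by (rule continuous_on_compose2[OF hk_conv_continuous[OF hk_heat_kernel' f]] continuous_on_compose2[OF hk_conv_continuous[OF hk_base f]]; use t in "auto intro!: continuous_intros")+
    then show "continuous_on {0..} h" unfolding h_def H_def by (intro continuous_intros)
    have "((\<lambda>s. Ht (s + t) f x) \<longlongrightarrow> 0) at_top"
     using filterlim_compose[OF lim filterlim_tendsto_add_at_top[OF tendsto_const[of t] filterlim_ident]]
     by (simp add: add.commute)
    moreover have "((\<lambda>s :: real. exp (- s)) \<longlongrightarrow> 0) at_top"
     by (rule filterlim_compose[OF exp_at_bot filterlim_uminus_at_bot_at_top])
    ultimately have "((\<lambda>s. - (exp (- s) * Ht (s + t) f x)) \<longlongrightarrow> - (0 * 0)) at_top"
     by (intro tendsto_minus tendsto_mult)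
    then show "((\<lambda>s. - (exp (- s) * Ht (s + t) f x)) \<longlongrightarrow> 0) at_top" by simp
   qed
   finally have J: "Ht t (conv (bessel_kernel r) g) x = Ht t f x"
    using G Gamma_real_pos[OF a0] by simp
   have "Ht t (\<lambda>x. 1 * f x + (- 1) * conv (bessel_kernel r) g x) x
    = Ht t f x - Ht t (conv (bessel_kernel r) g) x"
    using conv_integrable[OF gbound_heat_kernel[OF t] f, of x] conv_integrable[OF gbound_heat_kernel[OF t] gint_integrable[OF Ji], of x]
    by (simp add: conv_def[of "Gk t"] right_diff_distrib)
   then show "Ht t (\<lambda>x. 1 * f x + (- 1) * conv (bessel_kernel r) g x) x = 0" using J by simp
  qed
  then have "AE x in lborel. f x = bessel_potential r g x"
   using bessel_potential_eq[of g r] borel_measurable_integrable[OF gi] False by (auto elim!: eventually_mono)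
  then show ?thesis using gi gn by blast
 qed
 then show ?thesis using fi by (simp add: a_def)
qed

section \<open>Smooth functions and cut-off heat kernels\<close>

lemma C_k_continuous: "C_k k f \<Longrightarrow> continuous_on UNIV f"
 by (cases k) (auto simp: continuous_at_imp_continuous_on differentiable_imp_continuous_within)

text \<open>\<open>F\<close> takes the direction first, so that \<open>F v\<close> is the
  directional derivative whose regularity the recursion of \<open>C_k\<close> demands.\<close>

lemma C_k_I:
 assumes "\<And>x. (f has_derivative (\<lambda>v. F v x)) (at x)" "\<And>v. C_k k (F v)"
 shows "C_k (Suc k) f"
proof -
 have "frechet_derivative f (at x) = (\<lambda>v. F v x)" for x
  by (rule frechet_derivative_at[OF assms(1), symmetric])
 then show ?thesis using assms by (auto simp: differentiable_def)
qed

lemma C_k_D: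
 assumes "C_k (Suc k) f"
 shows "(f has_derivative (\<lambda>v. frechet_derivative f (at x) v)) (at x)" "C_k k (\<lambda>x. frechet_derivative f (at x) v)"
 using assms by (auto simp: frechet_derivative_works[symmetric])

lemma C_k_Suc: "C_k (Suc k) f \<Longrightarrow> C_k k f"
proof (induction k arbitrary: f)
 case 0
 then show ?case using C_k_continuous[of "Suc 0" f] by simp
next
 case (Suc k)
 then show ?case by (intro C_k_I[OF C_k_D(1)[OF Suc.prems]] Suc.IH C_k_D(2)[OF Suc.prems])
qed

lemma C_k_const: "C_k k (\<lambda>x. c)"
proof (induction k arbitrary: c)
 case (Suc k)
 show ?case by (rule C_k_I[OF has_derivative_const]) (rule Suc)
qed simp

lemma C_k_bounded_linear:
 assumes "bounded_linear f" shows "C_k k f"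
proof (cases k)
 case (Suc k')
 show ?thesis unfolding Suc by (rule C_k_I[OF bounded_linear_imp_has_derivative[OF assms]]) (rule C_k_const)
qed (simp add: assms linear_continuous_on)

lemma C_k_add: "C_k k f \<Longrightarrow> C_k k g \<Longrightarrow> C_k k (\<lambda>x. f x + g x)"
proof (induction k arbitrary: f g)
 case (Suc k)
 show ?case
  by (rule C_k_I[OF has_derivative_add[OF C_k_D(1)[OF Suc.prems(1)] C_k_D(1)[OF Suc.prems(2)]]])
   (intro Suc.IH C_k_D(2) Suc.prems)
qed (auto intro: continuous_intros)

lemma C_k_affine:
 assumes L: "bounded_linear L" shows "C_k k f \<Longrightarrow> C_k k (\<lambda>x. f (L x + c))"
proof (induction k arbitrary: f)
 case 0
 have "continuous_on UNIV (\<lambda>x. L x + c)" using linear_continuous_on[OF L, of UNIV] by (intro continuous_intros) auto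
 then show ?case using 0 by (auto intro: continuous_on_compose2)
next
 case (Suc k)
 have "((\<lambda>x. L x + c) has_derivative L) (at x)" for x
  using has_derivative_add[OF bounded_linear_imp_has_derivative[OF L] has_derivative_const] by simp
 then have "((\<lambda>x. f (L x + c)) has_derivative (\<lambda>v. frechet_derivative f (at (L x + c)) (L v))) (at x)" for x
  using has_derivative_compose[OF _ C_k_D(1)[OF Suc.prems]] by fast
 then show ?case by (rule C_k_I) (intro Suc.IH[OF C_k_D(2)[OF Suc.prems]])
qed

lemma C_k_mult:
 fixes f g :: "'a :: real_normed_vector \<Rightarrow> real"
 shows "C_k k f \<Longrightarrow> C_k k g \<Longrightarrow> C_k k (\<lambda>x. f x * g x)"
proof (induction k arbitrary: f g)
 case (Suc k)
 show ?case
  by (rule C_k_I[OF has_derivative_mult[OF C_k_D(1)[OF Suc.prems(1)] C_k_D(1)[OF Suc.prems(2)]]])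
   (intro C_k_add Suc.IH C_k_D(2) Suc.prems C_k_Suc)
qed (auto intro: continuous_intros)

lemma C_k_compose_real:
 fixes f :: "'a :: real_normed_vector \<Rightarrow> real" and g :: "real \<Rightarrow> real"
 shows "C_k k g \<Longrightarrow> C_k k f \<Longrightarrow> C_k k (\<lambda>x. g (f x))"
proof (induction k arbitrary: g)
 case 0
 then show ?case by (auto intro: continuous_on_compose2)
next
 case (Suc k)
 have "((\<lambda>x. g (f x)) has_derivative (\<lambda>v. frechet_derivative f (at x) v * frechet_derivative g (at (f x)) 1)) (at x)" for x
 proof -
  have 1: "((\<lambda>x. g (f x)) has_derivative (\<lambda>v. frechet_derivative g (at (f x)) (frechet_derivative f (at x) v))) (at x)"
   using has_derivative_compose[OF C_k_D(1)[OF Suc.prems(2)] C_k_D(1)[OF Suc.prems(1)]] by fast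
  have e: "frechet_derivative g (at (f x)) c = c * frechet_derivative g (at (f x)) 1" for c
   using linear_cmul[OF has_derivative_linear[OF C_k_D(1)[OF Suc.prems(1), of "f x"]], of c 1] by simp
  have 2: "(\<lambda>v. frechet_derivative g (at (f x)) (frechet_derivative f (at x) v)) = (\<lambda>v. frechet_derivative f (at x) v * frechet_derivative g (at (f x)) 1)"
   by (rule ext) (rule e)
  show ?thesis using 1 unfolding 2 .
 qed
 then show ?case
  by (rule C_k_I) (rule C_k_mult[OF C_k_D(2)[OF Suc.prems(2)] Suc.IH[OF C_k_D(2)[OF Suc.prems(1)] C_k_Suc[OF Suc.prems(2)]]])
qed

text \<open>The derivative contains \<open>inverse (f x)\<close> again, but only its regularity of
  one order less is needed, so the induction closes.\<close>

lemma C_k_inverse: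
 fixes f :: "'a :: real_normed_vector \<Rightarrow> real"
 assumes nz: "\<And>x. f x \<noteq> 0"
 shows "C_k k f \<Longrightarrow> C_k k (\<lambda>x. inverse (f x))"
proof (induction k)
 case 0
 then show ?case using nz by (auto intro: continuous_intros)
next
 case (Suc k)
 have "((\<lambda>x. inverse (f x)) has_derivative (\<lambda>v. (- 1) * (inverse (f x) * frechet_derivative f (at x) v * inverse (f x)))) (at x)" for x
  using Deriv.has_derivative_inverse[OF nz C_k_D(1)[OF Suc.prems]] by simp
 then show ?case
  by (rule C_k_I) (intro C_k_mult C_k_const Suc.IH C_k_D(2) Suc.prems C_k_Suc)
qed

lemma smooth_D:
 assumes "smooth f"
 shows "(f has_derivative (\<lambda>v. frechet_derivative f (at x) v)) (at x)" "smooth (\<lambda>x. frechet_derivative f (at x) v)"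
  "continuous_on UNIV f"
 using assms C_k_D[of _ f] C_k_continuous unfolding smooth_def by blast+

lemma smooth_mult: "smooth f \<Longrightarrow> smooth g \<Longrightarrow> smooth (\<lambda>x. f x * g x :: real)"
 and smooth_add: "smooth f' \<Longrightarrow> smooth g' \<Longrightarrow> smooth (\<lambda>x. f' x + g' x)"
 and smooth_const: "smooth (\<lambda>x. c)"
 by (auto simp: smooth_def intro: C_k_mult C_k_add C_k_const)

lemma smooth_affine: "smooth f \<Longrightarrow> bounded_linear L \<Longrightarrow> smooth (\<lambda>x. f (L x + c))"
 by (auto simp: smooth_def intro: C_k_affine)

lemma smooth_bounded_linear: "bounded_linear h \<Longrightarrow> smooth h"
 by (auto simp: smooth_def intro: C_k_bounded_linear)

lemma smooth_sum: "(\<And>i. i \<in> S \<Longrightarrow> smooth (f i)) \<Longrightarrow> smooth (\<lambda>x. \<Sum>i\<in>S. f i x)"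
 by (induction S rule: infinite_finite_induct) (auto intro: smooth_const smooth_add)

lemma smooth_compose_real: "smooth g \<Longrightarrow> smooth f \<Longrightarrow> smooth (\<lambda>x. (g :: real \<Rightarrow> real) (f x))"
 by (auto simp: smooth_def intro: C_k_compose_real)

lemma smooth_inverse: "smooth f \<Longrightarrow> (\<And>x. f x \<noteq> (0 :: real)) \<Longrightarrow> smooth (\<lambda>x. inverse (f x))"
 by (auto simp: smooth_def intro: C_k_inverse)

text \<open>Symmetry of second derivatives: the second difference over a small parallelogram is
 evaluated by the mean value theorem in both orders.\<close>

lemma mvt_line:
 fixes f :: "'a :: real_normed_vector \<Rightarrow> real"
 assumes "\<And>x. f differentiable (at x)" "h > 0"
 obtains s where "0 < s" "s < h" "f (a + h *\<^sub>R v) - f a = h * frechet_derivative f (at (a + s *\<^sub>R v)) v"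
proof -
 have D: "((\<lambda>s. f (a + s *\<^sub>R v)) has_real_derivative frechet_derivative f (at (a + s *\<^sub>R v)) v) (at s)" for s
 proof -
  have f: "(f has_derivative frechet_derivative f (at (a + s *\<^sub>R v))) (at (a + s *\<^sub>R v))"
   using assms(1) by (simp add: frechet_derivative_works[symmetric])
  have "((\<lambda>s. a + s *\<^sub>R v) has_derivative (\<lambda>t. t *\<^sub>R v)) (at s)"
   by (auto intro!: derivative_eq_intros)
  from has_derivative_compose[OF this f]
  have "((\<lambda>s. f (a + s *\<^sub>R v)) has_derivative (\<lambda>t. frechet_derivative f (at (a + s *\<^sub>R v)) (t *\<^sub>R v))) (at s)" .
  then show ?thesis
   using linear_cmul[OF has_derivative_linear[OF f]] by (simp add: has_field_derivative_def mult_commute_abs)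
 qed
 obtain s where "0 < s" "s < h" "f (a + h *\<^sub>R v) - f (a + 0 *\<^sub>R v) = (h - 0) * frechet_derivative f (at (a + s *\<^sub>R v)) v"
  using MVT2[OF assms(2), of "\<lambda>s. f (a + s *\<^sub>R v)" "\<lambda>s. frechet_derivative f (at (a + s *\<^sub>R v)) v"] D by blast
 then show ?thesis using that by simp
qed

lemma C_k_symmetric:
 fixes f :: "'a :: real_normed_vector \<Rightarrow> real"
 assumes f: "C_k 2 f"
 shows "frechet_derivative (\<lambda>x. frechet_derivative f (at x) v) (at x) w = frechet_derivative (\<lambda>x. frechet_derivative f (at x) w) (at x) v"
proof -
 define D where "D = (\<lambda>v x. frechet_derivative f (at x) v)"
 define D2 where "D2 = (\<lambda>w v x. frechet_derivative (D v) (at x) w)"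
 have f': "C_k (Suc (Suc 0)) f" using f by (simp add: numeral_2_eq_2)
 have d1: "f differentiable (at x)" for x using C_k_D(1)[OF f'] by (auto simp: differentiable_def)
 have d2: "D v differentiable (at x)" for v x
  using C_k_D(1)[OF C_k_D(2)[OF f']] unfolding D_def by (auto simp: differentiable_def)
 have c: "continuous_on UNIV (D2 w v)" for w v
  using C_k_D(2)[OF C_k_D(2)[OF f', of v], of w] by (simp add: D2_def D_def)
 have key: "\<exists>s t. 0 < s \<and> s < h \<and> 0 < t \<and> t < h \<and>
  f (x + h *\<^sub>R v + h *\<^sub>R w) - f (x + h *\<^sub>R v) - (f (x + h *\<^sub>R w) - f x) = h * (h * D2 w v (x + s *\<^sub>R v + t *\<^sub>R w))" if h: "h > 0" for h v w
 proof -
  define g where "g = (\<lambda>y. f (y + h *\<^sub>R w) - f y)"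
  have g: "(g has_derivative (\<lambda>v. D v (y + h *\<^sub>R w) - D v y)) (at y)" for y
  proof -
   have 1: "((\<lambda>y. y + h *\<^sub>R w) has_derivative (\<lambda>v. v)) (at y)" by (auto intro!: derivative_eq_intros)
   have 2: "(f has_derivative (\<lambda>v. D v (y + h *\<^sub>R w))) (at (y + h *\<^sub>R w))" "(f has_derivative (\<lambda>v. D v y)) (at y)"
    unfolding D_def using C_k_D(1)[OF f'] by blast+
   show ?thesis unfolding g_def by (intro has_derivative_diff has_derivative_compose[OF 1 2(1)] 2(2))
  qed
  have gf: "frechet_derivative g (at y) v = D v (y + h *\<^sub>R w) - D v y" for y v
   using frechet_derivative_at[OF g[of y]] by metis
  obtain s where s: "0 < s" "s < h" "g (x + h *\<^sub>R v) - g x = h * frechet_derivative g (at (x + s *\<^sub>R v)) v"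
   by (rule mvt_line[of g h x v]) (use g h in "auto simp: differentiable_def")
  obtain t where t: "0 < t" "t < h" "D v (x + s *\<^sub>R v + h *\<^sub>R w) - D v (x + s *\<^sub>R v) = h * frechet_derivative (D v) (at (x + s *\<^sub>R v + t *\<^sub>R w)) w"
   by (rule mvt_line[of "D v" h "x + s *\<^sub>R v" w]) (use d2 h in auto)
  have "g (x + h *\<^sub>R v) - g x = h * (h * D2 w v (x + s *\<^sub>R v + t *\<^sub>R w))" using s(3) t(3) by (simp only: gf D2_def)
  then have "f (x + h *\<^sub>R v + h *\<^sub>R w) - f (x + h *\<^sub>R v) - (f (x + h *\<^sub>R w) - f x) = h * (h * D2 w v (x + s *\<^sub>R v + t *\<^sub>R w))"
   by (simp only: g_def)
  then show ?thesis using s(1,2) t(1,2) by blast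
 qed
 define h where "h = (\<lambda>n. 1 / real (Suc n))"
 have h: "h n > 0" for n by (simp add: h_def)
 have h0: "h ~> 0" unfolding h_def by (rule LIMSEQ_inverse_real_of_nat[unfolded inverse_eq_divide])
 define Q where "Q = (\<lambda>n v w. f (x + h n *\<^sub>R v + h n *\<^sub>R w) - f (x + h n *\<^sub>R v) - (f (x + h n *\<^sub>R w) - f x))"
 have Q_commute: "Q n v w = Q n w v" for n v w
 proof -
  have "x + h n *\<^sub>R v + h n *\<^sub>R w = x + h n *\<^sub>R w + h n *\<^sub>R v" by (simp only: ac_simps)
  then have "f (x + h n *\<^sub>R v + h n *\<^sub>R w) = f (x + h n *\<^sub>R w + h n *\<^sub>R v)" by (rule arg_cong)
  then show ?thesis unfolding Q_def by linarith
 qed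
 \<comment> \<open>The mean value points are squeezed to x, along two different sequences for the
   two orders of v and w. The quotients coincide, so continuity of the second derivatives identifies
   the limits.\<close>
 have lim: "\<exists>\<xi>. \<xi> ~> x \<and> (\<forall>n. Q n v w = h n * (h n * D2 w v (\<xi> n)))" for v w
 proof -
  define R where "R = (\<lambda>n s t. 0 < s \<and> s < h n \<and> 0 < t \<and> t < h n \<and> Q n v w = h n * (h n * D2 w v (x + s *\<^sub>R v + t *\<^sub>R w)))"
  have "\<forall>n. \<exists>s t. R n s t" unfolding R_def Q_def by (intro allI key h)
  then obtain s where "\<forall>n. \<exists>t. R n (s n) t" by metis
  then obtain t where st: "\<And>n. R n (s n) (t n)" by metis
  have b: "0 \<le> s n" "s n \<le> h n" "0 \<le> t n" "t n \<le> h n" and e: "Q n v w = h n * (h n * D2 w v (x + s n *\<^sub>R v + t n *\<^sub>R w))" for n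
   using st[of n] unfolding R_def by (simp_all only: less_imp_le)
  have "s ~> 0" by (rule tendsto_sandwich[OF _ _ tendsto_const h0]) (simp_all add: b)
  moreover have "t ~> 0" by (rule tendsto_sandwich[OF _ _ tendsto_const h0]) (simp_all add: b)
  ultimately have "(\<lambda>n. x + s n *\<^sub>R v + t n *\<^sub>R w) ~> x + 0 *\<^sub>R v + 0 *\<^sub>R w" by (intro tendsto_intros)
  then have "(\<lambda>n. x + s n *\<^sub>R v + t n *\<^sub>R w) ~> x" by simp
  then show ?thesis using e by blast
 qed
 obtain \<xi> where x1: "\<xi> ~> x" "\<forall>n. Q n v w = h n * (h n * D2 w v (\<xi> n))"
  using lim[of v w] by blast
 obtain \<zeta> where x2: "\<zeta> ~> x" "\<forall>n. Q n w v = h n * (h n * D2 v w (\<zeta> n))"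
  using lim[of w v] by blast
 have eq: "D2 w v (\<xi> n) = D2 v w (\<zeta> n)" for n
 proof -
  have "h n * (h n * D2 w v (\<xi> n)) = h n * (h n * D2 v w (\<zeta> n))"
   by (rule trans[OF x1(2)[rule_format, symmetric] trans[OF Q_commute x2(2)[rule_format]]])
  then show ?thesis using h[of n] by simp
 qed
 have "(\<lambda>n. D2 w v (\<xi> n)) ~> D2 w v x" "(\<lambda>n. D2 v w (\<zeta> n)) ~> D2 v w x"
  using continuous_on_tendsto_compose[OF c x1(1)] continuous_on_tendsto_compose[OF c x2(1)] by auto
 then have "D2 w v x = D2 v w x" unfolding eq by (rule LIMSEQ_unique)
 then show ?thesis by (simp add: D2_def D_def)
qed

section \<open>A smooth cut-off function\<close>

text \<open>The powers of 1/x are included because the span of the family is closed under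
  differentiation; smoothness of all members is then a single induction.\<close>

definition bump_aux :: "nat \<Rightarrow> real \<Rightarrow> real"
 where "bump_aux j x = (if x > 0 then (1 / x) ^ j * exp (- (1 / x)) else 0)"

text \<open>A quadratic bound at the origin is all that differentiability there needs: it gives
  derivative 0 at 0 for every member of the family.\<close>

lemma bump_aux_bound: "\<exists>C. \<forall>x. \<bar>bump_aux j x\<bar> \<le> C * x\<^sup>2"
proof -
 obtain C :: real where C: "C \<ge> 0" "\<And>q. q \<ge> 0 \<Longrightarrow> (1 + q) ^ (j + 2) \<le> C * exp (1 * q)"
  using exp_dominates_power[of 1 "j + 2"] by auto
 have "\<bar>bump_aux j x\<bar> \<le> C * x\<^sup>2" for x
 proof (cases "x > 0")
  case True
  define q where "q = 1 / x"
  have q: "q > 0" using True by (simp add: q_def)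
  have "q ^ j * q\<^sup>2 \<le> (1 + q) ^ (j + 2)" using q by (subst power_add[symmetric]) (intro power_mono, auto)
  also have "\<dots> \<le> C * exp q" using C(2)[of q] q by simp
  finally have "q ^ j * exp (- q) * q\<^sup>2 \<le> C" using q by (simp add: exp_minus field_simps)
  moreover have "q ^ j * exp (- q) = (q ^ j * exp (- q) * q\<^sup>2) * x\<^sup>2" using True by (simp add: q_def power_divide)
  ultimately have "q ^ j * exp (- q) \<le> C * x\<^sup>2" by (metis mult_right_mono zero_le_power2)
  then show ?thesis using True q by (simp add: bump_aux_def q_def[symmetric])
 qed (use C in "simp add: bump_aux_def")
 then show ?thesis by blast
qed

lemma bump_aux_deriv:
 "(bump_aux j has_real_derivative (- real j * bump_aux (Suc j) x + bump_aux (Suc (Suc j)) x)) (at x)"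
proof -
 consider "x > 0" | "x < 0" | "x = 0" by linarith
 then show ?thesis
 proof cases
  case 1
  have "((\<lambda>x. (1 / x) ^ j * exp (- (1 / x))) has_real_derivative (- real j * bump_aux (Suc j) x + bump_aux (Suc (Suc j)) x)) (at x)"
  proof (cases j)
   case 0
   then show ?thesis using 1 by (auto intro!: derivative_eq_intros simp: bump_aux_def power2_eq_square)
  next
   case (Suc i)
   define q where "q = 1 / x"
   have d1: "((\<lambda>x. 1 / x) has_real_derivative - q\<^sup>2) (at x)"
    using 1 by (auto intro!: derivative_eq_intros simp: q_def power2_eq_square)
   have d2: "((\<lambda>x. (1 / x) ^ Suc i) has_real_derivative (1 + real i) * (- q\<^sup>2 * q ^ i)) (at x)"
    using DERIV_power_Suc[OF d1, of i] by (simp only: q_def)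
   have d3: "((\<lambda>x. exp (- (1 / x))) has_real_derivative exp (- q) * q\<^sup>2) (at x)"
    using DERIV_fun_exp[OF DERIV_minus[OF d1]] by (simp add: q_def)
   have "bump_aux k x = q ^ k * exp (- q)" for k using 1 by (simp add: bump_aux_def q_def)
   then show ?thesis unfolding Suc
    by (intro DERIV_cong[OF DERIV_mult[OF d2 d3]]) (simp add: q_def[symmetric] power2_eq_square algebra_simps)
  qed
  then show ?thesis
   by (rule has_field_derivative_transform_within_open[of _ _ _ "{0<..}"]) (use 1 in "auto simp: bump_aux_def")
 next
  case 2
  have "((\<lambda>x. 0) has_real_derivative (- real j * bump_aux (Suc j) x + bump_aux (Suc (Suc j)) x)) (at x)"
   using 2 by (simp add: bump_aux_def)
  then show ?thesis
   by (rule has_field_derivative_transform_within_open[of _ _ _ "{..<0}"]) (use 2 in "auto simp: bump_aux_def")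
 next
  case 3
  obtain C where C: "\<And>x. \<bar>bump_aux j x\<bar> \<le> C * x\<^sup>2" using bump_aux_bound by blast
  have "((\<lambda>y. bump_aux j y / y) \<longlongrightarrow> 0) (at 0)"
  proof (rule Lim_null_comparison)
   show "\<forall>\<^sub>F y in at 0. norm (bump_aux j y / y) \<le> C * \<bar>y\<bar>"
   proof (rule eventually_at_topological[THEN iffD2], intro exI[of _ UNIV] conjI ballI impI)
    fix y :: real assume "y \<noteq> 0"
    then show "norm (bump_aux j y / y) \<le> C * \<bar>y\<bar>"
     using C[of y] by (simp add: abs_divide divide_le_eq power2_eq_square abs_mult[symmetric] mult.assoc)
   qed auto
   show "((\<lambda>y. C * \<bar>y\<bar>) \<longlongrightarrow> 0) (at 0)" by (auto intro!: tendsto_eq_intros)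
  qed
  then show ?thesis using 3 by (simp add: has_field_derivative_iff bump_aux_def)
 qed
qed

lemma bump_aux_smooth: "smooth (bump_aux j)"
proof -
 have "C_k k (bump_aux j)" for k j
 proof (induction k arbitrary: j)
  case 0
  have "bump_aux j differentiable (at x)" for x
   using bump_aux_deriv by (auto simp: differentiable_def has_field_derivative_def)
  then show ?case by (simp add: continuous_at_imp_continuous_on differentiable_imp_continuous_within)
 next
  case (Suc k)
  have "(bump_aux j has_derivative (\<lambda>v. v * (- real j * bump_aux (Suc j) x + bump_aux (Suc (Suc j)) x))) (at x)" for x
   using bump_aux_deriv[of j x] by (simp add: has_field_derivative_def mult_commute_abs)
  then show ?case
   by (rule C_k_I) (intro C_k_mult C_k_add C_k_const Suc.IH)
 qed
 then show ?thesis by (simp add: smooth_def)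
qed

definition smooth_step :: "real \<Rightarrow> real"
 where "smooth_step x = bump_aux 0 x * inverse (bump_aux 0 x + bump_aux 0 (1 - x))"

lemma smooth_step:
 "smooth smooth_step" "x \<le> 0 \<Longrightarrow> smooth_step x = 0" "x \<ge> 1 \<Longrightarrow> smooth_step x = 1"
 "0 \<le> smooth_step x" "smooth_step x \<le> 1"
proof -
 have p: "bump_aux 0 x + bump_aux 0 (1 - x) > 0" for x
  by (cases "x > 0"; cases "x < 1") (auto simp: bump_aux_def add_pos_pos)
 have s1: "smooth (\<lambda>x. bump_aux 0 (1 - x))"
  using smooth_affine[OF bump_aux_smooth[of 0], of uminus 1] bounded_linear_minus[OF bounded_linear_ident] by simp
 show "smooth smooth_step" unfolding smooth_step_def[abs_def]
  by (intro smooth_mult smooth_inverse smooth_add bump_aux_smooth s1) (use p in "auto simp: less_imp_neq[symmetric]")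
 have b: "bump_aux 0 x \<ge> 0" "bump_aux 0 (1 - x) \<ge> 0" by (auto simp: bump_aux_def)
 show "0 \<le> smooth_step x" unfolding smooth_step_def using b p[of x] by simp
 show "smooth_step x \<le> 1" unfolding smooth_step_def using b p[of x] by (simp add: field_simps)
 show "x \<le> 0 \<Longrightarrow> smooth_step x = 0" by (simp add: smooth_step_def bump_aux_def)
 show "x \<ge> 1 \<Longrightarrow> smooth_step x = 1" using p[of x] by (simp add: smooth_step_def bump_aux_def)
qed

text \<open>All derivatives of the profile are named because they occur as generators of
  \<open>fam\<close>. For l > 0 they vanish below 1, where the profile is constant, so that such
  generators have limit 0.\<close>

definition cutoff :: "nat \<Rightarrow> real \<Rightarrow> real"
 where "cutoff l = ((\<lambda>g z. frechet_derivative g (at z) 1) ^^ l) (\<lambda>z. smooth_step (2 - z))"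

lemma cutoff_0: "cutoff 0 z = smooth_step (2 - z)"
 and cutoff_Suc: "cutoff (Suc l) z = frechet_derivative (cutoff l) (at z) 1"
 by (simp_all add: cutoff_def)

lemma cutoff_smooth: "smooth (cutoff l)"
proof (induction l)
 case 0
 have "smooth (\<lambda>z. smooth_step (- z + 2))"
  by (rule smooth_affine[OF smooth_step(1)]) (intro bounded_linear_minus bounded_linear_ident)
 then show ?case by (simp add: cutoff_0[abs_def])
next
 case (Suc l)
 show ?case using smooth_D(2)[OF Suc, of 1] by (simp add: cutoff_Suc[abs_def])
qed

lemma cutoff_deriv: "(cutoff l has_derivative (\<lambda>v. v * cutoff (Suc l) z)) (at z)"
proof -
 have D: "(cutoff l has_derivative (\<lambda>v. frechet_derivative (cutoff l) (at z) v)) (at z)"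
  by (rule smooth_D(1)[OF cutoff_smooth])
 have "frechet_derivative (cutoff l) (at z) v = v * cutoff (Suc l) z" for v
  using linear_cmul[OF has_derivative_linear[OF D], of v 1] by (simp add: cutoff_Suc)
 then show ?thesis using D by simp
qed

lemma cutoff_locally_const:
 assumes "open S" "z \<in> S" "\<And>y. y \<in> S \<Longrightarrow> cutoff l y = c"
 shows "cutoff (Suc l) z = 0"
proof -
 have "(cutoff l has_derivative (\<lambda>v. 0)) (at z)"
  by (rule has_derivative_transform_within_open[OF has_derivative_const[of c] assms(1,2)]) (use assms(3) in auto)
 from frechet_derivative_at[OF this] show ?thesis by (metis cutoff_Suc)
qed

lemma cutoff_eq_0: "z > 2 \<Longrightarrow> cutoff l z = 0"
proof (induction l arbitrary: z)
 case 0
 then show ?case by (simp add: cutoff_0 smooth_step)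
next
 case (Suc l)
 then show ?case by (intro cutoff_locally_const[of "{2<..}"]) auto
qed

lemma cutoff_eq_1: "z < 1 \<Longrightarrow> cutoff l z = (if l = 0 then 1 else 0)"
proof (induction l arbitrary: z)
 case 0
 then show ?case by (simp add: cutoff_0 smooth_step)
next
 case (Suc l)
 then show ?case using cutoff_locally_const[of "{..<1}" z l] by auto
qed

lemma cutoff_bounded: "\<exists>B. \<forall>z. \<bar>cutoff l z\<bar> \<le> B"
proof -
 have "compact (cutoff l ` {1..2})"
  by (intro compact_continuous_image continuous_on_subset[OF smooth_D(3)[OF cutoff_smooth]]) auto
 then have "bounded (cutoff l ` {1..2})" by (rule compact_imp_bounded)
 then obtain B where "\<forall>y\<in>cutoff l ` {1..2}. norm y \<le> B" unfolding bounded_iff by blast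
 then have B: "\<And>z. z \<in> {1..2} \<Longrightarrow> \<bar>cutoff l z\<bar> \<le> B" by auto
 have "\<bar>cutoff l z\<bar> \<le> max B 1" for z
  using B[of z] cutoff_eq_0[of z l] cutoff_eq_1[of z l] by (cases "z < 1"; cases "z > 2") auto
 then show ?thesis by blast
qed

lemma gauss_absorb:
 assumes s: "s > 0"
 shows "\<exists>C\<ge>0. \<forall>y :: real ^ 'n. (1 + (norm y)\<^sup>2) ^ N * Gk s y \<le> C * Gk (2 * s) y"
proof -
 obtain K :: real where K: "K \<ge> 0" "\<And>q. q \<ge> 0 \<Longrightarrow> (1 + q) ^ N \<le> K * exp (1 / (8 * s) * q)"
  using exp_dominates_power[of "1 / (8 * s)" N] s by auto
 define c where "c = (4 * pi * s) powr (- (real CARD('n) / 2))"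
 define c' where "c' = (4 * pi * (2 * s)) powr (- (real CARD('n) / 2))"
 have c: "c \<ge> 0" "c' > 0" using s by (auto simp: c_def c'_def)
 show ?thesis
 proof (intro exI conjI allI)
  show "K * c / c' \<ge> 0" using K c by simp
  fix y :: "real ^ 'n"
  have e: "exp (1 / (8 * s) * (norm y)\<^sup>2) * exp (- ((norm y)\<^sup>2 / (4 * s))) = exp (- ((norm y)\<^sup>2 / (4 * (2 * s))))"
   using s by (subst exp_add[symmetric]) (simp add: field_simps)
  have "(1 + (norm y)\<^sup>2) ^ N * Gk s y \<le> (K * exp (1 / (8 * s) * (norm y)\<^sup>2)) * Gk s y"
   using K(2)[of "(norm y)\<^sup>2"] by (intro mult_right_mono heat_kernel_nonneg) auto
  also have "\<dots> = K * c * (exp (1 / (8 * s) * (norm y)\<^sup>2) * exp (- ((norm y)\<^sup>2 / (4 * s))))"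
   by (simp add: heat_kernel_def c_def mult_ac)
  also have "\<dots> = K * c / c' * Gk (2 * s) y"
   unfolding e using c by (simp add: heat_kernel_def c'_def)
  finally show "(1 + (norm y)\<^sup>2) ^ N * Gk s y \<le> K * c / c' * Gk (2 * s) y" .
 qed
qed

text \<open>
 The families below are the space-time derivatives of a heat kernel multiplied by a cutoff at
 radius \<open>\<epsilon>\<^bsup>-1/2\<^esup>\<close>; the second argument is the limit for \<open>\<epsilon> \<rightarrow> 0\<close>. Closure under derivatives yields smoothness,
 compact support, convergence and Gaussian domination of all derivatives at once.
\<close>

inductive fam :: "(real \<Rightarrow> real) \<Rightarrow> real ^ 'n \<Rightarrow> real set \<Rightarrow>
  (real \<Rightarrow> real \<times> (real ^ 'n) \<Rightarrow> real) \<Rightarrow> (real \<times> (real ^ 'n) \<Rightarrow> real) \<Rightarrow> bool" for ka x S where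
 fam_base: "hk d f \<Longrightarrow> smooth \<theta> \<Longrightarrow> (\<And>s. s \<notin> S \<Longrightarrow> \<theta> s = 0) \<Longrightarrow>
  fam ka x S (\<lambda>ep z. \<theta> (fst z) * (ep ^ l * cutoff l (ep * (norm (snd z - x))\<^sup>2)) * f (ka (fst z)) (snd z - x))
   (\<lambda>z. if l = 0 then \<theta> (fst z) * f (ka (fst z)) (snd z - x) else 0)"
| fam_mult: "fam ka x S F F0 \<Longrightarrow> fam ka x S (\<lambda>ep z. (snd z - x) $ k * F ep z) (\<lambda>z. (snd z - x) $ k * F0 z)"
| fam_lin: "fam ka x S F F0 \<Longrightarrow> fam ka x S G G0 \<Longrightarrow>
  fam ka x S (\<lambda>ep z. a * F ep z + b * G ep z) (\<lambda>z. a * F0 z + b * G0 z)"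

lemma fam_zero: "fam ka (x :: real ^ 'n) S (\<lambda>ep z. 0) (\<lambda>z. 0)"
 using fam_base[of 0 Gk "\<lambda>_. 0" S ka x 0] by (simp add: hk_base smooth_const)

lemma fam_sum:
 "(\<And>i. i \<in> I \<Longrightarrow> fam ka x S (F i) (F0 i)) \<Longrightarrow> fam ka x S (\<lambda>ep z. \<Sum>i\<in>I. F i ep z) (\<lambda>z. \<Sum>i\<in>I. F0 i z)"
proof (induction I rule: infinite_finite_induct)
 case (insert i I)
 have "fam ka x S (\<lambda>ep z. 1 * F i ep z + 1 * (\<Sum>i\<in>I. F i ep z)) (\<lambda>z. 1 * F0 i z + 1 * (\<Sum>i\<in>I. F0 i z))"
  by (intro fam_lin insert) auto
 then show ?case using insert by simp
qed (auto simp: fam_zero)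

lemma fam_cmult: "fam ka x S F F0 \<Longrightarrow> fam ka x S (\<lambda>ep z. a * F ep z) (\<lambda>z. a * F0 z)"
 using fam_lin[of ka x S F F0 F F0 a 0] by simp

text \<open>Inside the radius where the profile is constant the two functions coincide, so
  convergence is eventual equality and derivatives of \<open>F0\<close> can be read off from
  \<open>F ep\<close>. The value \<open>ep = 0\<close> is included.\<close>

lemma fam_eq_limit:
 assumes "fam ka x S F F0" "ep * (norm (snd z - x))\<^sup>2 < 1"
 shows "F ep z = F0 z"
 using assms(1) by induction (auto simp: cutoff_eq_1[OF assms(2)])

lemma fam_support:
 assumes "fam ka x S F F0" "fst z \<notin> S \<or> ep * (norm (snd z - x))\<^sup>2 > 2"
 shows "F ep z = 0"
 using assms(1) by induction (use assms(2) in "auto simp: cutoff_eq_0")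

text \<open>The product rule leads back into the family: the derivative falls on \<theta>, on the
  kernel (in space, or in time through \<open>ka\<close>), or on the cutoff. In the last case the
  chain rule yields a factor \<open>ep\<close>, counted by l, and a factor
  \<open>(snd z - x) $ k\<close>, for which \<open>fam_mult\<close> exists.\<close>

lemma fam_base_deriv:
 fixes f :: "real \<Rightarrow> real ^ 'n \<Rightarrow> real"
 assumes ka: "smooth ka" "\<And>s. ka s > 0" and S: "closed S"
  and f: "hk d f" and \<theta>: "smooth \<theta>" "\<And>s. s \<notin> S \<Longrightarrow> \<theta> s = 0"
 shows "\<exists>F' F0'. (\<forall>v. fam ka x S (F' v) (F0' v)) \<and>
  (\<forall>ep z. ((\<lambda>z. \<theta> (fst z) * (ep ^ l * cutoff l (ep * (norm (snd z - x))\<^sup>2)) * f (ka (fst z)) (snd z - x)) has_derivative (\<lambda>v. F' v ep z)) (at z))"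
proof -
 obtain f' g where fg: "\<And>k. hk (Suc d) (f' k)" "hk (Suc (Suc d)) g" "hk_deriv f f' g"
  using hk_deriv_ex[OF f] by blast
 define \<theta>' where "\<theta>' = (\<lambda>s. frechet_derivative \<theta> (at s) 1)"
 define ka' where "ka' = (\<lambda>s. frechet_derivative ka (at s) 1)"
 have s': "smooth \<theta>'" "smooth ka'" unfolding \<theta>'_def ka'_def using smooth_D(2) \<theta> ka by auto
 have d1: "(\<theta> has_derivative (\<lambda>v. v * \<theta>' s)) (at s)" "(ka has_derivative (\<lambda>v. v * ka' s)) (at s)" for s
 proof -
  have "frechet_derivative \<theta> (at s) v = v * \<theta>' s" "frechet_derivative ka (at s) v = v * ka' s" for v
   unfolding \<theta>'_def ka'_def
   using linear_cmul[OF has_derivative_linear[OF smooth_D(1)[OF \<theta>(1), of s]], of v 1]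
    linear_cmul[OF has_derivative_linear[OF smooth_D(1)[OF ka(1), of s]], of v 1] by simp_all
  then show "(\<theta> has_derivative (\<lambda>v. v * \<theta>' s)) (at s)" "(ka has_derivative (\<lambda>v. v * ka' s)) (at s)"
   using smooth_D(1)[OF \<theta>(1), of s] smooth_D(1)[OF ka(1), of s] by simp_all
 qed
 have t0: "\<theta>' s = 0" if "s \<notin> S" for s
 proof -
  have "(\<theta> has_derivative (\<lambda>v. 0)) (at s)"
   by (rule has_derivative_transform_within_open[OF has_derivative_const[of 0 "at s"], of "- S"]) (use S that \<theta>(2) in auto)
  from frechet_derivative_at[OF this] show ?thesis unfolding \<theta>'_def by metis
 qed
 define Bf where "Bf = (\<lambda>(\<theta> :: real \<Rightarrow> real) l (f :: real \<Rightarrow> real ^ 'n \<Rightarrow> real) ep (z :: real \<times> (real ^ 'n)).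
  \<theta> (fst z) * (ep ^ l * cutoff l (ep * (norm (snd z - x))\<^sup>2)) * f (ka (fst z)) (snd z - x))"
 define B0 where "B0 = (\<lambda>(\<theta> :: real \<Rightarrow> real) l (f :: real \<Rightarrow> real ^ 'n \<Rightarrow> real) (z :: real \<times> (real ^ 'n)).
  if l = (0 :: nat) then \<theta> (fst z) * f (ka (fst z)) (snd z - x) else 0)"
 have B: "fam ka x S (Bf \<theta> l f) (B0 \<theta> l f)" if "hk d f" "smooth \<theta>" "\<And>s. s \<notin> S \<Longrightarrow> \<theta> s = 0" for d f \<theta> l
  unfolding Bf_def B0_def by (rule fam_base[OF that])
 define F' where "F' = (\<lambda>v ep z. fst v * Bf \<theta>' l f ep z + 1 * ((SS k. (2 * snd v $ k) * ((snd z - x) $ k * Bf \<theta> (Suc l) f ep z))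
   + (SS k. snd v $ k * Bf \<theta> l (f' k) ep z) + fst v * Bf (\<lambda>s. \<theta> s * ka' s) l g ep z))"
 define F0' where "F0' = (\<lambda>v z. fst v * B0 \<theta>' l f z + 1 * ((SS k. (2 * snd v $ k) * ((snd z - x) $ k * B0 \<theta> (Suc l) f z))
   + (SS k. snd v $ k * B0 \<theta> l (f' k) z) + fst v * B0 (\<lambda>s. \<theta> s * ka' s) l g z))"
 have "fam ka x S (F' v) (F0' v)" for v
 proof -
  have "fam ka x S (\<lambda>ep z. SS k. (2 * snd v $ k) * ((snd z - x) $ k * Bf \<theta> (Suc l) f ep z)) (\<lambda>z. SS k. (2 * snd v $ k) * ((snd z - x) $ k * B0 \<theta> (Suc l) f z))"
   by (intro fam_sum fam_cmult fam_mult B[OF f \<theta>])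
  note s1 = this
  have s2: "fam ka x S (\<lambda>ep z. SS k. snd v $ k * Bf \<theta> l (f' k) ep z) (\<lambda>z. SS k. snd v $ k * B0 \<theta> l (f' k) z)"
   by (intro fam_sum fam_cmult B[OF fg(1) \<theta>])
  have s3: "fam ka x S (Bf (\<lambda>s. \<theta> s * ka' s) l g) (B0 (\<lambda>s. \<theta> s * ka' s) l g)"
   by (rule B[OF fg(2) smooth_mult[OF \<theta>(1) s'(2)]]) (simp add: \<theta>(2))
  have s4: "fam ka x S (Bf \<theta>' l f) (B0 \<theta>' l f)" by (rule B[OF f s'(1) t0])
  show ?thesis
   using fam_lin[OF s4 fam_lin[OF fam_lin[OF s1 s2, of 1 1] s3, of 1 "fst v"], of "fst v" 1]
   unfolding F'_def F0'_def by (simp only: mult_1)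
 qed
 moreover have "((\<lambda>z. \<theta> (fst z) * (ep ^ l * cutoff l (ep * (norm (snd z - x))\<^sup>2)) * f (ka (fst z)) (snd z - x)) has_derivative (\<lambda>v. F' v ep z)) (at z)" for ep z
 proof -
  have a: "((\<lambda>z :: real \<times> (real ^ 'n). \<theta> (fst z)) has_derivative (\<lambda>v. fst v * \<theta>' (fst z))) (at z)"
   by (rule has_derivative_compose[OF has_derivative_fst[OF has_derivative_ident] d1(1)])
  have n: "((\<lambda>z :: real \<times> (real ^ 'n). ep * (norm (snd z - x))\<^sup>2) has_derivative (\<lambda>v. ep * (2 * ((snd z - x) \<bullet> snd v)))) (at z)"
  proof -
   have 0: "((\<lambda>z :: real \<times> (real ^ 'n). snd z - x) has_derivative snd) (at z)"
    using has_derivative_diff[OF has_derivative_snd[OF has_derivative_ident] has_derivative_const[of x]] by simp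
   have "((\<lambda>z :: real \<times> (real ^ 'n). (snd z - x) \<bullet> (snd z - x)) has_derivative (\<lambda>v. (snd z - x) \<bullet> snd v + snd v \<bullet> (snd z - x))) (at z)"
    by (rule has_derivative_inner[OF 0 0])
   then have "((\<lambda>z :: real \<times> (real ^ 'n). (norm (snd z - x))\<^sup>2) has_derivative (\<lambda>v. 2 * ((snd z - x) \<bullet> snd v))) (at z)"
    by (simp add: power2_norm_eq_inner inner_commute[of "snd _" "snd z - x"])
   then show ?thesis by (rule has_derivative_mult_right)
  qed
  have b: "((\<lambda>z. ep ^ l * cutoff l (ep * (norm (snd z - x))\<^sup>2)) has_derivative (\<lambda>v. ep ^ l * ((ep * (2 * ((snd z - x) \<bullet> snd v))) * cutoff (Suc l) (ep * (norm (snd z - x))\<^sup>2)))) (at z)"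
   by (intro has_derivative_mult_right has_derivative_compose[OF n cutoff_deriv])
  have c: "((\<lambda>z. f (ka (fst z)) (snd z - x)) has_derivative (\<lambda>v. (fst v * ka' (fst z)) * g (ka (fst z)) (snd z - x) + (SS k. snd v $ k * f' k (ka (fst z)) (snd z - x)))) (at z)"
  proof -
   have 0: "((\<lambda>z :: real \<times> (real ^ 'n). snd z - x) has_derivative snd) (at z)"
    using has_derivative_diff[OF has_derivative_snd[OF has_derivative_ident] has_derivative_const[of x]] by simp
   have 1: "((\<lambda>z :: real \<times> (real ^ 'n). ka (fst z)) has_derivative (\<lambda>v. fst v * ka' (fst z))) (at z)"
    by (rule has_derivative_compose[OF has_derivative_fst[OF has_derivative_ident] d1(2)])
   have "((\<lambda>p. f (fst p) (snd p)) has_derivative (\<lambda>v. fst v * g (ka (fst z)) (snd z - x) + (SS k. snd v $ k * f' k (ka (fst z)) (snd z - x)))) (at (ka (fst z), snd z - x))"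
    using fg(3) ka(2) by (simp add: hk_deriv_def)
   from has_derivative_compose[OF has_derivative_Pair[OF 1 0] this] show ?thesis by simp
  qed
  show ?thesis
  proof (rule has_derivative_eq_rhs[OF has_derivative_mult[OF has_derivative_mult[OF a b] c]], rule ext)
   fix v :: "real \<times> (real ^ 'n)"
   define C where "C = cutoff l (ep * (norm (snd z - x))\<^sup>2)"
   define C' where "C' = cutoff (Suc l) (ep * (norm (snd z - x))\<^sup>2)"
   define G where "G = g (ka (fst z)) (snd z - x)"
   define H where "H = f (ka (fst z)) (snd z - x)"
   have s1: "(SS k. (2 * snd v $ k) * ((snd z - x) $ k * Bf \<theta> (Suc l) f ep z)) = 2 * ((snd z - x) \<bullet> snd v) * Bf \<theta> (Suc l) f ep z"
    by (simp add: inner_vec_def sum_distrib_left sum_distrib_right mult_ac)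
   have s2: "(SS k. snd v $ k * Bf \<theta> l (f' k) ep z) = \<theta> (fst z) * (ep ^ l * C) * (SS k. snd v $ k * f' k (ka (fst z)) (snd z - x))"
    by (simp add: Bf_def C_def sum_distrib_left mult_ac)
   show "\<theta> (fst z) * (ep ^ l * cutoff l (ep * (norm (snd z - x))\<^sup>2)) * (fst v * ka' (fst z) * g (ka (fst z)) (snd z - x) + (SS k. snd v $ k * f' k (ka (fst z)) (snd z - x))) +
    (\<theta> (fst z) * (ep ^ l * (ep * (2 * ((snd z - x) \<bullet> snd v)) * cutoff (Suc l) (ep * (norm (snd z - x))\<^sup>2))) + fst v * \<theta>' (fst z) * (ep ^ l * cutoff l (ep * (norm (snd z - x))\<^sup>2))) * f (ka (fst z)) (snd z - x)
    = F' v ep z"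
    unfolding F'_def s1 s2 unfolding Bf_def C_def[symmetric] C'_def[symmetric] G_def[symmetric] H_def[symmetric]
    by (simp add: algebra_simps)
  qed
 qed
 ultimately show ?thesis by blast
qed

lemma fam_deriv:
 fixes x :: "real ^ 'n"
 assumes ka: "smooth ka" "\<And>s. ka s > 0" and S: "closed S" and F: "fam ka x S F F0"
 shows "\<exists>F' F0'. (\<forall>v. fam ka x S (F' v) (F0' v)) \<and> (\<forall>ep z. (F ep has_derivative (\<lambda>v. F' v ep z)) (at z))"
 using F
proof induction
 case (fam_base d f \<theta> l)
 show ?case by (rule fam_base_deriv[OF ka S fam_base])
next
 case (fam_mult F F0 k)
 then obtain F' F0' where F': "\<And>v. fam ka x S (F' v) (F0' v)" "\<And>ep z. (F ep has_derivative (\<lambda>v. F' v ep z)) (at z)" by blast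
 show ?case
 proof (intro exI conjI allI)
  show "fam ka x S (\<lambda>ep z. 1 * ((snd z - x) $ k * F' v ep z) + snd v $ k * F ep z) (\<lambda>z. 1 * ((snd z - x) $ k * F0' v z) + snd v $ k * F0 z)" for v
   by (intro fam_lin fam.fam_mult F' fam_mult(1))
  fix ep z
  have "((\<lambda>z :: real \<times> (real ^ 'n). (snd z - x) $ k) has_derivative (\<lambda>v. snd v $ k)) (at z)"
  proof -
   have "((\<lambda>z :: real \<times> (real ^ 'n). snd z - x) has_derivative snd) (at z)"
    using has_derivative_diff[OF has_derivative_snd[OF has_derivative_ident] has_derivative_const[of x]] by simp
   from bounded_linear.has_derivative[OF bounded_linear_vec_nth this] show ?thesis .
  qed
  from has_derivative_mult[OF this F'(2)[of ep z]]
  show "((\<lambda>z. (snd z - x) $ k * F ep z) has_derivative (\<lambda>v. 1 * ((snd z - x) $ k * F' v ep z) + snd v $ k * F ep z)) (at z)"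
   by simp
 qed
next
 case (fam_lin F F0 G G0 a b)
 then obtain F' F0' G' G0' where F': "\<And>v. fam ka x S (F' v) (F0' v)" "\<And>ep z. (F ep has_derivative (\<lambda>v. F' v ep z)) (at z)"
  and G': "\<And>v. fam ka x S (G' v) (G0' v)" "\<And>ep z. (G ep has_derivative (\<lambda>v. G' v ep z)) (at z)" by blast
 show ?case
 proof (intro exI conjI allI)
  show "fam ka x S (\<lambda>ep z. a * F' v ep z + b * G' v ep z) (\<lambda>z. a * F0' v z + b * G0' v z)" for v
   by (intro fam.fam_lin F' G')
  show "((\<lambda>z. a * F ep z + b * G ep z) has_derivative (\<lambda>v. a * F' v ep z + b * G' v ep z)) (at z)" for ep z
   by (intro has_derivative_add has_derivative_mult_right F' G')
 qed
qed

section \<open>Derivatives, supports and uniform bounds of the cut-off families\<close>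

abbreviation dd :: "'a \<Rightarrow> ('a :: real_normed_vector \<Rightarrow> 'b :: real_normed_vector) \<Rightarrow> 'a \<Rightarrow> 'b"
 where "dd v f z \<equiv> frechet_derivative f (at z) v"

lemma fam_dd:
 fixes x :: "real ^ 'n"
 assumes ka: "smooth ka" "\<And>s. ka s > 0" and S: "closed S" and F: "fam ka x S F F0"
 shows "fam ka x S (\<lambda>ep z. dd v (F ep) z) (\<lambda>z. dd v F0 z)" "F ep differentiable (at z)" "F0 differentiable (at z)"
proof -
 obtain F' F0' where F': "\<And>v. fam ka x S (F' v) (F0' v)" "\<And>ep z. (F ep has_derivative (\<lambda>v. F' v ep z)) (at z)"
  using fam_deriv[OF assms] by blast
 show "F ep differentiable (at z)" using F'(2)[of ep z] unfolding differentiable_def by blast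
 have D: "(F0 has_derivative (\<lambda>v. F0' v z)) (at z)" for z
 proof -
  \<comment> \<open>Small enough that z lies strictly inside the region where \<open>F ep\<close>
    and \<open>F0\<close> coincide, so they share the derivative at z.\<close>
  define ep where "ep = 1 / (1 + (norm (snd z - x))\<^sup>2)"
  have e: "ep * (norm (snd z - x))\<^sup>2 < 1" by (simp add: ep_def divide_less_eq add_pos_nonneg)
  define U where "U = {z :: real \<times> (real ^ 'n). ep * (norm (snd z - x))\<^sup>2 < 1}"
  have "open U" unfolding U_def by (intro open_Collect_less continuous_intros)
  moreover have "z \<in> U" using e by (simp add: U_def)
  ultimately have "(F0 has_derivative (\<lambda>v. F' v ep z)) (at z)"
   by (rule has_derivative_transform_within_open[OF F'(2)]) (auto simp: U_def intro!: fam_eq_limit[OF F])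
  moreover have "F' v ep z = F0' v z" for v by (rule fam_eq_limit[OF F'(1) e])
  ultimately show ?thesis by simp
 qed
 from D[of z] show "F0 differentiable (at z)" unfolding differentiable_def by blast
 have "dd v (F ep) z = F' v ep z" for ep z
  using frechet_derivative_at[OF F'(2)[of ep z]] by metis
 moreover have "dd v F0 z = F0' v z" for z
  using frechet_derivative_at[OF D[of z]] by metis
 ultimately show "fam ka x S (\<lambda>ep z. dd v (F ep) z) (\<lambda>z. dd v F0 z)"
  using F'(1)[of v] by simp
qed

lemma fam_smooth:
 fixes x :: "real ^ 'n"
 assumes ka: "smooth ka" "\<And>s. ka s > 0" and S: "closed S" and F: "fam ka x S F F0"
 shows "smooth (F ep)" "smooth F0"
proof -
 have "C_k k (F ep) \<and> C_k k F0" for k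
  using F
 proof (induction k arbitrary: F F0)
  case 0
  then show ?case using fam_dd(2,3)[OF ka S 0]
   by (simp add: continuous_at_imp_continuous_on differentiable_imp_continuous_within)
 next
  case (Suc k)
  then show ?case using fam_dd[OF ka S Suc.prems] by auto
 qed
 then show "smooth (F ep)" "smooth F0" by (auto simp: smooth_def)
qed

lemma fam_test_function:
 fixes x :: "real ^ 'n"
 assumes ka: "smooth ka" "\<And>s. ka s > 0" and S: "compact S" and F: "fam ka x S F F0" and e: "ep > 0"
 shows "test_function (F ep)" "closure {z. F ep z \<noteq> 0} \<subseteq> S \<times> UNIV"
proof -
 define R where "R = sqrt (2 / ep)"
 have sub: "{z. F ep z \<noteq> 0} \<subseteq> S \<times> cball x R"
 proof clarify
  fix s y assume nz: "F ep (s, y) \<noteq> 0"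
  then have s: "s \<in> S" using fam_support[OF F, of "(s, y)" ep] by auto
  have "ep * (norm (y - x))\<^sup>2 \<le> 2" using nz fam_support[OF F, of "(s, y)" ep] by (cases "ep * (norm (y - x))\<^sup>2 > 2") auto
  then have "(norm (y - x))\<^sup>2 \<le> 2 / ep" using e by (simp add: field_simps)
  then have "norm (y - x) \<le> R" unfolding R_def by (rule real_le_rsqrt)
  then show "s \<in> S \<and> y \<in> cball x R" using s by (simp add: dist_norm norm_minus_commute)
 qed
 have c: "compact (S \<times> cball x R)" using S by (intro compact_Times) auto
 have cl: "closure {z. F ep z \<noteq> 0} \<subseteq> S \<times> cball x R"
  using sub compact_imp_closed[OF c] by (rule closure_minimal)
 then show "closure {z. F ep z \<noteq> 0} \<subseteq> S \<times> UNIV" by auto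
 have "compact ((S \<times> cball x R) \<inter> closure {z. F ep z \<noteq> 0})" using c by (intro compact_Int_closed) auto
 then have "compact (closure {z. F ep z \<noteq> 0})" using cl by (simp add: Int_absorb1)
 then show "test_function (F ep)" unfolding test_function_def
  using fam_smooth(1)[OF ka compact_imp_closed[OF S] F] by simp
qed

text \<open>Uniformity in the cut-off is the point: powers of \<open>ep\<close> are at most 1 and
  each derivative of the profile is bounded, while factors \<open>(snd z - x) $ k\<close> cost only
  a power of 1 + |y - x|^2.\<close>

lemma fam_poly_bound:
 fixes x :: "real ^ 'n"
 assumes F: "fam ka x S F F0" and ka: "\<And>s. s \<in> S \<Longrightarrow> a \<le> ka s \<and> ka s \<le> b" "0 < a" "a \<le> b" and S: "compact S"
 shows "\<exists>C\<ge>0. \<exists>N. \<forall>ep\<in>{0..1}. \<forall>z. \<bar>F ep z\<bar> \<le> C * ((1 + (norm (snd z - x))\<^sup>2) ^ N * Gk (2 * b) (snd z - x))"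
 using F
proof induction
 case (fam_base d f \<theta> l)
 obtain C where C: "C \<ge> 0" "\<And>s z. a \<le> s \<Longrightarrow> s \<le> b \<Longrightarrow> \<bar>f s z\<bar> \<le> C * Gk (2 * b) z"
  by (rule hk_local_bound[OF fam_base(1) ka(2,3)]) iprover
 obtain B where B: "\<And>z. \<bar>cutoff l z\<bar> \<le> B" using cutoff_bounded by blast
 have "compact (\<theta> ` S)" by (intro compact_continuous_image continuous_on_subset[OF smooth_D(3)[OF fam_base(2)]] S) auto
 then have "bounded (\<theta> ` S)" by (rule compact_imp_bounded)
 then obtain T where "\<forall>y\<in>\<theta> ` S. norm y \<le> T" unfolding bounded_iff by blast
 then have T: "\<And>s. s \<in> S \<Longrightarrow> \<bar>\<theta> s\<bar> \<le> T" by auto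
 have BT: "B \<ge> 0" using B[of 0] by linarith
 show ?case
 proof (intro exI conjI ballI allI)
  show "\<bar>T\<bar> * B * C \<ge> 0" using C BT by simp
  fix ep :: real and z :: "real \<times> (real ^ 'n)" assume e: "ep \<in> {0..1}"
  have G: "0 \<le> Gk (2 * b) (snd z - x)" by (rule heat_kernel_nonneg)
  show "\<bar>\<theta> (fst z) * (ep ^ l * cutoff l (ep * (norm (snd z - x))\<^sup>2)) * f (ka (fst z)) (snd z - x)\<bar>
   \<le> \<bar>T\<bar> * B * C * ((1 + (norm (snd z - x))\<^sup>2) ^ 0 * Gk (2 * b) (snd z - x))"
  proof (cases "fst z \<in> S")
   case True
   have "\<bar>ep ^ l * cutoff l (ep * (norm (snd z - x))\<^sup>2)\<bar> \<le> 1 * B"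
    unfolding abs_mult using e B by (intro mult_mono) (auto simp: power_le_one)
   then have "\<bar>\<theta> (fst z)\<bar> * \<bar>ep ^ l * cutoff l (ep * (norm (snd z - x))\<^sup>2)\<bar> * \<bar>f (ka (fst z)) (snd z - x)\<bar>
    \<le> \<bar>T\<bar> * (1 * B) * (C * Gk (2 * b) (snd z - x))"
    using T[OF True] C BT ka(1)[OF True] by (intro mult_mono) (auto simp: heat_kernel_nonneg)
   then show ?thesis by (simp add: abs_mult mult_ac)
  qed (use fam_base(3) C BT G in auto)
 qed
next
 case (fam_mult F F0 k)
 then obtain C N where C: "C \<ge> 0" "\<And>ep z. ep \<in> {0..1} \<Longrightarrow> \<bar>F ep z\<bar> \<le> C * ((1 + (norm (snd z - x))\<^sup>2) ^ N * Gk (2 * b) (snd z - x))" by meson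
 show ?case
 proof (intro exI[of _ C] conjI C exI[of _ "Suc N"] ballI allI)
  fix ep :: real and z :: "real \<times> (real ^ 'n)" assume e: "ep \<in> {0..1}"
  have "\<bar>(snd z - x) $ k\<bar> \<le> 1 + (norm (snd z - x))\<^sup>2"
  proof -
   have "norm (snd z - x) \<le> 1 + (norm (snd z - x))\<^sup>2"
    using zero_le_power2[of "norm (snd z - x) - 1/2"] by (simp add: power2_eq_square algebra_simps)
   then show ?thesis using component_le_norm_cart[of "snd z - x" k] by linarith
  qed
  then have "\<bar>(snd z - x) $ k\<bar> * \<bar>F ep z\<bar> \<le> (1 + (norm (snd z - x))\<^sup>2) * (C * ((1 + (norm (snd z - x))\<^sup>2) ^ N * Gk (2 * b) (snd z - x)))"
   by (intro mult_mono C e) auto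
  then show "\<bar>(snd z - x) $ k * F ep z\<bar> \<le> C * ((1 + (norm (snd z - x))\<^sup>2) ^ Suc N * Gk (2 * b) (snd z - x))"
   by (simp add: abs_mult mult_ac)
 qed
next
 case (fam_lin F F0 G G0 c1 c2)
 then obtain C N C' N' where C: "C \<ge> 0" "\<And>ep z. ep \<in> {0..1} \<Longrightarrow> \<bar>F ep z\<bar> \<le> C * ((1 + (norm (snd z - x))\<^sup>2) ^ N * Gk (2 * b) (snd z - x))"
  and C': "C' \<ge> 0" "\<And>ep z. ep \<in> {0..1} \<Longrightarrow> \<bar>G ep z\<bar> \<le> C' * ((1 + (norm (snd z - x))\<^sup>2) ^ N' * Gk (2 * b) (snd z - x))" by meson
 show ?case
 proof (intro exI[of _ "\<bar>c1\<bar> * C + \<bar>c2\<bar> * C'"] conjI exI[of _ "N + N'"] ballI allI)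
  fix ep :: real and z :: "real \<times> (real ^ 'n)" assume e: "ep \<in> {0..1}"
  define q where "q = 1 + (norm (snd z - x))\<^sup>2"
  have q: "q ^ N \<le> q ^ (N + N')" "q ^ N' \<le> q ^ (N + N')" "q \<ge> 0" unfolding q_def by (auto intro!: power_increasing)
  have "\<bar>F ep z\<bar> \<le> C * (q ^ (N + N') * Gk (2 * b) (snd z - x))"
   unfolding q_def by (rule order.trans[OF C(2)[OF e]]) (intro mult_left_mono mult_right_mono q[unfolded q_def] C heat_kernel_nonneg)
  moreover have "\<bar>G ep z\<bar> \<le> C' * (q ^ (N + N') * Gk (2 * b) (snd z - x))"
   unfolding q_def by (rule order.trans[OF C'(2)[OF e]]) (intro mult_left_mono mult_right_mono q[unfolded q_def] C' heat_kernel_nonneg)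
  ultimately have "\<bar>c1\<bar> * \<bar>F ep z\<bar> + \<bar>c2\<bar> * \<bar>G ep z\<bar> \<le> \<bar>c1\<bar> * (C * (q ^ (N + N') * Gk (2 * b) (snd z - x))) + \<bar>c2\<bar> * (C' * (q ^ (N + N') * Gk (2 * b) (snd z - x)))"
   by (intro add_mono mult_left_mono) auto
  moreover have "\<bar>c1 * F ep z + c2 * G ep z\<bar> \<le> \<bar>c1\<bar> * \<bar>F ep z\<bar> + \<bar>c2\<bar> * \<bar>G ep z\<bar>"
   by (metis abs_mult abs_triangle_ineq)
  ultimately show "\<bar>c1 * F ep z + c2 * G ep z\<bar> \<le> (\<bar>c1\<bar> * C + \<bar>c2\<bar> * C') * ((1 + (norm (snd z - x))\<^sup>2) ^ (N + N') * Gk (2 * b) (snd z - x))"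
   unfolding q_def by (simp add: algebra_simps)
 qed (use C C' in auto)
qed

text \<open>The Gaussian time is doubled twice, once in \<open>hk_local_bound\<close> and once in
  \<open>gauss_absorb\<close> to swallow the polynomial; hence \<open>4 * b\<close>.\<close>

lemma fam_bound:
 fixes x :: "real ^ 'n"
 assumes F: "fam ka x S F F0" and ka: "\<And>s. s \<in> S \<Longrightarrow> a \<le> ka s \<and> ka s \<le> b" "0 < a" "a \<le> b" and S: "compact S"
 obtains C where "C \<ge> 0" "\<And>ep s y. 0 \<le> ep \<Longrightarrow> ep \<le> 1 \<Longrightarrow> \<bar>F ep (s, y)\<bar> \<le> C * Gk (4 * b) (y - x)"
  "\<And>s y. \<bar>F0 (s, y)\<bar> \<le> C * Gk (4 * b) (y - x)"
proof -
 obtain C N where C: "C \<ge> 0" "\<And>ep z. ep \<in> {0..1} \<Longrightarrow> \<bar>F ep z\<bar> \<le> C * ((1 + (norm (snd z - x))\<^sup>2) ^ N * Gk (2 * b) (snd z - x))"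
  using fam_poly_bound[OF assms] by meson
 obtain C' where C': "C' \<ge> 0" "\<And>y :: real ^ 'n. (1 + (norm y)\<^sup>2) ^ N * Gk (2 * b) y \<le> C' * Gk (2 * (2 * b)) y"
  using gauss_absorb[of "2 * b" N, where 'n='n] ka by auto
 have b: "\<bar>F ep (s, y)\<bar> \<le> C * C' * Gk (4 * b) (y - x)" if "0 \<le> ep" "ep \<le> 1" for ep s y
 proof -
  have "\<bar>F ep (s, y)\<bar> \<le> C * (C' * Gk (2 * (2 * b)) (y - x))"
  proof (rule order.trans)
   show "\<bar>F ep (s, y)\<bar> \<le> C * ((1 + (norm (y - x))\<^sup>2) ^ N * Gk (2 * b) (y - x))"
    using C(2)[of ep "(s, y)"] that by simp
  qed (intro mult_left_mono C C')
  then show ?thesis by (simp add: mult.assoc)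
 qed
 show ?thesis
 proof (rule that[OF _ b])
  show "C * C' \<ge> 0" using C C' by simp
  show "\<bar>F0 (s, y)\<bar> \<le> C * C' * Gk (4 * b) (y - x)" for s y
   \<comment> \<open>At \<open>ep = 0\<close> the family equals its limit, so the uniform bound
     covers \<open>F0\<close> as well.\<close>
   using b[of 0 s y] fam_eq_limit[OF F, of 0 "(s, y)"] by simp
 qed
qed

section \<open>Test functions and weak derivatives\<close>

lemma vec_lambda_has_derivative:
 fixes \<phi> :: "'n::finite \<Rightarrow> 'a :: real_normed_vector \<Rightarrow> real"
 assumes "\<And>j. (\<phi> j has_derivative \<phi>' j) (at z)"
 shows "((\<lambda>z. \<chi> j. \<phi> j z) has_derivative (\<lambda>v. \<chi> j. \<phi>' j v)) (at z)"
proof -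
 have "((\<lambda>z. SS j. \<phi> j z *\<^sub>R axis j (1 :: real)) has_derivative (\<lambda>v. SS j. \<phi>' j v *\<^sub>R axis j 1)) (at z)"
  by (intro has_derivative_sum has_derivative_scaleR_left assms)
 moreover have "(SS j. c j *\<^sub>R axis j (1 :: real)) = (\<chi> j. c j)" for c :: "'n \<Rightarrow> real"
  by (simp add: vec_eq_iff axis_def if_distrib[of "(*) _"] sum.delta cong: if_cong)
 ultimately show ?thesis by simp
qed

lemma smooth_vec_lambda:
 fixes \<phi> :: "'n::finite \<Rightarrow> 'a :: real_normed_vector \<Rightarrow> real"
 assumes "\<And>j. smooth (\<phi> j)" shows "smooth (\<lambda>z. \<chi> j. \<phi> j z)"
proof -
 have "(\<And>j. C_k k (\<phi> j)) \<Longrightarrow> C_k k (\<lambda>z. \<chi> j. \<phi> j z)" for k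
 proof (induction k arbitrary: \<phi>)
  case 0
  then show ?case by (auto intro!: continuous_intros)
 next
  case (Suc k)
  show ?case by (rule C_k_I[OF vec_lambda_has_derivative[OF C_k_D(1)[OF Suc.prems]]]) (rule Suc.IH[OF C_k_D(2)[OF Suc.prems]])
 qed
 then show ?thesis using assms by (auto simp: smooth_def)
qed

lemma dd_vec_lambda:
 fixes \<phi> :: "'n::finite \<Rightarrow> 'a :: real_normed_vector \<Rightarrow> real"
 assumes "\<And>j. \<phi> j differentiable (at z)"
 shows "dd v (\<lambda>z. \<chi> j. \<phi> j z) z = (\<chi> j. dd v (\<phi> j) z)"
proof -
 have "((\<lambda>z. \<chi> j. \<phi> j z) has_derivative (\<lambda>v. \<chi> j. dd v (\<phi> j) z)) (at z)"
  using assms by (intro vec_lambda_has_derivative) (simp add: frechet_derivative_works[symmetric])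
 from frechet_derivative_at[OF this] show ?thesis by metis
qed

lemma smooth_differentiable: "smooth f \<Longrightarrow> f differentiable (at z)"
 using smooth_D(1) by (auto simp: differentiable_def)

lemma partial_slice:
 fixes f :: "real \<times> (real ^ 'n) \<Rightarrow> 'b :: real_normed_vector"
 assumes "f differentiable (at (s, y))"
 shows "partial k (\<lambda>y. f (s, y)) y = dd (0, axis k 1) f (s, y)"
proof -
 have "(f has_derivative (\<lambda>v. dd v f (s, y))) (at (s, y))" using assms by (simp add: frechet_derivative_works[symmetric])
 moreover have "((\<lambda>y. (s, y)) has_derivative (\<lambda>h. (0, h))) (at y)"
  by (intro has_derivative_Pair has_derivative_ident has_derivative_const)
 ultimately have "((\<lambda>y. f (s, y)) has_derivative (\<lambda>h. dd (0, h) f (s, y))) (at y)"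
  by (rule has_derivative_compose[rotated])
 from frechet_derivative_at[OF this] show ?thesis unfolding partial_def by metis
qed

lemma vector_derivative_slice:
 fixes f :: "real \<times> (real ^ 'n) \<Rightarrow> 'b :: real_normed_vector"
 assumes "f differentiable (at (s, y))"
 shows "vector_derivative (\<lambda>s. f (s, y)) (at s) = dd (1, 0) f (s, y)"
proof -
 have D: "(f has_derivative (\<lambda>v. dd v f (s, y))) (at (s, y))" using assms by (simp add: frechet_derivative_works[symmetric])
 moreover have "((\<lambda>s. (s, y)) has_derivative (\<lambda>h. (h, 0))) (at s)"
  by (intro has_derivative_Pair has_derivative_ident has_derivative_const)
 ultimately have "((\<lambda>s. f (s, y)) has_derivative (\<lambda>h. dd (h, 0) f (s, y))) (at s)"
  by (rule has_derivative_compose[rotated])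
 moreover have "(\<lambda>h. dd (h, 0) f (s, y)) = (\<lambda>h. h *\<^sub>R dd (1, 0) f (s, y))"
 proof (rule ext)
  fix h show "dd (h, 0) f (s, y) = h *\<^sub>R dd (1, 0) f (s, y)"
   using linear_cmul[OF has_derivative_linear[OF D], of h "(1, 0)"] by simp
 qed
 ultimately have "((\<lambda>s. f (s, y)) has_vector_derivative dd (1, 0) f (s, y)) (at s)"
  unfolding has_vector_derivative_def by (simp only:)
 then show ?thesis by (rule vector_derivative_at)
qed

lemma smooth_slice:
 fixes f :: "real \<times> (real ^ 'n) \<Rightarrow> 'b :: real_normed_vector"
 assumes "smooth f" shows "smooth (\<lambda>y. f (s, y))"
proof -
 have "bounded_linear (\<lambda>y :: real ^ 'n. (0 :: real, y))"
  by (intro bounded_linear_Pair bounded_linear_zero bounded_linear_ident)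
 from smooth_affine[OF assms this, of "(s, 0)"] show ?thesis by simp
qed

lemma test_function_slice:
 fixes f :: "real \<times> (real ^ 'n) \<Rightarrow> 'b :: real_normed_vector"
 assumes "test_function f" shows "test_function (\<lambda>y. f (s, y))"
proof -
 have c: "compact (snd ` closure {z. f z \<noteq> 0})"
  using assms by (intro compact_continuous_image continuous_intros) (auto simp: test_function_def)
 have "{y. f (s, y) \<noteq> 0} \<subseteq> snd ` closure {z. f z \<noteq> 0}"
 proof
  fix y assume "y \<in> {y. f (s, y) \<noteq> 0}"
  then have "(s, y) \<in> closure {z. f z \<noteq> 0}" by (intro subsetD[OF closure_subset]) simp
  then show "y \<in> snd ` closure {z. f z \<noteq> 0}" by force
 qed
 then have "closure {y. f (s, y) \<noteq> 0} \<subseteq> snd ` closure {z. f z \<noteq> 0}"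
  using compact_imp_closed[OF c] by (rule closure_minimal)
 then have "compact (closure {y. f (s, y) \<noteq> 0})"
  using c compact_Int_closed[OF c closed_closure, of "{y. f (s, y) \<noteq> 0}"] by (simp add: Int_absorb1)
 then show ?thesis using assms smooth_slice[of f s] by (simp add: test_function_def)
qed

lemma test_function_bounded:
 fixes f :: "'a :: real_normed_vector \<Rightarrow> real"
 assumes "test_function f" obtains B where "\<And>x. \<bar>f x\<bar> \<le> B" "B \<ge> 0"
proof -
 have "compact (f ` closure {x. f x \<noteq> 0})"
  using assms by (intro compact_continuous_image continuous_on_subset[OF smooth_D(3)[of f]]) (auto simp: test_function_def)
 then have "bounded (f ` closure {x. f x \<noteq> 0})" by (rule compact_imp_bounded)
 then obtain B where B: "\<forall>y\<in>f ` closure {x. f x \<noteq> 0}. norm y \<le> B" unfolding bounded_iff by blast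
 have "\<bar>f x\<bar> \<le> max B 0" for x
 proof (cases "f x = 0")
  case False
  then have "x \<in> closure {x. f x \<noteq> 0}" by (intro subsetD[OF closure_subset]) simp
  then show ?thesis using B by force
 qed simp
 then show ?thesis using that[of "max B 0"] by simp
qed

lemma test_function_mult:
 fixes f g :: "'a :: euclidean_space \<Rightarrow> real"
 assumes f: "test_function f" and g: "smooth g"
 shows "test_function (\<lambda>x. f x * g x)"
proof -
 have c: "compact (closure {x. f x \<noteq> 0})" using f by (simp add: test_function_def)
 have "closure {x. f x * g x \<noteq> 0} \<subseteq> closure {x. f x \<noteq> 0}" by (intro closure_mono) auto
 then have "compact (closure {x. f x * g x \<noteq> 0})"
  using compact_Int_closed[OF c closed_closure, of "{x. f x * g x \<noteq> 0}"] by (simp add: Int_absorb1)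
 then show ?thesis using f g by (simp add: test_function_def smooth_mult)
qed

lemma test_function_partial:
 fixes f :: "real ^ 'n \<Rightarrow> real"
 assumes f: "test_function f" shows "test_function (partial k f)"
proof -
 have c: "compact (closure {x. f x \<noteq> 0})" using f by (simp add: test_function_def)
 have "partial k f x = 0" if "x \<notin> closure {x. f x \<noteq> 0}" for x
 proof -
  have "(f has_derivative (\<lambda>v. 0)) (at x)"
   by (rule has_derivative_transform_within_open[OF has_derivative_const[of 0], of "- closure {x. f x \<noteq> 0}"])
    (use that closure_subset[of "{x. f x \<noteq> 0}"] in auto)
  from frechet_derivative_at[OF this] show ?thesis unfolding partial_def by metis
 qed
 then have "{x. partial k f x \<noteq> 0} \<subseteq> closure {x. f x \<noteq> 0}" by auto
 then have "closure {x. partial k f x \<noteq> 0} \<subseteq> closure {x. f x \<noteq> 0}" by (rule closure_minimal) simp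
 then have "compact (closure {x. partial k f x \<noteq> 0})"
  using compact_Int_closed[OF c closed_closure, of "{x. partial k f x \<noteq> 0}"] by (simp add: Int_absorb1)
 moreover have "smooth (partial k f)"
  unfolding partial_def[abs_def] using f by (intro smooth_D(2)) (simp add: test_function_def)
 ultimately show ?thesis by (simp add: test_function_def)
qed

lemma dd_diff:
 "f differentiable (at z) \<Longrightarrow> g differentiable (at z) \<Longrightarrow> dd v (\<lambda>z. f z - g z) z = dd v f z - dd v g z"
proof -
 assume "f differentiable (at z)" "g differentiable (at z)"
 then have "((\<lambda>z. f z - g z) has_derivative (\<lambda>v. dd v f z - dd v g z)) (at z)"
  by (intro has_derivative_diff) (simp_all add: frechet_derivative_works[symmetric])
 from frechet_derivative_at[OF this] show ?thesis by metis
qed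

lemma dd_cmult:
 fixes f :: "'a :: real_normed_vector \<Rightarrow> real"
 assumes "f differentiable (at z)" shows "dd v (\<lambda>z. c * f z) z = c * dd v f z"
proof -
 have "((\<lambda>z. c * f z) has_derivative (\<lambda>v. c * dd v f z)) (at z)"
  using assms by (intro has_derivative_mult_right) (simp add: frechet_derivative_works[symmetric])
 from frechet_derivative_at[OF this] show ?thesis by metis
qed

lemma dd_sum:
 fixes f :: "'i \<Rightarrow> 'a :: real_normed_vector \<Rightarrow> real"
 assumes "\<And>i. i \<in> I \<Longrightarrow> f i differentiable (at z)" shows "dd v (\<lambda>z. \<Sum>i\<in>I. f i z) z = (\<Sum>i\<in>I. dd v (f i) z)"
proof -
 have "((\<lambda>z. \<Sum>i\<in>I. f i z) has_derivative (\<lambda>v. \<Sum>i\<in>I. dd v (f i) z)) (at z)"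
  using assms by (intro has_derivative_sum) (simp add: frechet_derivative_works[symmetric])
 from frechet_derivative_at[OF this] show ?thesis by metis
qed

lemma dd_commute:
 fixes f :: "'a :: real_normed_vector \<Rightarrow> real"
 assumes "smooth f" shows "dd v (\<lambda>z. dd w f z) z = dd w (\<lambda>z. dd v f z) z"
 using C_k_symmetric[of f w z v] assms by (simp add: smooth_def)

section \<open>Borel representatives of Lebesgue measurable fields\<close>

text \<open>Elements of the function spaces are only Lebesgue measurable, whereas Fubini is applied
  on products of \<open>lborel\<close>. Every component is therefore replaced by a Borel function
  equal to it almost everywhere.\<close>

definition borel_rep :: "(real ^ 'n \<Rightarrow> real) \<Rightarrow> real ^ 'n \<Rightarrow> real"
 where "borel_rep f = (SOME g. g \<in> BM borel \<and> (AE x in lborel. f x = g x))"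

lemma borel_rep:
 assumes "f \<in> BM lebesgue"
 shows "borel_rep f \<in> BM borel" "AE x in lborel. f x = borel_rep f x" "AE x in lebesgue. f x = borel_rep f x"
proof -
 have "\<exists>g. g \<in> BM borel \<and> (AE x in lborel. f x = g x)"
  using completion_ex_borel_measurable_real[OF assms] by auto
 then have *: "borel_rep f \<in> BM borel \<and> (AE x in lborel. f x = borel_rep f x)"
  unfolding borel_rep_def by (rule someI_ex)
 then show "borel_rep f \<in> BM borel" "AE x in lborel. f x = borel_rep f x" by auto
 then show "AE x in lebesgue. f x = borel_rep f x" by (simp add: AE_completion_iff)
qed

lemma lebesgue_integral_AE_borel:
 fixes f g :: "'a :: euclidean_space \<Rightarrow> 'b :: {banach, second_countable_topology}"
 assumes [measurable]: "g \<in> BM borel" and ae: "AE x in lebesgue. f x = g x"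
  and f: "f \<in> BM lebesgue"
 shows "(LINT x|lebesgue. f x) = (LBINT x. g x)" "integrable lebesgue f \<longleftrightarrow> Li g"
proof -
 have g: "g \<in> BM lebesgue" by (rule measurable_completion) simp
 have "(LINT x|lebesgue. f x) = (LINT x|lebesgue. g x)" by (rule integral_cong_AE[OF f g ae])
 then show "(LINT x|lebesgue. f x) = (LBINT x. g x)" by (simp add: integral_completion)
 have "integrable lebesgue f \<longleftrightarrow> integrable lebesgue g" by (rule integrable_cong_AE[OF f g ae])
 then show "integrable lebesgue f \<longleftrightarrow> Li g" by (simp add: integrable_completion)
qed

lemma borel_rep_mult:
 assumes f: "f \<in> BM lebesgue" and g [measurable]: "g \<in> BM borel"
 shows "(LINT x|lebesgue. f x * g x) = (LBINT x. borel_rep f x * g x)"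
  "integrable lebesgue (\<lambda>x. f x * g x) \<longleftrightarrow> Li (\<lambda>x. borel_rep f x * g x)"
proof -
 note [measurable] = borel_rep(1)[OF f]
 have ae: "AE x in lebesgue. f x * g x = borel_rep f x * g x" using borel_rep(3)[OF f] by eventually_elim simp
 have g': "g \<in> BM lebesgue" by (rule measurable_completion) simp
 have m: "(\<lambda>x. f x * g x) \<in> BM lebesgue" by (rule borel_measurable_times[OF f g'])
 have b: "(\<lambda>x. borel_rep f x * g x) \<in> BM borel" by measurable
 show "(LINT x|lebesgue. f x * g x) = (LBINT x. borel_rep f x * g x)"
  "integrable lebesgue (\<lambda>x. f x * g x) \<longleftrightarrow> Li (\<lambda>x. borel_rep f x * g x)"
  by (rule lebesgue_integral_AE_borel[OF b ae m])+
qed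

lemma vec_nth_measurable:
 assumes "f \<in> BM M" shows "(\<lambda>x. (f x :: real ^ 'n) $ j) \<in> BM M"
 by (rule measurable_compose[OF assms borel_measurable_continuous_onI]) (auto intro: continuous_intros)

lemma Lp_space_2_rep:
 fixes f :: "real ^ 'n \<Rightarrow> real ^ 'm"
 assumes "f \<in> Lp_space 2" shows "L2 (borel_rep (\<lambda>x. f x $ j))" "(\<lambda>x. f x $ j) \<in> BM lebesgue"
  "(LBINT x. (borel_rep (\<lambda>x. f x $ j) x)\<^sup>2) \<le> (Lp_norm 2 f)\<^sup>2"
proof -
 have f: "f \<in> BM lebesgue" "integrable lebesgue (\<lambda>x. norm (f x) powr 2)" using assms by (auto simp: Lp_space_def)
 show m: "(\<lambda>x. f x $ j) \<in> BM lebesgue" by (rule vec_nth_measurable[OF f(1)])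
 note [measurable] = borel_rep(1)[OF m]
 have ae: "AE x in lebesgue. (f x $ j)\<^sup>2 = (borel_rep (\<lambda>x. f x $ j) x)\<^sup>2" using borel_rep(3)[OF m] by eventually_elim simp
 have m2: "(\<lambda>x. (f x $ j)\<^sup>2) \<in> BM lebesgue" using m by (rule borel_measurable_power)
 have b: "(f x $ j)\<^sup>2 \<le> norm (f x) powr 2" for x
  using component_le_norm_cart[of "f x" j] by (simp add: abs_le_square_iff[symmetric] powr_numeral)
 have i: "integrable lebesgue (\<lambda>x. (f x $ j)\<^sup>2)"
  by (rule Bochner_Integration.integrable_bound[OF f(2) m2]) (use b in "auto intro!: AE_I2")
 then have "Li (\<lambda>x. (borel_rep (\<lambda>x. f x $ j) x)\<^sup>2)"
  using lebesgue_integral_AE_borel(2)[OF _ ae m2] by simp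
 then show "L2 (borel_rep (\<lambda>x. f x $ j))" by (simp add: L2_def)
 have "(LBINT x. (borel_rep (\<lambda>x. f x $ j) x)\<^sup>2) = (LINT x|lebesgue. (f x $ j)\<^sup>2)"
  using lebesgue_integral_AE_borel(1)[OF _ ae m2] by simp
 also have "\<dots> \<le> (LINT x|lebesgue. norm (f x) powr 2)" by (rule integral_mono[OF i f(2) b])
 also have "\<dots> = (Lp_norm 2 f)\<^sup>2"
  by (simp add: Lp_norm_def powr_half_sqrt real_sqrt_pow2)
 finally show "(LBINT x. (borel_rep (\<lambda>x. f x $ j) x)\<^sup>2) \<le> (Lp_norm 2 f)\<^sup>2" .
qed

lemma lebesgue_inner_integral:
 fixes f :: "real ^ 'n \<Rightarrow> real ^ 'm"
 assumes "\<And>j. integrable lebesgue (\<lambda>x. f x $ j * g x $ j)"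
 shows "(LINT x|lebesgue. f x \<bullet> g x) = (SS j. LINT x|lebesgue. f x $ j * g x $ j)"
 unfolding inner_vec_def using assms by simp

lemma L2_pair_rep:
 fixes f :: "real ^ 'n \<Rightarrow> real ^ 'n"
 assumes f: "f \<in> Lp_space 2" and g: "\<And>j. L2 (\<lambda>x. g x $ j)"
 shows "L2_pair f g = (SS j. LBINT x. borel_rep (\<lambda>x. f x $ j) x * g x $ j)"
proof -
 have m: "(\<lambda>x. g x $ j) \<in> BM borel" for j using L2_measurable[OF g] .
 have "integrable lebesgue (\<lambda>x. f x $ j * g x $ j)" for j
  unfolding borel_rep_mult(2)[OF Lp_space_2_rep(2)[OF f] m] by (intro L2_mult Lp_space_2_rep f g)
 then show ?thesis unfolding L2_pair_def by (simp add: lebesgue_inner_integral borel_rep_mult(1)[OF Lp_space_2_rep(2)[OF f] m])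
qed

lemma smooth_norm_square: "smooth (\<lambda>y :: real ^ 'n. (norm y)\<^sup>2)"
proof -
 have "smooth (\<lambda>y :: real ^ 'n. SS k. y $ k * y $ k)"
  by (intro smooth_sum smooth_mult smooth_bounded_linear bounded_linear_vec_nth)
 then show ?thesis by (simp add: power2_norm_eq_inner inner_vec_def)
qed

lemma test_function_cutoff:
 fixes g :: "real ^ 'n \<Rightarrow> real"
 assumes "smooth g" "ep > 0"
 shows "test_function (\<lambda>y. cutoff 0 (ep * (norm y)\<^sup>2) * g y)"
proof (rule test_function_mult[OF _ assms(1)])
 have s: "smooth (\<lambda>y :: real ^ 'n. cutoff 0 (ep * (norm y)\<^sup>2))"
  by (rule smooth_compose_real[OF cutoff_smooth smooth_mult[OF smooth_const smooth_norm_square]])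
 have sub: "{y :: real ^ 'n. cutoff 0 (ep * (norm y)\<^sup>2) \<noteq> 0} \<subseteq> cball 0 (sqrt (2 / ep))"
 proof
  fix y :: "real ^ 'n" assume "y \<in> {y. cutoff 0 (ep * (norm y)\<^sup>2) \<noteq> 0}"
  then have "ep * (norm y)\<^sup>2 \<le> 2" using cutoff_eq_0[of "ep * (norm y)\<^sup>2" 0] by (cases "ep * (norm y)\<^sup>2 > 2") auto
  then have "(norm y)\<^sup>2 \<le> 2 / ep" using assms(2) by (simp add: field_simps)
  then have "norm y \<le> sqrt (2 / ep)" by (rule real_le_rsqrt)
  then show "y \<in> cball 0 (sqrt (2 / ep))" by simp
 qed
 then have "closure {y :: real ^ 'n. cutoff 0 (ep * (norm y)\<^sup>2) \<noteq> 0} \<subseteq> cball 0 (sqrt (2 / ep))" by (rule closure_minimal) simp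
 then have "compact (closure {y :: real ^ 'n. cutoff 0 (ep * (norm y)\<^sup>2) \<noteq> 0})"
  using compact_Int_closed[OF compact_cball closed_closure, of 0 "sqrt (2 / ep)"] by (metis Int_absorb1)
 with s show "test_function (\<lambda>y :: real ^ 'n. cutoff 0 (ep * (norm y)\<^sup>2))" by (simp add: test_function_def)
qed

lemma fam_heat_const:
 assumes "hk d f"
 shows "fam (\<lambda>_. t) (x :: real ^ 'n) UNIV (\<lambda>ep z. cutoff 0 (ep * (norm (snd z - x))\<^sup>2) * f t (snd z - x)) (\<lambda>z. f t (snd z - x))"
 using fam_base[OF assms smooth_const[of 1], of UNIV "\<lambda>_. t" x 0] by simp

lemma smooth_hk:
 assumes "hk d f" "t > 0" shows "smooth (\<lambda>y. f t (y - x :: real ^ 'n))"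
 using smooth_slice[OF fam_smooth(2)[OF smooth_const[of t] _ _ fam_heat_const[OF assms(1)]]] assms(2) by simp

lemma test_function_measurable:
 fixes \<psi> :: "real ^ 'n \<Rightarrow> real"
 assumes "test_function \<psi>" shows "\<psi> \<in> BM borel"
 using assms smooth_D(3) by (intro borel_measurable_continuous_onI) (auto simp: test_function_def)

lemma test_function_L2:
 fixes \<psi> :: "real ^ 'n \<Rightarrow> real"
 assumes "test_function \<psi>" shows "L2 \<psi>"
proof -
 define S where "S = closure {x. \<psi> x \<noteq> 0}"
 have "smooth \<psi>" using assms unfolding test_function_def by (rule conjunct1)
 then have c: "continuous_on UNIV \<psi>" by (rule smooth_D(3))
 have "continuous_on S \<psi>" by (rule continuous_on_subset[OF c subset_UNIV])
 then have cS: "continuous_on S (\<lambda>x. (\<psi> x)\<^sup>2)" by (rule continuous_on_power)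
 have "compact S" using assms unfolding test_function_def S_def by (rule conjunct2)
 then have "Li (\<lambda>x. indicator S x *\<^sub>R (\<psi> x)\<^sup>2)"
  by (rule borel_integrable_compact[OF _ cS])
 moreover have "(\<lambda>x. indicator S x *\<^sub>R (\<psi> x)\<^sup>2) = (\<lambda>x. (\<psi> x)\<^sup>2)"
 proof (rule ext)
  fix x
  have "x \<in> S" if "\<psi> x \<noteq> 0" unfolding S_def using that by (intro subsetD[OF closure_subset]) simp
  then show "indicator S x *\<^sub>R (\<psi> x)\<^sup>2 = (\<psi> x)\<^sup>2" by (cases "\<psi> x = 0") auto
 qed
 ultimately have "Li (\<lambda>x. (\<psi> x)\<^sup>2)" by (simp only:)
 then show ?thesis using test_function_measurable[OF assms] by (simp add: L2_def)
qed

lemma L2_bounded_mult: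
 fixes f :: "real ^ 'n \<Rightarrow> real"
 assumes f: "L2 f" and [measurable]: "g \<in> BM borel" and B: "\<And>x. \<bar>g x\<bar> \<le> B"
 shows "L2 (\<lambda>x. f x * g x)"
proof -
 have [measurable]: "f \<in> BM borel" using f by (rule L2_measurable)
 have "Li (\<lambda>x. (f x * g x)\<^sup>2)"
 proof (rule Bochner_Integration.integrable_bound)
  show "Li (\<lambda>x. B\<^sup>2 * (f x)\<^sup>2)" using f by (simp add: L2_def)
  show "AE x in lborel. norm ((f x * g x)\<^sup>2) \<le> norm (B\<^sup>2 * (f x)\<^sup>2)"
  proof (rule AE_I2)
   fix x
   have "(g x)\<^sup>2 \<le> B\<^sup>2" using B[of x] by (simp add: abs_le_square_iff[symmetric])
   then have "(g x)\<^sup>2 * (f x)\<^sup>2 \<le> B\<^sup>2 * (f x)\<^sup>2" by (intro mult_right_mono) auto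
   then show "norm ((f x * g x)\<^sup>2) \<le> norm (B\<^sup>2 * (f x)\<^sup>2)" by (simp add: power_mult_distrib mult.commute)
  qed
 qed measurable
 then show ?thesis by (simp add: L2_def)
qed

lemma locally_integrable_measurable:
 fixes f :: "real ^ 'n \<Rightarrow> 'b :: {banach, second_countable_topology}"
 assumes "locally_integrable f" shows "f \<in> BM lebesgue"
proof (rule borel_measurable_LIMSEQ_metric)
 show "(\<lambda>x. indicator (cball 0 (real n)) x *\<^sub>R f x) \<in> BM lebesgue" for n
  using assms unfolding locally_integrable_def set_integrable_def
  by (meson borel_measurable_integrable compact_cball)
 fix x :: "real ^ 'n"
 obtain N where "norm x < real N" using reals_Archimedean2 by blast
 then have "eventually (\<lambda>n. indicator (cball 0 (real n)) x *\<^sub>R f x = f x) sequentially"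
  unfolding eventually_sequentially by (intro exI[of _ N]) (auto simp: indicator_def)
 then show "(\<lambda>n. indicator (cball 0 (real n)) x *\<^sub>R f x) ~> f x" by (rule tendsto_eventually)
qed

lemma locally_integrable_test:
 fixes f :: "real ^ 'n \<Rightarrow> 'b :: {banach, second_countable_topology}"
 assumes f: "locally_integrable f" and \<psi>: "test_function \<psi>"
 shows "integrable lebesgue (\<lambda>x. \<psi> x *\<^sub>R f x)"
proof -
 define S where "S = closure {x. \<psi> x \<noteq> 0}"
 obtain B where B: "\<And>x. \<bar>\<psi> x\<bar> \<le> B" "B \<ge> 0" using test_function_bounded[OF \<psi>] by blast
 have "set_integrable lebesgue S f" using f \<psi> by (auto simp: locally_integrable_def test_function_def S_def)
 then have i: "integrable lebesgue (\<lambda>x. B *\<^sub>R (indicator S x *\<^sub>R f x))" unfolding set_integrable_def by (rule integrable_scaleR_right)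
 have m: "\<psi> \<in> BM lebesgue" by (rule measurable_completion) (simp add: test_function_measurable[OF \<psi>])
 show ?thesis
 proof (rule Bochner_Integration.integrable_bound[OF i])
  show "(\<lambda>x. \<psi> x *\<^sub>R f x) \<in> BM lebesgue"
   by (intro borel_measurable_scaleR m locally_integrable_measurable f)
  show "AE x in lebesgue. norm (\<psi> x *\<^sub>R f x) \<le> norm (B *\<^sub>R (indicator S x *\<^sub>R f x))"
  proof (rule AE_I2)
   fix x
   have "x \<in> S" if "\<psi> x \<noteq> 0" unfolding S_def using that by (intro subsetD[OF closure_subset]) simp
   then show "norm (\<psi> x *\<^sub>R f x) \<le> norm (B *\<^sub>R (indicator S x *\<^sub>R f x))"
    using B by (cases "\<psi> x = 0") (auto intro!: mult_right_mono)
  qed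
 qed
qed

section \<open>Uniqueness of weak derivatives\<close>

text \<open>The fundamental lemma of the calculus of variations, obtained from
  \<open>heat_injective\<close>: a Gaussian times the cutoff is a test function, so the heat flow of
  the cut-off d vanishes. The cutoff is needed since a locally integrable d need not be in
  \<open>gint\<close>; every point lies in its plateau for some n.\<close>

lemma weak_zero:
 fixes d :: "real ^ 'n \<Rightarrow> real"
 assumes d: "locally_integrable d" and z: "\<And>\<psi>. test_function \<psi> \<Longrightarrow> (LINT x|lebesgue. \<psi> x * d x) = 0"
 shows "AE x in lebesgue. d x = 0"
proof -
 have m: "d \<in> BM lebesgue" by (rule locally_integrable_measurable[OF d])
 note [measurable] = borel_rep(1)[OF m]
 define e where "e = (\<lambda>n. 1 / real (Suc n))"
 define f where "f = (\<lambda>n y. cutoff 0 (e n * (norm y)\<^sup>2) * borel_rep d y)"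
 have e: "e n > 0" for n by (simp add: e_def)
 have "AE x in lborel. f n x = 0" for n
 proof (rule heat_injective)
  have t: "test_function (\<lambda>y :: real ^ 'n. cutoff 0 (e n * (norm y)\<^sup>2))"
   using test_function_cutoff[OF smooth_const[of 1] e] by simp
  have "integrable lebesgue (\<lambda>y. d y * cutoff 0 (e n * (norm y)\<^sup>2))"
   using locally_integrable_test[OF d t] by (simp add: mult.commute)
  then have "Li (f n)"
   unfolding borel_rep_mult(2)[OF m test_function_measurable[OF t]] by (simp add: f_def mult.commute)
  then show "gint (f n)" by (rule gint_integrable)
  fix t :: real and x :: "real ^ 'n" assume t: "t > 0"
  have s: "test_function (\<lambda>y. cutoff 0 (e n * (norm y)\<^sup>2) * Gk t (y - x))"
   by (rule test_function_cutoff[OF smooth_hk[OF hk_base t] e])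
  have "Ht t (f n) x = (LBINT y. borel_rep d y * (cutoff 0 (e n * (norm y)\<^sup>2) * Gk t (y - x)))"
   unfolding conv_def f_def by (simp add: heat_kernel_diff_commute[of t x] mult_ac)
  also have "\<dots> = (LINT y|lebesgue. d y * (cutoff 0 (e n * (norm y)\<^sup>2) * Gk t (y - x)))"
   by (rule borel_rep_mult(1)[OF m test_function_measurable[OF s], symmetric])
  also have "\<dots> = 0" using z[OF s] by (simp add: mult.commute)
  finally show "Ht t (f n) x = 0" .
 qed
 then have "AE x in lborel. \<forall>n. f n x = 0" by (simp add: AE_all_countable)
 then have "AE x in lborel. borel_rep d x = 0"
 proof eventually_elim
  case (elim x)
  obtain n where n: "(norm x)\<^sup>2 < real n" using reals_Archimedean2 by blast
  then have "e n * (norm x)\<^sup>2 < 1" by (simp add: e_def divide_less_eq)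
  then show ?case using elim[rule_format, of n] by (simp add: f_def cutoff_eq_1)
 qed
 with borel_rep(2)[OF m] have "AE x in lborel. d x = 0" by eventually_elim simp
 then show ?thesis by (simp add: AE_completion_iff)
qed

definition weak_deriv :: "'n \<Rightarrow> (real ^ 'n \<Rightarrow> real) \<Rightarrow> (real ^ 'n \<Rightarrow> real) \<Rightarrow> bool"
 where "weak_deriv k U W \<longleftrightarrow> (\<forall>\<psi>. test_function \<psi> \<longrightarrow>
  (LBINT x. partial k \<psi> x * U x) = - (LBINT x. \<psi> x * W x))"

lemma has_weak_partial_component:
 fixes f :: "real ^ 'n \<Rightarrow> real ^ 'm"
 assumes h: "has_weak_partial k f g" and \<psi>: "test_function \<psi>"
 shows "(LINT x|lebesgue. partial k \<psi> x * f x $ j) = - (LINT x|lebesgue. \<psi> x * g x $ j)"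
proof -
 have l: "locally_integrable f" "locally_integrable g" using h by (auto simp: has_weak_partial_def)
 have "(LINT x|lebesgue. partial k \<psi> x *\<^sub>R f x) $ j = - (LINT x|lebesgue. \<psi> x *\<^sub>R g x) $ j"
  using h \<psi> by (auto simp: has_weak_partial_def)
 then show ?thesis
  using integral_bounded_linear[OF bounded_linear_vec_nth[of j] locally_integrable_test[OF l(1) test_function_partial[OF \<psi>]], of k]
   integral_bounded_linear[OF bounded_linear_vec_nth[of j] locally_integrable_test[OF l(2) \<psi>]]
  by simp
qed

lemma locally_integrable_component:
 fixes f :: "real ^ 'n \<Rightarrow> real ^ 'm"
 assumes "locally_integrable f" shows "locally_integrable (\<lambda>x. f x $ j)"
 unfolding locally_integrable_def set_integrable_def
proof (intro allI impI)
 fix K :: "(real ^ 'n) set" assume "compact K"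
 then have "integrable lebesgue (\<lambda>x. indicator K x *\<^sub>R f x)" using assms by (auto simp: locally_integrable_def set_integrable_def)
 from integrable_bounded_linear[OF bounded_linear_vec_nth this, of j]
 show "integrable lebesgue (\<lambda>x. indicator K x *\<^sub>R f x $ j)" by simp
qed

text \<open>\<open>weak_partial\<close> is some chosen weak derivative, while membership in
  \<open>H1_space\<close> only provides a square integrable one. Uniqueness up to null sets
  transfers square integrability to the chosen function.\<close>

lemma weak_partial_H1:
 fixes f :: "real ^ 'n \<Rightarrow> real ^ 'm"
 assumes f: "f \<in> H1_space"
 shows "(\<lambda>x. weak_partial k f x $ j) \<in> BM lebesgue"
  and "L2 (borel_rep (\<lambda>x. weak_partial k f x $ j))"
  and "weak_deriv k (borel_rep (\<lambda>x. f x $ j)) (borel_rep (\<lambda>x. weak_partial k f x $ j))"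
  and "has_weak_partial k f (weak_partial k f)"
proof -
 obtain g where g: "g \<in> Lp_space 2" "has_weak_partial k f g" using f by (auto simp: H1_space_def)
 show h: "has_weak_partial k f (weak_partial k f)"
  unfolding weak_partial_def by (rule someI[of _ g]) (rule g(2))
 have fm: "(\<lambda>x. f x $ j) \<in> BM lebesgue" for j using Lp_space_2_rep(2)[of f] f by (auto simp: H1_space_def)
 have l: "locally_integrable (weak_partial k f)" "locally_integrable g" using h g by (auto simp: has_weak_partial_def)
 show m: "(\<lambda>x. weak_partial k f x $ j) \<in> BM lebesgue"
  by (intro vec_nth_measurable locally_integrable_measurable l)
 have gm: "(\<lambda>x. g x $ j) \<in> BM lebesgue" by (intro vec_nth_measurable locally_integrable_measurable l)
 have "AE x in lebesgue. weak_partial k f x $ j - g x $ j = 0"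
 proof (rule weak_zero)
  have "set_integrable lebesgue K (\<lambda>x. weak_partial k f x $ j - g x $ j)" if "compact K" for K
   using locally_integrable_component[OF l(1), of j] locally_integrable_component[OF l(2), of j] that
   by (auto simp: locally_integrable_def intro!: set_integral_diff)
  then show "locally_integrable (\<lambda>x. weak_partial k f x $ j - g x $ j)" by (simp add: locally_integrable_def)
  fix \<psi> :: "real ^ 'n \<Rightarrow> real" assume \<psi>: "test_function \<psi>"
  have i: "integrable lebesgue (\<lambda>x. \<psi> x * weak_partial k f x $ j)" "integrable lebesgue (\<lambda>x. \<psi> x * g x $ j)"
   using locally_integrable_test[OF locally_integrable_component[OF l(1)] \<psi>, of j]
    locally_integrable_test[OF locally_integrable_component[OF l(2)] \<psi>, of j] by simp_all
  show "(LINT x|lebesgue. \<psi> x * (weak_partial k f x $ j - g x $ j)) = 0"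
   using has_weak_partial_component[OF h \<psi>, of j] has_weak_partial_component[OF g(2) \<psi>, of j] i
   by (simp add: right_diff_distrib)
 qed
 then have ae: "AE x in lebesgue. weak_partial k f x $ j = g x $ j" by eventually_elim simp
 have gL: "L2 (borel_rep (\<lambda>x. g x $ j))" by (rule Lp_space_2_rep(1)[OF g(1)])
 have "AE x in lebesgue. borel_rep (\<lambda>x. weak_partial k f x $ j) x = borel_rep (\<lambda>x. g x $ j) x"
  using ae borel_rep(3)[OF m] borel_rep(3)[OF gm] by eventually_elim simp
 then have ae': "AE x in lborel. borel_rep (\<lambda>x. weak_partial k f x $ j) x = borel_rep (\<lambda>x. g x $ j) x" by (simp add: AE_completion_iff)
 note [measurable] = borel_rep(1)[OF m] borel_rep(1)[OF gm]
 have "AE x in lborel. (borel_rep (\<lambda>x. weak_partial k f x $ j) x)\<^sup>2 = (borel_rep (\<lambda>x. g x $ j) x)\<^sup>2" using ae' by eventually_elim simp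
 then have "Li (\<lambda>x. (borel_rep (\<lambda>x. weak_partial k f x $ j) x)\<^sup>2)"
  using gL by (subst integrable_cong_AE[of _ _ "\<lambda>x. (borel_rep (\<lambda>x. g x $ j) x)\<^sup>2"]) (auto simp: L2_def)
 then show "L2 (borel_rep (\<lambda>x. weak_partial k f x $ j))" by (simp add: L2_def)
 show "weak_deriv k (borel_rep (\<lambda>x. f x $ j)) (borel_rep (\<lambda>x. weak_partial k f x $ j))"
  unfolding weak_deriv_def
 proof (intro allI impI)
  fix \<psi> :: "real ^ 'n \<Rightarrow> real" assume \<psi>: "test_function \<psi>"
  show "(LBINT x. partial k \<psi> x * borel_rep (\<lambda>x. f x $ j) x) = - (LBINT x. \<psi> x * borel_rep (\<lambda>x. weak_partial k f x $ j) x)"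
   using has_weak_partial_component[OF h \<psi>, of j]
    borel_rep_mult(1)[OF fm test_function_measurable[OF test_function_partial[OF \<psi>]], of j]
    borel_rep_mult(1)[OF m test_function_measurable[OF \<psi>]]
   by (simp add: mult.commute)
 qed
qed

definition heat_grad :: "'n \<Rightarrow> real \<Rightarrow> real ^ 'n \<Rightarrow> real"
 where "heat_grad k sg x = - (1/2) * (x $ k / sg * Gk sg x)"

lemma hk_heat_grad: "hk 1 (heat_grad k)"
proof -
 have "hk (Suc 0) (\<lambda>sg x :: real ^ 'a. - (1/2) * (x $ k / sg * Gk sg x))" by (intro hk_cmult hk_mul hk_base)
 then show ?thesis by (simp add: heat_grad_def[abs_def])
qed

lemma hk_deriv_heat_kernel_grad: "hk_deriv Gk heat_grad Gk'"
 using hk_deriv_heat_kernel by (simp add: heat_grad_def[abs_def])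

lemma heat_grad_odd: "heat_grad k sg (x - y) = - heat_grad k sg (y - x)"
 by (simp add: heat_grad_def heat_kernel_diff_commute[of sg x y] algebra_simps minus_divide_left[symmetric] diff_divide_distrib)

lemma partial_hk:
 fixes f :: "real \<Rightarrow> real ^ 'n \<Rightarrow> real"
 assumes "hk_deriv f f' g" "t > 0"
 shows "partial k (\<lambda>y. f t (y - x)) y = f' k t (y - x)"
proof -
 have "((\<lambda>y. f t y) has_derivative (\<lambda>v. SS k. v $ k * f' k t (y - x))) (at (y - x))"
  by (rule hk_deriv_space[OF assms])
 moreover have "((\<lambda>y. y - x) has_derivative (\<lambda>v. v)) (at y)" by (auto intro!: derivative_eq_intros)
 ultimately have "((\<lambda>y. f t (y - x)) has_derivative (\<lambda>v. SS k. v $ k * f' k t (y - x))) (at y)"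
  by (rule has_derivative_compose[rotated])
 from frechet_derivative_at[OF this, symmetric]
 show ?thesis by (simp add: partial_def axis_def if_distrib[of "\<lambda>c. c * _"] sum.delta cong: if_cong)
qed

lemma partial_mult:
 fixes f g :: "real ^ 'n \<Rightarrow> real"
 assumes "smooth f" "smooth g"
 shows "partial k (\<lambda>y. f y * g y) y = f y * partial k g y + partial k f y * g y"
 using frechet_derivative_at[OF has_derivative_mult[OF smooth_D(1)[OF assms(1), of y] smooth_D(1)[OF assms(2), of y]], symmetric]
 by (simp add: partial_def)

section \<open>Weakly continuous curves in \<open>L\<^sup>2\<close>\<close>

text \<open>The Gaussian majorant of k reduces the double integral to the pairing of |a| with the
  heat flow of |b|, finite because the flow preserves L^2.\<close>

lemma pair_integrable_L2:
 fixes a b k :: "real ^ 'n \<Rightarrow> real"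
 assumes a: "L2 a" and b: "L2 b" and k: "gbound k"
 shows "integrable lb2 (\<lambda>(x, y). a x * k (x - y) * b y)"
proof -
 obtain C s where C: "C \<ge> 0" "s > 0" "\<And>z. \<bar>k z\<bar> \<le> C * Gk s z" using gboundE[OF k] by blast
 have [measurable]: "a \<in> BM borel" "b \<in> BM borel" "k \<in> BM borel"
  using a b k by (auto intro: L2_measurable gbound_measurable)
 have g: "gint (\<lambda>y. \<bar>b y\<bar>)" by (rule gint_abs[OF L2_gint[OF b]])
 have "(\<integral>\<^sup>+p. ennreal (norm (case p of (x, y) \<Rightarrow> a x * k (x - y) * b y)) \<partial>lb2)
  = (NN x. NN y. ennreal \<bar>a x * k (x - y) * b y\<bar>)"
  by (subst lborel.nn_integral_fst[symmetric]) auto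
 also have "\<dots> \<le> (NN x. ennreal (C * (\<bar>a x\<bar> * Ht s (\<lambda>y. \<bar>b y\<bar>) x)))"
 proof (rule nn_integral_mono)
  fix x
  have i: "Li (\<lambda>y. C * \<bar>a x\<bar> * (Gk s (x - y) * \<bar>b y\<bar>))"
   by (intro integrable_mult_right conv_integrable gbound_heat_kernel C g)
  have "(NN y. ennreal \<bar>a x * k (x - y) * b y\<bar>) \<le> (NN y. ennreal (C * \<bar>a x\<bar> * (Gk s (x - y) * \<bar>b y\<bar>)))"
  proof (intro nn_integral_mono ennreal_leI)
   fix y
   have "\<bar>a x\<bar> * \<bar>k (x - y)\<bar> * \<bar>b y\<bar> \<le> \<bar>a x\<bar> * (C * Gk s (x - y)) * \<bar>b y\<bar>"
    using C by (intro mult_right_mono mult_left_mono) auto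
   then show "\<bar>a x * k (x - y) * b y\<bar> \<le> C * \<bar>a x\<bar> * (Gk s (x - y) * \<bar>b y\<bar>)"
    by (simp add: abs_mult mult_ac)
  qed
  also have "\<dots> = ennreal (LBINT y. C * \<bar>a x\<bar> * (Gk s (x - y) * \<bar>b y\<bar>))"
   using C by (intro nn_integral_eq_integral i) (auto simp: heat_kernel_nonneg)
  finally show "(NN y. ennreal \<bar>a x * k (x - y) * b y\<bar>) \<le> ennreal (C * (\<bar>a x\<bar> * Ht s (\<lambda>y. \<bar>b y\<bar>) x))"
   by (simp add: conv_def mult.assoc)
 qed
 also have "\<dots> < \<infinity>"
 proof -
  have "Li (\<lambda>x. C * (\<bar>a x\<bar> * Ht s (\<lambda>y. \<bar>b y\<bar>) x))"
   by (intro integrable_mult_right L2_mult L2_abs a b heat_L2(1) C)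
  moreover have "0 \<le> Ht s (\<lambda>y. \<bar>b y\<bar>) x" for x unfolding conv_def by (simp add: heat_kernel_nonneg)
  ultimately show ?thesis using C by (subst nn_integral_eq_integral) auto
 qed
 finally show ?thesis by (intro integrableI_bounded) auto
qed

lemma L2_conv_swap:
 fixes a b k :: "real ^ 'n \<Rightarrow> real"
 assumes "L2 a" "L2 b" "gbound k"
 shows "(LBINT x. a x * conv k b x) = (LBINT y. (LBINT x. a x * k (x - y)) * b y)"
proof -
 have "(LBINT x. a x * conv k b x) = (LBINT x. (LBINT y. a x * k (x - y) * b y))"
  by (simp add: conv_def mult.assoc)
 also have "\<dots> = (LBINT y. (LBINT x. a x * k (x - y) * b y))"
  by (rule lborel_pair.Fubini_integral[OF pair_integrable_L2[OF assms], symmetric])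
 finally show ?thesis by simp
qed

text \<open>The bound \<open>E\<close> would follow from weak continuity by the uniform boundedness principle.\<close>

definition wcurve :: "(real \<Rightarrow> real ^ 'n \<Rightarrow> real) \<Rightarrow> (real \<Rightarrow> real) \<Rightarrow> bool"
 where "wcurve U E \<longleftrightarrow> (\<forall>t\<ge>0. L2 (U t)) \<and> (\<forall>T. \<forall>t\<in>{0..T}. nrm2 (U t) \<le> E T) \<and>
  (\<forall>g. L2 g \<longrightarrow> continuous_on {0..} (\<lambda>t. LBINT x. U t x * g x))"

text \<open>Weak against strong convergence: the curve converges weakly and is bounded by
  \<open>E T\<close>, so a strongly convergent second factor may vary with n.\<close>

lemma wcurve_pair_tendsto:
 assumes U: "wcurve U E" and s: "s ~> t" "\<And>n. s n \<ge> 0" "t \<ge> 0"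
  and g: "\<And>n. L2 (g n)" "L2 g0" "(\<lambda>n. nrm2 (\<lambda>x. g n x - g0 x)) ~> 0"
 shows "(\<lambda>n. LBINT x. U (s n) x * g n x) ~> (LBINT x. U t x * g0 x)"
proof -
 have UL: "L2 (U t)" if "t \<ge> 0" for t using U that by (simp add: wcurve_def)
 obtain T where T: "\<And>n. s n \<le> T"
 proof -
  have "Bseq s" using s(1) by (rule convergent_imp_Bseq[OF convergentI])
  then obtain K where "\<And>n. norm (s n) \<le> K" unfolding Bseq_def by blast
  then show ?thesis using that[of K] by (auto intro: order.trans[OF abs_ge_self])
 qed
 have "(\<lambda>n. LBINT x. U (s n) x * g0 x) ~> (LBINT x. U t x * g0 x)"
 proof (rule continuous_on_tendsto_compose[of "{0..}" "\<lambda>t. LBINT x. U t x * g0 x"])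
  show "continuous_on {0..} (\<lambda>t. LBINT x. U t x * g0 x)" using U g(2) by (simp add: wcurve_def)
 qed (use s in auto)
 moreover have "(\<lambda>n. LBINT x. U (s n) x * (g n x - g0 x)) ~> 0"
 proof (rule Lim_null_comparison)
  show "\<forall>\<^sub>F n in sequentially. norm (LBINT x. U (s n) x * (g n x - g0 x)) \<le> E T * nrm2 (\<lambda>x. g n x - g0 x)"
  proof (intro always_eventually allI)
   fix n
   have "\<bar>LBINT x. U (s n) x * (g n x - g0 x)\<bar> \<le> nrm2 (U (s n)) * nrm2 (\<lambda>x. g n x - g0 x)"
    by (intro L2_CS UL L2_diff g s)
   also have "\<dots> \<le> E T * nrm2 (\<lambda>x. g n x - g0 x)"
    using U s(2)[of n] T[of n] by (intro mult_right_mono) (auto simp: wcurve_def)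
   finally show "norm (LBINT x. U (s n) x * (g n x - g0 x)) \<le> E T * nrm2 (\<lambda>x. g n x - g0 x)" by simp
  qed
  show "(\<lambda>n. E T * nrm2 (\<lambda>x. g n x - g0 x)) ~> 0" using tendsto_mult_left[OF g(3), of "E T"] by simp
 qed
 ultimately have "(\<lambda>n. (LBINT x. U (s n) x * g0 x) + (LBINT x. U (s n) x * (g n x - g0 x))) ~> (LBINT x. U t x * g0 x) + 0"
  by (rule tendsto_add)
 moreover have "(LBINT x. U (s n) x * g0 x) + (LBINT x. U (s n) x * (g n x - g0 x)) = (LBINT x. U (s n) x * g n x)" for n
  using L2_mult[OF UL[OF s(2)] g(2)] L2_mult[OF UL[OF s(2)] g(1)] by (simp add: right_diff_distrib)
 ultimately show ?thesis by simp
qed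

lemma dominated_nrm2_tendsto:
 fixes g :: "nat \<Rightarrow> real ^ 'n \<Rightarrow> real"
 assumes [measurable]: "\<And>n. g n \<in> BM borel" "g0 \<in> BM borel"
  and lim: "\<And>x. (\<lambda>n. g n x) ~> g0 x" and w: "L2 w" "\<And>n x. \<bar>g n x\<bar> \<le> w x"
 shows "L2 (g n)" "L2 g0" "(\<lambda>n. nrm2 (\<lambda>x. g n x - g0 x)) ~> 0"
proof -
 have w0: "\<bar>g0 x\<bar> \<le> w x" for x
  by (rule LIMSEQ_le_const2[OF tendsto_rabs[OF lim]]) (use w(2) in auto)
 have wi: "Li (\<lambda>x. (w x)\<^sup>2)" using w(1) by (simp add: L2_def)
 have sq: "a\<^sup>2 \<le> b\<^sup>2" if "\<bar>a\<bar> \<le> b" for a b :: real using that by (simp add: abs_le_square_iff[symmetric])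
 have "Li (\<lambda>x. (g n x)\<^sup>2)" for n
  by (rule Bochner_Integration.integrable_bound[OF wi]) (use sq[OF w(2)] in "auto intro!: AE_I2")
 then show "L2 (g n)" by (simp add: L2_def)
 have "Li (\<lambda>x. (g0 x)\<^sup>2)"
  by (rule Bochner_Integration.integrable_bound[OF wi]) (use sq[OF w0] in "auto intro!: AE_I2")
 then show "L2 g0" by (simp add: L2_def)
 have "(\<lambda>n. LBINT x. (g n x - g0 x)\<^sup>2) ~> (LINT x|(lborel :: (real ^ 'n) measure). 0)"
 proof (rule integral_dominated_convergence[where w = "\<lambda>x. 4 * (w x)\<^sup>2"])
  show "AE x in lborel. (\<lambda>n. (g n x - g0 x)\<^sup>2) ~> 0"
  proof (rule AE_I2)
   fix x have "(\<lambda>n. (g n x - g0 x)\<^sup>2) ~> (g0 x - g0 x)\<^sup>2" by (intro tendsto_intros lim)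
   then show "(\<lambda>n. (g n x - g0 x)\<^sup>2) ~> 0" by simp
  qed
  show "AE x in lborel. norm ((g n x - g0 x)\<^sup>2) \<le> 4 * (w x)\<^sup>2" for n
  proof (rule AE_I2)
   fix x
   have "\<bar>g n x - g0 x\<bar> \<le> 2 * w x" using w(2)[of n x] w0[of x] by linarith
   from sq[OF this] show "norm ((g n x - g0 x)\<^sup>2) \<le> 4 * (w x)\<^sup>2" by (simp add: power_mult_distrib)
  qed
 qed (use wi in auto)
 from tendsto_real_sqrt[OF this] show "(\<lambda>n. nrm2 (\<lambda>x. g n x - g0 x)) ~> 0" by (simp add: nrm2_def)
qed

lemma wcurve_continuous_pair:
 fixes \<phi> :: "real \<times> (real ^ 'n) \<Rightarrow> real"
 assumes U: "wcurve U E" and \<phi>: "continuous_on UNIV \<phi>" and w: "L2 w" "\<And>s y. \<bar>\<phi> (s, y)\<bar> \<le> w y"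
 shows "continuous_on {0..} (\<lambda>s. LBINT y. U s y * \<phi> (s, y))"
 unfolding continuous_on_sequentially comp_def
proof (intro ballI allI impI, elim conjE)
 fix s and t :: real assume t: "t \<in> {0..}" and s: "\<forall>n. s n \<in> {0..}" "s ~> t"
 have lim: "(\<lambda>n. \<phi> (s n, y)) ~> \<phi> (t, y)" for y
  by (rule continuous_on_tendsto_compose[OF \<phi>]) (auto intro!: tendsto_intros s)
 have [measurable]: "\<phi> \<in> BM borel" using \<phi> by (rule borel_measurable_continuous_onI)
 have m: "(\<lambda>y. \<phi> (c, y)) \<in> BM borel" for c
  by (rule borel_measurable_continuous_onI) (rule continuous_on_compose2[OF \<phi>], auto intro!: continuous_intros)
 show "(\<lambda>n. LBINT y. U (s n) y * \<phi> (s n, y)) ~> (LBINT y. U t y * \<phi> (t, y))"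
  by (rule wcurve_pair_tendsto[OF U s(2) _ _ dominated_nrm2_tendsto[of "\<lambda>n y. \<phi> (s n, y)" "\<lambda>y. \<phi> (t, y)" w]])
   (use s t m lim w in auto)
qed

lemma L2_pair_tendsto:
 assumes f: "\<And>n. L2 (f n)" "L2 f0" "(\<lambda>n. nrm2 (\<lambda>x. f n x - f0 x)) ~> 0"
  and g: "\<And>n. L2 (g n)" "L2 g0" "(\<lambda>n. nrm2 (\<lambda>x. g n x - g0 x)) ~> 0"
 shows "(\<lambda>n. LBINT x. f n x * g n x) ~> (LBINT x. f0 x * g0 x)"
proof -
 define a where "a = (\<lambda>n. nrm2 (\<lambda>x. f n x - f0 x))"
 define b where "b = (\<lambda>n. nrm2 (\<lambda>x. g n x - g0 x))"
 have fd: "L2 (\<lambda>x. f n x - f0 x)" and gd: "L2 (\<lambda>x. g n x - g0 x)" for n using f g by (auto intro: L2_diff)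
 have "(\<lambda>n. (LBINT x. f n x * g n x) - (LBINT x. f0 x * g0 x)) ~> 0"
 proof (rule Lim_null_comparison)
  show "\<forall>\<^sub>F n in sequentially. norm ((LBINT x. f n x * g n x) - (LBINT x. f0 x * g0 x)) \<le> a n * b n + a n * nrm2 g0 + nrm2 f0 * b n"
  proof (intro always_eventually allI)
   fix n
   have "(LBINT x. f n x * g n x) - (LBINT x. f0 x * g0 x) =
    (LBINT x. (f n x - f0 x) * (g n x - g0 x)) + (LBINT x. (f n x - f0 x) * g0 x) + (LBINT x. f0 x * (g n x - g0 x))"
   proof -
    have "f n x * g n x = (f n x - f0 x) * (g n x - g0 x) + (f n x - f0 x) * g0 x + f0 x * (g n x - g0 x) + f0 x * g0 x" for x
     by (simp add: algebra_simps)
    then have "(LBINT x. f n x * g n x) = (LBINT x. (f n x - f0 x) * (g n x - g0 x) + (f n x - f0 x) * g0 x + f0 x * (g n x - g0 x) + f0 x * g0 x)"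
     by (simp only:)
    also have "\<dots> = (LBINT x. (f n x - f0 x) * (g n x - g0 x)) + (LBINT x. (f n x - f0 x) * g0 x) + (LBINT x. f0 x * (g n x - g0 x)) + (LBINT x. f0 x * g0 x)"
     using L2_mult[OF fd[of n] gd[of n]] L2_mult[OF fd[of n] g(2)] L2_mult[OF f(2) gd[of n]] L2_mult[OF f(2) g(2)]
     by (simp only: Bochner_Integration.integral_add Bochner_Integration.integrable_add)
    finally show ?thesis by simp
   qed
   then show "norm ((LBINT x. f n x * g n x) - (LBINT x. f0 x * g0 x)) \<le> a n * b n + a n * nrm2 g0 + nrm2 f0 * b n"
    using L2_CS[OF fd[of n] gd[of n]] L2_CS[OF fd[of n] g(2)] L2_CS[OF f(2) gd[of n]] unfolding a_def b_def real_norm_def by linarith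
  qed
  have "(\<lambda>n. a n * b n + a n * nrm2 g0 + nrm2 f0 * b n) ~> 0 * 0 + 0 * nrm2 g0 + nrm2 f0 * 0"
   unfolding a_def b_def by (intro tendsto_intros f g)
  then show "(\<lambda>n. a n * b n + a n * nrm2 g0 + nrm2 f0 * b n) ~> 0" by simp
 qed
 then show ?thesis by (simp add: LIM_zero_iff)
qed

lemma nrm2_mult_le:
 assumes f: "L2 f" and [measurable]: "g \<in> BM borel" and B: "\<And>x. \<bar>g x\<bar> \<le> B"
 shows "nrm2 (\<lambda>x. f x * g x) \<le> B * nrm2 f"
proof -
 have B0: "B \<ge> 0" using B[of undefined] by linarith
 have "(LBINT x. (f x * g x)\<^sup>2) \<le> (LBINT x. B\<^sup>2 * (f x)\<^sup>2)"
 proof (rule integral_mono)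
  show "Li (\<lambda>x. (f x * g x)\<^sup>2)" using L2_bounded_mult[OF f assms(2) B] by (simp add: L2_def)
  show "Li (\<lambda>x. B\<^sup>2 * (f x)\<^sup>2)" using f by (simp add: L2_def)
  fix x
  have "(g x)\<^sup>2 \<le> B\<^sup>2" using B[of x] by (simp add: abs_le_square_iff[symmetric])
  then have "(g x)\<^sup>2 * (f x)\<^sup>2 \<le> B\<^sup>2 * (f x)\<^sup>2" by (intro mult_right_mono) auto
  then show "(f x * g x)\<^sup>2 \<le> B\<^sup>2 * (f x)\<^sup>2" by (simp add: power_mult_distrib mult.commute)
 qed
 then have "nrm2 (\<lambda>x. f x * g x) \<le> sqrt (B\<^sup>2 * (LBINT x. (f x)\<^sup>2))" unfolding nrm2_def by simp
 also have "\<dots> = B * nrm2 f" using B0 by (simp add: real_sqrt_mult nrm2_def)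
 finally show ?thesis .
qed

section \<open>Joint measurability along weakly continuous curves\<close>

text \<open>The representatives \<open>U s\<close> are chosen separately for each s, so nothing is
  known about measurability in (s, y) jointly. The heat flow at (s, y) is a pairing of
  \<open>U s\<close> with a shifted Gaussian, hence depends continuously on both variables by weak
  continuity.\<close>

lemma conv_heat_curve_measurable:
 fixes U :: "real \<Rightarrow> real ^ 'n \<Rightarrow> real"
 assumes U: "wcurve U E" and e: "e > 0"
 shows "(\<lambda>p. indicator {0..} (fst p) * Ht e (U (fst p)) (snd p)) \<in> BM borel"
proof -
 have "continuous_on ({0..} \<times> UNIV) (\<lambda>p. Ht e (U (fst p)) (snd p))"
  unfolding continuous_on_sequentially comp_def
 proof (intro ballI allI impI, elim conjE)
  fix p and p0 :: "real \<times> (real ^ 'n)" assume p0: "p0 \<in> {0..} \<times> UNIV" and p: "\<forall>n. p n \<in> {0..} \<times> UNIV" "p ~> p0"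
  define y where "y = (\<lambda>n. snd (p n))"
  define y0 where "y0 = snd p0"
  have s: "(\<lambda>n. fst (p n)) ~> fst p0" and yl: "y ~> y0" unfolding y_def y0_def using p(2) by (auto intro: tendsto_intros)
  have "Bseq (\<lambda>n. y n - y0)" using yl by (intro convergent_imp_Bseq convergentI[of _ "y0 - y0"] tendsto_intros)
  then obtain K where K: "\<And>n. norm (y n - y0) \<le> K" unfolding Bseq_def by blast
  \<comment> \<open>From |y0 - z|^2 \<le> 2 |y n - z|^2 + 2 K^2: a Gaussian with a centre within K
    of \<open>y0\<close> is dominated by one of double width centred at \<open>y0\<close>.\<close>
  define C where "C = 2 powr (real CARD('n) / 2) * exp (K\<^sup>2 / (4 * e))"
  have bd: "Gk e (y n - z) \<le> C * Gk (2 * e) (y0 - z)" for n z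
  proof -
   have "norm (y0 - z) \<le> norm (y n - z) + norm (y n - y0)" using norm_triangle_ineq4[of "y n - z" "y n - y0"] by simp
   then have "(norm (y0 - z))\<^sup>2 \<le> (norm (y n - z) + norm (y n - y0))\<^sup>2" by (intro power_mono) auto
   also have "\<dots> \<le> 2 * (norm (y n - z))\<^sup>2 + 2 * (norm (y n - y0))\<^sup>2"
    using zero_le_power2[of "norm (y n - z) - norm (y n - y0)"] by (simp add: power2_eq_square algebra_simps)
   also have "(norm (y n - y0))\<^sup>2 \<le> K\<^sup>2" using K[of n] by (intro power_mono) auto
   finally have "(norm (y0 - z))\<^sup>2 \<le> 2 * (norm (y n - z))\<^sup>2 + 2 * K\<^sup>2" by simp
   then have "- ((norm (y n - z))\<^sup>2 / (4 * e)) \<le> K\<^sup>2 / (4 * e) + - ((norm (y0 - z))\<^sup>2 / (4 * (2 * e)))"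
    using e by (simp add: field_simps)
   then have 1: "exp (- ((norm (y n - z))\<^sup>2 / (4 * e))) \<le> exp (K\<^sup>2 / (4 * e)) * exp (- ((norm (y0 - z))\<^sup>2 / (4 * (2 * e))))"
    unfolding exp_add[symmetric] by simp
   have 2: "(4 * pi * e) powr (- (real CARD('n) / 2)) = 2 powr (real CARD('n) / 2) * (4 * pi * (2 * e)) powr (- (real CARD('n) / 2))"
   proof -
    have "(4 * pi * (2 * e)) powr (- (real CARD('n) / 2)) = (2 * (4 * pi * e)) powr (- (real CARD('n) / 2))"
     by (simp add: mult_ac)
    also have "\<dots> = 2 powr (- (real CARD('n) / 2)) * (4 * pi * e) powr (- (real CARD('n) / 2))" by (rule powr_mult)
    finally show ?thesis by (simp add: mult.assoc[symmetric] powr_add[symmetric])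
   qed
   have "Gk e (y n - z) \<le> (4 * pi * e) powr (- (real CARD('n) / 2)) * (exp (K\<^sup>2 / (4 * e)) * exp (- ((norm (y0 - z))\<^sup>2 / (4 * (2 * e)))))"
    unfolding heat_kernel_def by (intro mult_left_mono 1) auto
   also have "\<dots> = C * Gk (2 * e) (y0 - z)" unfolding 2 C_def heat_kernel_def by (simp only: mult_ac)
   finally show ?thesis .
  qed
  have wL: "L2 (\<lambda>z. C * Gk (2 * e) (y0 - z) + 0 * Gk (2 * e) (y0 - z))"
   using e by (intro L2_lin gbound_shift(1) gbound_heat_kernel) auto
  have c: "continuous_on UNIV (Gk e :: real ^ 'n \<Rightarrow> real)" by (rule hk_continuous[OF hk_base e])
  have lim: "(\<lambda>n. Gk e (y n - z)) ~> Gk e (y0 - z)" for z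
   by (rule continuous_on_tendsto_compose[OF c]) (auto intro!: tendsto_intros yl)
  have "(\<lambda>n. LBINT z. U (fst (p n)) z * Gk e (y n - z)) ~> (LBINT z. U (fst p0) z * Gk e (y0 - z))"
   by (rule wcurve_pair_tendsto[OF U s _ _ dominated_nrm2_tendsto[of "\<lambda>n z. Gk e (y n - z)" "\<lambda>z. Gk e (y0 - z)" "\<lambda>z. C * Gk (2 * e) (y0 - z)"]])
    (use p p0 lim wL bd in "auto simp: heat_kernel_nonneg mem_Times_iff")
  then show "(\<lambda>n. Ht e (U (fst (p n))) (snd (p n))) ~> Ht e (U (fst p0)) (snd p0)"
   by (simp add: conv_def y_def y0_def mult.commute)
 qed
 moreover have "closed ({0 :: real..} \<times> (UNIV :: (real ^ 'n) set))" by (intro closed_Times) auto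
 ultimately have "(\<lambda>p. indicator ({0..} \<times> UNIV) p *\<^sub>R Ht e (U (fst p)) (snd p)) \<in> BM borel"
  by (intro borel_measurable_continuous_on_indicator) auto
 moreover have "indicator ({0..} \<times> UNIV) p = (indicator {0..} (fst p) :: real)" for p :: "real \<times> (real ^ 'n)"
  by (auto simp: indicator_def mem_Times_iff)
 ultimately show ?thesis by simp
qed

text \<open>Products are approximated by products of the heat regularizations, which are jointly
  measurable and converge strongly in L^2 at each fixed time. The parameter space M is general so
  that it may be time alone or time and space together.\<close>

lemma wcurve_product_measurable:
 fixes U V :: "real \<Rightarrow> real ^ 'n \<Rightarrow> real"
 assumes U: "wcurve U E" and V: "wcurve V E" and s [measurable]: "s \<in> BM M"
  and K [measurable]: "(\<lambda>(w, y). K w y) \<in> BM (M \<Otimes>\<^sub>M lborel)" and B: "\<And>w. s w \<ge> 0 \<Longrightarrow> \<exists>B. \<forall>y. \<bar>K w y\<bar> \<le> B"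
 shows "(\<lambda>w. indicator {0..} (s w) * (LBINT y. U (s w) y * V (s w) y * K w y)) \<in> BM M"
proof -
 define X where "X = (\<lambda>n. 1 / real (Suc n))"
 have X: "X ~> 0" "\<And>n. X n > 0" "\<And>n. X n \<le> 1"
  unfolding X_def using LIMSEQ_inverse_real_of_nat by (auto simp: inverse_eq_divide)
 define A where "A = (\<lambda>U n (p :: real \<times> (real ^ 'n)). indicator {0..} (fst p) * Ht (X n) (U (fst p)) (snd p))"
 have [measurable]: "A U n \<in> BM borel" "A V n \<in> BM borel" for n
  unfolding A_def by (rule conv_heat_curve_measurable[OF U X(2)], rule conv_heat_curve_measurable[OF V X(2)])
 have m: "(\<lambda>w. LBINT y. A U n (s w, y) * A V n (s w, y) * K w y) \<in> BM M" for n
  by measurable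
 show ?thesis
 proof (rule borel_measurable_LIMSEQ_real[OF _ m])
  fix w assume "w \<in> space M"
  show "(\<lambda>n. LBINT y. A U n (s w, y) * A V n (s w, y) * K w y) ~> indicator {0..} (s w) * (LBINT y. U (s w) y * V (s w) y * K w y)"
  proof (cases "s w \<ge> 0")
   case True
   have UL: "L2 (U (s w))" and VL: "L2 (V (s w))" using U V True by (auto simp: wcurve_def)
   obtain B where B: "\<And>y. \<bar>K w y\<bar> \<le> B" using assms(5)[OF True] by blast
   have Km [measurable]: "K w \<in> BM borel"
    using measurable_compose[OF measurable_Pair1'[OF \<open>w \<in> space M\<close>] K] by simp
   have "(\<lambda>n. LBINT y. Ht (X n) (U (s w)) y * (Ht (X n) (V (s w)) y * K w y)) ~> (LBINT y. U (s w) y * (V (s w) y * K w y))"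
   proof (rule L2_pair_tendsto[OF heat_L2(1)[OF UL X(2)] UL heat_strong_tendsto[OF UL X]])
    show "L2 (\<lambda>y. Ht (X n) (V (s w)) y * K w y)" for n by (intro L2_bounded_mult[OF heat_L2(1)[OF VL X(2)] Km B])
    show "L2 (\<lambda>y. V (s w) y * K w y)" by (intro L2_bounded_mult[OF VL Km B])
    show "(\<lambda>n. nrm2 (\<lambda>y. Ht (X n) (V (s w)) y * K w y - V (s w) y * K w y)) ~> 0"
    proof (rule Lim_null_comparison)
     show "\<forall>\<^sub>F n in sequentially. norm (nrm2 (\<lambda>y. Ht (X n) (V (s w)) y * K w y - V (s w) y * K w y)) \<le> B * nrm2 (\<lambda>y. Ht (X n) (V (s w)) y - V (s w) y)"
     proof (intro always_eventually allI)
      fix n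
      show "norm (nrm2 (\<lambda>y. Ht (X n) (V (s w)) y * K w y - V (s w) y * K w y)) \<le> B * nrm2 (\<lambda>y. Ht (X n) (V (s w)) y - V (s w) y)"
       using nrm2_mult_le[OF L2_diff[OF heat_L2(1)[OF VL X(2)] VL] Km B, of n] by (simp add: left_diff_distrib)
     qed
     show "(\<lambda>n. B * nrm2 (\<lambda>y. Ht (X n) (V (s w)) y - V (s w) y)) ~> 0"
      using tendsto_mult_left[OF heat_strong_tendsto[OF VL X], of B] by simp
    qed
   qed
   then show ?thesis using True by (simp add: A_def mult.assoc)
  qed (simp add: A_def)
 qed
qed

section \<open>Divergence-free fields built from a scalar\<close>

abbreviation ex :: "'n::finite \<Rightarrow> real \<times> (real ^ 'n)" where "ex k \<equiv> (0, axis k 1)"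
abbreviation et :: "real \<times> (real ^ 'n)" where "et \<equiv> (1, 0)"

definition Lap :: "(real \<times> (real ^ 'n) \<Rightarrow> real) \<Rightarrow> real \<times> (real ^ 'n) \<Rightarrow> real"
 where "Lap f z = (SS k. dd (ex k) (\<lambda>z. dd (ex k) f z) z)"

text \<open>The field \<open>\<nabla>\<partial>\<^sub>i f - e\<^sub>i \<Delta>f\<close>, divergence free for every scalar \<open>f\<close>.\<close>

definition fld :: "'n \<Rightarrow> (real \<times> (real ^ 'n) \<Rightarrow> real) \<Rightarrow> 'n \<Rightarrow> real \<times> (real ^ 'n) \<Rightarrow> real"
 where "fld i f j z = dd (ex j) (\<lambda>z. dd (ex i) f z) z - (if j = i then 1 else 0) * Lap f z"

lemma smooth_Lap: "smooth f \<Longrightarrow> smooth (Lap f)"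
 unfolding Lap_def[abs_def] by (intro smooth_sum smooth_D(2))

lemma smooth_cmult: "smooth f \<Longrightarrow> smooth (\<lambda>z. c * f z :: real)"
 by (rule smooth_mult[OF smooth_const])

lemma smooth_diff: "smooth f \<Longrightarrow> smooth g \<Longrightarrow> smooth (\<lambda>z. f z - g z :: real)"
 using smooth_add[of f "\<lambda>z. (-1) * g z"] smooth_cmult[of g "-1"] by simp

lemma smooth_fld: "smooth f \<Longrightarrow> smooth (fld i f j)"
 unfolding fld_def[abs_def] by (intro smooth_diff smooth_cmult smooth_Lap smooth_D(2))

lemma dd_commute': "smooth f \<Longrightarrow> (\<lambda>z. dd v (\<lambda>z. dd w f z) z) = (\<lambda>z. dd w (\<lambda>z. dd v f z) z)"
 for f :: "'a::real_normed_vector \<Rightarrow> real"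
 using dd_commute by blast

lemma dd_Lap:
 assumes f: "smooth f" shows "dd v (Lap f) z = Lap (dd v f) z"
proof -
 have "dd v (Lap f) z = (SS k. dd v (\<lambda>z. dd (ex k) (\<lambda>z. dd (ex k) f z) z) z)"
  unfolding Lap_def[abs_def] by (intro dd_sum smooth_differentiable smooth_D(2) f)
 also have "\<dots> = (SS k. dd (ex k) (\<lambda>z. dd (ex k) (\<lambda>z. dd v f z) z) z)"
 proof (rule sum.cong[OF refl])
  fix k
  have "dd v (\<lambda>z. dd (ex k) (\<lambda>z. dd (ex k) f z) z) z = dd (ex k) (\<lambda>z. dd v (\<lambda>z. dd (ex k) f z) z) z"
   by (rule dd_commute[OF smooth_D(2)[OF f]])
  then show "dd v (\<lambda>z. dd (ex k) (\<lambda>z. dd (ex k) f z) z) z = dd (ex k) (\<lambda>z. dd (ex k) (\<lambda>z. dd v f z) z) z"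
   by (simp only: dd_commute'[OF f, of v])
 qed
 finally show "dd v (Lap f) z = Lap (dd v f) z" by (simp add: Lap_def)
qed

lemma dd_fld:
 assumes f: "smooth f" shows "dd v (fld i f j) z = fld i (dd v f) j z"
proof -
 have "dd v (fld i f j) z = dd v (\<lambda>z. dd (ex j) (\<lambda>z. dd (ex i) f z) z) z - dd v (\<lambda>z. (if j = i then 1 else 0) * Lap f z) z"
  unfolding fld_def[abs_def] by (intro dd_diff smooth_differentiable smooth_D(2) smooth_cmult smooth_Lap f)
 also have "dd v (\<lambda>z. (if j = i then 1 else 0) * Lap f z) z = (if j = i then 1 else 0) * Lap (dd v f) z"
  by (subst dd_cmult) (simp_all add: smooth_differentiable smooth_Lap f dd_Lap)
 also have "dd v (\<lambda>z. dd (ex j) (\<lambda>z. dd (ex i) f z) z) z = dd (ex j) (\<lambda>z. dd v (\<lambda>z. dd (ex i) f z) z) z"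
  by (rule dd_commute[OF smooth_D(2)[OF f]])
 finally show "dd v (fld i f j) z = fld i (dd v f) j z" by (simp only: dd_commute'[OF f, of v] fld_def[of i "dd v f" j z])
qed

lemma fld_div:
 assumes f: "smooth f" shows "(SS j. dd (ex j) (fld i f j) z) = 0"
proof -
 have "(SS j. dd (ex j) (fld i f j) z) = (SS j. dd (ex j) (\<lambda>z. dd (ex i) (\<lambda>z. dd (ex j) f z) z) z) - Lap (\<lambda>z. dd (ex i) f z) z"
  unfolding dd_fld[OF f] by (simp add: fld_def sum_subtractf if_distrib[of "\<lambda>c. c * _"] sum.delta' cong: if_cong)
 also have "(SS j. dd (ex j) (\<lambda>z. dd (ex i) (\<lambda>z. dd (ex j) f z) z) z) = Lap (\<lambda>z. dd (ex i) f z) z"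
  unfolding Lap_def by (simp only: dd_commute'[OF f, of "ex i"])
 finally show ?thesis by simp
qed

lemma Lap_fld:
 assumes f: "smooth f" shows "Lap (fld i f j) = fld i (Lap f) j"
proof
 fix z
 have "Lap (fld i f j) z = (SS k. fld i (dd (ex k) (dd (ex k) f)) j z)"
  unfolding Lap_def by (simp add: dd_fld f dd_fld[OF smooth_D(2)[OF f]])
 also have "\<dots> = (SS k. dd (ex j) (dd (ex i) (dd (ex k) (dd (ex k) f))) z) - (if j = i then 1 else 0) * (SS k. Lap (dd (ex k) (dd (ex k) f)) z)"
  unfolding fld_def by (simp add: sum_subtractf sum_distrib_left)
 also have "(SS k. dd (ex j) (dd (ex i) (dd (ex k) (dd (ex k) f))) z) = dd (ex j) (dd (ex i) (Lap f)) z"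
 proof -
  have "dd (ex i) (Lap f) = (\<lambda>z. SS k. dd (ex i) (dd (ex k) (dd (ex k) f)) z)"
   unfolding Lap_def[abs_def] by (rule ext) (intro dd_sum smooth_differentiable smooth_D(2) f)
  then show ?thesis
   by (simp only:) (intro dd_sum[symmetric] smooth_differentiable smooth_D(2) f)
 qed
 also have "(SS k. Lap (dd (ex k) (dd (ex k) f)) z) = Lap (Lap f) z"
  unfolding Lap_def[of "Lap f"] by (simp add: dd_Lap f dd_Lap[OF smooth_D(2)[OF f]])
 finally show "Lap (fld i f j) z = fld i (Lap f) j z" by (simp only: fld_def[of i "Lap f" j z])
qed

lemma dd_zero_open:
 assumes "open S" "z \<in> S" "\<And>z. z \<in> S \<Longrightarrow> f z = 0" shows "dd v f z = 0"
proof -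
 have "(f has_derivative (\<lambda>v. 0)) (at z)"
  by (rule has_derivative_transform_within_open[OF has_derivative_const[of 0] assms(1,2)]) (use assms(3) in auto)
 from frechet_derivative_at[OF this] show ?thesis by metis
qed

text \<open>The construction has constant coefficients and commutes with the backward heat operator.
  The equation is assumed on an open set only, because the test function is cut off in time.\<close>

lemma fld_backward_heat:
 assumes f: "smooth f" and S: "open S" "z \<in> S" and h: "\<And>z. z \<in> S \<Longrightarrow> dd et f z + Lap f z = 0"
 shows "dd et (fld i f j) z + Lap (fld i f j) z = 0"
proof -
 define h where "h = (\<lambda>z. dd et f z + Lap f z)"
 have s: "smooth (dd et f)" "smooth (Lap f)" using f by (auto intro: smooth_D(2) smooth_Lap)
 have add: "dd v (\<lambda>z. a z + b z) z = dd v a z + dd v b z" if "smooth a" "smooth b" for v a b and z :: "real \<times> (real ^ 'a)"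
 proof -
  have "((\<lambda>z. a z + b z) has_derivative (\<lambda>v. dd v a z + dd v b z)) (at z)"
   by (intro has_derivative_add smooth_D(1) that)
  from frechet_derivative_at[OF this] show ?thesis by metis
 qed
 have "dd et (fld i f j) z + Lap (fld i f j) z = fld i (dd et f) j z + fld i (Lap f) j z"
  by (simp add: dd_fld Lap_fld f)
 also have "\<dots> = fld i h j z"
 proof -
  have d1: "dd v h = (\<lambda>z. dd v (dd et f) z + dd v (Lap f) z)" for v
   unfolding h_def by (rule ext) (rule add[OF s])
  have d2: "dd w (dd v h) z = dd w (dd v (dd et f)) z + dd w (dd v (Lap f)) z" for v w z
   unfolding d1 by (rule add) (intro smooth_D(2) s)+
  show ?thesis unfolding fld_def Lap_def[of h] Lap_def[of "dd et f"] Lap_def[of "Lap f"]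
   by (simp add: d2 sum.distrib algebra_simps)
 qed
 also have "\<dots> = 0"
 proof -
  have 1: "dd v h z = 0" if "z \<in> S" for v z by (rule dd_zero_open[OF S(1) that]) (use h in "simp add: h_def")
  have 2: "dd w (dd v h) z = 0" for v w by (rule dd_zero_open[OF S 1])
  show ?thesis unfolding fld_def Lap_def by (simp add: 2)
 qed
 finally show ?thesis .
qed

abbreviation cmp :: "(real ^ 'n \<Rightarrow> real ^ 'n) \<Rightarrow> 'n \<Rightarrow> real ^ 'n \<Rightarrow> real"
 where "cmp f j \<equiv> borel_rep (\<lambda>x. f x $ j)"

section \<open>The weakly continuous solution at every time\<close>

text \<open>Good times are dense from the right at every t, including t = 0; together with weak
  continuity this upgrades statements for almost every time to all times.\<close>

lemma AE_lebesgue_sequence: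
 fixes t T :: real
 assumes ae: "AE s in lebesgue_on S. P s" and S: "{t..<T} \<subseteq> S" "S \<in> sets lebesgue" and t: "t < T"
 obtains s where "s ~> t" "\<And>n. t \<le> s n" "\<And>n::nat. s n < T" "\<And>n. P (s n)"
proof -
 have ae': "AE s in lebesgue. s \<in> S \<longrightarrow> P s" using ae S(2) by (simp add: AE_restrict_space_iff)
 have "\<exists>s. t < s \<and> s < min T (t + 1 / real (Suc n)) \<and> P s" for n
 proof (rule ccontr)
  define b where "b = min T (t + 1 / real (Suc n))"
  assume no: "\<not> ?thesis"
  have b: "t < b" using t by (simp add: b_def)
  have "AE s in lebesgue. s \<notin> {t<..<b}"
   using ae' by eventually_elim (use no S(1) in "auto simp: b_def subset_eq")
  then have "emeasure lebesgue {t<..<b} = 0" by (subst AE_iff_null_sets[THEN iffD2, THEN null_setsD1]) auto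
  then show False using b by simp
 qed
 then obtain s where s: "\<And>n. t < s n" "\<And>n. s n < min T (t + 1 / real (Suc n))" "\<And>n. P (s n)" by metis
 have "s ~> t"
 proof (rule tendsto_sandwich)
  show "(\<lambda>n. t) ~> t" by simp
  show "(\<lambda>n. t + 1 / real (Suc n)) ~> t"
   using tendsto_add[OF tendsto_const[of t] LIMSEQ_inverse_real_of_nat] by (simp add: inverse_eq_divide)
 qed (use s in "auto intro!: always_eventually less_imp_le simp del: of_nat_Suc")
 moreover have "t \<le> s n" "s n < T" for n using s(1,2)[of n] by auto
 ultimately show ?thesis using that s(3) by blast
qed

lemma L2_pair_component:
 fixes f :: "real ^ 'n \<Rightarrow> real ^ 'n"
 assumes g: "L2 g"
 shows "(\<lambda>x. \<chi> i. if i = j then g x else 0) \<in> Lp_space 2"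
  "f \<in> Lp_space 2 \<Longrightarrow> L2_pair f (\<lambda>x. \<chi> i. if i = j then g x else 0) = (LBINT x. cmp f j x * g x)"
proof -
 note [measurable] = L2_measurable[OF g]
 have m: "(\<lambda>x. \<chi> i. if i = j then g x else 0 :: real ^ 'n) \<in> BM borel"
  by (subst borel_measurable_euclidean_space) (auto simp: Basis_vec_def inner_axis)
 have n: "norm (\<chi> i. if i = j then g x else 0 :: real ^ 'n) powr 2 = (g x)\<^sup>2" for x
  by (simp add: norm_vec_def L2_set_def if_distrib[of "\<lambda>c. c\<^sup>2"] sum.delta powr_numeral cong: if_cong)
 have "integrable lebesgue (\<lambda>x. (g x)\<^sup>2)" using g by (simp add: L2_def integrable_completion)
 moreover have "(\<lambda>x. \<chi> i. if i = j then g x else 0 :: real ^ 'n) \<in> BM lebesgue"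
  by (rule measurable_completion) (use m in simp)
 ultimately show "(\<lambda>x. \<chi> i. if i = j then g x else 0 :: real ^ 'n) \<in> Lp_space 2"
  unfolding Lp_space_def mem_Collect_eq n by simp
 have z: "L2 (\<lambda>x. 0 :: real)" by (simp add: L2_def)
 assume f: "f \<in> Lp_space 2"
 have "L2 (\<lambda>x. (\<chi> i. if i = j then g x else 0 :: real ^ 'n) $ k)" for k by (cases "k = j") (use g z in auto)
 from L2_pair_rep[OF f this] have r: "L2_pair f (\<lambda>x. \<chi> i. if i = j then g x else 0) = (SS k. LBINT x. cmp f k x * (if k = j then g x else 0))"
  by simp
 show "L2_pair f (\<lambda>x. \<chi> i. if i = j then g x else 0) = (LBINT x. cmp f j x * g x)"
 proof -
  have "(LBINT x. cmp f k x * (if k = j then g x else 0)) = (if k = j then LBINT x. cmp f j x * g x else 0)" for k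
   by simp
  then show ?thesis by (simp only: r) simp
 qed
qed

text \<open>The norm is bounded for almost every time. Weak lower semicontinuity gives the bound at
  each t: the pairing of \<open>U (s n)\<close> with \<open>U t\<close> is at most D times the norm
  of \<open>U t\<close> and tends to its square.\<close>

lemma weak_solution_wcurve:
 fixes u :: "real \<Rightarrow> real ^ 'n \<Rightarrow> real ^ 'n"
 assumes ws: "weak_solution u\<^sub>0 u" and wc: "weakly_continuous_from u\<^sub>0 u"
 obtains E where "\<And>j. wcurve (\<lambda>t. cmp (u t) j) E"
proof -
 have uL: "u t \<in> Lp_space 2" if "t \<ge> 0" for t using wc that by (simp add: weakly_continuous_from_def)
 have UL: "L2 (cmp (u t) j)" if "t \<ge> 0" for t j by (rule Lp_space_2_rep(1)[OF uL[OF that]])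
 have cont: "continuous_on {0..} (\<lambda>t. LBINT x. cmp (u t) j x * g x)" if g: "L2 g" for g j
 proof -
  have "continuous_on {0..} (\<lambda>t. L2_pair (u t) (\<lambda>x. \<chi> i. if i = j then g x else 0))"
   using wc L2_pair_component(1)[OF g] by (simp add: weakly_continuous_from_def)
  then show ?thesis by (rule continuous_on_eq) (use L2_pair_component(2)[OF g uL] in auto)
 qed
 have "\<exists>C. \<forall>t\<in>{0..T}. \<forall>j. nrm2 (cmp (u t) j) \<le> C" for T
 proof (cases "T \<ge> 0")
  case True
  \<comment> \<open>A longer interval than [0, T], since the end point T is approached from the
    right.\<close>
  then have "u \<in> Linf_L2 (T + 1)" using ws by (simp add: weak_solution_def)
  then obtain C where C: "AE t in lebesgue_on {0..T+1}. Lp_norm 2 (u t) \<le> C" by (auto simp: Linf_L2_def)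
  define D where "D = max C 0"
  have "nrm2 (cmp (u t) j) \<le> D" if t: "t \<in> {0..T}" for t j
  proof -
   obtain s where s: "s ~> t" "\<And>n. t \<le> s n" "\<And>n::nat. s n < T + 1" "\<And>n. Lp_norm 2 (u (s n)) \<le> C"
    by (rule AE_lebesgue_sequence[OF C, of t "T + 1"]) (use t in auto)
   let ?U = "\<lambda>t. cmp (u t) j"
   have bd: "nrm2 (?U (s n)) \<le> D" for n
   proof -
    have "(nrm2 (?U (s n)))\<^sup>2 \<le> (Lp_norm 2 (u (s n)))\<^sup>2"
     unfolding nrm2_square using s(2)[of n] t by (intro Lp_space_2_rep(3) uL) auto
    then have "nrm2 (?U (s n)) \<le> Lp_norm 2 (u (s n))" by (rule power2_le_imp_le) (simp add: Lp_norm_def)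
    then show ?thesis using s(4)[of n] by (simp add: D_def)
   qed
   have "(\<lambda>n. LBINT x. ?U (s n) x * ?U t x) ~> (LBINT x. ?U t x * ?U t x)"
    by (rule continuous_on_tendsto_compose[OF cont[OF UL] s(1)]) (use s(2) t in "auto intro!: always_eventually intro: order.trans")
   then have "(LBINT x. ?U t x * ?U t x) \<le> D * nrm2 (?U t)"
   proof (rule LIMSEQ_le_const2, intro exI allI impI)
    fix n :: nat
    have "(LBINT x. ?U (s n) x * ?U t x) \<le> nrm2 (?U (s n)) * nrm2 (?U t)"
     using L2_CS[OF UL[of "s n" j] UL[of t j]] s(2)[of n] t by auto
    also have "\<dots> \<le> D * nrm2 (?U t)" by (intro mult_right_mono bd) simp
    finally show "(LBINT x. ?U (s n) x * ?U t x) \<le> D * nrm2 (?U t)" .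
   qed
   then have "nrm2 (?U t) * nrm2 (?U t) \<le> D * nrm2 (?U t)"
    using nrm2_square[of "?U t"] by (simp add: power2_eq_square)
   then show ?thesis using nrm2_nonneg[of "?U t"] by (cases "nrm2 (?U t) = 0") (auto simp: D_def)
  qed
  then show ?thesis by blast
 qed auto
 then obtain E where E: "\<And>T t j. t \<in> {0..T} \<Longrightarrow> nrm2 (cmp (u t) j) \<le> E T" by metis
 show ?thesis by (rule that[of E]) (use UL cont E in "auto simp: wcurve_def")
qed

lemma weakly_div_free_component:
 fixes f :: "real ^ 'n \<Rightarrow> real ^ 'n"
 assumes f: "f \<in> Lp_space 2" and d: "weakly_div_free f" and \<psi>: "test_function \<psi>"
 shows "(SS k. LBINT x. cmp f k x * partial k \<psi> x) = 0"
proof -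
 have p: "L2 (partial k \<psi>)" for k by (intro test_function_L2 test_function_partial \<psi>)
 have "integrable lebesgue (\<lambda>x. f x $ k * partial k \<psi> x)" for k
  unfolding borel_rep_mult(2)[OF Lp_space_2_rep(2)[OF f] L2_measurable[OF p]] by (intro L2_mult Lp_space_2_rep f p)
 then have "(LINT x|lebesgue. (SS k. f x $ k * partial k \<psi> x)) = (SS k. LINT x|lebesgue. f x $ k * partial k \<psi> x)"
  by simp
 moreover have "(LINT x|lebesgue. (SS k. f x $ k * partial k \<psi> x)) = 0" using d \<psi> by (simp add: weakly_div_free_def)
 ultimately show ?thesis by (simp add: borel_rep_mult(1)[OF Lp_space_2_rep(2)[OF f] L2_measurable[OF p]])
qed

lemma test_function_dd:
 fixes f :: "'a :: euclidean_space \<Rightarrow> real"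
 assumes f: "test_function f"
 shows "test_function (dd v f)" "closure {z. dd v f z \<noteq> 0} \<subseteq> closure {z. f z \<noteq> 0}"
proof -
 have "dd v f z = 0" if "z \<notin> closure {z. f z \<noteq> 0}" for z
 proof -
  have "(f has_derivative (\<lambda>v. 0)) (at z)"
   by (rule has_derivative_transform_within_open[OF has_derivative_const[of 0], of "- closure {x. f x \<noteq> 0}"])
    (use that closure_subset[of "{x. f x \<noteq> 0}"] in auto)
  from frechet_derivative_at[OF this] show ?thesis by metis
 qed
 then have "{z. dd v f z \<noteq> 0} \<subseteq> closure {z. f z \<noteq> 0}" by auto
 then show c: "closure {z. dd v f z \<noteq> 0} \<subseteq> closure {z. f z \<noteq> 0}" by (rule closure_minimal) simp
 have "compact (closure {z. f z \<noteq> 0})" using f by (simp add: test_function_def)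
 from compact_Int_closed[OF this closed_closure, of "{z. dd v f z \<noteq> 0}"]
 have "compact (closure {z. dd v f z \<noteq> 0})" using c by (simp add: Int_absorb1)
 then show "test_function (dd v f)" using f by (auto simp: test_function_def intro: smooth_D(2))
qed

lemma test_function_supported:
 fixes f :: "'a :: euclidean_space \<Rightarrow> real" and g :: "'a \<Rightarrow> 'b :: real_normed_vector"
 assumes f: "test_function f" and g: "smooth g" "\<And>z. z \<notin> closure {z. f z \<noteq> 0} \<Longrightarrow> g z = 0"
 shows "test_function g" "closure {z. g z \<noteq> 0} \<subseteq> closure {z. f z \<noteq> 0}"
proof -
 have "{z. g z \<noteq> 0} \<subseteq> closure {z. f z \<noteq> 0}" using g(2) by auto
 then show c: "closure {z. g z \<noteq> 0} \<subseteq> closure {z. f z \<noteq> 0}" by (rule closure_minimal) simp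
 have "compact (closure {z. f z \<noteq> 0})" using f by (simp add: test_function_def)
 from compact_Int_closed[OF this closed_closure, of "{z. g z \<noteq> 0}"]
 have "compact (closure {z. g z \<noteq> 0})" using c by (simp add: Int_absorb1)
 then show "test_function g" using g by (simp add: test_function_def)
qed

lemma test_function_fld:
 assumes f: "test_function f"
 shows "z \<notin> closure {z. f z \<noteq> 0} \<Longrightarrow> Lap f z = 0" "test_function (Lap f)"
  "z \<notin> closure {z. f z \<noteq> 0} \<Longrightarrow> fld i f j z = 0" "test_function (fld i f j)"
proof -
 have s: "smooth f" using f by (simp add: test_function_def)
 have z: "dd v (dd w f) z = 0" if "z \<notin> closure {z. f z \<noteq> 0}" for v w z
 proof -
  have "z \<notin> closure {z. dd v (dd w f) z \<noteq> 0}"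
   using that test_function_dd(2)[OF test_function_dd(1)[OF f], of w v] test_function_dd(2)[OF f, of w] by blast
  then show ?thesis using closure_subset[of "{z. dd v (dd w f) z \<noteq> 0}"] by blast
 qed
 have L: "Lap f z = 0" if "z \<notin> closure {z. f z \<noteq> 0}" for z by (simp add: Lap_def z[OF that])
 have F: "fld i f j z = 0" if "z \<notin> closure {z. f z \<noteq> 0}" for z by (simp add: fld_def z[OF that] L[OF that])
 show "test_function (Lap f)" by (rule test_function_supported(1)[OF f smooth_Lap[OF s] L])
 show "test_function (fld i f j)" by (rule test_function_supported(1)[OF f smooth_fld[OF s] F])
 show "z \<notin> closure {z. f z \<noteq> 0} \<Longrightarrow> Lap f z = 0" by (rule L)
 show "z \<notin> closure {z. f z \<noteq> 0} \<Longrightarrow> fld i f j z = 0" by (rule F)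
qed

lemma test_function_dominated:
 fixes f :: "real \<times> (real ^ 'n) \<Rightarrow> real"
 assumes f: "test_function f"
 obtains w where "L2 w" "\<And>s y. \<bar>f (s, y)\<bar> \<le> w y"
proof -
 define K where "K = snd ` closure {z. f z \<noteq> 0}"
 have K: "compact K" unfolding K_def
  using f by (intro compact_continuous_image continuous_intros) (auto simp: test_function_def)
 obtain B where B: "\<And>z. \<bar>f z\<bar> \<le> B" using test_function_bounded[OF f] by blast
 have "K \<in> sets lborel" using compact_imp_closed[OF K] by simp
 moreover have "emeasure lborel K < \<infinity>" by (rule emeasure_compact_finite[OF K])
 ultimately have "Li (\<lambda>y. indicator K y * B\<^sup>2 :: real)" by (intro integrable_mult_left) simp
 moreover have "(indicator K y * B)\<^sup>2 = (indicator K y * B\<^sup>2 :: real)" for y by (auto simp: indicator_def)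
 ultimately have "L2 (\<lambda>y. indicator K y * B)" using compact_imp_closed[OF K] by (simp add: L2_def)
 moreover have "\<bar>f (s, y)\<bar> \<le> indicator K y * B" for s y
 proof (cases "f (s, y) = 0")
  case True then show ?thesis using B[of "(s, y)"] by auto
 next
  case False
  then have "(s, y) \<in> closure {z. f z \<noteq> 0}" by (intro subsetD[OF closure_subset]) simp
  then have "y \<in> K" unfolding K_def by force
  then show ?thesis using B by simp
 qed
 ultimately show ?thesis using that by blast
qed

lemma smooth_continuous: "smooth f \<Longrightarrow> continuous_on UNIV f"
 by (rule smooth_D(3))

lemma wcurve_pair_measurable:
 fixes \<psi> :: "real \<times> (real ^ 'n) \<Rightarrow> real"
 assumes U: "wcurve U E" and c: "continuous_on UNIV \<psi>" and w: "L2 w" "\<And>s y. \<bar>\<psi> (s, y)\<bar> \<le> w y"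
 shows "(\<lambda>s. indicator {0..t} s * (LBINT y. U s y * \<psi> (s, y))) \<in> BM borel"
proof -
 have "continuous_on {0..t} (\<lambda>s. LBINT y. U s y * \<psi> (s, y))"
  by (rule continuous_on_subset[OF wcurve_continuous_pair[OF U c w]]) auto
 from borel_measurable_continuous_on_indicator[OF _ this] show ?thesis by simp
qed

lemma wcurve_quadratic_measurable:
 fixes \<psi> :: "real \<times> (real ^ 'n) \<Rightarrow> real"
 assumes U: "wcurve U E" "wcurve V E" and c: "continuous_on UNIV \<psi>" and B: "\<And>z. \<bar>\<psi> z\<bar> \<le> B"
 shows "(\<lambda>s. indicator {0..t} s * (LBINT y. U s y * V s y * \<psi> (s, y))) \<in> BM borel"
proof -
 have "\<psi> \<in> BM borel" using c by (rule borel_measurable_continuous_onI)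
 then have Km: "(\<lambda>(s, x). \<psi> (s, x)) \<in> BM lb2" by (simp add: lborel_prod split_beta')
 have "(\<lambda>s. indicator {0..} s * (LBINT y. U s y * V s y * \<psi> (s, y))) \<in> BM lborel"
  using B by (intro wcurve_product_measurable[OF U _ Km]) auto
 then have [measurable]: "(\<lambda>s. indicator {0..} s * (LBINT y. U s y * V s y * \<psi> (s, y))) \<in> BM borel" by simp
 have "(\<lambda>s. indicator {0..t} s * (indicator {0..} s * (LBINT y. U s y * V s y * \<psi> (s, y)))) \<in> BM borel" by measurable
 moreover have "indicator {0..t} s * (indicator {0..} s * c) = (indicator {0..t} s * c :: real)" for s c by (auto simp: indicator_def)
 ultimately show ?thesis by simp
qed

section \<open>Removal of the cut-off and integration by parts\<close>

text \<open>Collects what dominated convergence in s needs when the cut-off is removed: pointwise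
  limits of linear and quadratic pairings, bounds uniform in n, and measurability.\<close>

lemma fam_pair_limit:
 fixes x :: "real ^ 'n"
 assumes ka: "smooth ka" "\<And>s. ka s > 0" "\<forall>s\<in>S. a \<le> ka s \<and> ka s \<le> b" "0 < a" "a \<le> b" and S: "compact S"
  and F: "fam ka x S F F0" and X: "X ~> 0" "\<And>n. X n > 0" "\<And>n. X n \<le> (1 :: real)"
  and U: "wcurve U E" and V: "wcurve V E"
 shows "s \<ge> 0 \<Longrightarrow> (\<lambda>n. LBINT y. U s y * F (X n) (s, y)) ~> (LBINT y. U s y * F0 (s, y))"
  "s \<ge> 0 \<Longrightarrow> (\<lambda>n. LBINT y. U s y * V s y * F (X n) (s, y)) ~> (LBINT y. U s y * V s y * F0 (s, y))"
  "\<exists>B. \<forall>n. \<forall>s\<in>{0..t}. \<bar>LBINT y. U s y * F (X n) (s, y)\<bar> \<le> B"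
  "\<exists>B. \<forall>n. \<forall>s\<in>{0..t}. \<bar>LBINT y. U s y * V s y * F (X n) (s, y)\<bar> \<le> B"
  "(\<lambda>s. indicator {0..t} s * (LBINT y. U s y * F (X n) (s, y))) \<in> BM borel"
  "(\<lambda>s. indicator {0..t} s * (LBINT y. U s y * V s y * F (X n) (s, y))) \<in> BM borel"
  "continuous_on {0..} (\<lambda>s. LBINT y. U s y * F0 (s, y))"
proof -
 have "\<exists>C\<ge>0. (\<forall>ep s y. 0 \<le> ep \<longrightarrow> ep \<le> 1 \<longrightarrow> \<bar>F ep (s, y)\<bar> \<le> C * Gk (4 * b) (y - x))
   \<and> (\<forall>s y. \<bar>F0 (s, y)\<bar> \<le> C * Gk (4 * b) (y - x))"
 proof (rule fam_bound[OF F bspec[OF ka(3)] ka(4,5) S])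
  fix C assume C: "C \<ge> 0" "\<And>ep s y. 0 \<le> ep \<Longrightarrow> ep \<le> 1 \<Longrightarrow> \<bar>F ep (s, y)\<bar> \<le> C * Gk (4 * b) (y - x)"
   "\<And>s y. \<bar>F0 (s, y)\<bar> \<le> C * Gk (4 * b) (y - x)"
  show ?thesis by (intro exI[of _ C] conjI allI impI C)
 qed
 then obtain C where C: "C \<ge> 0" "\<And>ep s y. 0 \<le> ep \<Longrightarrow> ep \<le> 1 \<Longrightarrow> \<bar>F ep (s, y)\<bar> \<le> C * Gk (4 * b) (y - x)"
  "\<And>s y. \<bar>F0 (s, y)\<bar> \<le> C * Gk (4 * b) (y - x)"
  by blast
 define w where "w = (\<lambda>y. C * Gk (4 * b) (y - x))"
 have b: "4 * b > 0" using ka by auto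
 have "L2 (\<lambda>y. C * Gk (4 * b) (x - y) + 0 * Gk (4 * b) (x - y))"
  by (intro L2_lin gbound_shift(1) gbound_heat_kernel b)
 then have w: "L2 w" by (simp add: w_def heat_kernel_diff_commute[of _ x])
 have Fw: "\<bar>F (X n) (s, y)\<bar> \<le> w y" "\<bar>F0 (s, y)\<bar> \<le> w y" for n s y
  unfolding w_def using C(2)[of "X n" s y] C(3) X(2,3)[of n] by auto
 define B where "B = C * (4 * pi * (4 * b)) powr (- (real CARD('n) / 2))"
 have wB: "w y \<le> B" for y
  unfolding w_def B_def heat_kernel_def using C(1) b by (intro mult_left_mono) (auto intro!: mult_left_le)
 have FB: "\<bar>F (X n) z\<bar> \<le> B" "\<bar>F0 z\<bar> \<le> B" for n z
  using Fw(1)[of n "fst z" "snd z"] Fw(2)[of "fst z" "snd z"] wB[of "snd z"] by auto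
 have sm: "smooth (F ep)" "smooth F0" for ep using fam_smooth[OF ka(1,2) compact_imp_closed[OF S] F] by auto
 have fm: "F ep \<in> BM borel" "F0 \<in> BM borel" for ep
  by (auto intro!: borel_measurable_continuous_onI smooth_continuous sm)
 have m: "(\<lambda>y. F ep (s, y)) \<in> BM borel" "(\<lambda>y. F0 (s, y)) \<in> BM borel" for s ep
  using measurable_compose[OF _ fm(1), of "\<lambda>y. (s, y)"] measurable_compose[OF _ fm(2), of "\<lambda>y. (s, y)"] by auto
 have lim: "(\<lambda>n. F (X n) z) ~> F0 z" for z
 proof (rule tendsto_eventually)
  have "(\<lambda>n. X n * (norm (snd z - x))\<^sup>2) ~> 0 * (norm (snd z - x))\<^sup>2" by (intro tendsto_intros X)
  then have "\<forall>\<^sub>F n in sequentially. X n * (norm (snd z - x))\<^sup>2 < 1" by (rule order_tendstoD) simp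
  then show "\<forall>\<^sub>F n in sequentially. F (X n) z = F0 z" by eventually_elim (rule fam_eq_limit[OF F])
 qed
 have UL: "L2 (U s)" and VL: "L2 (V s)" if "s \<ge> 0" for s using U V that by (auto simp: wcurve_def)
 have E: "nrm2 (U s) \<le> E t" "nrm2 (V s) \<le> E t" if "s \<in> {0..t}" for s using U V that by (auto simp: wcurve_def)
 have FL: "L2 (\<lambda>y. F (X n) (s, y))" for n s
  by (rule dominated_nrm2_tendsto(1)[of "\<lambda>n y. F (X n) (s, y)" "\<lambda>y. F0 (s, y)" w]) (use m lim w Fw in auto)
 { fix s :: real assume s: "s \<ge> 0"
  have d: "(\<lambda>n. nrm2 (\<lambda>y. F (X n) (s, y) - F0 (s, y))) ~> 0" "L2 (\<lambda>y. F0 (s, y))"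
   by (rule dominated_nrm2_tendsto(3)[of "\<lambda>n y. F (X n) (s, y)" "\<lambda>y. F0 (s, y)" w], use m lim w Fw in auto)
    (rule dominated_nrm2_tendsto(2)[of "\<lambda>n y. F (X n) (s, y)" "\<lambda>y. F0 (s, y)" w], use m lim w Fw in auto)
  show "(\<lambda>n. LBINT y. U s y * F (X n) (s, y)) ~> (LBINT y. U s y * F0 (s, y))"
   by (rule L2_pair_tendsto[OF UL[OF s] UL[OF s] _ FL d(2,1)]) (simp add: nrm2_def)
  show "(\<lambda>n. LBINT y. U s y * V s y * F (X n) (s, y)) ~> (LBINT y. U s y * V s y * F0 (s, y))"
  proof (rule integral_dominated_convergence[where w = "\<lambda>y. B * \<bar>U s y * V s y\<bar>"])
   note [measurable] = L2_measurable[OF UL[OF s]] L2_measurable[OF VL[OF s]] m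
   show "(\<lambda>y. U s y * V s y * F0 (s, y)) \<in> BM lborel" "(\<lambda>y. U s y * V s y * F (X n) (s, y)) \<in> BM lborel" for n
    by (intro borel_measurable_times; simp)+
   show "Li (\<lambda>y. B * \<bar>U s y * V s y\<bar>)" by (intro integrable_mult_right integrable_abs L2_mult UL VL s)
   show "AE y in lborel. (\<lambda>n. U s y * V s y * F (X n) (s, y)) ~> U s y * V s y * F0 (s, y)"
    by (intro AE_I2 tendsto_mult_left lim)
   show "AE y in lborel. norm (U s y * V s y * F (X n) (s, y)) \<le> B * \<bar>U s y * V s y\<bar>" for n
    by (intro AE_I2) (simp add: abs_mult mult.commute mult_right_mono[OF FB(1)])
  qed }
 show "\<exists>B. \<forall>n. \<forall>s\<in>{0..t}. \<bar>LBINT y. U s y * F (X n) (s, y)\<bar> \<le> B"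
 proof (intro exI allI ballI)
  fix n s assume s: "s \<in> {0..t}"
  have n: "nrm2 (\<lambda>y. F (X n) (s, y)) \<le> nrm2 w"
   unfolding nrm2_def using FL w Fw(1)[of n s] by (intro real_sqrt_le_mono integral_mono) (auto simp: L2_def abs_le_square_iff[symmetric] intro: order.trans[OF _ abs_ge_self])
  have "\<bar>LBINT y. U s y * F (X n) (s, y)\<bar> \<le> nrm2 (U s) * nrm2 (\<lambda>y. F (X n) (s, y))"
   using s by (intro L2_CS UL FL) auto
  also have "\<dots> \<le> E t * nrm2 w" using order.trans[OF nrm2_nonneg E(1)[OF s]] by (intro mult_mono E s n) auto
  finally show "\<bar>LBINT y. U s y * F (X n) (s, y)\<bar> \<le> E t * nrm2 w" .
 qed
 show "\<exists>B. \<forall>n. \<forall>s\<in>{0..t}. \<bar>LBINT y. U s y * V s y * F (X n) (s, y)\<bar> \<le> B"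
 proof (intro exI allI ballI)
  fix n s assume s: "s \<in> {0..t}"
  have s0: "s \<ge> 0" using s by simp
  have VF: "L2 (\<lambda>y. V s y * F (X n) (s, y))" "nrm2 (\<lambda>y. V s y * F (X n) (s, y)) \<le> B * nrm2 (V s)"
   by (rule L2_bounded_mult[OF VL[OF s0] m(1) FB(1)], rule nrm2_mult_le[OF VL[OF s0] m(1) FB(1)])
  have B0: "B \<ge> 0" using order.trans[OF abs_ge_zero FB(2)] .
  have "\<bar>LBINT y. U s y * (V s y * F (X n) (s, y))\<bar> \<le> nrm2 (U s) * nrm2 (\<lambda>y. V s y * F (X n) (s, y))"
   by (intro L2_CS UL VF s0)
  also have "\<dots> \<le> E t * (B * E t)"
   using order.trans[OF nrm2_nonneg E(1)[OF s]] B0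
   by (intro mult_mono E s order.trans[OF VF(2)] mult_left_mono) auto
  finally show "\<bar>LBINT y. U s y * V s y * F (X n) (s, y)\<bar> \<le> E t * (B * E t)" by (simp add: mult.assoc)
 qed
 show "(\<lambda>s. indicator {0..t} s * (LBINT y. U s y * F (X n) (s, y))) \<in> BM borel"
  by (rule wcurve_pair_measurable[OF U smooth_continuous[OF sm(1)] w Fw(1)])
 show "(\<lambda>s. indicator {0..t} s * (LBINT y. U s y * V s y * F (X n) (s, y))) \<in> BM borel"
  by (rule wcurve_quadratic_measurable[OF U V smooth_continuous[OF sm(1)] FB(1)])
 show "continuous_on {0..} (\<lambda>s. LBINT y. U s y * F0 (s, y))"
  by (rule wcurve_continuous_pair[OF U smooth_continuous[OF sm(2)] w Fw(2)])
qed

text \<open>Test functions live on all of time, but \<open>T - s\<close> is a legitimate heat time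
  only for s < T. The function \<open>ka\<close> interpolates between \<open>T - s\<close>, where
  \<Theta> = 1, and the constant 1, where \<Theta> = 0, and thus stays smooth and positive.\<close>

lemma smooth_cutoff_in_time:
 fixes t T :: real assumes t: "0 \<le> t" "t < T"
 obtains \<Theta> ka :: "real \<Rightarrow> real" and \<delta> where "smooth \<Theta>" "smooth ka" "\<And>s. ka s > (0 :: real)" "\<delta> > 0" "t + \<delta> < T"
  "\<And>s. s \<notin> {-2..T - \<delta>} \<Longrightarrow> \<Theta> s = 0" "\<And>s. -1 < s \<Longrightarrow> s < t + \<delta> \<Longrightarrow> \<Theta> s = 1 \<and> ka s = T - s"
proof -
 \<comment> \<open>Thirds of the gap: \<Theta> is 1 up to t + \<delta>, falls to 0 between t +
   \<delta> and t + 2 \<delta> = T - \<delta>, and its support ends strictly before T.\<close>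
 define \<delta> where "\<delta> = (T - t) / 3"
 have d: "\<delta> > 0" "T = t + 3 * \<delta>" using t by (auto simp: \<delta>_def field_simps)
 define \<Theta> where "\<Theta> = (\<lambda>s. smooth_step (s + 2) * smooth_step (s * (- 1 / \<delta>) + (T - \<delta>) / \<delta>))"
 define ka where "ka = (\<lambda>s. (s * (-1) + T) * \<Theta> s + (\<Theta> s * (-1) + 1))"
 have a: "smooth (\<lambda>s :: real. s * c + b)" for c b :: real
  by (rule smooth_affine[where f = "\<lambda>x. x" and L = "\<lambda>s. s * c"]) (auto intro!: smooth_bounded_linear bounded_linear_ident bounded_linear_mult_left)
 have a2: "smooth (\<lambda>s :: real. s + 2)" using a[of 1 2] by simp
 have s\<Theta>: "smooth \<Theta>" unfolding \<Theta>_def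
  by (rule smooth_mult[OF smooth_compose_real[OF smooth_step(1) a2] smooth_compose_real[OF smooth_step(1) a]])
 have ska: "smooth ka" unfolding ka_def
  by (rule smooth_add[OF smooth_mult[OF a s\<Theta>] smooth_compose_real[OF a s\<Theta>]])
 have b: "0 \<le> \<Theta> s" "\<Theta> s \<le> 1" for s unfolding \<Theta>_def using smooth_step(4,5) by (auto intro!: mult_nonneg_nonneg mult_le_one)
 have q: "s * (- 1 / \<delta>) + (T - \<delta>) / \<delta> = (T - \<delta> - s) / \<delta>" for s by (simp add: diff_divide_distrib)
 have z: "\<Theta> s = 0" if "s \<notin> {-2..T - \<delta>}" for s
  using that d smooth_step(2)[of "s + 2"] smooth_step(2)[of "(T - \<delta> - s) / \<delta>"] unfolding \<Theta>_def q by (auto simp: divide_nonpos_pos)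
 have o: "\<Theta> s = 1" if "-1 < s" "s < t + \<delta>" for s
  using that d smooth_step(3)[of "s + 2"] smooth_step(3)[of "(T - \<delta> - s) / \<delta>"] unfolding \<Theta>_def q by (simp add: le_divide_eq)
 have p: "ka s > 0" for s
 proof (cases "s < T")
  case True
  show ?thesis
  proof (cases "\<Theta> s = 1")
   case False
   then have "1 - \<Theta> s > 0" "(T - s) * \<Theta> s \<ge> 0" using b[of s] True by auto
   then show ?thesis unfolding ka_def by (simp add: algebra_simps)
  qed (use True in "simp add: ka_def")
 next
  case False
  then show ?thesis using z[of s] d by (simp add: ka_def)
 qed
 show ?thesis by (rule that[OF s\<Theta> ska p d(1) _ z]) (use d o in "auto simp: ka_def")
qed

text \<open>A Gaussian is not compactly supported, so the definition of the weak derivative is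
  extended to it by removing a cut-off. In effect: the heat flow commutes with the weak
  derivative.\<close>

lemma weak_deriv_heat:
 fixes U W :: "real ^ 'n \<Rightarrow> real"
 assumes U: "L2 U" and W: "L2 W" and UW: "weak_deriv k U W" and t: "t > 0"
 shows "(LBINT y. heat_grad k t (y - x) * U y) = - (LBINT y. Gk t (y - x) * W y)"
proof -
 obtain \<Theta> ka :: "real \<Rightarrow> real" and \<delta> where \<Theta>: "smooth \<Theta>" "\<delta> > 0"
  "\<And>s. s \<notin> {-2..1 - \<delta>} \<Longrightarrow> \<Theta> s = 0" "\<And>s. -1 < s \<Longrightarrow> s < 0 + \<delta> \<Longrightarrow> \<Theta> s = 1 \<and> ka s = 1 - s"
  by (rule smooth_cutoff_in_time[of 0 1]) auto
 define S where "S = {-2..1 - \<delta>}"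
 have S: "compact S" by (simp add: S_def)
 define F where "F = (\<lambda>ep z. \<Theta> (fst z) * (ep ^ 0 * cutoff 0 (ep * (norm (snd z - x))\<^sup>2)) * Gk t (snd z - x))"
 define F0 where "F0 = (\<lambda>z. if 0 = (0 :: nat) then \<Theta> (fst z) * Gk t (snd z - x) else 0)"
 have F: "fam (\<lambda>_. t) x S F F0" unfolding F_def F0_def by (rule fam_base[OF hk_base \<Theta>(1)]) (use \<Theta>(3) in "simp add: S_def")
 have F0: "F0 (0, y) = Gk t (y - x)" for y using \<Theta>(2,4) by (simp add: F0_def)
 note kS = smooth_const[of t] t
 have dF: "fam (\<lambda>_. t) x S (\<lambda>ep. dd (ex k) (F ep)) (dd (ex k) F0)"
  by (rule fam_dd(1)[OF kS compact_imp_closed[OF S] F])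
 define X where "X = (\<lambda>n. 1 / real (Suc n))"
 have X: "X ~> 0" "\<And>n. X n > 0" "\<And>n. X n \<le> 1"
  unfolding X_def using LIMSEQ_inverse_real_of_nat by (auto simp: inverse_eq_divide)
 \<comment> \<open>A fixed L^2 function is a constant weakly continuous curve; the space-time limits
   are then used on the slice at time 0.\<close>
 have w: "wcurve (\<lambda>_. f) (\<lambda>_. nrm2 f)" if "L2 f" for f :: "real ^ 'n \<Rightarrow> real" using that by (simp add: wcurve_def)
 have b: "\<forall>s\<in>S. t \<le> t \<and> t \<le> t" by simp
 have l1: "(\<lambda>n. LBINT y. U y * dd (ex k) (F (X n)) (0, y)) ~> (LBINT y. U y * dd (ex k) F0 (0, y))"
  by (rule fam_pair_limit(1)[OF kS b t order.refl S dF X w[OF U] w[OF U] order.refl])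
 have l2: "(\<lambda>n. - (LBINT y. W y * F (X n) (0, y))) ~> - (LBINT y. W y * F0 (0, y))"
  by (intro tendsto_minus fam_pair_limit(1)[OF kS b t order.refl S F X w[OF W] w[OF W] order.refl])
 have sl: "partial k (\<lambda>y. G (0, y)) y = dd (ex k) G (0, y)" if "smooth G" for G y by (rule partial_slice[OF smooth_differentiable[OF that]])
 have "(LBINT y. U y * dd (ex k) (F (X n)) (0, y)) = - (LBINT y. W y * F (X n) (0, y))" for n
 proof -
  have tf: "test_function (F (X n))" by (rule fam_test_function(1)[OF kS S F X(2)])
  have "(LBINT y. dd (ex k) (F (X n)) (0, y) * U y) = - (LBINT y. F (X n) (0, y) * W y)"
   using UW[unfolded weak_deriv_def, rule_format, OF test_function_slice[OF tf, of 0]] tf by (simp add: sl test_function_def)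
  then show ?thesis by (simp add: mult.commute)
 qed
 then have "(LBINT y. U y * dd (ex k) F0 (0, y)) = - (LBINT y. W y * F0 (0, y))"
  using LIMSEQ_unique[OF l1] l2 by simp
 moreover have "dd (ex k) F0 (0, y) = heat_grad k t (y - x)" for y
  using sl[OF fam_smooth(2)[OF kS compact_imp_closed[OF S] F], of y] partial_hk[OF hk_deriv_heat_kernel_grad t, of k x y] by (simp add: F0)
 ultimately show ?thesis by (simp add: F0 mult.commute)
qed

text \<open>The product of \<phi> and \<open>U j\<close> is not a test function. For fixed y the
  function \<open>\<phi> x * Gk t (x - y)\<close> is one; weighting the resulting identities with
  \<open>U j y\<close> and integrating over y amounts to testing with \<phi> times
  \<open>Ht t (U j)\<close>. The limit t -> 0 is weak convergence in L^2.\<close>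

lemma convection_by_parts:
 fixes U :: "'n \<Rightarrow> real ^ 'n \<Rightarrow> real"
 assumes U: "\<And>k. L2 (U k)" and W: "\<And>k. L2 (W k)" and UW: "\<And>k. weak_deriv k (U j) (W k)"
  and div: "\<And>\<psi>. test_function \<psi> \<Longrightarrow> (SS k. LBINT x. U k x * partial k \<psi> x) = 0"
  and \<phi>: "test_function \<phi>"
 shows "(SS k. LBINT x. U k x * W k x * \<phi> x) = - (SS k. LBINT x. U k x * U j x * partial k \<phi> x)"
proof -
 have p: "test_function (partial k \<phi>)" for k by (rule test_function_partial[OF \<phi>])
 have aL: "L2 (\<lambda>x. U k x * partial k \<phi> x)" for k
 proof -
  obtain B where "\<And>x. \<bar>partial k \<phi> x\<bar> \<le> B" using test_function_bounded[OF p] by blast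
  then show ?thesis by (intro L2_bounded_mult[OF U test_function_measurable[OF p]])
 qed
 have bL: "L2 (\<lambda>x. U k x * \<phi> x)" for k
 proof -
  obtain B where "\<And>x. \<bar>\<phi> x\<bar> \<le> B" using test_function_bounded[OF \<phi>] by blast
  then show ?thesis by (intro L2_bounded_mult[OF U test_function_measurable[OF \<phi>]])
 qed
 have key: "(SS k. (LBINT x. (U k x * partial k \<phi> x) * Ht t (U j) x)
   + (LBINT x. (U k x * \<phi> x) * Ht t (W k) x)) = 0" if t: "t > 0" for t
 proof -
  have gg: "gbound (heat_grad k t :: real ^ 'n \<Rightarrow> real)" "gbound (Gk t :: real ^ 'n \<Rightarrow> real)" for k
   using t by (auto intro: hk_gbound[OF hk_heat_grad] gbound_heat_kernel)
  have s: "smooth (\<lambda>x :: real ^ 'n. Gk t (x - y))" for y by (rule smooth_hk[OF hk_base t])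
  have \<phi>s: "smooth \<phi>" using \<phi> by (simp add: test_function_def)
  have i1: "Li (\<lambda>x. (U k x * partial k \<phi> x) * Gk t (x - y))" for k y
   using gbound_shift(1)[OF gg(2), of y] by (intro L2_mult aL) (simp add: heat_kernel_diff_commute[of t _ y])
  have i2: "Li (\<lambda>x. (U k x * \<phi> x) * heat_grad k t (x - y))" for k y
  proof -
   have "L2 (\<lambda>x. 0 * heat_grad k t (y - x) + (- 1) * heat_grad k t (y - x))"
    by (intro L2_lin gbound_shift(1)[OF gg(1)])
   then have "L2 (\<lambda>x. heat_grad k t (x - y))" by (simp add: heat_grad_odd[of k t _ y])
   then show ?thesis by (intro L2_mult bL)
  qed
  have "(SS k. (LBINT x. (U k x * partial k \<phi> x) * Gk t (x - y)) + (LBINT x. (U k x * \<phi> x) * heat_grad k t (x - y))) = 0" for y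
  proof -
   have "0 = (SS k. LBINT x. U k x * partial k (\<lambda>x. \<phi> x * Gk t (x - y)) x)"
    using div[OF test_function_mult[OF \<phi> s]] by simp
   also have "\<dots> = (SS k. (LBINT x. (U k x * partial k \<phi> x) * Gk t (x - y)) + (LBINT x. (U k x * \<phi> x) * heat_grad k t (x - y)))"
   proof (rule sum.cong[OF refl])
    fix k
    have "U k x * partial k (\<lambda>x. \<phi> x * Gk t (x - y)) x = (U k x * partial k \<phi> x) * Gk t (x - y) + (U k x * \<phi> x) * heat_grad k t (x - y)" for x
     unfolding partial_mult[OF \<phi>s s] partial_hk[OF hk_deriv_heat_kernel_grad t] by (simp add: algebra_simps)
    then show "(LBINT x. U k x * partial k (\<lambda>x. \<phi> x * Gk t (x - y)) x)
     = (LBINT x. (U k x * partial k \<phi> x) * Gk t (x - y)) + (LBINT x. (U k x * \<phi> x) * heat_grad k t (x - y))"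
     using i1 i2 by simp
   qed
   finally show ?thesis by simp
  qed
  note zero = this
  have P1: "integrable lb2 (\<lambda>(x, y). (U k x * partial k \<phi> x) * Gk t (x - y) * U j y)" for k
   by (rule pair_integrable_L2[OF aL U gg(2)])
  have P2: "integrable lb2 (\<lambda>(x, y). (U k x * \<phi> x) * heat_grad k t (x - y) * U j y)" for k
   by (rule pair_integrable_L2[OF bL U gg(1)])
  have e1: "(LBINT x. (U k x * partial k \<phi> x) * Ht t (U j) x) = (LBINT y. (LBINT x. (U k x * partial k \<phi> x) * Gk t (x - y)) * U j y)" for k
   by (rule L2_conv_swap[OF aL U gg(2)])
  have e2: "(LBINT x. (U k x * \<phi> x) * Ht t (W k) x) = (LBINT y. (LBINT x. (U k x * \<phi> x) * heat_grad k t (x - y)) * U j y)" for k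
  proof -
   have "Ht t (W k) x = conv (heat_grad k t) (U j) x" for x
    using weak_deriv_heat[OF U W UW t, of k x] by (simp add: conv_def heat_grad_odd[of k t x] heat_kernel_diff_commute[of t x])
   then show ?thesis using L2_conv_swap[OF bL U gg(1)] by (simp only:)
  qed
  have I1: "Li (\<lambda>y. (LBINT x. (U k x * partial k \<phi> x) * Gk t (x - y)) * U j y)"
   "Li (\<lambda>y. (LBINT x. (U k x * \<phi> x) * heat_grad k t (x - y)) * U j y)" for k
   using lborel_pair.integrable_snd[OF P1[of k]] lborel_pair.integrable_snd[OF P2[of k]] by simp_all
  have "(SS k. (LBINT x. (U k x * partial k \<phi> x) * Ht t (U j) x) + (LBINT x. (U k x * \<phi> x) * Ht t (W k) x))
   = (LBINT y. (SS k. (LBINT x. (U k x * partial k \<phi> x) * Gk t (x - y)) + (LBINT x. (U k x * \<phi> x) * heat_grad k t (x - y))) * U j y)"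
   unfolding e1 e2 sum_distrib_right distrib_right using I1 by simp
  also have "\<dots> = 0" by (simp add: zero)
  finally show ?thesis .
 qed
 define X where "X = (\<lambda>n. 1 / real (Suc n))"
 have X: "X ~> 0" "\<And>n. X n > 0" "\<And>n. X n \<le> 1"
  unfolding X_def using LIMSEQ_inverse_real_of_nat by (auto simp: inverse_eq_divide)
 have "(\<lambda>n. SS k. (LBINT x. (U k x * partial k \<phi> x) * Ht (X n) (U j) x)
   + (LBINT x. (U k x * \<phi> x) * Ht (X n) (W k) x))
  ~> (SS k. (LBINT x. (U k x * partial k \<phi> x) * U j x) + (LBINT x. (U k x * \<phi> x) * W k x))"
  by (intro tendsto_sum tendsto_add heat_weak_tendsto U W aL bL X)
 then have "(SS k. (LBINT x. (U k x * partial k \<phi> x) * U j x) + (LBINT x. (U k x * \<phi> x) * W k x)) = 0"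
  using key[OF X(2)] by (simp add: LIMSEQ_const_iff)
 then show ?thesis by (simp add: sum.distrib mult_ac)
qed

section \<open>Testing with backward heat kernels\<close>

lemma div_free_test_field_fld:
 fixes f :: "real \<times> (real ^ 'n) \<Rightarrow> real"
 assumes f: "test_function f" and S: "closure {z. f z \<noteq> 0} \<subseteq> {..<T} \<times> UNIV"
 shows "div_free_test_field T (\<lambda>z. \<chi> j. fld i f j z)"
proof -
 have s: "smooth f" using f by (simp add: test_function_def)
 have sv: "smooth (\<lambda>z. \<chi> j. fld i f j z)" by (intro smooth_vec_lambda smooth_fld s)
 have z: "(\<chi> j. fld i f j z) = 0" if "z \<notin> closure {z. f z \<noteq> 0}" for z
  using test_function_fld(3)[OF f that] by (simp add: vec_eq_iff)
 note t = test_function_supported[OF f sv z]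
 have "partial k (\<lambda>y. \<chi> j. fld i f j (r, y)) x $ k = dd (ex k) (fld i f k) (r, x)" for k r x
  by (simp add: partial_slice[where f = "\<lambda>z. \<chi> j. fld i f j z"] smooth_differentiable sv dd_vec_lambda smooth_fld s)
 then have "(SS k. partial k (\<lambda>y. \<chi> j. fld i f j (r, y)) x $ k) = 0" for r x
  using fld_div[OF s] by simp
 then show ?thesis using t S by (auto simp: div_free_test_field_def)
qed

text \<open>The gradient part of the field is orthogonal to divergence-free vectors, so only the
  Laplacian of the i-th component survives. Hence the boundary terms of the weak identity see a
  single component.\<close>

lemma div_free_fld:
 fixes f :: "real \<times> (real ^ 'n) \<Rightarrow> real"
 assumes f: "test_function f" and UL: "\<And>j. L2 (U j)"
  and div: "\<And>\<psi>. test_function \<psi> \<Longrightarrow> (SS k. LBINT x. U k x * partial k \<psi> x) = 0"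
 shows "(SS j. LBINT x. U j x * fld i f j (s, x)) = - (LBINT x. U i x * Lap f (s, x))"
proof -
 have sf: "smooth f" using f by (simp add: test_function_def)
 have t: "test_function (\<lambda>x. dd (ex i) f (s, x))" by (rule test_function_slice[OF test_function_dd(1)[OF f]])
 have p: "partial k (\<lambda>x. dd (ex i) f (s, x)) x = dd (ex k) (dd (ex i) f) (s, x)" for k x
  by (rule partial_slice) (intro smooth_differentiable smooth_D(2) sf)
 have 1: "Li (\<lambda>x. U j x * dd (ex j) (dd (ex i) f) (s, x))" for j
  by (intro L2_mult UL test_function_L2 test_function_slice test_function_dd(1) f)
 have 2: "Li (\<lambda>x. U j x * Lap f (s, x))" for j
  by (intro L2_mult UL test_function_L2 test_function_slice test_function_fld(2) f)
 have "(LBINT x. U j x * fld i f j (s, x)) = (LBINT x. U j x * dd (ex j) (dd (ex i) f) (s, x)) - (if j = i then LBINT x. U i x * Lap f (s, x) else 0)" for j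
  using 1[of j] 1[of i] 2[of i] by (simp add: fld_def right_diff_distrib)
 then have "(SS j. LBINT x. U j x * fld i f j (s, x)) = (SS j. LBINT x. U j x * dd (ex j) (dd (ex i) f) (s, x)) - (LBINT x. U i x * Lap f (s, x))"
  by (simp add: sum_subtractf)
 then show ?thesis using div[OF t] by (simp add: p)
qed

text \<open>All derivatives are moved onto the test field: the time derivative and the viscous term
  join to the backward heat operator, which will annihilate the field, and the nonlinearity becomes
  quadratic in w without gradients. The hypotheses on w hold at almost every time.\<close>

lemma weak_integrand:
 fixes f :: "real \<times> (real ^ 'n) \<Rightarrow> real" and w :: "real ^ 'n \<Rightarrow> real ^ 'n"
 assumes f: "test_function f" and w: "w \<in> Lp_space 2" "w \<in> H1_space" "weakly_div_free w"
 shows "- L2_pair w (\<lambda>x. vector_derivative (\<lambda>ta. \<chi> j. fld i f j (ta, x)) (at s))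
   + (SS k. L2_pair (weak_partial k w) (partial k (\<lambda>x. \<chi> j. fld i f j (s, x))))
   + L2_pair (convection w) (\<lambda>x. \<chi> j. fld i f j (s, x))
  = - ((SS j. LBINT x. cmp w j x * (dd et (fld i f j) (s, x) + Lap (fld i f j) (s, x)))
   + (SS j. SS k. LBINT x. cmp w k x * cmp w j x * dd (ex k) (fld i f j) (s, x)))"
proof -
 define U where "U = (\<lambda>j. cmp w j)"
 define W where "W = (\<lambda>k j. borel_rep (\<lambda>x. weak_partial k w x $ j))"
 define \<phi> where "\<phi> = (\<lambda>j. fld i f j)"
 have UL: "L2 (U j)" for j unfolding U_def by (rule Lp_space_2_rep(1)[OF w(1)])
 have WL: "L2 (W k j)" for k j unfolding W_def by (rule weak_partial_H1(2)[OF w(2)])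
 have UW: "weak_deriv k (U j) (W k j)" for k j unfolding U_def W_def by (rule weak_partial_H1(3)[OF w(2)])
 have div: "(SS k. LBINT x. U k x * partial k \<psi> x) = 0" if "test_function \<psi>" for \<psi>
  unfolding U_def by (rule weakly_div_free_component[OF w(1,3) that])
 have sf: "smooth f" using f by (simp add: test_function_def)
 have s\<phi>: "smooth (\<phi> j)" and t\<phi>: "test_function (\<phi> j)" for j
  unfolding \<phi>_def by (intro smooth_fld sf, intro test_function_fld f)
 have sv: "smooth (\<lambda>z. \<chi> j. \<phi> j z)" by (intro smooth_vec_lambda s\<phi>)
 have dL: "L2 (\<lambda>x. dd v (\<phi> j) (s, x))" for v j by (intro test_function_L2 test_function_slice test_function_dd(1) t\<phi>)
 have d2L: "L2 (\<lambda>x. dd v (dd v' (\<phi> j)) (s, x))" for v v' j by (intro test_function_L2 test_function_slice test_function_dd(1) t\<phi>)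
 have \<phi>L: "L2 (\<lambda>x. \<phi> j (s, x))" for j by (intro test_function_L2 test_function_slice t\<phi>)
 have Um: "U j \<in> BM borel" "W k j \<in> BM borel" "(\<lambda>x. \<phi> j (s, x)) \<in> BM borel" for k j
  using L2_measurable[OF UL] L2_measurable[OF WL] L2_measurable[OF \<phi>L] by auto
 have "vector_derivative (\<lambda>ta. \<chi> j. \<phi> j (ta, x)) (at s) = (\<chi> j. dd et (\<phi> j) (s, x))" for x
  by (simp add: vector_derivative_slice[where f = "\<lambda>z. \<chi> j. \<phi> j z"] smooth_differentiable sv dd_vec_lambda s\<phi>)
 then have 1: "L2_pair w (\<lambda>x. vector_derivative (\<lambda>ta. \<chi> j. \<phi> j (ta, x)) (at s)) = (SS j. LBINT x. U j x * dd et (\<phi> j) (s, x))"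
  by (simp add: L2_pair_rep[OF w(1)] dL U_def)
 have pv: "partial k (\<lambda>x. \<chi> j. \<phi> j (s, x)) x = (\<chi> j. dd (ex k) (\<phi> j) (s, x))" for k x
  by (simp add: partial_slice[where f = "\<lambda>z. \<chi> j. \<phi> j z"] smooth_differentiable sv dd_vec_lambda s\<phi>)
 have "L2_pair (weak_partial k w) (partial k (\<lambda>x. \<chi> j. \<phi> j (s, x))) = - (SS j. LBINT x. U j x * dd (ex k) (dd (ex k) (\<phi> j)) (s, x))" for k
 proof -
  have m: "(\<lambda>x. weak_partial k w x $ j) \<in> BM lebesgue" for j by (rule weak_partial_H1(1)[OF w(2)])
  have i: "integrable lebesgue (\<lambda>x. weak_partial k w x $ j * partial k (\<lambda>x. \<chi> j. \<phi> j (s, x)) x $ j)" for j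
   unfolding pv using borel_rep_mult(2)[OF m[of j] L2_measurable[OF dL[where v = "ex k" and j = j]]] L2_mult[OF WL[of k j] dL[where v = "ex k" and j = j]] by (simp add: W_def)
  have "L2_pair (weak_partial k w) (partial k (\<lambda>x. \<chi> j. \<phi> j (s, x))) = (SS j. LBINT x. W k j x * dd (ex k) (\<phi> j) (s, x))"
   unfolding L2_pair_def pv lebesgue_inner_integral[OF i[unfolded pv]] using borel_rep_mult(1)[OF m L2_measurable[OF dL]] by (simp add: W_def)
  also have "\<dots> = (SS j. - (LBINT x. U j x * dd (ex k) (dd (ex k) (\<phi> j)) (s, x)))"
  proof (rule sum.cong[OF refl])
   fix j
   have t: "test_function (\<lambda>x. dd (ex k) (\<phi> j) (s, x))" by (intro test_function_slice test_function_dd(1) t\<phi>)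
   have p: "partial k (\<lambda>x. dd (ex k) (\<phi> j) (s, x)) x = dd (ex k) (dd (ex k) (\<phi> j)) (s, x)" for x
    by (rule partial_slice) (intro smooth_differentiable smooth_D(2) s\<phi>)
   have "(LBINT x. dd (ex k) (dd (ex k) (\<phi> j)) (s, x) * U j x) = - (LBINT x. dd (ex k) (\<phi> j) (s, x) * W k j x)"
    using UW[unfolded weak_deriv_def, rule_format, OF t, of k j] by (simp only: p)
   then show "(LBINT x. W k j x * dd (ex k) (\<phi> j) (s, x)) = - (LBINT x. U j x * dd (ex k) (dd (ex k) (\<phi> j)) (s, x))"
    by (simp add: mult.commute)
  qed
  finally show ?thesis by (simp add: sum_negf)
 qed
 then have "(SS k. L2_pair (weak_partial k w) (partial k (\<lambda>x. \<chi> j. \<phi> j (s, x)))) = - (SS j. SS k. LBINT x. U j x * dd (ex k) (dd (ex k) (\<phi> j)) (s, x))"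
  by (simp add: sum_negf) (rule sum.swap)
 also have "\<dots> = - (SS j. LBINT x. U j x * Lap (\<phi> j) (s, x))"
  using L2_mult[OF UL d2L] by (simp add: Lap_def sum_distrib_left)
 finally have 2: "(SS k. L2_pair (weak_partial k w) (partial k (\<lambda>x. \<chi> j. \<phi> j (s, x)))) = - (SS j. LBINT x. U j x * Lap (\<phi> j) (s, x))" .
 have 3: "L2_pair (convection w) (\<lambda>x. \<chi> j. \<phi> j (s, x)) = - (SS j. SS k. LBINT x. U k x * U j x * dd (ex k) (\<phi> j) (s, x))"
 proof -
  have wm: "(\<lambda>x. w x $ k) \<in> BM lebesgue" "(\<lambda>x. weak_partial k w x $ j) \<in> BM lebesgue" for k j
   by (rule Lp_space_2_rep(2)[OF w(1)], rule weak_partial_H1(1)[OF w(2)])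
  have \<phi>m: "(\<lambda>x. \<phi> j (s, x)) \<in> BM lebesgue" for j by (rule measurable_completion) (use Um(3) in simp)
  have c: "convection w x \<bullet> (\<chi> j. \<phi> j (s, x)) = (SS j. SS k. w x $ k * weak_partial k w x $ j * \<phi> j (s, x))" for x
   by (simp add: inner_vec_def convection_def sum_distrib_right)
  have m: "(\<lambda>x. convection w x \<bullet> (\<chi> j. \<phi> j (s, x))) \<in> BM lebesgue"
   unfolding c by (intro borel_measurable_sum borel_measurable_times wm \<phi>m)
  have b: "(\<lambda>x. SS j. SS k. U k x * W k j x * \<phi> j (s, x)) \<in> BM borel"
   by (intro borel_measurable_sum borel_measurable_times Um)
  have "AE x in lebesgue. \<forall>k. w x $ k = U k x"
   unfolding U_def AE_all_countable using borel_rep(3)[OF wm(1)] by blast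
  moreover have "AE x in lebesgue. \<forall>k. \<forall>j. weak_partial k w x $ j = W k j x"
   unfolding W_def AE_all_countable using borel_rep(3)[OF wm(2)] by blast
  ultimately have ae: "AE x in lebesgue. convection w x \<bullet> (\<chi> j. \<phi> j (s, x)) = (SS j. SS k. U k x * W k j x * \<phi> j (s, x))"
   unfolding c by eventually_elim simp
  have i: "Li (\<lambda>x. U k x * W k j x * \<phi> j (s, x))" for j k
  proof -
   obtain B where "\<And>z. \<bar>\<phi> j z\<bar> \<le> B" using test_function_bounded[OF t\<phi>] by blast
   then have "L2 (\<lambda>x. W k j x * \<phi> j (s, x))" by (intro L2_bounded_mult[OF WL Um(3)])
   from L2_mult[OF UL this] show ?thesis by (simp add: mult.assoc)
  qed
  have "L2_pair (convection w) (\<lambda>x. \<chi> j. \<phi> j (s, x)) = (SS j. SS k. LBINT x. U k x * W k j x * \<phi> j (s, x))"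
   unfolding L2_pair_def lebesgue_integral_AE_borel(1)[OF b ae m] using i by simp
  also have "\<dots> = (SS j. - (SS k. LBINT x. U k x * U j x * dd (ex k) (\<phi> j) (s, x)))"
  proof (rule sum.cong[OF refl])
   fix j
   have "partial k (\<lambda>x. \<phi> j (s, x)) x = dd (ex k) (\<phi> j) (s, x)" for k x by (rule partial_slice) (intro smooth_differentiable s\<phi>)
   then show "(SS k. LBINT x. U k x * W k j x * \<phi> j (s, x)) = - (SS k. LBINT x. U k x * U j x * dd (ex k) (\<phi> j) (s, x))"
    using convection_by_parts[OF UL WL UW div test_function_slice[OF t\<phi>], of j j s] by simp
  qed
  finally show ?thesis by (simp add: sum_negf)
 qed
 have L\<phi>: "L2 (\<lambda>x. Lap (\<phi> j) (s, x))" for j by (intro test_function_L2 test_function_slice test_function_fld(2) t\<phi>)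
 have "(SS j. LBINT x. U j x * (dd et (\<phi> j) (s, x) + Lap (\<phi> j) (s, x))) = (SS j. LBINT x. U j x * dd et (\<phi> j) (s, x)) + (SS j. LBINT x. U j x * Lap (\<phi> j) (s, x))"
  using L2_mult[OF UL dL] L2_mult[OF UL L\<phi>] by (simp add: distrib_left sum.distrib)
 then show ?thesis using 1 2 3 unfolding U_def \<phi>_def by simp
qed

lemma weak_identity:
 fixes f :: "real \<times> (real ^ 'n) \<Rightarrow> real"
 assumes ws: "weak_solution u\<^sub>0 u" and wc: "weakly_continuous_from u\<^sub>0 u" and T: "T > 0"
  and f: "test_function f" and S: "closure {z. f z \<noteq> 0} \<subseteq> {..<T} \<times> UNIV"
 shows "AE t in lebesgue_on {0..<T}. (LBINT s. indicator {0..t} s *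
   ((SS j. LBINT x. cmp (u s) j x * (dd et (fld i f j) (s, x) + Lap (fld i f j) (s, x)))
   + (SS j. SS k. LBINT x. cmp (u s) k x * cmp (u s) j x * dd (ex k) (fld i f j) (s, x))))
  = (LBINT x. cmp u\<^sub>0 i x * Lap f (0, x)) - (LBINT x. cmp (u t) i x * Lap f (t, x))"
proof -
 obtain E where E: "\<And>j. wcurve (\<lambda>t. cmp (u t) j) E" using weak_solution_wcurve[OF ws wc] by blast
 define H where "H = (\<lambda>s. (SS j. LBINT x. cmp (u s) j x * (dd et (fld i f j) (s, x) + Lap (fld i f j) (s, x)))
   + (SS j. SS k. LBINT x. cmp (u s) k x * cmp (u s) j x * dd (ex k) (fld i f j) (s, x)))"
 define I where "I = (\<lambda>s. - L2_pair (u s) (\<lambda>x. vector_derivative (\<lambda>ta. \<chi> j. fld i f j (ta, x)) (at s))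
   + (SS k. L2_pair (weak_partial k (u s)) (partial k (\<lambda>x. \<chi> j. fld i f j (s, x))))
   + L2_pair (convection (u s)) (\<lambda>x. \<chi> j. fld i f j (s, x)))"
 have u0: "u\<^sub>0 \<in> Lp_space 2" "weakly_div_free u\<^sub>0" and H1: "u \<in> L2_H1 T"
  and df: "AE t in lebesgue_on {0..T}. weakly_div_free (u t)"
  using ws T by (auto simp: weak_solution_def)
 have uL: "u t \<in> Lp_space 2" if "t \<ge> 0" for t using wc that by (simp add: weakly_continuous_from_def)
 have "div_free_test_field T (\<lambda>z. \<chi> j. fld i f j z)" by (rule div_free_test_field_fld[OF f S])
 then have id: "AE t in lebesgue_on {0..<T}. (LINT s:{0..t}|lebesgue. I s)
   = L2_pair u\<^sub>0 (\<lambda>x. \<chi> j. fld i f j (0, x)) - L2_pair (u t) (\<lambda>x. \<chi> j. fld i f j (t, x))"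
  using ws T unfolding weak_solution_def Let_def I_def by blast
 have tf: "test_function (fld i f j)" "smooth (fld i f j)" for j using test_function_fld(4)[OF f, of i j] by (auto simp: test_function_def)
 have df': "AE t in lebesgue. t \<in> {0..T} \<longrightarrow> weakly_div_free (u t)" using df by (simp add: AE_restrict_space_iff)
 have "AE t in lebesgue_on {0..T}. u t \<in> H1_space" using H1 by (simp add: L2_H1_def strongly_measurable_def)
 then have h': "AE t in lebesgue. t \<in> {0..T} \<longrightarrow> u t \<in> H1_space" by (simp add: AE_restrict_space_iff)
 have IH: "AE s in lebesgue. s \<in> {0..T} \<longrightarrow> I s = - H s"
  using df' h'
 proof eventually_elim
  case (elim s)
  show ?case unfolding I_def H_def by (intro impI, rule weak_integrand[OF f]) (use elim uL in auto)
 qed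
 have Hm: "(\<lambda>s. indicator {0..t} s * H s) \<in> BM borel" for t
 proof -
  have a: "(\<lambda>s. indicator {0..t} s * (LBINT x. cmp (u s) j x * (dd et (fld i f j) (s, x) + Lap (fld i f j) (s, x)))) \<in> BM borel" for j
  proof -
   obtain w1 where w1: "L2 w1" "\<And>s y. \<bar>dd et (fld i f j) (s, y)\<bar> \<le> w1 y" by (rule test_function_dominated[OF test_function_dd(1)[OF tf(1)]]) iprover
   obtain w2 where w2: "L2 w2" "\<And>s y. \<bar>Lap (fld i f j) (s, y)\<bar> \<le> w2 y" by (rule test_function_dominated[OF test_function_fld(2)[OF tf(1)]]) iprover
   have w: "L2 (\<lambda>y. w1 y + w2 y)" using L2_lin[OF w1(1) w2(1), of 1 1] by simp
   show ?thesis
   proof (rule wcurve_pair_measurable[OF E _ w, of "\<lambda>z. dd et (fld i f j) z + Lap (fld i f j) z"])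
    show "continuous_on UNIV (\<lambda>z. dd et (fld i f j) z + Lap (fld i f j) z)"
     by (intro smooth_continuous smooth_add smooth_Lap smooth_D(2) tf)
    show "\<bar>dd et (fld i f j) (s, y) + Lap (fld i f j) (s, y)\<bar> \<le> w1 y + w2 y" for s y
     using w1(2)[of s y] w2(2)[of s y] by linarith
   qed
  qed
  have b: "(\<lambda>s. indicator {0..t} s * (LBINT x. cmp (u s) k x * cmp (u s) j x * dd (ex k) (fld i f j) (s, x))) \<in> BM borel" for j k
  proof -
   obtain B where "\<And>z. \<bar>dd (ex k) (fld i f j) z\<bar> \<le> B" using test_function_bounded[OF test_function_dd(1)[OF tf(1)]] by blast
   then show ?thesis by (rule wcurve_quadratic_measurable[OF E E smooth_continuous[OF smooth_D(2)[OF tf(2)]]])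
  qed
  show ?thesis unfolding H_def distrib_left[of "indicator {0..t} s" for s] sum_distrib_left by (intro borel_measurable_add borel_measurable_sum a b)
 qed
 have HI: "(LINT s:{0..t}|lebesgue. I s) = - (LBINT s. indicator {0..t} s * H s)" if t: "t \<in> {0..<T}" for t
 proof -
  have ae: "AE s in lebesgue. indicator {0..t} s *\<^sub>R I s = - (indicator {0..t} s * H s)"
   using IH by eventually_elim (use t in "auto simp: indicator_def")
  have g: "(\<lambda>s. - (indicator {0..t} s * H s)) \<in> BM borel" using Hm by (rule borel_measurable_uminus)
  \<comment> \<open>Measurability of the original integrand is deduced, by completeness, from its
    almost everywhere equality with the Borel function built from \<open>H\<close>.\<close>
  have "(\<lambda>s. indicator {0..t} s *\<^sub>R I s) \<in> BM lebesgue"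
  proof (rule borel_measurable_AE)
   show "(\<lambda>s. - (indicator {0..t} s * H s)) \<in> BM lebesgue" by (rule measurable_completion) (use g in simp)
   show "AE s in lebesgue. - (indicator {0..t} s * H s) = indicator {0..t} s *\<^sub>R I s" using ae by eventually_elim simp
  qed
  from lebesgue_integral_AE_borel(1)[OF g ae this] show ?thesis by (simp add: set_lebesgue_integral_def)
 qed
 have fL: "L2 (\<lambda>x. (\<chi> j. fld i f j (s, x)) $ k)" for s k
  using test_function_L2[OF test_function_slice[OF tf(1)]] by simp
 have pair: "L2_pair g (\<lambda>x. \<chi> j. fld i f j (s, x)) = - (LBINT x. cmp g i x * Lap f (s, x))" if g: "g \<in> Lp_space 2" "weakly_div_free g" for g s
  using div_free_fld[OF f Lp_space_2_rep(1)[OF g(1)] weakly_div_free_component[OF g], of i s] by (simp add: L2_pair_rep[OF g(1) fL])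
 have id': "AE t in lebesgue. t \<in> {0..<T} \<longrightarrow> (LINT s:{0..t}|lebesgue. I s)
   = L2_pair u\<^sub>0 (\<lambda>x. \<chi> j. fld i f j (0, x)) - L2_pair (u t) (\<lambda>x. \<chi> j. fld i f j (t, x))"
  using id by (simp add: AE_restrict_space_iff)
 have "AE t in lebesgue. t \<in> {0..<T} \<longrightarrow> (LBINT s. indicator {0..t} s * H s)
  = (LBINT x. cmp u\<^sub>0 i x * Lap f (0, x)) - (LBINT x. cmp (u t) i x * Lap f (t, x))"
  using id' df'
 proof eventually_elim
  case (elim t)
  then show ?case using HI[of t] pair[OF u0, of 0] pair[OF uL[of t], of t] by auto
 qed
 then show ?thesis unfolding H_def by (simp add: AE_restrict_space_iff)
qed

section \<open>The limit kernels and the Duhamel formula\<close>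

lemma fam_fld:
 fixes x :: "real ^ 'n"
 assumes ka: "smooth ka" "\<And>s. ka s > 0" and S: "closed S" and F: "fam ka x S F F0"
 shows "fam ka x S (\<lambda>ep. Lap (F ep)) (Lap F0)" "fam ka x S (\<lambda>ep. fld i (F ep) j) (fld i F0 j)"
proof -
 note d = fam_dd(1)[OF ka S]
 have L: "fam ka x S (\<lambda>ep z. SS k. dd (ex k) (dd (ex k) (F ep)) z) (\<lambda>z. SS k. dd (ex k) (dd (ex k) F0) z)"
  by (intro fam_sum d[OF d[OF F]])
 then show 1: "fam ka x S (\<lambda>ep. Lap (F ep)) (Lap F0)" by (simp only: Lap_def[abs_def])
 have "fam ka x S (\<lambda>ep z. 1 * dd (ex j) (dd (ex i) (F ep)) z + (- (if j = i then 1 else 0)) * Lap (F ep) z)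
  (\<lambda>z. 1 * dd (ex j) (dd (ex i) F0) z + (- (if j = i then 1 else 0)) * Lap F0 z)"
  by (intro fam_lin d[OF d[OF F]] 1)
 then show "fam ka x S (\<lambda>ep. fld i (F ep) j) (fld i F0 j)" by (simp add: fld_def[abs_def])
qed

lemma dd_backward:
 fixes f :: "real \<Rightarrow> real ^ 'n \<Rightarrow> real"
 assumes f: "hk_deriv f f' g" and I: "open I" "I \<subseteq> {..<T}" "s \<in> I" and F: "\<And>s y. s \<in> I \<Longrightarrow> F (s, y) = f (T - s) (y - x)"
 shows "dd (ex k) F (s, y) = f' k (T - s) (y - x)" "dd et F (s, y) = - g (T - s) (y - x)"
proof -
 have "T - s > 0" using I by auto
 then have h: "((\<lambda>p. f (fst p) (snd p)) has_derivative (\<lambda>v. fst v * g (T - s) (y - x) + (SS k. snd v $ k * f' k (T - s) (y - x)))) (at (T - s, y - x))"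
  using f by (simp add: hk_deriv_def)
 have "((\<lambda>z :: real \<times> (real ^ 'n). (T - fst z, snd z - x)) has_derivative (\<lambda>v. (0 - fst v, snd v - 0))) (at (s, y))"
  by (intro has_derivative_Pair has_derivative_diff has_derivative_const has_derivative_fst has_derivative_snd has_derivative_ident)
 moreover have "((\<lambda>p. f (fst p) (snd p)) has_derivative (\<lambda>v. fst v * g (T - s) (y - x) + (SS k. snd v $ k * f' k (T - s) (y - x)))) (at (T - fst (s, y), snd (s, y) - x))"
  using h by simp
 ultimately have "((\<lambda>z. f (fst (T - fst z, snd z - x)) (snd (T - fst z, snd z - x))) has_derivative
   (\<lambda>v. fst (0 - fst v, snd v - 0) * g (T - s) (y - x) + (SS k. snd (0 - fst v, snd v - 0) $ k * f' k (T - s) (y - x)))) (at (s, y))"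
  by (rule has_derivative_compose)
 then have "((\<lambda>z. f (T - fst z) (snd z - x)) has_derivative (\<lambda>v. - fst v * g (T - s) (y - x) + (SS k. snd v $ k * f' k (T - s) (y - x)))) (at (s, y))"
  by simp
 then have "(F has_derivative (\<lambda>v. - fst v * g (T - s) (y - x) + (SS k. snd v $ k * f' k (T - s) (y - x)))) (at (s, y))"
 proof (rule has_derivative_transform_within_open)
  show "open (I \<times> (UNIV :: (real ^ 'n) set))" using I by (intro open_Times) auto
 qed (use I F in auto)
 note D = frechet_derivative_at[OF this]
 have d: "dd v F (s, y) = - fst v * g (T - s) (y - x) + (SS k. snd v $ k * f' k (T - s) (y - x))" for v
  using fun_cong[OF D, of v] by simp
 have "(SS l. axis k 1 $ l * f' l (T - s) (y - x)) = (SS l. if l = k then f' l (T - s) (y - x) else 0)"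
  by (rule sum.cong) (simp_all add: axis_def)
 then show "dd (ex k) F (s, y) = f' k (T - s) (y - x)" unfolding d by simp
 show "dd et F (s, y) = - g (T - s) (y - x)" unfolding d by simp
qed

text \<open>The derivatives provided by \<open>hk_deriv_ex\<close> are not explicit. The second ones
  are constructed by hand here because their trace must be recognized as \<open>Gk'\<close>.\<close>

lemma heat_equation:
 obtains G2 g2 where "\<And>i j. hk 2 (G2 i j)" "\<And>i. hk_deriv (heat_grad i) (G2 i) (g2 i)"
  "\<And>sg x :: real ^ 'n. (SS k. G2 k k sg x) = Gk' sg x"
proof -
 define D where "D = (\<lambda>i k sg x. (if k = i then 1 else 0) * (Gk sg x / sg) + 1 * (x $ i / sg * heat_grad k sg (x :: real ^ 'n)))"
 define g where "g = (\<lambda>i sg x. (- 1) * (x $ i / sg * Gk sg x / sg) + 1 * (x $ i / sg * Gk' sg (x :: real ^ 'n)))"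
 define G2 where "G2 = (\<lambda>i k sg x. - (1/2) * D i k sg (x :: real ^ 'n))"
 have "hk 2 (\<lambda>sg x :: real ^ 'n. Gk sg x / sg)" using hk_div[OF hk_base] by (simp add: numeral_2_eq_2)
 moreover have "hk 2 (\<lambda>sg x :: real ^ 'n. x $ i / sg * heat_grad k sg x)" for i k using hk_mul[OF hk_heat_grad[of k], of i] by (simp add: numeral_2_eq_2)
 ultimately have "hk 2 (D i k)" for i k unfolding D_def by (intro hk_lin)
 then have 1: "hk 2 (G2 i k)" for i k unfolding G2_def by (intro hk_cmult)
 have d1: "hk_deriv (\<lambda>sg x. x $ i / sg * Gk sg x) (D i) (g i)" for i
  using hk_deriv_mul[OF hk_deriv_heat_kernel_grad, of i] unfolding D_def g_def by simp
 have 2: "hk_deriv (heat_grad i) (G2 i) (\<lambda>sg x. - (1/2) * g i sg x)" for i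
  unfolding hk_deriv_def
 proof (intro allI impI)
  fix sg :: real and x :: "real ^ 'n" assume "sg > 0"
  with \<open>sg > 0\<close> have "((\<lambda>p. - (1/2) * (snd p $ i / fst p * Gk (fst p) (snd p))) has_derivative (\<lambda>v. - (1/2) * (fst v * g i sg x + (SS k. snd v $ k * D i k sg x)))) (at (sg, x))"
   using d1[of i] by (intro has_derivative_mult_right) (auto simp: hk_deriv_def)
  moreover have "(\<lambda>v. - (1/2) * (fst v * g i sg x + (SS k. snd v $ k * D i k sg x))) = (\<lambda>v. fst v * (- (1/2) * g i sg x) + (SS k. snd v $ k * G2 i k sg x))"
   unfolding G2_def by (rule ext) (simp add: distrib_left sum_distrib_left mult_ac)
  ultimately show "((\<lambda>p. heat_grad i (fst p) (snd p)) has_derivative (\<lambda>v. fst v * (- (1/2) * g i sg x) + (SS k. snd v $ k * G2 i k sg x))) (at (sg, x))"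
   unfolding heat_grad_def by (simp only:)
 qed
 have 3: "(SS k. G2 k k sg x) = Gk' sg x" for sg x
  unfolding G2_def D_def heat_grad_def Gk'_def
  by (simp add: sum.distrib sum_subtractf sum_distrib_left[symmetric] sum_negf sum_divide_distrib[symmetric] algebra_simps)
 show ?thesis by (rule that[OF 1 2 3])
qed

text \<open>The kernel of \<open>(\<partial>\<^sub>k \<partial>\<^sub>j \<partial>\<^sub>i - \<delta>\<^sub>i\<^sub>j \<partial>\<^sub>k \<Delta>) e\<^bsup>t\<Delta>\<^esup>\<close>, through which the nonlinear term enters
 \<open>\<Delta> u\<close> after the pressure has been eliminated.\<close>

definition oseen :: "('n \<Rightarrow> 'n \<Rightarrow> 'n \<Rightarrow> real \<Rightarrow> real ^ 'n \<Rightarrow> real) \<Rightarrow> bool"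
 where "oseen M \<longleftrightarrow> (\<forall>i j k. hk 3 (M i j k)) \<and>
  (\<forall>F I T x s y. smooth F \<longrightarrow> open I \<longrightarrow> I \<subseteq> {..<T} \<longrightarrow> (\<forall>s\<in>I. \<forall>y. F (s, y) = Gk (T - s) (y - x)) \<longrightarrow> s \<in> I \<longrightarrow>
   dd et F (s, y) = - Gk' (T - s) (y - x) \<and> Lap F (s, y) = Gk' (T - s) (y - x)
   \<and> (\<forall>i j k. dd (ex k) (fld i F j) (s, y) = M i j k (T - s) (y - x)))"

lemma oseen_ex: obtains M :: "'n \<Rightarrow> 'n \<Rightarrow> 'n \<Rightarrow> real \<Rightarrow> real ^ 'n \<Rightarrow> real" where "oseen M"
proof -
 obtain G2 g2 where G2: "\<And>i j. hk 2 (G2 i j)" "\<And>i. hk_deriv (heat_grad i) (G2 i) (g2 i)"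
  "\<And>sg x :: real ^ 'n. (SS k. G2 k k sg x) = Gk' sg x" using heat_equation by blast
 \<comment> \<open>Of the third derivatives only the parabolic order 3 matters, so an abstract
   choice suffices.\<close>
 obtain G3 g3 where G3: "\<And>i j k. hk 3 (G3 i j k)" "\<And>i j. hk_deriv (G2 i j) (G3 i j) (g3 i j)"
  using hk_deriv_ex[OF G2(1)] unfolding numeral_3_eq_3 numeral_2_eq_2 by metis
 obtain H h where H: "\<And>k :: 'n. hk 3 (H k)" "hk_deriv Gk' H h"
  using hk_deriv_ex[OF hk_heat_kernel'] unfolding numeral_3_eq_3 numeral_2_eq_2 by metis
 define M where "M = (\<lambda>i j k sg x. 1 * G3 i j k sg x + (- (if j = i then 1 else 0)) * H k sg (x :: real ^ 'n))"
 have Mhk: "hk 3 (M i j k)" for i j k unfolding M_def by (intro hk_lin G3 H)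
 have "dd et F (s, y) = - Gk' (T - s) (y - x) \<and> Lap F (s, y) = Gk' (T - s) (y - x)
   \<and> (\<forall>i j k. dd (ex k) (fld i F j) (s, y) = M i j k (T - s) (y - x))"
  if F: "smooth F" and I: "open I" "I \<subseteq> {..<T}" and FG': "\<forall>s\<in>I. \<forall>y. F (s, y) = Gk (T - s) (y - x)" and s: "s \<in> I"
  for F :: "real \<times> (real ^ 'n) \<Rightarrow> real" and I T x s y
 proof -
  have FG: "F (s, y) = Gk (T - s) (y - x)" if "s \<in> I" for s y using FG' that by blast
  have 1: "dd (ex i) F (s, y) = heat_grad i (T - s) (y - x)" if "s \<in> I" for i s y
   by (rule dd_backward(1)[OF hk_deriv_heat_kernel_grad I that FG])
  have 2: "dd (ex j) (dd (ex i) F) (s, y) = G2 i j (T - s) (y - x)" if "s \<in> I" for i j s y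
   by (rule dd_backward(1)[OF G2(2) I that 1])
  have 3: "dd (ex k) (dd (ex j) (dd (ex i) F)) (s, y) = G3 i j k (T - s) (y - x)" if "s \<in> I" for i j k s y
   by (rule dd_backward(1)[OF G3(2) I that 2])
  have L: "Lap F (s, y) = Gk' (T - s) (y - x)" if "s \<in> I" for s y
   unfolding Lap_def by (simp add: 2[OF that] G2(3))
  have L1: "dd (ex k) (Lap F) (s, y) = H k (T - s) (y - x)" if "s \<in> I" for k s y
   by (rule dd_backward(1)[OF H(2) I that L])
  have "dd (ex k) (fld i F j) (s, y) = M i j k (T - s) (y - x)" for i j k
  proof -
   have "dd (ex k) (fld i F j) (s, y) = dd (ex k) (dd (ex j) (dd (ex i) F)) (s, y) - dd (ex k) (\<lambda>z. (if j = i then 1 else 0) * Lap F z) (s, y)"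
    unfolding fld_def[abs_def] by (intro dd_diff smooth_differentiable smooth_D(2) smooth_cmult smooth_Lap F)
   also have "dd (ex k) (\<lambda>z. (if j = i then 1 else 0) * Lap F z) (s, y) = (if j = i then 1 else 0) * dd (ex k) (Lap F) (s, y)"
    by (intro dd_cmult smooth_differentiable smooth_Lap F)
   finally show ?thesis by (simp add: 3[OF s] L1[OF s] M_def)
  qed
  then show ?thesis
   using dd_backward(2)[OF hk_deriv_heat_kernel_grad I s FG] L[OF s] by simp
 qed
 then have "oseen M" unfolding oseen_def using Mhk by blast
 then show ?thesis by (rule that)
qed



lemma Gk'_diff_commute: "Gk' sg (x - y) = Gk' sg (y - x)"
proof -
 have "(x - y) $ k / sg * ((x - y) $ k / sg * c) = (y - x) $ k / sg * ((y - x) $ k / sg * c)" for k c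
  using minus_diff_eq[of "y $ k" "x $ k"] by (metis (no_types, lifting) minus_divide_left minus_mult_minus mult.assoc vector_minus_component)
 then show ?thesis unfolding Gk'_def by (simp only: heat_kernel_diff_commute[of sg x y])
qed

text \<open>T lies strictly beyond t, so the kernel is evaluated at heat times at least T - t > 0
  and the integrand in s stays bounded. Two limits are taken in succession: the cut-off is removed
  at good times r > t or r = t, then r tends to t from the right.\<close>

lemma mild_identity:
 fixes u :: "real \<Rightarrow> real ^ 'n \<Rightarrow> real ^ 'n"
 assumes ws: "weak_solution u\<^sub>0 u" and wc: "weakly_continuous_from u\<^sub>0 u" and M: "oseen M" and t: "0 \<le> t" "t < T"
 shows "(LBINT s. indicator {0..t} s * (SS j. SS k. quad (cmp (u s) k) (cmp (u s) j) (M i j k (T - s)) x))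
  = Ht' T (cmp u\<^sub>0 i) x - Ht' (T - t) (cmp (u t) i) x"
proof -
 obtain E where E: "\<And>j. wcurve (\<lambda>t. cmp (u t) j) E" using weak_solution_wcurve[OF ws wc] by blast
 obtain \<Theta> ka :: "real \<Rightarrow> real" and \<delta> where \<Theta>: "smooth \<Theta>" "smooth ka" "\<And>s. ka s > (0 :: real)" "\<delta> > 0" "t + \<delta> < T"
  "\<And>s. s \<notin> {-2..T - \<delta>} \<Longrightarrow> \<Theta> s = 0" "\<And>s. -1 < s \<Longrightarrow> s < t + \<delta> \<Longrightarrow> \<Theta> s = 1 \<and> ka s = T - s"
  using smooth_cutoff_in_time[OF t] by blast
 define S where "S = {-2..T - \<delta>}"
 have S: "compact S" "S \<noteq> {}" using t \<Theta>(4,5) by (auto simp: S_def)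
 have kac: "continuous_on S ka" by (rule continuous_on_subset[OF smooth_continuous[OF \<Theta>(2)]]) simp
 \<comment> \<open>The extreme values of \<open>ka\<close> on the support in time serve as the
   bounds a and b of \<open>fam_pair_limit\<close>.\<close>
 obtain p q where pq: "p \<in> S" "q \<in> S" "\<And>s. s \<in> S \<Longrightarrow> ka p \<le> ka s \<and> ka s \<le> ka q"
  using continuous_attains_inf[OF S kac] continuous_attains_sup[OF S kac] by blast
 define I where "I = {-1<..<t + \<delta>}"
 have I: "open I" "I \<subseteq> {..<T}" "{0..t} \<subseteq> I" using \<Theta>(4,5) by (auto simp: I_def)
 define F where "F = (\<lambda>ep z. \<Theta> (fst z) * (ep ^ 0 * cutoff 0 (ep * (norm (snd z - x))\<^sup>2)) * Gk (ka (fst z)) (snd z - x))"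
 define F0 where "F0 = (\<lambda>z. if 0 = (0 :: nat) then \<Theta> (fst z) * Gk (ka (fst z)) (snd z - x) else 0)"
 have fF: "fam ka x S F F0" unfolding F_def F0_def by (rule fam_base[OF hk_base \<Theta>(1)]) (use \<Theta>(6) in "simp add: S_def")
 have cS: "closed S" by (rule compact_imp_closed[OF S(1)])
 have sF0: "smooth F0" by (rule fam_smooth(2)[OF \<Theta>(2,3) cS fF])
 have F0e: "F0 (s, y) = Gk (T - s) (y - x)" if "s \<in> I" for s y using that \<Theta>(7)[of s] by (simp add: F0_def I_def)
 have os: "dd et F0 (s, y) = - Gk' (T - s) (y - x)" "Lap F0 (s, y) = Gk' (T - s) (y - x)"
  "dd (ex k) (fld i F0 j) (s, y) = M i j k (T - s) (y - x)" if "s \<in> I" for s y j k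
  using M sF0 I F0e that unfolding oseen_def by blast+
 define P where "P = (\<lambda>j ep z. 1 * dd et (fld i (F ep) j) z + 1 * Lap (fld i (F ep) j) z)"
 define P0 where "P0 = (\<lambda>j z. 1 * dd et (fld i F0 j) z + 1 * Lap (fld i F0 j) z)"
 define Q where "Q = (\<lambda>j k ep. dd (ex k) (fld i (F ep) j))"
 define Q0 where "Q0 = (\<lambda>j k. dd (ex k) (fld i F0 j))"
 note ff = fam_fld[OF \<Theta>(2,3) cS]
 have fP: "fam ka x S (P j) (P0 j)" for j unfolding P_def P0_def by (intro fam_lin fam_dd(1)[OF \<Theta>(2,3) cS] ff(1) ff(2) fF)
 have fQ: "fam ka x S (Q j k) (Q0 j k)" for j k unfolding Q_def Q0_def by (intro fam_dd(1)[OF \<Theta>(2,3) cS] ff(2) fF)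
 \<comment> \<open>On I the uncut scalar solves the backward heat equation, hence so does the field,
   and the linear terms drop out of the limit.\<close>
 have P00: "P0 j (s, y) = 0" if "s \<in> I" for j s y
 proof -
  have "open (I \<times> (UNIV :: (real ^ 'n) set))" using I by (intro open_Times) auto
  from fld_backward_heat[OF sF0 this, of "(s, y)" i j] show ?thesis using os(1,2) that by (auto simp: P0_def)
 qed
 define X where "X = (\<lambda>n. 1 / real (Suc n))"
 have X: "X ~> 0" "\<And>n. X n > 0" "\<And>n. X n \<le> 1"
  unfolding X_def using LIMSEQ_inverse_real_of_nat by (auto simp: inverse_eq_divide)
 define U where "U = (\<lambda>j s. cmp (u s) j)"
 have UE: "wcurve (U j) E" for j unfolding U_def by (rule E)
 have pqS: "\<forall>s\<in>S. ka p \<le> ka s \<and> ka s \<le> ka q" using pq(3) by blast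
 note lim = fam_pair_limit[OF \<Theta>(2,3) pqS \<Theta>(3) pq(3)[OF pq(1), THEN conjunct2] S(1) _ X UE UE]
 define H where "H = (\<lambda>n s. (SS j. LBINT y. U j s y * P j (X n) (s, y)) + (SS j. SS k. LBINT y. U k s y * U j s y * Q j k (X n) (s, y)))"
 define H0 where "H0 = (\<lambda>s. (SS j. LBINT y. U j s y * P0 j (s, y)) + (SS j. SS k. LBINT y. U k s y * U j s y * Q0 j k (s, y)))"
 define L where "L = (\<lambda>n t. LBINT y. U i t y * Lap (F (X n)) (t, y))"
 define L0 where "L0 = (\<lambda>t. LBINT y. U i t y * Lap F0 (t, y))"
 define t1 where "t1 = t + \<delta>"
 have Hlim: "(\<lambda>n. H n s) ~> H0 s" if "s \<ge> 0" for s
  unfolding H_def H0_def by (intro tendsto_add tendsto_sum lim(1)[OF fP that] lim(2)[OF fQ that])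
 have Llim: "(\<lambda>n. L n s) ~> L0 s" if "s \<ge> 0" for s unfolding L_def L0_def by (rule lim(1)[OF ff(1)[OF fF] that])
 have Lc: "continuous_on {0..} L0" unfolding L0_def by (rule lim(7)[OF ff(1)[OF fF]])
 have Hm: "(\<lambda>s. indicator {0..r} s * H n s) \<in> BM borel" for r n
  unfolding H_def distrib_left[of "indicator {0..r} s" for s] sum_distrib_left
  by (intro borel_measurable_add borel_measurable_sum lim(5)[OF fP] lim(6)[OF fQ])
 have H0m: "(\<lambda>s. indicator {0..r} s * H0 s) \<in> BM borel" for r
 proof (rule borel_measurable_LIMSEQ_real[OF _ Hm])
  fix s show "(\<lambda>n. indicator {0..r} s * H n s) ~> indicator {0..r} s * H0 s"
   by (cases "s \<ge> 0") (auto intro: tendsto_mult_left Hlim)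
 qed
 obtain B where B: "\<And>n s. s \<in> {0..t1} \<Longrightarrow> \<bar>H n s\<bar> \<le> B"
 proof -
  have "\<forall>j. \<exists>B. \<forall>n. \<forall>s\<in>{0..t1}. \<bar>LBINT y. U j s y * P j (X n) (s, y)\<bar> \<le> B" using lim(3)[OF fP] by blast
  then obtain b where b: "\<And>j n s. s \<in> {0..t1} \<Longrightarrow> \<bar>LBINT y. U j s y * P j (X n) (s, y)\<bar> \<le> b j" by metis
  have "\<forall>j k. \<exists>B. \<forall>n. \<forall>s\<in>{0..t1}. \<bar>LBINT y. U k s y * U j s y * Q j k (X n) (s, y)\<bar> \<le> B" using lim(4)[OF fQ] by blast
  then obtain c where c: "\<And>j k n s. s \<in> {0..t1} \<Longrightarrow> \<bar>LBINT y. U k s y * U j s y * Q j k (X n) (s, y)\<bar> \<le> c j k" by metis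
  have "\<bar>H n s\<bar> \<le> (SS j. b j) + (SS j. SS k. c j k)" if "s \<in> {0..t1}" for n s
  proof -
   have 1: "\<bar>SS j. LBINT y. U j s y * P j (X n) (s, y)\<bar> \<le> (SS j. b j)"
    by (rule order.trans[OF sum_abs sum_mono]) (rule b[OF that])
   have "\<bar>SS k. LBINT y. U k s y * U j s y * Q j k (X n) (s, y)\<bar> \<le> (SS k. c j k)" for j
    by (rule order.trans[OF sum_abs sum_mono]) (rule c[OF that])
   note c' = this
   have "\<bar>SS j. SS k. LBINT y. U k s y * U j s y * Q j k (X n) (s, y)\<bar> \<le> (SS j. SS k. c j k)"
    by (rule order.trans[OF sum_abs sum_mono]) (rule c')
   then show ?thesis unfolding H_def using 1 by linarith
  qed
  then show ?thesis using that by blast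
 qed
 have B0: "\<bar>H0 s\<bar> \<le> B" if "s \<in> {0..t1}" for s
  by (rule LIMSEQ_le_const2[OF tendsto_rabs[OF Hlim]]) (use that B in auto)
 have "B \<ge> 0" using order.trans[OF abs_ge_zero B0[of 0]] t \<Theta>(4) by (simp add: t1_def)
 have wi: "Li (\<lambda>s. B * indicator {0..t1} s :: real)"
  by (intro integrable_mult_right integrable_real_indicator) (auto simp: emeasure_lborel_Icc_eq)
 have T0: "T > 0" using t by simp
 \<comment> \<open>The cut-off runs through a sequence, so one null set of times serves all n; the
   limit in n can then be taken at a fixed good time.\<close>
 have id: "AE r in lebesgue_on {0..<T}. \<forall>n. (LBINT s. indicator {0..r} s * H n s) = (LBINT y. cmp u\<^sub>0 i y * Lap (F (X n)) (0, y)) - L n r"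
  unfolding AE_all_countable
 proof
  fix n
  have tf: "test_function (F (X n))" "closure {z. F (X n) z \<noteq> 0} \<subseteq> S \<times> UNIV"
   by (rule fam_test_function[OF \<Theta>(2,3) S(1) fF X(2)])+
  have "closure {z. F (X n) z \<noteq> 0} \<subseteq> {..<T} \<times> UNIV" using tf(2) \<Theta>(4) by (auto simp: S_def)
  from weak_identity[OF ws wc T0 tf(1) this, of i]
  show "AE r in lebesgue_on {0..<T}. (LBINT s. indicator {0..r} s * H n s) = (LBINT y. cmp u\<^sub>0 i y * Lap (F (X n)) (0, y)) - L n r"
   by (simp add: H_def L_def U_def P_def Q_def)
 qed
 \<comment> \<open>The weak identity contains the datum itself, the curve its value at time 0; they
   agree almost everywhere.\<close>
 have u0: "(LBINT y. cmp u\<^sub>0 i y * g y) = (LBINT y. U i 0 y * g y)" if g: "g \<in> BM borel" for g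
 proof (rule integral_cong_AE)
  have w: "u\<^sub>0 \<in> Lp_space 2" "u 0 \<in> Lp_space 2" "AE x in lebesgue. u 0 x = u\<^sub>0 x"
   using ws wc T0 by (auto simp: weak_solution_def weakly_continuous_from_def)
  have "AE x in lborel. u 0 x = u\<^sub>0 x" using w(3) by (simp add: AE_completion_iff)
  then show "AE y in lborel. cmp u\<^sub>0 i y * g y = U i 0 y * g y"
   using borel_rep(2)[OF Lp_space_2_rep(2)[OF w(1)], of i] borel_rep(2)[OF Lp_space_2_rep(2)[OF w(2)], of i]
   by eventually_elim (simp add: U_def)
  show "(\<lambda>y. cmp u\<^sub>0 i y * g y) \<in> BM lborel" "(\<lambda>y. U i 0 y * g y) \<in> BM lborel"
   unfolding U_def using borel_rep(1)[OF Lp_space_2_rep(2)[OF w(1)], of i] borel_rep(1)[OF Lp_space_2_rep(2)[OF w(2)], of i] g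
   by (auto intro!: borel_measurable_times)
 qed
 have Lapm: "(\<lambda>y. Lap f (s, y)) \<in> BM borel" if "smooth f" for f :: "real \<times> (real ^ 'n) \<Rightarrow> real" and s
  by (rule borel_measurable_continuous_onI, rule smooth_continuous, rule smooth_slice, rule smooth_Lap, rule that)
 have sF: "smooth (F (X n))" for n by (rule fam_smooth(1)[OF \<Theta>(2,3) cS fF])
 have id': "AE r in lebesgue_on {0..<T}. \<forall>n. (LBINT s. indicator {0..r} s * H n s) = L n 0 - L n r"
  using id unfolding u0[OF Lapm[OF sF]] by (simp only: L_def)
 \<comment> \<open>The good times remain below \<open>t1 = t + \<delta>\<close>, where the bound B
   of the integrands is available.\<close>
 obtain r where r: "r ~> t" "\<And>m. t \<le> r m" "\<And>m::nat. r m < t1" "\<And>m. \<forall>n. (LBINT s. indicator {0..r m} s * H n s) = L n 0 - L n (r m)"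
  by (rule AE_lebesgue_sequence[OF id', of t t1]) (use t \<Theta>(4,5) in "auto simp: t1_def")
 have main: "(LBINT s. indicator {0..r m} s * H0 s) = L0 0 - L0 (r m)" for m
 proof (rule LIMSEQ_unique)
  show "(\<lambda>n. LBINT s. indicator {0..r m} s * H n s) ~> (LBINT s. indicator {0..r m} s * H0 s)"
  proof (rule integral_dominated_convergence[OF _ _ wi])
   show "AE s in lborel. (\<lambda>n. indicator {0..r m} s * H n s) ~> indicator {0..r m} s * H0 s"
   proof (rule AE_I2)
    fix s show "(\<lambda>n. indicator {0..r m} s * H n s) ~> indicator {0..r m} s * H0 s"
     by (cases "s \<ge> 0") (auto intro: tendsto_mult_left Hlim)
   qed
   show "AE s in lborel. norm (indicator {0..r m} s * H n s) \<le> B * indicator {0..t1} s" for n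
    using B r(3)[of m] \<open>B \<ge> 0\<close> by (intro AE_I2) (auto simp: indicator_def)
  qed (use Hm H0m in auto)
  have "(\<lambda>n. L n 0 - L n (r m)) ~> L0 0 - L0 (r m)" using r(2)[of m] t by (intro tendsto_diff Llim) auto
  then show "(\<lambda>n. LBINT s. indicator {0..r m} s * H n s) ~> L0 0 - L0 (r m)" using r(4)[of m] by simp
 qed
 have "(LBINT s. indicator {0..t} s * H0 s) = L0 0 - L0 t"
 proof (rule LIMSEQ_unique)
  show "(\<lambda>m. LBINT s. indicator {0..r m} s * H0 s) ~> (LBINT s. indicator {0..t} s * H0 s)"
  proof (rule integral_dominated_convergence[OF _ _ wi])
   show "AE s in lborel. (\<lambda>m. indicator {0..r m} s * H0 s) ~> indicator {0..t} s * H0 s"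
   proof (rule AE_I2)
    fix s
    have "\<forall>\<^sub>F m in sequentially. indicator {0..r m} s * H0 s = indicator {0..t} s * H0 s"
    proof (cases "s \<le> t")
     case True then show ?thesis using order.trans[OF True r(2)] by (intro always_eventually allI) (simp add: indicator_def)
    next
     case False
     then have "\<forall>\<^sub>F m in sequentially. r m < s" by (intro order_tendstoD(2)[OF r(1)]) simp
     then show ?thesis by eventually_elim (use False in auto)
    qed
    then show "(\<lambda>m. indicator {0..r m} s * H0 s) ~> indicator {0..t} s * H0 s" by (rule tendsto_eventually)
   qed
   show "AE s in lborel. norm (indicator {0..r m} s * H0 s) \<le> B * indicator {0..t1} s" for m
    using B0 r(3)[of m] \<open>B \<ge> 0\<close> by (intro AE_I2) (auto simp: indicator_def)
  qed (use H0m in auto)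
  have "(\<lambda>m. L0 0 - L0 (r m)) ~> L0 0 - L0 t"
   by (intro tendsto_diff tendsto_const continuous_on_tendsto_compose[OF Lc r(1)]) (use order.trans[OF t(1) r(2)] t in auto)
  then show "(\<lambda>m. LBINT s. indicator {0..r m} s * H0 s) ~> L0 0 - L0 t" by (simp only: main)
 qed
 moreover have "indicator {0..t} s * H0 s = indicator {0..t} s * (SS j. SS k. quad (cmp (u s) k) (cmp (u s) j) (M i j k (T - s)) x)" for s
 proof (cases "s \<in> {0..t}")
  case True
  then have "s \<in> I" using I(3) by auto
  then show ?thesis by (simp add: H0_def Q0_def os(3) P00 U_def)
 qed auto
 moreover have "L0 s = Ht' (T - s) (U i s) x" if "s \<in> {0..t}" for s
 proof -
  have "s \<in> I" using I(3) that by auto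
  then show ?thesis unfolding L0_def conv_def by (simp add: os(2) mult.commute Gk'_diff_commute[of _ x])
 qed
 moreover have "Ht' T (U i 0) x = Ht' T (cmp u\<^sub>0 i) x"
 proof -
  have "(\<lambda>y. Gk' T (x - y)) \<in> BM borel"
   using hk_measurable[OF hk_heat_kernel'] by measurable
  from u0[OF this] show ?thesis by (simp add: conv_def mult.commute)
 qed
 ultimately show ?thesis using t by (simp add: U_def)
qed

section \<open>Increments in time\<close>

lemma hk_L1:
 assumes f: "hk d (f :: real \<Rightarrow> real ^ 'n \<Rightarrow> real)"
 obtains C where "C \<ge> 0" "\<And>sg. sg > 0 \<Longrightarrow> (NN z. ennreal \<bar>f sg z\<bar>) \<le> ennreal (C * sg powr (- (real d / 2)))"
proof -
 obtain C where C: "C \<ge> 0" "\<And>sg x :: real ^ 'n. sg > 0 \<Longrightarrow> \<bar>f sg x\<bar> \<le> C * sg powr (- (real d / 2)) * Gk (2 * sg) x"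
  using hk_bound[OF f] by blast
 have "(NN z. ennreal \<bar>f sg z\<bar>) \<le> ennreal (C * sg powr (- (real d / 2)))" if s: "sg > 0" for sg
 proof -
  have "(NN z. ennreal \<bar>f sg z\<bar>) \<le> (NN z. ennreal (C * sg powr (- (real d / 2))) * ennreal (Gk (2 * sg) (z :: real ^ 'n)))"
   using C s by (intro nn_integral_mono) (simp add: ennreal_mult'[symmetric] ennreal_leI)
  also have "\<dots> = ennreal (C * sg powr (- (real d / 2)))"
   using nn_integral_heat_kernel_0[of "2 * sg", where 'n='n] s by (subst nn_integral_cmult) auto
  finally show ?thesis .
 qed
 with C(1) show ?thesis by (rule that)
qed

text \<open>The time derivative has order d + 2, so its L^1 norm is at most a multiple of
  \<sigma>^(-d/2-1), the derivative of a power \<sigma>^(-d/2) up to a constant. The bound is kept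
  as an exact difference of powers since it is integrated once more, over s.\<close>

lemma hk_L1_diff:
 assumes f: "hk d (f :: real \<Rightarrow> real ^ 'n \<Rightarrow> real)" and d: "d > 0"
 obtains C where "C \<ge> 0" "\<And>sg h. sg > 0 \<Longrightarrow> h \<ge> 0 \<Longrightarrow> (NN z. ennreal \<bar>f (sg + h) z - f sg z\<bar>)
  \<le> ennreal (C * (sg powr (- (real d / 2)) - (sg + h) powr (- (real d / 2))))"
proof -
 obtain f' g where fg: "hk (Suc (Suc d)) g" "hk_deriv f f' g" using hk_deriv_ex[OF f] by blast
 obtain g' gt where gg: "hk_deriv g g' gt" using hk_deriv_ex[OF fg(1)] by blast
 define e where "e = real d / 2"
 have e: "e > 0" using d by (simp add: e_def)
 obtain C where C: "C \<ge> 0" "\<And>sg. sg > 0 \<Longrightarrow> (NN z. ennreal \<bar>g sg z\<bar>) \<le> ennreal (C * sg powr (- (real (Suc (Suc d)) / 2)))"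
  using hk_L1[OF fg(1)] by blast
 have ee: "- (real (Suc (Suc d)) / 2) = - e - 1" by (simp add: e_def field_simps)
 have [measurable]: "(\<lambda>(ta, z). g ta z) \<in> BM (borel \<Otimes>\<^sub>M borel)" using hk_measurable[OF fg(1)] by measurable
 have "(NN z. ennreal \<bar>f (sg + h) z - f sg z\<bar>) \<le> ennreal (C / e * (sg powr (- e) - (sg + h) powr (- e)))"
  if s: "sg > 0" and h: "h \<ge> 0" for sg h
 proof -
  define b where "b = sg + h"
  have "ennreal \<bar>f b z - f sg z\<bar> \<le> (NN ta. ennreal (indicator {sg..b} ta) * ennreal \<bar>g ta z\<bar>)" for z
  proof -
   have "has_bochner_integral lborel (\<lambda>ta. indicator {sg..b} ta *\<^sub>R g ta z) (f b z - f sg z)"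
   proof (rule has_bochner_integral_FTC_Icc)
    show "sg \<le> b" using h by (simp add: b_def)
    show "continuous_on {sg..b} (\<lambda>ta. g ta z)"
     by (intro continuous_at_imp_continuous_on ballI DERIV_isCont[OF hk_deriv_time[OF gg]]) (use s in auto)
    show "((\<lambda>ta. f ta z) has_vector_derivative g ta z) (at ta within {sg..b})" if "sg \<le> ta" "ta \<le> b" for ta
     using hk_deriv_time[OF fg(2), of ta z] that s
     by (auto simp: has_real_derivative_iff_has_vector_derivative intro: has_vector_derivative_at_within)
   qed
   then have i: "Li (\<lambda>ta. indicator {sg..b} ta *\<^sub>R g ta z)" "f b z - f sg z = (LBINT ta. indicator {sg..b} ta *\<^sub>R g ta z)"
    by (auto simp: has_bochner_integral_iff)
   have "ennreal \<bar>f b z - f sg z\<bar> \<le> (NN ta. ennreal (norm (indicator {sg..b} ta *\<^sub>R g ta z)))"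
    unfolding i(2) using integral_norm_bound_ennreal[OF i(1)] by simp
   also have "\<dots> = (NN ta. ennreal (indicator {sg..b} ta) * ennreal \<bar>g ta z\<bar>)"
    by (intro nn_integral_cong) (auto simp: indicator_def)
   finally show ?thesis .
  qed
  then have "(NN z. ennreal \<bar>f b z - f sg z\<bar>) \<le> (NN z. NN ta. ennreal (indicator {sg..b} ta) * ennreal \<bar>g ta z\<bar>)"
   by (intro nn_integral_mono)
  also have "\<dots> = (NN ta. NN z. ennreal (indicator {sg..b} ta) * ennreal \<bar>g ta z\<bar>)"
   by (rule lborel_pair.Fubini'[symmetric]) measurable
  also have "\<dots> = (NN ta. ennreal (indicator {sg..b} ta) * (NN z. ennreal \<bar>g ta z\<bar>))"
   by (intro nn_integral_cong nn_integral_cmult) measurable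
  also have "\<dots> \<le> (NN ta. ennreal (C * ta powr (- e - 1)) * indicator {sg..b} ta)"
   using C(2) s unfolding ee by (intro nn_integral_mono) (auto simp: indicator_def)
  also have "\<dots> = ennreal (- (C / e) * b powr (- e) - - (C / e) * sg powr (- e))"
  proof (rule nn_integral_FTC_Icc)
   show "((\<lambda>ta. - (C / e) * ta powr (- e)) has_real_derivative C * ta powr (- e - 1)) (at ta)" if "ta \<in> {sg..b}" for ta
    using that s e by (auto intro!: derivative_eq_intros)
  qed (use C h in "auto simp: b_def")
  finally show ?thesis by (simp add: b_def algebra_simps)
 qed
 then show ?thesis using C e that[of "C / e"] by (simp add: e_def)
qed

lemma hk_sup:
 assumes f: "hk d (f :: real \<Rightarrow> real ^ 'n \<Rightarrow> real)" and a: "a > 0"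
 obtains B where "\<And>sg z. sg \<ge> a \<Longrightarrow> \<bar>f sg z\<bar> \<le> B"
proof -
 obtain C where C: "C \<ge> 0" "\<And>sg x :: real ^ 'n. sg > 0 \<Longrightarrow> \<bar>f sg x\<bar> \<le> C * sg powr (- (real d / 2)) * Gk (2 * sg) x"
  using hk_bound[OF f] by blast
 have "\<bar>f sg z\<bar> \<le> C * a powr (- (real d / 2)) * (4 * pi * (2 * a)) powr (- (real CARD('n) / 2))" if "sg \<ge> a" for sg z
 proof -
  have "Gk (2 * sg) z \<le> (4 * pi * (2 * sg)) powr (- (real CARD('n) / 2))"
   unfolding heat_kernel_def using that a by (auto intro!: mult_left_le)
  also have "\<dots> \<le> (4 * pi * (2 * a)) powr (- (real CARD('n) / 2))" using that a by (intro powr_mono2') auto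
  finally have "Gk (2 * sg) z \<le> (4 * pi * (2 * a)) powr (- (real CARD('n) / 2))" .
  moreover have "sg powr (- (real d / 2)) \<le> a powr (- (real d / 2))" using that a by (intro powr_mono2') auto
  ultimately have "C * sg powr (- (real d / 2)) * Gk (2 * sg) z \<le> C * a powr (- (real d / 2)) * (4 * pi * (2 * a)) powr (- (real CARD('n) / 2))"
   using C by (intro mult_mono mult_left_mono) (auto simp: heat_kernel_nonneg)
  then show ?thesis using C(2)[of sg z] that a by simp
 qed
 then show ?thesis by (rule that)
qed

text \<open>Young's inequality with the product of a and b in L^1, whose norm is estimated by
  Cauchy-Schwarz.\<close>

lemma quadratic_L1:
 fixes a b K :: "real ^ 'n \<Rightarrow> real"
 assumes a: "L2 a" and b: "L2 b" and [measurable]: "K \<in> BM borel"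
 shows "(NN x. ennreal \<bar>quad a b K x\<bar>) \<le> ennreal (nrm2 a * nrm2 b) * (NN z. ennreal \<bar>K z\<bar>)"
proof -
 note [measurable] = L2_measurable[OF a] L2_measurable[OF b]
 have "ennreal \<bar>quad a b K x\<bar> \<le> (NN y. ennreal \<bar>a y * b y\<bar> * ennreal \<bar>K (y - x)\<bar>)" for x
 proof (cases "Li (\<lambda>y. a y * b y * K (y - x))")
  case True
  from integral_norm_bound_ennreal[OF this] show ?thesis by (simp add: abs_mult[of "a _ * b _"] ennreal_mult')
 qed (simp add: not_integrable_integral_eq)
 then have "(NN x. ennreal \<bar>quad a b K x\<bar>) \<le> (NN x. NN y. ennreal \<bar>a y * b y\<bar> * ennreal \<bar>K (y - x)\<bar>)"
  by (intro nn_integral_mono)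
 also have "\<dots> = (NN y. NN x. ennreal \<bar>a y * b y\<bar> * ennreal \<bar>K (y - x)\<bar>)"
  by (rule lborel_pair.Fubini') measurable
 also have "\<dots> = (NN y. ennreal \<bar>a y * b y\<bar> * (NN z. ennreal \<bar>K z\<bar>))"
  using nn_integral_reflect[of "\<lambda>z. ennreal \<bar>K z\<bar>"] by (simp add: nn_integral_cmult)
 also have "\<dots> = (NN y. ennreal \<bar>a y * b y\<bar>) * (NN z. ennreal \<bar>K z\<bar>)"
  by (rule nn_integral_multc) measurable
 also have "(NN y. ennreal \<bar>a y * b y\<bar>) \<le> ennreal (nrm2 a * nrm2 b)"
 proof -
  have "(NN y. ennreal \<bar>a y * b y\<bar>) = ennreal (LBINT y. \<bar>a y\<bar> * \<bar>b y\<bar>)"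
   unfolding abs_mult by (rule nn_integral_eq_integral) (auto intro!: L2_mult L2_abs a b)
  then show ?thesis using L2_CS[OF L2_abs[OF a] L2_abs[OF b]] by (simp add: nrm2_abs ennreal_leI)
 qed
 finally show ?thesis by (simp add: mult_right_mono)
qed

text \<open>Boundedness of K makes the time integral converge at each x, but the estimate uses only
  the L^1 norms of \<open>K s\<close>, which remain useful where the sup norm blows up.\<close>

lemma wcurve_quadratic_L1:
 fixes U V :: "real \<Rightarrow> real ^ 'n \<Rightarrow> real"
 assumes U: "wcurve U E" and V: "wcurve V E" and I: "I \<subseteq> {0..t}" and [measurable]: "I \<in> sets borel"
  and Km: "(\<lambda>(s, z). K s z) \<in> BM (borel \<Otimes>\<^sub>M borel)" and B: "\<And>s z. s \<in> I \<Longrightarrow> \<bar>K s z\<bar> \<le> B"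
 shows "Li (\<lambda>s. indicator I s * (quad (U s) (V s) (K s) x))"
  and "(\<lambda>x. LBINT s. indicator I s * (quad (U s) (V s) (K s) x)) \<in> BM borel"
  and "(NN x. ennreal \<bar>LBINT s. indicator I s * (quad (U s) (V s) (K s) x)\<bar>)
   \<le> ennreal ((E t)\<^sup>2) * (NN s. indicator I s * (NN z. ennreal \<bar>K s z\<bar>))"
proof -
 have [measurable]: "K s \<in> BM borel" for s using measurable_Pair2[OF Km, of s] by simp
 note [measurable] = Km
 define N where "N = (\<lambda>s x. indicator I s * (quad (U s) (V s) (K s) x))"
 have UL: "L2 (U s)" "L2 (V s)" "nrm2 (U s) \<le> E t" "nrm2 (V s) \<le> E t" if "s \<in> I" for s
  using that I U V by (auto simp: wcurve_def)
 have nU: "nrm2 (U s) * nrm2 (V s) \<le> (E t)\<^sup>2" if "s \<in> I" for s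
  unfolding power2_eq_square using UL(3,4)[OF that] by (intro mult_mono) (auto intro: order.trans[OF nrm2_nonneg])
 have "(\<lambda>w. indicator {0..} (fst w) * (LBINT y. U (fst w) y * V (fst w) y * (indicator I (fst w) * K (fst w) (y - snd w)))) \<in> BM lb2"
 proof (rule wcurve_product_measurable[OF U V])
  show "\<exists>B. \<forall>y. \<bar>indicator I (fst w) * K (fst w) (y - snd w)\<bar> \<le> B" for w :: "real \<times> (real ^ 'n)"
   using B[of "fst w"] by (cases "fst w \<in> I") auto
  have "(\<lambda>p :: (real \<times> (real ^ 'n)) \<times> (real ^ 'n). K (fst (fst p)) (snd p - snd (fst p))) \<in> BM (lb2 \<Otimes>\<^sub>M lborel)"
   by measurable
  then show "(\<lambda>(w, y). indicator I (fst w) * K (fst w) (y - snd w)) \<in> BM (lb2 \<Otimes>\<^sub>M lborel)"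
   by (simp add: split_beta')
 qed simp
 moreover have "indicator {0..} (fst w) * (LBINT y. U (fst w) y * V (fst w) y * (indicator I (fst w) * K (fst w) (y - snd w))) = N (fst w) (snd w)" for w
  using I by (cases "fst w \<in> I") (auto simp: N_def)
 ultimately have Nm: "(\<lambda>w. N (fst w) (snd w)) \<in> BM lb2" by simp
 note [measurable] = Nm
 have m1: "(\<lambda>s. N s x) \<in> BM lborel" for x by (rule measurable_compose[OF _ Nm, of "\<lambda>s. (s, x)", simplified]) measurable
 have m2: "(\<lambda>x. N s x) \<in> BM lborel" for s by (rule measurable_compose[OF _ Nm, of "\<lambda>x. (s, x)", simplified]) measurable
 have "Li (\<lambda>s. N s x)"
 proof (rule Bochner_Integration.integrable_bound[OF _ m1])
  show "Li (\<lambda>s. ((E t)\<^sup>2 * B) * indicator {0..t} s :: real)"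
   by (intro integrable_mult_right integrable_real_indicator) (auto simp: emeasure_lborel_Icc_eq)
  show "AE s in lborel. norm (N s x) \<le> norm (((E t)\<^sup>2 * B) * indicator {0..t} s :: real)"
  proof (rule AE_I2)
   fix s
   show "norm (N s x) \<le> norm (((E t)\<^sup>2 * B) * indicator {0..t} s :: real)"
   proof (cases "s \<in> I")
    case True
    have B0: "B \<ge> 0" using order.trans[OF abs_ge_zero B[OF True]] .
    have VK: "L2 (\<lambda>y. V s y * K s (y - x))" "nrm2 (\<lambda>y. V s y * K s (y - x)) \<le> B * nrm2 (V s)"
     by (rule L2_bounded_mult[OF UL(2)[OF True] _ B[OF True]], measurable) (rule nrm2_mult_le[OF UL(2)[OF True] _ B[OF True]], measurable)
    have "\<bar>LBINT y. U s y * (V s y * K s (y - x))\<bar> \<le> nrm2 (U s) * nrm2 (\<lambda>y. V s y * K s (y - x))"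
     by (rule L2_CS[OF UL(1)[OF True] VK(1)])
    also have "\<dots> \<le> nrm2 (U s) * (B * nrm2 (V s))" by (intro mult_left_mono VK) simp
    also have "\<dots> = (nrm2 (U s) * nrm2 (V s)) * B" by simp
    also have "\<dots> \<le> (E t)\<^sup>2 * B" by (intro mult_right_mono nU[OF True] B0)
    finally show ?thesis using True I B0 by (auto simp: N_def mult.assoc)
   qed (simp add: N_def)
  qed
 qed
 then show "Li (\<lambda>s. indicator I s * (quad (U s) (V s) (K s) x))" by (simp only: N_def)
 have "(\<lambda>x. LBINT s. N s x) \<in> BM lborel"
  by (rule lborel.borel_measurable_lebesgue_integral) (use measurable_compose[OF measurable_pair_swap'[of lborel lborel] Nm] in "simp add: split_beta'")
 then show "(\<lambda>x. LBINT s. indicator I s * (quad (U s) (V s) (K s) x)) \<in> BM borel" by (simp add: N_def)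
 have "ennreal \<bar>LBINT s. N s x\<bar> \<le> (NN s. ennreal \<bar>N s x\<bar>)" for x
 proof (cases "Li (\<lambda>s. N s x)")
  case True
  from integral_norm_bound_ennreal[OF this] show ?thesis by simp
 qed (simp add: not_integrable_integral_eq)
 then have "(NN x. ennreal \<bar>LBINT s. N s x\<bar>) \<le> (NN x. NN s. ennreal \<bar>N s x\<bar>)"
  by (intro nn_integral_mono)
 also have "\<dots> = (NN s. NN x. ennreal \<bar>N s x\<bar>)"
  by (rule lborel_pair.Fubini') (use Nm in "simp add: split_beta'")
 also have "\<dots> \<le> (NN s. ennreal ((E t)\<^sup>2) * (indicator I s * (NN z. ennreal \<bar>K s z\<bar>)))"
 proof (rule nn_integral_mono)
  fix s
  show "(NN x. ennreal \<bar>N s x\<bar>) \<le> ennreal ((E t)\<^sup>2) * (indicator I s * (NN z. ennreal \<bar>K s z\<bar>))"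
  proof (cases "s \<in> I")
   case True
   have "(NN x. ennreal \<bar>N s x\<bar>) \<le> ennreal (nrm2 (U s) * nrm2 (V s)) * (NN z. ennreal \<bar>K s z\<bar>)"
    using quadratic_L1[OF UL(1,2)[OF True], of "K s"] True by (simp add: N_def)
   also have "\<dots> \<le> ennreal ((E t)\<^sup>2) * (NN z. ennreal \<bar>K s z\<bar>)" by (intro mult_right_mono ennreal_leI nU[OF True]) simp
   finally show ?thesis using True by simp
  qed (simp add: N_def)
 qed
 also have "\<dots> = ennreal ((E t)\<^sup>2) * (NN s. indicator I s * (NN z. ennreal \<bar>K s z\<bar>))"
  by (rule nn_integral_cmult) measurable
 finally show "(NN x. ennreal \<bar>LBINT s. indicator I s * (quad (U s) (V s) (K s) x)\<bar>)
   \<le> ennreal ((E t)\<^sup>2) * (NN s. indicator I s * (NN z. ennreal \<bar>K s z\<bar>))" by (simp only: N_def)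
qed

section \<open>Increments of the solution minus the heat flow of its datum\<close>

text \<open>The i-th component of v(t) in Borel representatives. Time 0 is treated separately
  because \<open>Ht 0\<close> is not the identity.\<close>

definition fluct :: "(real ^ 'n \<Rightarrow> real ^ 'n) \<Rightarrow> (real \<Rightarrow> real ^ 'n \<Rightarrow> real ^ 'n) \<Rightarrow> real \<Rightarrow> 'n \<Rightarrow> real ^ 'n \<Rightarrow> real"
 where "fluct u\<^sub>0 u t i x = cmp (u t) i x - (if t = 0 then cmp u\<^sub>0 i x else Ht t (cmp u\<^sub>0 i) x)"

abbreviation dfl where "dfl u\<^sub>0 u t h i \<equiv> \<lambda>x. fluct u\<^sub>0 u (t + h) i x - fluct u\<^sub>0 u t i x"

lemma fluct_L2:
 assumes ws: "weak_solution u\<^sub>0 u" and wc: "weakly_continuous_from u\<^sub>0 u" and t: "t \<ge> 0"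
 shows "L2 (fluct u\<^sub>0 u t i)"
proof -
 have u: "u\<^sub>0 \<in> Lp_space 2" "u t \<in> Lp_space 2" using ws wc t by (auto simp: weak_solution_def weakly_continuous_from_def)
 note L = Lp_space_2_rep(1)[OF u(1), of i] Lp_space_2_rep(1)[OF u(2), of i]
 show ?thesis
 proof (cases "t = 0")
  case True then show ?thesis using L2_diff[OF L(2,1)] by (simp add: fluct_def[abs_def])
 next
  case False then show ?thesis using L2_diff[OF L(2) heat_L2(1)[OF L(1), of t]] t by (simp add: fluct_def[abs_def])
 qed
qed

lemma conv_diff:
 assumes "gbound k" "gint f" "gint g"
 shows "conv k (\<lambda>x. f x - g x) x = conv k f x - conv k g x"
 unfolding conv_def using conv_integrable[OF assms(1,2), of x] conv_integrable[OF assms(1,3), of x] by (simp add: right_diff_distrib)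

text \<open>\<open>mild_identity\<close> at T = \<sigma> + t. The datum enters there through
  \<open>Ht' (\<sigma> + t)\<close>, which is exactly what \<open>Ht' \<sigma>\<close> makes of its
  heat flow at time t, so the datum cancels.\<close>

lemma fluct_mild:
 fixes u :: "real \<Rightarrow> real ^ 'n \<Rightarrow> real ^ 'n"
 assumes ws: "weak_solution u\<^sub>0 u" and wc: "weakly_continuous_from u\<^sub>0 u" and M: "oseen M" and t: "0 \<le> t" and sg: "sg > 0"
 shows "Ht' sg (fluct u\<^sub>0 u t i) x
  = - (LBINT s. indicator {0..t} s * (SS j. SS k. quad (cmp (u s) k) (cmp (u s) j) (M i j k (sg + t - s)) x))"
proof -
 have u: "u\<^sub>0 \<in> Lp_space 2" "u t \<in> Lp_space 2" using ws wc t by (auto simp: weak_solution_def weakly_continuous_from_def)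
 have L: "gint (cmp u\<^sub>0 i)" "gint (cmp (u t) i)" by (intro L2_gint Lp_space_2_rep(1) u)+
 have g: "gbound (Gk' sg :: real ^ 'n \<Rightarrow> real)" by (rule hk_gbound[OF hk_heat_kernel' sg])
 have "Ht' sg (fluct u\<^sub>0 u t i) x = Ht' sg (cmp (u t) i) x - Ht' (sg + t) (cmp u\<^sub>0 i) x"
 proof (cases "t = 0")
  case True then show ?thesis using conv_diff[OF g L(2,1), of x] by (simp add: fluct_def[abs_def])
 next
  case False
  then have t': "t > 0" using t by simp
  have "gint (Ht t (cmp u\<^sub>0 i))" by (intro gint_conv gbound_heat_kernel L t')
  from conv_diff[OF g L(2) this, of x] show ?thesis using t' conv_heat_heat'(1)[OF t' sg L(1), of x] by (simp add: fluct_def[abs_def])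
 qed
 then show ?thesis using mild_identity[OF ws wc M t, of "sg + t" i x] sg by simp
qed

text \<open>The Duhamel integrals for t + h and t differ by the new times in (t, t + h], where the
  size of the kernel is used, and by a shift h of the kernel on [0, t], where its increment is used.
  Both contributions integrate to multiples of the same difference of powers J.\<close>

lemma fluct_increment:
 fixes u :: "real \<Rightarrow> real ^ 'n \<Rightarrow> real ^ 'n"
 assumes ws: "weak_solution u\<^sub>0 u" and wc: "weakly_continuous_from u\<^sub>0 u" and E: "\<And>j. wcurve (\<lambda>t. cmp (u t) j) E"
 obtains C where "C \<ge> 0" "\<And>t h sg i. 0 \<le> t \<Longrightarrow> 0 \<le> h \<Longrightarrow> sg > 0 \<Longrightarrow>
  (NN x. ennreal \<bar>Ht' sg (dfl u\<^sub>0 u t h i) x\<bar>)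
   \<le> ennreal (C * (E (t + h))\<^sup>2 * (sg powr (- (1/2)) - (sg + h) powr (- (1/2))))"
proof -
 obtain M :: "'n \<Rightarrow> 'n \<Rightarrow> 'n \<Rightarrow> real \<Rightarrow> real ^ 'n \<Rightarrow> real" where M: "oseen M" by (rule oseen_ex)
 have hM: "hk 3 (M i j k)" for i j k using M by (simp add: oseen_def)
 have "\<exists>C\<ge>0. \<forall>sg>0. (NN z. ennreal \<bar>M i j k sg z\<bar>) \<le> ennreal (C * sg powr (- (3 / 2)))" for i j k
  using hk_L1[OF hM[of i j k]] by (metis of_nat_numeral)
 then obtain C1 where C1: "\<And>i j k. C1 i j k \<ge> 0" "\<And>i j k sg. sg > 0 \<Longrightarrow> (NN z. ennreal \<bar>M i j k sg z\<bar>) \<le> ennreal (C1 i j k * sg powr (- (3 / 2)))" by metis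
 define P where "P i j k C \<longleftrightarrow> C \<ge> 0 \<and> (\<forall>sg>0. \<forall>h\<ge>0. (NN z. ennreal \<bar>M i j k (sg + h) z - M i j k sg z\<bar>)
   \<le> ennreal (C * (sg powr (- (3 / 2)) - (sg + h) powr (- (3 / 2)))))" for i j k C
 have "\<exists>C. P i j k C" for i j k
 proof (rule hk_L1_diff[OF hM[of i j k]])
  fix C assume "C \<ge> 0" "\<And>sg h. sg > 0 \<Longrightarrow> h \<ge> 0 \<Longrightarrow> (NN z. ennreal \<bar>M i j k (sg + h) z - M i j k sg z\<bar>)
   \<le> ennreal (C * (sg powr (- (real 3 / 2)) - (sg + h) powr (- (real 3 / 2))))"
  then show ?thesis by (intro exI[of _ C]) (simp add: P_def)
 qed simp
 then obtain C2 where "\<And>i j k. P i j k (C2 i j k)" by metis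
 then have C2: "\<And>i j k. C2 i j k \<ge> 0" "\<And>i j k sg h. sg > 0 \<Longrightarrow> h \<ge> 0 \<Longrightarrow> (NN z. ennreal \<bar>M i j k (sg + h) z - M i j k sg z\<bar>)
   \<le> ennreal (C2 i j k * (sg powr (- (3 / 2)) - (sg + h) powr (- (3 / 2))))" by (simp_all add: P_def)
 \<comment> \<open>Summing over i as well makes the constant independent of the component.\<close>
 define C where "C = (SS i. SS j. SS k. 2 * C1 i j k + 2 * C2 i j k)"
 have C0: "0 \<le> (SS j. SS k. 2 * C1 i j k + 2 * C2 i j k)" for i using C1(1) C2(1) by (intro sum_nonneg) simp
 show ?thesis
 proof (rule that[of C])
  show "C \<ge> 0" unfolding C_def by (intro sum_nonneg) (use C1(1) C2(1) in simp)
  fix t h sg :: real and i assume t: "0 \<le> t" and h: "0 \<le> h" and sg: "sg > 0"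
  define J where "J = sg powr (- (1/2)) - (sg + h) powr (- (1/2))"
  have J: "J \<ge> 0" using powr_mono2'[of "- (1/2)" sg "sg + h"] h sg by (simp add: J_def)
  define U where "U = (\<lambda>j s. cmp (u s) j)"
  have UE: "wcurve (U j) E" for j unfolding U_def by (rule E)
  define K1 where "K1 = (\<lambda>j k s. M i j k (sg + (t + h) - s))"
  define K2 where "K2 = (\<lambda>j k s. M i j k (sg + t - s))"
  have "\<forall>j k. \<exists>B. \<forall>\<rho>\<ge>sg. \<forall>z. \<bar>M i j k \<rho> z\<bar> \<le> B" using hk_sup[OF hM sg] by metis
  then obtain B where B: "\<And>j k \<rho> z. \<rho> \<ge> sg \<Longrightarrow> \<bar>M i j k \<rho> z\<bar> \<le> B j k" by metis
  have B1: "\<bar>K1 j k s z\<bar> \<le> B j k" if "s \<in> {0..t+h}" for j k s z unfolding K1_def using that by (intro B) auto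
  have B2: "\<bar>K2 j k s z\<bar> \<le> B j k" if "s \<in> {0..t}" for j k s z unfolding K2_def using that by (intro B) auto
  have B12: "\<bar>K1 j k s z - K2 j k s z\<bar> \<le> 2 * B j k" if "s \<in> {0..t}" for j k s z
   using B1[of s j k z] B2[of s j k z] that h by (simp add: abs_le_iff)
  have m1: "(\<lambda>(s, z). K1 j k s z) \<in> BM (borel \<Otimes>\<^sub>M borel)" for j k
   unfolding K1_def using hk_measurable[OF hM] by measurable
  have m2: "(\<lambda>(s, z). K2 j k s z) \<in> BM (borel \<Otimes>\<^sub>M borel)" for j k
   unfolding K2_def using hk_measurable[OF hM] by measurable
  have m12: "(\<lambda>(s, z). K1 j k s z - K2 j k s z) \<in> BM (borel \<Otimes>\<^sub>M borel)" for j k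
   using borel_measurable_diff[OF m1 m2] by (simp add: split_beta')
  have K1m: "K1 j k s \<in> BM borel" and K2m: "K2 j k s \<in> BM borel" for j k s
   using measurable_Pair2[OF m1, of s] measurable_Pair2[OF m2, of s] by simp_all
  have I: "{t<..t+h} \<subseteq> {0..t+h}" "{0..t} \<subseteq> {0..t+h}" using t h by auto
  note q = wcurve_quadratic_L1[OF UE UE]
  note qa = q[OF I(1) _ m1 B1[OF subsetD[OF I(1)]]]
  note qb = q[OF order.refl _ m1 B1]
  note qc = q[OF I(2) _ m12 B12]
  note qd = q[OF order.refl _ m2 B2]
  note qe = q[OF I(2) _ m1 B1[OF subsetD[OF I(2)]]]
  have qa1: "Li (\<lambda>s. indicator {t<..t+h} s * (quad (U k s) (U j s) (K1 j k s) x))" for j k x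
   by (rule qa(1)) simp
  have qb1: "Li (\<lambda>s. indicator {0..t+h} s * (quad (U k s) (U j s) (K1 j k s) x))" for j k x
   by (rule qb(1)) simp
  have qd1: "Li (\<lambda>s. indicator {0..t} s * (quad (U k s) (U j s) (K2 j k s) x))" for j k x
   by (rule qd(1)) simp
  have qe1: "Li (\<lambda>s. indicator {0..t} s * (quad (U k s) (U j s) (K1 j k s) x))" for j k x
   by (rule qe(1)) simp
  define A1 where "A1 = (\<lambda>j k x. LBINT s. indicator {t<..t+h} s * (quad (U k s) (U j s) (K1 j k s) x))"
  define A2 where "A2 = (\<lambda>j k x. LBINT s. indicator {0..t} s * (LBINT y. U k s y * U j s y * (K1 j k s (y - x) - K2 j k s (y - x))))"
  have e1: "(LBINT s. indicator {0..t+h} s * (quad (U k s) (U j s) (K1 j k s) x))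
   = A1 j k x + (LBINT s. indicator {0..t} s * (quad (U k s) (U j s) (K1 j k s) x))" for j k x
  proof -
   have "indicator {0..t+h} s * c = indicator {t<..t+h} s * c + (indicator {0..t} s * c :: real)" for s c
    using t h by (auto simp: indicator_def)
   then show ?thesis unfolding A1_def using qa1[where x = x and j = j and k = k] qe1[where x = x and j = j and k = k] by simp
  qed
  have e2: "(LBINT s. indicator {0..t} s * (quad (U k s) (U j s) (K1 j k s) x))
   - (LBINT s. indicator {0..t} s * (quad (U k s) (U j s) (K2 j k s) x)) = A2 j k x" for j k x
  proof -
   have "indicator {0..t} s * (LBINT y. U k s y * U j s y * (K1 j k s (y - x) - K2 j k s (y - x)))
    = indicator {0..t} s * (quad (U k s) (U j s) (K1 j k s) x) - indicator {0..t} s * (quad (U k s) (U j s) (K2 j k s) x)" for s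
   proof (cases "s \<in> {0..t}")
    case True
    have UL: "L2 (U j s)" for j using UE True by (auto simp: wcurve_def)
    have i: "Li (\<lambda>y. U k s y * (U j s y * K (y - x)))" if [measurable]: "K \<in> BM borel" and "\<And>z. \<bar>K z\<bar> \<le> B j k" for K
     by (rule L2_mult[OF UL L2_bounded_mult[OF UL _ that(2)]]) measurable
    have "Li (\<lambda>y. U k s y * (U j s y * K1 j k s (y - x)))" "Li (\<lambda>y. U k s y * (U j s y * K2 j k s (y - x)))"
     by (rule i[OF K1m B1], use True h in simp) (rule i[OF K2m B2[OF True]])
    then show ?thesis using True by (simp add: right_diff_distrib mult.assoc)
   qed simp
   then show ?thesis unfolding A2_def using qe1[where x = x and j = j and k = k] qd1[where x = x and j = j and k = k] by simp
  qed
  have u: "fluct u\<^sub>0 u (t + h) i \<in> Collect gint" "fluct u\<^sub>0 u t i \<in> Collect gint"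
   using t h by (auto intro!: L2_gint fluct_L2[OF ws wc])
  have g: "gbound (Gk' sg :: real ^ 'n \<Rightarrow> real)" by (rule hk_gbound[OF hk_heat_kernel' sg])
  have cf: "Ht' sg (dfl u\<^sub>0 u t h i) x = - (SS j. SS k. A1 j k x + A2 j k x)" for x
  proof -
   have sw: "(LBINT s. (SS j. SS k. F j k s)) = (SS j. SS k. LBINT s. F j k s)"
    if "\<And>j k. Li (F j k)" for F :: "'n \<Rightarrow> 'n \<Rightarrow> real \<Rightarrow> real" using that by simp
   have s1: "(LBINT s. indicator {0..t+h} s * (SS j. SS k. quad (U k s) (U j s) (K1 j k s) x))
    = (SS j. SS k. LBINT s. indicator {0..t+h} s * (quad (U k s) (U j s) (K1 j k s) x))"
    unfolding sum_distrib_left by (rule sw[OF qb1])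
   have s2: "(LBINT s. indicator {0..t} s * (SS j. SS k. quad (U k s) (U j s) (K2 j k s) x))
    = (SS j. SS k. LBINT s. indicator {0..t} s * (quad (U k s) (U j s) (K2 j k s) x))"
    unfolding sum_distrib_left by (rule sw[OF qd1])
   have "Ht' sg (dfl u\<^sub>0 u t h i) x
    = - (SS j. SS k. LBINT s. indicator {0..t+h} s * (quad (U k s) (U j s) (K1 j k s) x))
     + (SS j. SS k. LBINT s. indicator {0..t} s * (quad (U k s) (U j s) (K2 j k s) x))"
    using conv_diff[OF g CollectD[OF u(1)] CollectD[OF u(2)], of x] fluct_mild[OF ws wc M _ sg, of "t + h" i x] fluct_mild[OF ws wc M t sg, of i x] t h
     s1 s2 by (simp add: K1_def K2_def U_def)
   also have "\<dots> = - (SS j. SS k. (LBINT s. indicator {0..t+h} s * (quad (U k s) (U j s) (K1 j k s) x))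
     - (LBINT s. indicator {0..t} s * (quad (U k s) (U j s) (K2 j k s) x)))"
    by (simp add: sum_subtractf)
   also have "\<dots> = - (SS j. SS k. A1 j k x + A2 j k x)"
    by (intro arg_cong[where f = uminus] sum.cong refl) (simp add: e1 e2[symmetric])
   finally show ?thesis .
  qed
  have Am1: "A1 j k \<in> BM borel" for j k unfolding A1_def by (rule qa(2)) simp
  have Am2: "A2 j k \<in> BM borel" for j k unfolding A2_def by (rule qc(2)) simp
  note [measurable] = Am1 Am2
  have b1: "(NN x. ennreal \<bar>A1 j k x\<bar>) \<le> ennreal ((E (t + h))\<^sup>2) * ennreal (2 * C1 i j k * J)" for j k
  proof -
   have "(NN s. indicator {t<..t+h} s * (NN z. ennreal \<bar>K1 j k s z\<bar>))
    \<le> (NN s. ennreal (C1 i j k * (sg + (t + h) - s) powr (- (3/2))) * indicator {t..t+h} s)"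
    unfolding K1_def using C1(2)[of _ i j k] sg by (intro nn_integral_mono) (auto simp: indicator_def)
   \<comment> \<open>A primitive of the power -3/2 is the power -1/2; the factor 2 comes from the
     exponent.\<close>
   also have "\<dots> = ennreal (2 * C1 i j k * (sg + (t + h) - (t + h)) powr (- (1/2)) - 2 * C1 i j k * (sg + (t + h) - t) powr (- (1/2)))"
   proof (rule nn_integral_FTC_Icc)
    show "((\<lambda>s. 2 * C1 i j k * (sg + (t + h) - s) powr (- (1/2))) has_real_derivative C1 i j k * (sg + (t + h) - s) powr (- (3/2))) (at s)" if "s \<in> {t..t+h}" for s
     using that sg by (auto intro!: derivative_eq_intros)
   qed (use C1 h in auto)
   also have "\<dots> = ennreal (2 * C1 i j k * J)" by (simp add: J_def algebra_simps)
   finally show ?thesis unfolding A1_def by (intro order.trans[OF qa(3)] mult_left_mono) auto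
  qed
  have b2: "(NN x. ennreal \<bar>A2 j k x\<bar>) \<le> ennreal ((E (t + h))\<^sup>2) * ennreal (2 * C2 i j k * J)" for j k
  proof -
   have "(NN s. indicator {0..t} s * (NN z. ennreal \<bar>K1 j k s z - K2 j k s z\<bar>))
    \<le> (NN s. ennreal (C2 i j k * ((sg + t - s) powr (- (3/2)) - (sg + t - s + h) powr (- (3/2)))) * indicator {0..t} s)"
   proof (rule nn_integral_mono)
    fix s
    show "indicator {0..t} s * (NN z. ennreal \<bar>K1 j k s z - K2 j k s z\<bar>) \<le> ennreal (C2 i j k * ((sg + t - s) powr (- (3/2)) - (sg + t - s + h) powr (- (3/2)))) * indicator {0..t} s"
     using C2(2)[of "sg + t - s" h i j k] sg h by (auto simp: indicator_def K1_def K2_def algebra_simps)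
   qed
   also have "\<dots> = ennreal (2 * C2 i j k * ((sg + t - t) powr (- (1/2)) - (sg + t - t + h) powr (- (1/2))) - 2 * C2 i j k * ((sg + t - 0) powr (- (1/2)) - (sg + t - 0 + h) powr (- (1/2))))"
   proof (rule nn_integral_FTC_Icc)
    show "((\<lambda>s. 2 * C2 i j k * ((sg + t - s) powr (- (1/2)) - (sg + t - s + h) powr (- (1/2)))) has_real_derivative C2 i j k * ((sg + t - s) powr (- (3/2)) - (sg + t - s + h) powr (- (3/2)))) (at s)" if "s \<in> {0..t}" for s
     using that sg h by (auto intro!: derivative_eq_intros simp: algebra_simps)
    show "0 \<le> C2 i j k * ((sg + t - s) powr (- (3/2)) - (sg + t - s + h) powr (- (3/2)))" if "s \<in> {0..t}" for s
     using that sg h C2(1)[of i j k] powr_mono2'[of "- (3/2)" "sg + t - s" "sg + t - s + h"] by (intro mult_nonneg_nonneg) auto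
   qed (use t in auto)
   \<comment> \<open>The contribution of the end point s = 0 enters with a minus sign and is
     dropped, which removes the dependence on t.\<close>
   also have "\<dots> \<le> ennreal (2 * C2 i j k * J)"
   proof (rule ennreal_leI)
    have "(sg + t + h) powr (- (1/2)) \<le> (sg + t) powr (- (1/2))" using sg t h by (intro powr_mono2') auto
    then have "2 * C2 i j k * ((sg + t - 0) powr (- (1/2)) - (sg + t - 0 + h) powr (- (1/2))) \<ge> 0" using C2(1)[of i j k] by simp
    then show "2 * C2 i j k * ((sg + t - t) powr (- (1/2)) - (sg + t - t + h) powr (- (1/2))) - 2 * C2 i j k * ((sg + t - 0) powr (- (1/2)) - (sg + t - 0 + h) powr (- (1/2))) \<le> 2 * C2 i j k * J"
     by (simp add: J_def)
   qed
   finally show ?thesis unfolding A2_def by (intro order.trans[OF qc(3)] mult_left_mono) auto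
  qed
  have "(NN x. ennreal \<bar>Ht' sg (dfl u\<^sub>0 u t h i) x\<bar>)
   \<le> (NN x. (SS j. SS k. ennreal \<bar>A1 j k x\<bar> + ennreal \<bar>A2 j k x\<bar>))"
  proof (rule nn_integral_mono)
   fix x
   have "\<bar>Ht' sg (dfl u\<^sub>0 u t h i) x\<bar> \<le> (SS j. SS k. \<bar>A1 j k x\<bar> + \<bar>A2 j k x\<bar>)"
    unfolding cf abs_minus_cancel by (rule order.trans[OF sum_abs sum_mono], rule order.trans[OF sum_abs sum_mono], rule abs_triangle_ineq)
   then show "ennreal \<bar>Ht' sg (dfl u\<^sub>0 u t h i) x\<bar> \<le> (SS j. SS k. ennreal \<bar>A1 j k x\<bar> + ennreal \<bar>A2 j k x\<bar>)"
    by (simp add: ennreal_plus[symmetric] sum_ennreal sum_nonneg ennreal_leI del: ennreal_plus)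
  qed
  also have "\<dots> = (SS j. SS k. (NN x. ennreal \<bar>A1 j k x\<bar>) + (NN x. ennreal \<bar>A2 j k x\<bar>))"
   by (simp add: nn_integral_sum nn_integral_add)
  also have "\<dots> \<le> (SS j. SS k. ennreal ((E (t + h))\<^sup>2) * ennreal (2 * C1 i j k * J) + ennreal ((E (t + h))\<^sup>2) * ennreal (2 * C2 i j k * J))"
   by (intro sum_mono add_mono b1 b2)
  also have "\<dots> = ennreal (SS j. SS k. (E (t + h))\<^sup>2 * (2 * C1 i j k * J) + (E (t + h))\<^sup>2 * (2 * C2 i j k * J))"
   using C1(1) C2(1) J by (simp add: ennreal_mult'[symmetric] ennreal_plus[symmetric] sum_ennreal sum_nonneg del: ennreal_plus)
  also have "(SS j. SS k. (E (t + h))\<^sup>2 * (2 * C1 i j k * J) + (E (t + h))\<^sup>2 * (2 * C2 i j k * J))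
   = (SS j. SS k. 2 * C1 i j k + 2 * C2 i j k) * ((E (t + h))\<^sup>2 * J)"
   unfolding sum_distrib_right by (intro sum.cong refl) (simp only: distrib_right distrib_left mult_ac)
  also have "\<dots> \<le> C * ((E (t + h))\<^sup>2 * J)"
   unfolding C_def by (intro mult_right_mono member_le_sum) (use C0 J in auto)
  finally show "(NN x. ennreal \<bar>Ht' sg (dfl u\<^sub>0 u t h i) x\<bar>)
   \<le> ennreal (C * (E (t + h))\<^sup>2 * (sg powr (- (1/2)) - (sg + h) powr (- (1/2))))"
   by (simp add: J_def mult.assoc ennreal_leI)
 qed
qed

text \<open>Cauchy-Schwarz against the Gaussian, whose squared L^2 norm is at most its maximum times
  its mass 1 and so tends to 0.\<close>

lemma conv_heat_vanishing:
 fixes f :: "real ^ 'n \<Rightarrow> real"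
 assumes f: "L2 f"
 shows "((\<lambda>s. Ht s f x) \<longlongrightarrow> 0) at_top"
proof (rule Lim_null_comparison)
 show "\<forall>\<^sub>F s in at_top. norm (Ht s f x) \<le> sqrt ((4 * pi * s) powr (- (real CARD('n) / 2))) * nrm2 f"
 proof (rule eventually_mono[OF eventually_gt_at_top[of 0]])
  fix s :: real assume s: "s > 0"
  have g: "gbound (Gk s :: real ^ 'n \<Rightarrow> real)" by (rule gbound_heat_kernel[OF s])
  have i: "Li (Gk s :: real ^ 'n \<Rightarrow> real)" by (rule gbound_integrable[OF g])
  have "(LBINT y. Gk s (y :: real ^ 'n)) = 1"
   using nn_integral_heat_kernel_0[OF s, where 'n='n] i
   by (subst (asm) nn_integral_eq_integral) (auto simp: heat_kernel_nonneg)
  moreover have "(LBINT y. (Gk s (y :: real ^ 'n))\<^sup>2) \<le> (LBINT y. (4 * pi * s) powr (- (real CARD('n) / 2)) * Gk s (y :: real ^ 'n))"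
  proof (rule integral_mono)
   show "Li (\<lambda>y :: real ^ 'n. (Gk s y)\<^sup>2)" using gbound_L2[OF g] by (simp add: L2_def)
   show "(Gk s y)\<^sup>2 \<le> (4 * pi * s) powr (- (real CARD('n) / 2)) * Gk s y" for y :: "real ^ 'n"
    unfolding power2_eq_square by (rule mult_right_mono) (use s in "auto simp: heat_kernel_def intro!: mult_left_le")
  qed (use i in simp)
  ultimately have a: "nrm2 (Gk s :: real ^ 'n \<Rightarrow> real) \<le> sqrt ((4 * pi * s) powr (- (real CARD('n) / 2)))"
   unfolding nrm2_def by (intro real_sqrt_le_mono) simp
  have "\<bar>Ht s f x\<bar> \<le> nrm2 (Gk s :: real ^ 'n \<Rightarrow> real) * nrm2 f"
   unfolding conv_def gbound_shift(2)[OF g, of x, symmetric] by (rule L2_CS[OF gbound_shift(1)[OF g] f])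
  note b = this
  show "norm (Ht s f x) \<le> sqrt ((4 * pi * s) powr (- (real CARD('n) / 2))) * nrm2 f"
   using order.trans[OF b mult_right_mono[OF a nrm2_nonneg]] by simp
 qed
 have "((\<lambda>s. (4 * pi * s) powr (- (real CARD('n) / 2))) \<longlongrightarrow> 0) at_top"
  by (rule tendsto_neg_powr) (auto intro!: filterlim_tendsto_pos_mult_at_top[OF tendsto_const] filterlim_ident)
 from tendsto_mult_left_zero[OF tendsto_real_sqrt[OF this, simplified], of "nrm2 f"]
 show "((\<lambda>s. sqrt ((4 * pi * s) powr (- (real CARD('n) / 2))) * nrm2 f) \<longlongrightarrow> 0) at_top" .
qed

text \<open>The weight that combines the behaviour \<open>h\<^sup>\<alpha>\<close> near \<open>\<sigma> = 0\<close> with the decay needed for large \<open>\<sigma>\<close>.\<close>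

definition wt :: "real \<Rightarrow> real \<Rightarrow> real"
 where "wt \<alpha> sg = (if sg \<le> 1 then sg powr (- (1/2) - \<alpha>) else sg powr (- (3/2)))"

text \<open>With q = \<sigma>/(\<sigma> + h) and q \<le> sqrt q the difference is at most
  \<sigma>^(-1/2) h/(\<sigma> + h). For \<sigma> \<le> 1 the quotient is at most min(1, h/\<sigma>),
  hence at most the power \<alpha> of h/\<sigma>; for \<sigma> > 1 it is at most h/\<sigma>, which
  buys the extra decay. The maximum covers both cases.\<close>

lemma wt_bound:
 assumes s: "sg > 0" and h: "h \<ge> 0" and a: "0 < \<alpha>" "\<alpha> \<le> 1"
 shows "sg powr (- (1/2)) - (sg + h) powr (- (1/2)) \<le> max (h powr \<alpha>) h * wt \<alpha> sg"
proof -
 define q where "q = sg / (sg + h)"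
 have q: "0 < q" "q \<le> 1" "1 - q = h / (sg + h)" using s h by (auto simp: q_def field_simps)
 have "(sg + h) powr (- (1/2)) = sg powr (- (1/2)) * q powr (1/2)"
 proof -
  have "sg + h = sg / q" using s h by (simp add: q_def)
  then show ?thesis using s q by (simp add: powr_divide powr_minus_divide)
 qed
 moreover have "q powr 1 \<le> q powr (1/2)" using q by (intro powr_mono') auto
 ultimately have 1: "sg powr (- (1/2)) - (sg + h) powr (- (1/2)) \<le> sg powr (- (1/2)) * (h / (sg + h))"
  using q(1) mult_left_mono[of q "q powr (1/2)" "sg powr (- (1/2))"] by (simp add: q(3)[symmetric] right_diff_distrib)
 show ?thesis
 proof (cases "sg \<le> 1")
  case True
  have "h / (sg + h) \<le> (h / sg) powr \<alpha>"
  proof (cases "h \<ge> sg")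
   case True
   then have "1 \<le> (h / sg) powr \<alpha>" using s a by (intro ge_one_powr_ge_zero) auto
   moreover have "h / (sg + h) \<le> 1" using s h by simp
   ultimately show ?thesis by linarith
  next
   case False
   have "h / (sg + h) \<le> (h / sg) powr 1" using s h by (simp add: frac_le)
   also have "\<dots> \<le> (h / sg) powr \<alpha>" using False s h a by (intro powr_mono') auto
   finally show ?thesis .
  qed
  then have "sg powr (- (1/2)) * (h / (sg + h)) \<le> sg powr (- (1/2)) * (h powr \<alpha> * sg powr (- \<alpha>))"
   using s h by (intro mult_left_mono) (auto simp: powr_divide powr_minus_divide)
  also have "\<dots> = h powr \<alpha> * wt \<alpha> sg" using True by (simp add: wt_def powr_add[symmetric])
  also have "\<dots> \<le> max (h powr \<alpha>) h * wt \<alpha> sg" by (intro mult_right_mono) (auto simp: wt_def)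
  finally show ?thesis using 1 by linarith
 next
  case False
  have "h / (sg + h) \<le> h * sg powr (- 1)" using s h by (simp add: powr_minus_divide frac_le)
  then have "sg powr (- (1/2)) * (h / (sg + h)) \<le> sg powr (- (1/2)) * (h * sg powr (- 1))" by (intro mult_left_mono) auto
  also have "\<dots> = h * (sg powr (- (1/2)) * sg powr (- 1))" by simp
  also have "sg powr (- (1/2)) * sg powr (- 1) = wt \<alpha> sg" unfolding powr_add[symmetric] using False by (simp add: wt_def)
  also have "h * wt \<alpha> sg \<le> max (h powr \<alpha>) h * wt \<alpha> sg" by (intro mult_right_mono) (auto simp: wt_def)
  finally show ?thesis using 1 by linarith
 qed
qed

lemma wt_integral:
 assumes r: "0 \<le> r" and a: "\<alpha> < (1 - r) / 2"
 obtains K where "K \<ge> 0" "(NN s. ennreal (pos s * (s powr (- (r / 2)) * wt \<alpha> s))) \<le> ennreal K"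
proof -
 define e where "e = - (1/2) - \<alpha> - r / 2"
 \<comment> \<open>Integrability at 0 is equivalent to \<alpha> + r/2 < 1/2, the hypothesis on the
   exponent.\<close>
 have e: "e > -1" using a by (simp add: e_def field_simps)
 have i0: "(NN s. ennreal (indicator {0..1} s * s powr e)) = ennreal (1 powr (e + 1) / (e + 1))"
  by (rule nn_integral_has_integral_lebesgue[OF _ has_integral_powr_from_0]) (use e in auto)
 have i1: "(NN s. ennreal (indicator {1..} s * s powr (- (3/2)))) = ennreal (- (1 powr (- (3/2) + 1)) / (- (3/2) + 1))"
  by (rule nn_integral_has_integral_lebesgue[OF _ has_integral_powr_to_inf]) auto
 have "(NN s. ennreal (pos s * (s powr (- (r / 2)) * wt \<alpha> s)))
  \<le> (NN s. ennreal (indicator {0..1} s * s powr e) + ennreal (indicator {1..} s * s powr (- (3/2))))"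
 proof (rule nn_integral_mono)
  fix s :: real
  have "pos s * (s powr (- (r / 2)) * wt \<alpha> s) \<le> indicator {0..1} s * s powr e + indicator {1..} s * s powr (- (3/2))"
  proof (cases "s \<le> 1")
   case True
   then show ?thesis by (auto simp: wt_def e_def indicator_def powr_add[symmetric] algebra_simps)
  next
   case False
   have "s powr (- (r / 2)) \<le> 1" using False r by (simp add: powr_le_one_le powr_minus_divide ge_one_powr_ge_zero)
   then show ?thesis using False by (auto simp: wt_def intro!: mult_left_le_one_le)
  qed
  then show "ennreal (pos s * (s powr (- (r / 2)) * wt \<alpha> s)) \<le> ennreal (indicator {0..1} s * s powr e) + ennreal (indicator {1..} s * s powr (- (3/2)))"
   by (simp add: ennreal_plus[symmetric] ennreal_leI del: ennreal_plus)
 qed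
 also have "\<dots> = ennreal (1 powr (e + 1) / (e + 1)) + ennreal (- (1 powr (- (3/2) + 1)) / (- (3/2) + 1))"
  by (subst nn_integral_add) (auto simp: i0 i1)
 \<comment> \<open>The summand 2 is the integral of the power -3/2 over [1, \<infinity>).\<close>
 also have "\<dots> = ennreal (1 / (e + 1) + 2)" using e by (simp add: ennreal_plus)
 finally show ?thesis using e by (intro that[of "1 / (e + 1) + 2"]) auto
qed

lemma fluct_estimate:
 fixes u :: "real \<Rightarrow> real ^ 'n \<Rightarrow> real ^ 'n"
 assumes ws: "weak_solution u\<^sub>0 u" and wc: "weakly_continuous_from u\<^sub>0 u" and E: "\<And>j. wcurve (\<lambda>t. cmp (u t) j) E"
  and r: "0 \<le> r" and \<alpha>: "0 < \<alpha>" "\<alpha> < (1 - r) / 2"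
 obtains C where "C \<ge> 0" "\<And>t h i. 0 \<le> t \<Longrightarrow> 0 \<le> h \<Longrightarrow> Li (dfl u\<^sub>0 u t h i) \<and>
  (\<exists>g. Li g \<and> (AE x in lborel. dfl u\<^sub>0 u t h i x = bessel_potential r g x) \<and>
  (LBINT x. \<bar>g x\<bar>) \<le> C * (E (t + h))\<^sup>2 * max (h powr \<alpha>) h)"
proof -
 obtain C where C: "C \<ge> 0" "\<And>t h sg i. 0 \<le> t \<Longrightarrow> 0 \<le> h \<Longrightarrow> sg > 0 \<Longrightarrow>
  (NN x. ennreal \<bar>Ht' sg (dfl u\<^sub>0 u t h i) x\<bar>)
   \<le> ennreal (C * (E (t + h))\<^sup>2 * (sg powr (- (1/2)) - (sg + h) powr (- (1/2))))"
  using fluct_increment[OF ws wc E] by blast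
 \<comment> \<open>The weight with exponent 0 controls the L^1 norm of the increment itself, the one
   with r the inverse Bessel potential; \<open>bessel_estimate\<close> wants one K for both.\<close>
 obtain K0 where K0: "K0 \<ge> 0" "(NN s. ennreal (pos s * (s powr (- (0 / 2)) * wt \<alpha> s))) \<le> ennreal K0"
  using wt_integral[of 0 \<alpha>] r \<alpha> by auto
 obtain K1 where K1: "K1 \<ge> 0" "(NN s. ennreal (pos s * (s powr (- (r / 2)) * wt \<alpha> s))) \<le> ennreal K1"
  using wt_integral[OF r \<alpha>(2)] by blast
 define K where "K = max K0 K1"
 have z: "pos s * (s powr (- (0 / 2)) * wt \<alpha> s) = pos s * wt \<alpha> s" for s by (auto simp: indicator_def)
 have K: "K \<ge> 0" "(NN s. ennreal (pos s * wt \<alpha> s)) \<le> ennreal K"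
  "(NN s. ennreal (pos s * (s powr (- (r / 2)) * wt \<alpha> s))) \<le> ennreal K"
  using K0(1) order.trans[OF K0(2)[unfolded z] ennreal_leI] order.trans[OF K1(2) ennreal_leI] by (auto simp: K_def)
 have r2: "r < 2" "0 < Gamma (1 - r / 2)" using \<alpha> by (auto intro!: Gamma_real_pos)
 show ?thesis
 proof (rule that[of "(1 + 1 / Gamma (1 - r / 2)) * (C * K)"])
  show "0 \<le> (1 + 1 / Gamma (1 - r / 2)) * (C * K)" using C(1) K(1) r2 by simp
  fix t h :: real and i assume t: "0 \<le> t" "0 \<le> h"
  have L: "L2 (dfl u\<^sub>0 u t h i)" using t by (intro L2_diff fluct_L2[OF ws wc]) auto
  define B where "B = C * (E (t + h))\<^sup>2 * max (h powr \<alpha>) h"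
  have CE: "C * (E (t + h))\<^sup>2 \<ge> 0" using C(1) by simp
  have B: "B \<ge> 0" unfolding B_def by (rule mult_nonneg_nonneg[OF CE]) (simp add: le_max_iff_disj)
  have "Li (dfl u\<^sub>0 u t h i) \<and>
   (\<exists>g. Li g \<and> (AE x in lborel. dfl u\<^sub>0 u t h i x = bessel_potential r g x) \<and>
   (LBINT x. \<bar>g x\<bar>) \<le> (1 + 1 / Gamma (1 - r / 2)) * (B * K))"
  proof (rule bessel_estimate[OF L2_gint[OF L] conv_heat_vanishing[OF L] r r2(1) B K(1) _ _ _ K(2,3)])
   fix s :: real assume s: "s > 0"
   have "C * (E (t + h))\<^sup>2 * (s powr (- (1/2)) - (s + h) powr (- (1/2))) \<le> C * (E (t + h))\<^sup>2 * (max (h powr \<alpha>) h * wt \<alpha> s)"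
    using \<alpha> r by (intro mult_left_mono[OF wt_bound[OF s t(2)] CE]) auto
   then show "(NN z. ennreal \<bar>Ht' s (dfl u\<^sub>0 u t h i) z\<bar>) \<le> ennreal (B * wt \<alpha> s)"
    by (intro order.trans[OF C(2)[OF t s]] ennreal_leI) (simp add: B_def mult.assoc)
  qed (auto simp: wt_def[abs_def])
  moreover have "(1 + 1 / Gamma (1 - r / 2)) * (B * K) = (1 + 1 / Gamma (1 - r / 2)) * (C * K) * (E (t + h))\<^sup>2 * max (h powr \<alpha>) h"
   by (simp add: B_def)
  ultimately show "Li (dfl u\<^sub>0 u t h i) \<and>
   (\<exists>g. Li g \<and> (AE x in lborel. dfl u\<^sub>0 u t h i x = bessel_potential r g x) \<and>
   (LBINT x. \<bar>g x\<bar>) \<le> (1 + 1 / Gamma (1 - r / 2)) * (C * K) * (E (t + h))\<^sup>2 * max (h powr \<alpha>) h)" by simp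
 qed
qed

section \<open>The Bessel potential norm\<close>

text \<open>Tonelli: each Gaussian has mass one, so the mass is bounded by that of the Gamma
  density. At points where the defining integral diverges the kernel is 0 by convention, and the
  bound still holds.\<close>

lemma bessel_kernel_L1:
 assumes r: "r > 0"
 shows "(NN z. ennreal \<bar>bessel_kernel r (z :: real ^ 'n)\<bar>) < \<infinity>"
proof -
 define \<omega> where "\<omega> = (\<lambda>s. pos s * (s powr (r / 2 - 1) * exp (- s)) :: real)"
 have \<omega>: "\<omega> \<in> BM borel" "\<And>s. \<omega> s \<ge> 0" unfolding \<omega>_def by auto
 note [measurable] = \<omega>(1)
 have G: "Gamma (r / 2) > 0" using r by (intro Gamma_real_pos) simp
 have "ennreal \<bar>bessel_kernel r z\<bar> \<le> ennreal (1 / Gamma (r / 2)) * (NN s. ennreal (\<omega> s) * ennreal (Gk s z))" for z :: "real ^ 'n"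
 proof -
  have "ennreal \<bar>LBINT s. \<omega> s * Gk s z\<bar> \<le> (NN s. ennreal (\<omega> s) * ennreal (Gk s z))"
  proof (cases "Li (\<lambda>s. \<omega> s * Gk s z)")
   case True
   from integral_norm_bound_ennreal[OF this] show ?thesis by (simp add: abs_mult \<omega>(2) heat_kernel_nonneg ennreal_mult)
  qed (simp add: not_integrable_integral_eq)
  moreover have "ennreal \<bar>bessel_kernel r z\<bar> = ennreal (1 / Gamma (r / 2)) * ennreal \<bar>LBINT s. \<omega> s * Gk s z\<bar>"
   using G by (simp add: bessel_kernel_eq \<omega>_def ennreal_mult'[symmetric] mult.assoc)
  ultimately show ?thesis by (simp add: mult_left_mono)
 qed
 then have "(NN z. ennreal \<bar>bessel_kernel r (z :: real ^ 'n)\<bar>)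
  \<le> (NN z. ennreal (1 / Gamma (r / 2)) * (NN s. ennreal (\<omega> s) * ennreal (Gk s (z :: real ^ 'n))))"
  by (intro nn_integral_mono)
 also have "\<dots> = ennreal (1 / Gamma (r / 2)) * (NN z. NN s. ennreal (\<omega> s) * ennreal (Gk s (z :: real ^ 'n)))"
  by (rule nn_integral_cmult) measurable
 also have "(NN z. NN s. ennreal (\<omega> s) * ennreal (Gk s (z :: real ^ 'n)))
  = (NN s. NN z. ennreal (\<omega> s) * ennreal (Gk s (z :: real ^ 'n)))"
  by (rule lborel_pair.Fubini') measurable
 also have "\<dots> = (NN s. ennreal (\<omega> s))"
 proof (rule nn_integral_cong)
  fix s show "(NN z. ennreal (\<omega> s) * ennreal (Gk s (z :: real ^ 'n))) = ennreal (\<omega> s)"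
  proof (cases "s > 0")
   case True then show ?thesis using nn_integral_heat_kernel_0[OF True, where 'n='n] by (simp add: nn_integral_cmult)
  qed (simp add: \<omega>_def)
 qed
 also have "\<dots> = ennreal (Gamma (r / 2))" using nn_integral_Gamma_half_line[of "r / 2"] r by (simp add: \<omega>_def)
 finally show ?thesis by (simp add: ennreal_mult_less_top le_less_trans)
qed

lemma bessel_integrable:
 fixes g :: "real ^ 'n \<Rightarrow> real"
 assumes g: "Li g" and r: "r > 0"
 shows "AE x in lborel. Li (\<lambda>y. bessel_kernel r (x - y) * g y)"
proof -
 have [measurable]: "g \<in> BM borel" using borel_measurable_integrable[OF g] by simp
 have "(NN x. NN y. ennreal \<bar>bessel_kernel r (x - y) * g y\<bar>) = (NN y. NN x. ennreal \<bar>bessel_kernel r (x - y)\<bar> * ennreal \<bar>g y\<bar>)"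
  unfolding abs_mult ennreal_mult'[OF abs_ge_zero] by (rule lborel_pair.Fubini') measurable
 also have "\<dots> = (NN y. (NN z. ennreal \<bar>bessel_kernel r (z :: real ^ 'n)\<bar>) * ennreal \<bar>g y\<bar>)"
  using nn_integral_translate[of "\<lambda>z :: real ^ 'n. ennreal \<bar>bessel_kernel r z\<bar>"] by (simp add: nn_integral_multc)
 also have "\<dots> = (NN z. ennreal \<bar>bessel_kernel r (z :: real ^ 'n)\<bar>) * (NN y. ennreal \<bar>g y\<bar>)"
  by (rule nn_integral_cmult) measurable
 also have "\<dots> < \<infinity>" using bessel_kernel_L1[OF r, where 'n='n] g by (simp add: ennreal_mult_less_top integrable_iff_bounded)
 finally have "AE x in lborel. (NN y. ennreal \<bar>bessel_kernel r (x - y) * g y\<bar>) \<noteq> \<infinity>"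
  by (intro nn_integral_PInf_AE) auto
 then show ?thesis by eventually_elim (auto simp: integrable_iff_bounded less_top)
qed

lemma kernel_component:
 fixes G :: "real ^ 'n \<Rightarrow> real ^ 'n"
 assumes m: "\<And>i. (\<lambda>x. G x $ i) \<in> BM lebesgue" and [measurable]: "k \<in> BM borel"
  and int: "\<And>i. Li (\<lambda>y. k (x - y) * cmp G i y)"
 shows "(LINT y|lebesgue. k (x - y) *\<^sub>R G y) $ i = conv k (cmp G i) x"
proof -
 have k: "(\<lambda>y. k (x - y)) \<in> BM borel" by measurable
 have i: "integrable lebesgue (\<lambda>y. G y $ i * k (x - y))" for i
  unfolding borel_rep_mult(2)[OF m k] using int[of i] by (simp add: mult.commute)
 \<comment> \<open>Taking components commutes with the Bochner integral only for an integrable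
   vector function, so integrability is first reassembled from the components.\<close>
 have "integrable lebesgue (\<lambda>y. SS i. (G y $ i * k (x - y)) *\<^sub>R axis i (1 :: real))"
  by (intro Bochner_Integration.integrable_sum integrable_scaleR_left) (use i in simp)
 moreover have "(SS i. (G y $ i * k (x - y)) *\<^sub>R axis i (1 :: real)) = k (x - y) *\<^sub>R G y" for y
 proof (simp add: vec_eq_iff, intro allI)
  fix i
  have "(SS j. G y $ j * k (x - y) * (axis j 1 :: real ^ 'n) $ i) = (SS j. if j = i then G y $ j * k (x - y) else 0)"
   by (rule sum.cong) (auto simp: axis_def)
  then show "(SS j. G y $ j * k (x - y) * (axis j 1 :: real ^ 'n) $ i) = k (x - y) * G y $ i" by simp
 qed
 ultimately have "integrable lebesgue (\<lambda>y. k (x - y) *\<^sub>R G y)" by simp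
 from integral_bounded_linear[OF bounded_linear_vec_nth this, of i]
 have "(LINT y|lebesgue. k (x - y) *\<^sub>R G y) $ i = (LINT y|lebesgue. G y $ i * k (x - y))" by (simp add: mult.commute)
 then show ?thesis unfolding borel_rep_mult(1)[OF m k] by (simp add: conv_def mult.commute)
qed

lemma Lp_space_1_rep:
 fixes G :: "real ^ 'n \<Rightarrow> real ^ 'n"
 assumes G: "G \<in> Lp_space 1"
 shows "(\<lambda>x. G x $ i) \<in> BM lebesgue" "Li (cmp G i)"
proof -
 have g: "G \<in> BM lebesgue" "integrable lebesgue (\<lambda>x. norm (G x))" using G by (auto simp: Lp_space_def)
 show m: "(\<lambda>x. G x $ i) \<in> BM lebesgue" by (rule vec_nth_measurable[OF g(1)])
 have "integrable lebesgue (\<lambda>x. G x $ i)"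
  by (rule Bochner_Integration.integrable_bound[OF g(2) m]) (simp add: component_le_norm_cart)
 then show "Li (cmp G i)"
  using lebesgue_integral_AE_borel(2)[OF borel_rep(1)[OF m] borel_rep(3)[OF m] m] by simp
qed

lemma bessel_potential_component:
 fixes G :: "real ^ 'n \<Rightarrow> real ^ 'n"
 assumes G: "G \<in> Lp_space 1" and r: "r > 0"
 shows "AE x in lborel. \<forall>i. bessel_potential r G x $ i = conv (bessel_kernel r) (cmp G i) x"
proof -
 have "AE x in lborel. \<forall>i. Li (\<lambda>y. bessel_kernel r (x - y) * cmp G i y)"
  unfolding AE_all_countable using bessel_integrable[OF Lp_space_1_rep(2)[OF G] r] by blast
 then show ?thesis
 proof eventually_elim
  case (elim x)
  show ?case using r elim kernel_component[OF Lp_space_1_rep(1)[OF G] bessel_kernel_measurable, of r x] by (simp add: bessel_potential_def)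
 qed
qed

text \<open>Needed because \<open>bessel_inverse\<close> is defined by choice: its norm is
  meaningful only if all admissible preimages agree almost everywhere. Componentwise this is
  \<open>bessel_injective\<close>.\<close>

lemma bessel_potential_unique:
 fixes G H :: "real ^ 'n \<Rightarrow> real ^ 'n"
 assumes G: "G \<in> Lp_space 1" and H: "H \<in> Lp_space 1" and r: "0 \<le> r" "r < 2"
  and eq: "AE x in lebesgue. bessel_potential r G x = bessel_potential r H x"
 shows "AE x in lebesgue. G x = H x"
proof (cases "r = 0")
 case True then show ?thesis using eq by (simp add: bessel_potential_def)
next
 case False
 then have r0: "r > 0" using r by simp
 have "AE x in lborel. cmp G i x - cmp H i x = 0" for i
 proof (rule bessel_injective[OF _ r0 r(2)])
  show "Li (\<lambda>x. cmp G i x - cmp H i x)" using Lp_space_1_rep(2)[OF G, of i] Lp_space_1_rep(2)[OF H, of i] by simp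
  have eq': "AE x in lborel. bessel_potential r G x = bessel_potential r H x" using eq by (simp add: AE_completion_iff)
  show "AE x in lborel. conv (bessel_kernel r) (\<lambda>x. cmp G i x - cmp H i x) x = 0"
   using eq' bessel_potential_component[OF G r0] bessel_potential_component[OF H r0]
    bessel_integrable[OF Lp_space_1_rep(2)[OF G, of i] r0] bessel_integrable[OF Lp_space_1_rep(2)[OF H, of i] r0]
  proof eventually_elim
   case (elim x)
   then have "conv (bessel_kernel r) (cmp G i) x = conv (bessel_kernel r) (cmp H i) x" by metis
   then show ?case using elim(4,5) by (simp add: conv_def right_diff_distrib)
  qed
 qed
 then have "AE x in lborel. \<forall>i. cmp G i x - cmp H i x = 0" unfolding AE_all_countable by blast
 then have 1: "AE x in lebesgue. \<forall>i. cmp G i x - cmp H i x = 0" by (rule AE_completion)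
 have 2: "AE x in lebesgue. \<forall>i. G x $ i = cmp G i x" "AE x in lebesgue. \<forall>i. H x $ i = cmp H i x"
  unfolding AE_all_countable using borel_rep(3)[OF Lp_space_1_rep(1)[OF G]] borel_rep(3)[OF Lp_space_1_rep(1)[OF H]] by blast+
 show ?thesis using 1 2 by eventually_elim (simp add: vec_eq_iff)
qed

text \<open>Passes from scalar preimages \<open>g i\<close> to the vector norm. The factor
  \<open>CARD('n)\<close> arises because the Euclidean norm is estimated by the sum of the
  components; uniqueness replaces the chosen preimage by the one at hand.\<close>

lemma bessel_norm_le:
 fixes f :: "real ^ 'n \<Rightarrow> real ^ 'n"
 assumes r: "0 \<le> r" "r < 2" and f: "\<And>i. AE x in lebesgue. f x $ i = \<phi> i x" and \<phi>: "\<And>i. Li (\<phi> i)"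
  and g: "\<And>i. Li (g i)" "\<And>i. AE x in lborel. \<phi> i x = bessel_potential r (g i) x" "\<And>i. (LBINT x. \<bar>g i x\<bar>) \<le> D"
 shows "f \<in> bessel_space 1 r" "bessel_norm 1 r f \<le> real CARD('n) * D"
proof -
 have vec: "(\<lambda>x. \<chi> i. h i x) \<in> Lp_space 1" "Lp_norm 1 (\<lambda>x. \<chi> i. h i x :: real ^ 'n) \<le> (SS i. LBINT x. \<bar>h i x\<bar>)"
  if h: "\<And>i. Li (h i)" for h :: "'n \<Rightarrow> real ^ 'n \<Rightarrow> real"
 proof -
  have [measurable]: "h i \<in> BM borel" for i using borel_measurable_integrable[OF h] by simp
  have b: "(\<lambda>x. \<chi> i. h i x :: real ^ 'n) \<in> BM borel"
   by (subst borel_measurable_euclidean_space) (auto simp: Basis_vec_def inner_axis)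
  have m: "(\<lambda>x. \<chi> i. h i x :: real ^ 'n) \<in> BM lebesgue" by (rule measurable_completion) (use b in simp)
  have n: "norm (\<chi> i. h i x :: real ^ 'n) \<le> (SS i. \<bar>h i x\<bar>)" for x
   using norm_le_l1_cart[of "\<chi> i. h i x :: real ^ 'n"] by simp
  have s: "Li (\<lambda>x. SS i. \<bar>h i x\<bar>)" by (intro Bochner_Integration.integrable_sum integrable_abs h)
  have i: "Li (\<lambda>x. norm (\<chi> i. h i x :: real ^ 'n))"
   by (rule Bochner_Integration.integrable_bound[OF s]) (use b n in "auto intro!: AE_I2 intro: order.trans")
  show "(\<lambda>x. \<chi> i. h i x) \<in> Lp_space 1" using m i by (simp add: Lp_space_def integrable_completion)
  have "Lp_norm 1 (\<lambda>x. \<chi> i. h i x :: real ^ 'n) = (LBINT x. norm (\<chi> i. h i x :: real ^ 'n))"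
   unfolding Lp_norm_def using b by (simp add: integral_completion)
  also have "\<dots> \<le> (LBINT x. (SS i. \<bar>h i x\<bar>))" by (rule integral_mono[OF i s n])
  finally show "Lp_norm 1 (\<lambda>x. \<chi> i. h i x :: real ^ 'n) \<le> (SS i. LBINT x. \<bar>h i x\<bar>)" using h by simp
 qed
 define G where "G = (\<lambda>x. \<chi> i. g i x :: real ^ 'n)"
 define F where "F = (\<lambda>x. \<chi> i. \<phi> i x :: real ^ 'n)"
 have G: "G \<in> Lp_space 1" "Lp_norm 1 G \<le> real CARD('n) * D"
  unfolding G_def using vec(1)[OF g(1)] order.trans[OF vec(2)[OF g(1)] sum_mono[OF g(3)]] by auto
 have F: "F \<in> Lp_space 1" unfolding F_def by (rule vec(1)[OF \<phi>])
 have "AE x in lebesgue. \<forall>i. f x $ i = \<phi> i x" unfolding AE_all_countable using f by blast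
 then have fF: "AE x in lebesgue. f x = F x" by eventually_elim (simp add: F_def vec_eq_iff)
 then have Ff: "AE x in lebesgue. F x = f x" by eventually_elim simp
 have fm: "f \<in> BM lebesgue" by (rule borel_measurable_AE[OF _ Ff]) (use F in "simp add: Lp_space_def")
 have "AE x in lebesgue. norm (f x) powr 1 = norm (F x) powr 1" using fF by eventually_elim simp
 then have "integrable lebesgue (\<lambda>x. norm (f x) powr 1)"
  using F fm by (subst integrable_cong_AE[of _ _ "\<lambda>x. norm (F x) powr 1"]) (auto simp: Lp_space_def)
 then have fL: "f \<in> Lp_space 1" using fm by (simp add: Lp_space_def)
 have "AE x in lborel. \<forall>i. \<phi> i x = bessel_potential r (g i) x" unfolding AE_all_countable using g(2) by blast
 then have a: "AE x in lebesgue. \<forall>i. \<phi> i x = bessel_potential r (g i) x" by (rule AE_completion)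
 have FG: "AE x in lebesgue. f x = bessel_potential r G x"
 proof (cases "r = 0")
  case True
  show ?thesis using fF a by eventually_elim (simp add: True bessel_potential_def F_def G_def)
 next
  case False
  then have r0: "r > 0" using r by simp
  have gm: "g i \<in> BM borel" for i using borel_measurable_integrable[OF g(1)] by simp
  have "conv (bessel_kernel r) (cmp G i) x = bessel_potential r (g i) x" for i x
  proof -
   note [measurable] = gm borel_rep(1)[OF Lp_space_1_rep(1)[OF G(1)], of i]
   have "AE y in lborel. g i y = cmp G i y" using borel_rep(2)[OF Lp_space_1_rep(1)[OF G(1)], of i] by eventually_elim (simp add: G_def)
   then have "(LBINT y. bessel_kernel r (x - y) * cmp G i y) = (LBINT y. bessel_kernel r (x - y) * g i y)"
    by (intro integral_cong_AE) auto
   then show ?thesis using bessel_potential_eq[OF gm False] by (simp add: conv_def)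
  qed
  then have "AE x in lborel. \<forall>i. bessel_potential r G x $ i = bessel_potential r (g i) x"
   using bessel_potential_component[OF G(1) r0] by simp
  then have "AE x in lebesgue. \<forall>i. bessel_potential r G x $ i = bessel_potential r (g i) x" by (rule AE_completion)
  then show ?thesis using fF a by eventually_elim (simp add: vec_eq_iff F_def)
 qed
 show "f \<in> bessel_space 1 r" using fL G(1) FG by (auto simp: bessel_space_def)
 define H where "H = bessel_inverse 1 r f"
 have "H \<in> Lp_space 1 \<and> (AE x in lebesgue. f x = bessel_potential r H x)"
  unfolding H_def bessel_inverse_def by (rule someI[of _ G]) (use G(1) FG in simp)
 then have H: "H \<in> Lp_space 1" "AE x in lebesgue. f x = bessel_potential r H x" by auto
 have "AE x in lebesgue. bessel_potential r H x = bessel_potential r G x" using FG H(2) by eventually_elim simp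
 then have HG: "AE x in lebesgue. H x = G x" by (rule bessel_potential_unique[OF H(1) G(1) r])
 have "AE x in lebesgue. norm (H x) powr 1 = norm (G x) powr 1" using HG by eventually_elim simp
 then have "(LINT x|lebesgue. norm (H x) powr 1) = (LINT x|lebesgue. norm (G x) powr 1)"
  using H(1) G(1) by (intro integral_cong_AE) (auto simp: Lp_space_def)
 then have "Lp_norm 1 H = Lp_norm 1 G" by (simp add: Lp_norm_def)
 then show "bessel_norm 1 r f \<le> real CARD('n) * D" using G(2) by (simp add: bessel_norm_def H_def)
qed

lemma velocity_component:
 fixes u :: "real \<Rightarrow> real ^ 'n \<Rightarrow> real ^ 'n"
 assumes ws: "weak_solution u\<^sub>0 u" and wc: "weakly_continuous_from u\<^sub>0 u" and t: "t \<ge> 0"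
 shows "AE x in lebesgue. (u t x - heat_semigroup t u\<^sub>0 x) $ i = fluct u\<^sub>0 u t i x"
proof -
 have u: "u\<^sub>0 \<in> Lp_space 2" "u t \<in> Lp_space 2" using ws wc t by (auto simp: weak_solution_def weakly_continuous_from_def)
 note ae = borel_rep(3)[OF Lp_space_2_rep(2)[OF u(1)], of i] borel_rep(3)[OF Lp_space_2_rep(2)[OF u(2)], of i]
 show ?thesis
 proof (cases "t = 0")
  case True
  show ?thesis using ae by eventually_elim (simp add: True fluct_def heat_semigroup_def)
 next
  case False
  then have t': "t > 0" using t by simp
  have hs: "heat_semigroup t u\<^sub>0 x $ i = Ht t (cmp u\<^sub>0 i) x" for x
   using False kernel_component[OF Lp_space_2_rep(2)[OF u(1)] _ conv_integrable[OF gbound_heat_kernel[OF t'] L2_gint[OF Lp_space_2_rep(1)[OF u(1)]]], where x = x and i = i]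
   by (simp add: heat_semigroup_def)
  show ?thesis using ae(2) by eventually_elim (simp add: fluct_def False hs)
 qed
qed

lemma bessel_potential_minus: "bessel_potential r (\<lambda>x. - g x) x = - bessel_potential r g x"
 for g :: "real ^ 'n \<Rightarrow> real"
 by (simp add: bessel_potential_def)

theorem corollary4p3:
  fixes u :: "real \<Rightarrow> real ^ 'n \<Rightarrow> real ^ 'n"
    and u\<^sub>0 :: "real ^ 'n \<Rightarrow> real ^ 'n"
    and v :: "real \<Rightarrow> real ^ 'n \<Rightarrow> real ^ 'n"
    and r \<alpha> :: real
  assumes "CARD('n) \<ge> 3"
    and "weak_solution u\<^sub>0 u"
    and "weakly_continuous_from u\<^sub>0 u"
    and "\<And>t x. v t x = u t x - heat_semigroup t u\<^sub>0 x"
    and "0 \<le> r" and "r < 1"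
    and "0 < \<alpha>" and "\<alpha> < (1 - r) / 2"
  shows "(\<forall>t\<ge>0. v t \<in> bessel_space 1 r) \<and>
    (\<exists>c :: real \<Rightarrow> real.
      (\<forall>a b. 0 \<le> a \<longrightarrow> bounded (c ` {a..b})) \<and>
      (\<forall>t h. 0 \<le> t \<longrightarrow> 0 \<le> t + h \<longrightarrow> \<bar>h\<bar> \<le> 1 \<longrightarrow>
        bessel_norm 1 r (\<lambda>x. v (t + h) x - v t x) \<le> c t * \<bar>h\<bar> powr \<alpha>))"
proof -
 note ws = assms(2) and wc = assms(3) and veq = assms(4) and r = assms(5,6) and \<alpha> = assms(7,8)
 have r2: "r < 2" using r by simp
 obtain E0 where E0: "\<And>j. wcurve (\<lambda>t. cmp (u t) j) E0" using weak_solution_wcurve[OF ws wc] by blast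
 define e where "e = (\<lambda>n :: nat. E0 (real n))"
 \<comment> \<open>The bound \<open>E0\<close> comes from a choice for each T and could be unbounded
   on a compact interval. Evaluated at the integer above T it takes only finitely many values on
   each compact interval of times.\<close>
 define E where "E = (\<lambda>T :: real. e (nat \<lceil>T\<rceil>))"
 have E: "wcurve (\<lambda>t. cmp (u t) j) E" for j
 proof -
  have "nrm2 (cmp (u t) j) \<le> E T" if "t \<in> {0..T}" for t T
  proof -
   have "T \<le> real (nat \<lceil>T\<rceil>)" by linarith
   then have "t \<in> {0..real (nat \<lceil>T\<rceil>)}" using that unfolding atLeastAtMost_iff by (intro conjI; linarith)
   then show ?thesis using E0[of j] unfolding wcurve_def E_def e_def by blast
  qed
  then show ?thesis using E0[of j] by (simp add: wcurve_def)
 qed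
 have vc: "AE x in lebesgue. v t x $ i = fluct u\<^sub>0 u t i x" if "t \<ge> 0" for t i
  using velocity_component[OF ws wc that, of i] by (simp add: veq)
 obtain C where C: "C \<ge> 0" "\<And>t h i. 0 \<le> t \<Longrightarrow> 0 \<le> h \<Longrightarrow> Li (dfl u\<^sub>0 u t h i) \<and>
  (\<exists>g. Li g \<and> (AE x in lborel. dfl u\<^sub>0 u t h i x = bessel_potential r g x) \<and>
  (LBINT x. \<bar>g x\<bar>) \<le> C * (E (t + h))\<^sup>2 * max (h powr \<alpha>) h)"
  using fluct_estimate[OF ws wc E r(1) \<alpha>] by blast
 \<comment> \<open>The sign a serves negative h: the increment is then taken forward from the
   earlier time and reversed.\<close>
 have forward: "f \<in> bessel_space 1 r \<and> bessel_norm 1 r f \<le> real CARD('n) * (C * (E (t + h))\<^sup>2 * max (h powr \<alpha>) h)"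
  if t: "0 \<le> t" "0 \<le> h" and f: "\<And>i. AE x in lebesgue. f x $ i = a * (dfl u\<^sub>0 u t h i x)" and a: "a = 1 \<or> a = -1"
  for t h a and f :: "real ^ 'n \<Rightarrow> real ^ 'n"
 proof -
  have "\<forall>i. \<exists>g. Li g \<and> (AE x in lborel. dfl u\<^sub>0 u t h i x = bessel_potential r g x) \<and>
   (LBINT x. \<bar>g x\<bar>) \<le> C * (E (t + h))\<^sup>2 * max (h powr \<alpha>) h" using C(2)[OF t] by blast
  from choice[OF this] obtain g where "\<forall>i. Li (g i) \<and> (AE x in lborel. dfl u\<^sub>0 u t h i x = bessel_potential r (g i) x) \<and>
   (LBINT x. \<bar>g i x\<bar>) \<le> C * (E (t + h))\<^sup>2 * max (h powr \<alpha>) h" by (rule exE)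
  then have g: "Li (g i)" "AE x in lborel. dfl u\<^sub>0 u t h i x = bessel_potential r (g i) x"
   "(LBINT x. \<bar>g i x\<bar>) \<le> C * (E (t + h))\<^sup>2 * max (h powr \<alpha>) h" for i by simp_all
  have i: "Li (\<lambda>x. a * (dfl u\<^sub>0 u t h i x))" for i
   using C(2)[OF t] by (intro integrable_mult_right) blast
  have ga: "Li (\<lambda>x. a * g i x)" "(LBINT x. \<bar>a * g i x\<bar>) \<le> C * (E (t + h))\<^sup>2 * max (h powr \<alpha>) h" for i
   using a g(1,3)[of i] by auto
  have gb: "AE x in lborel. a * (dfl u\<^sub>0 u t h i x) = bessel_potential r (\<lambda>x. a * g i x) x" for i
   using g(2)[of i] by eventually_elim (use a bessel_potential_minus[of r "g i"] in auto)
  show ?thesis using bessel_norm_le[OF r(1) r2 f i ga(1) gb ga(2)] by blast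
 qed
 \<comment> \<open>A sum of squares is monotone in t, hence locally bounded, and dominates each
   single term. The summand 1 in the range accounts for end times up to t + 1.\<close>
 define c where "c = (\<lambda>t :: real. real CARD('n) * (C * (\<Sum>n\<le>nat \<lceil>t\<rceil> + 1. (e n)\<^sup>2)))"
 have c0: "0 \<le> c t" for t unfolding c_def using C(1) by (intro mult_nonneg_nonneg sum_nonneg) auto
 have mono: "c s \<le> c t" if "s \<le> t" for s t
 proof -
  have "nat \<lceil>s\<rceil> \<le> nat \<lceil>t\<rceil>" using that by (intro nat_mono ceiling_mono)
  then show ?thesis unfolding c_def using C(1) by (intro mult_left_mono sum_mono2) auto
 qed
 have step: "real CARD('n) * (C * (E s)\<^sup>2 * max (k powr \<alpha>) k) \<le> c t * k powr \<alpha>" if "s \<le> t + 1" "0 \<le> k" "k \<le> 1" for s t k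
 proof -
  \<comment> \<open>For step sizes at most 1 the maximum in the estimate is the power
    \<alpha>.\<close>
  have "k \<le> k powr \<alpha>"
  proof (cases "k = 0")
   case False
   then have "k powr 1 \<le> k powr \<alpha>" using that \<alpha> r by (intro powr_mono') auto
   then show ?thesis using that by simp
  qed simp
  then have k: "max (k powr \<alpha>) k = k powr \<alpha>" by simp
  have "nat \<lceil>s\<rceil> \<le> nat \<lceil>t\<rceil> + 1" using that(1) by linarith
  then have "(E s)\<^sup>2 \<le> (\<Sum>n\<le>nat \<lceil>t\<rceil> + 1. (e n)\<^sup>2)" unfolding E_def by (intro member_le_sum) auto
  then have "real CARD('n) * (C * (E s)\<^sup>2) \<le> c t" unfolding c_def using C(1) by (intro mult_left_mono) auto
  from mult_right_mono[OF this, of "k powr \<alpha>"] show ?thesis by (simp add: k mult.assoc)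
 qed
 \<comment> \<open>v(t) is itself an increment, from time 0, since v(0) = 0 almost
   everywhere.\<close>
 have "v t \<in> bessel_space 1 r" if t: "t \<ge> 0" for t
 proof -
  have "AE x in lebesgue. v t x $ i = 1 * (fluct u\<^sub>0 u (0 + t) i x - fluct u\<^sub>0 u 0 i x)" for i
  proof -
   have "AE x in lebesgue. u 0 x = u\<^sub>0 x" using wc by (simp add: weakly_continuous_from_def)
   then show ?thesis using vc[OF t, of i] vc[OF order.refl, of i] by eventually_elim (simp add: veq heat_semigroup_def)
  qed
  with t show ?thesis by (intro forward[THEN conjunct1, of 0 t]) auto
 qed
 moreover have "bounded (c ` {a..b})" for a b
 proof (rule boundedI)
  fix y assume "y \<in> c ` {a..b}"
  then show "norm y \<le> c b" using c0 mono by auto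
 qed
 moreover have "bessel_norm 1 r (\<lambda>x. v (t + h) x - v t x) \<le> c t * \<bar>h\<bar> powr \<alpha>" if t: "0 \<le> t" "0 \<le> t + h" "\<bar>h\<bar> \<le> 1" for t h
 proof (cases "h \<ge> 0")
  case True
  have "AE x in lebesgue. (v (t + h) x - v t x) $ i = 1 * (dfl u\<^sub>0 u t h i x)" for i
   using vc[OF t(1), of i] vc[OF t(2), of i] by eventually_elim simp
  from forward[OF t(1) True this] step[of "t + h" t h] True t show ?thesis by auto
 next
  \<comment> \<open>The base point is now t + h and the step -h, so the end time is t and the
    constant \<open>c t\<close> still applies.\<close>
  case False
  have "AE x in lebesgue. (v (t + h) x - v t x) $ i = - 1 * (fluct u\<^sub>0 u ((t + h) + (- h)) i x - fluct u\<^sub>0 u (t + h) i x)" for i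
   using vc[OF t(1), of i] vc[OF t(2), of i] by eventually_elim simp
  from forward[OF t(2) _ this] step[of t t "- h"] False t show ?thesis by auto
 qed
 ultimately show ?thesis by blast
qed

end
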